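(* Let $T>0$, $\theta_1>0$ and $\theta_2\in\mathbb{R}$. Consider the stochastic wave equation $$\frac{\partial^2 u}{\partial t^2}=\theta_1\,\frac{\partial^2 u}{\partial x^2}+\theta_2\,\frac{\partial u}{\partial t}+\dot W(t),\quad 0<t<T,\ 0<x<\pi,$$ with zero initial conditions $u|_{t=0}=\frac{\partial u}{\partial t}|_{t=0}=0$ and zero boundary conditions $u|_{x=0}=u|_{x=\pi}=0$, driven by space-time white noise $\dot W$. Let $u(t,x)=\sqrt{2/\pi}\sum_{k\ge1}u_k(t)\sin(kx)$ be its solution, and let $(\hat\theta_{1,N},\hat\theta_{2,N})$ be the (joint) maximum likelihood estimator of $(\theta_1,\theta_2)$ based on the observations $\{u_1(t),\ldots,u_N(t),\ t\in[0,T]\}$ of the first $N$ Fourier coefficients. Then, as $N\to\infty$ with $T$ fixed, the estimator is strongly consistent, that is, $$\lim_{N\to\infty}\hat\theta_{1,N}=\theta_1,\qquad \lim_{N\to\infty}\hat\theta_{2,N}=\theta_2\qquad\text{with probability one},$$ and asymptotically normal with diagonal normalizing matrix with diagonal elements $N^{3/2}$ and $N^{1/2}$, that is, the random vector $$\big(N^{3/2}(\hat\theta_{1,N}-\theta_1),\ N^{1/2}(\hat\theta_{2,N}-\theta_2)\big)$$ converges in distribution to a non-degenerate zero-mean Gaussian vector in $\mathbb{R}^2$.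
   Context: Fix a stochastic basis $(\Omega,\mathcal{F},\{\mathcal{F}_t\}_{t\ge0},\mathbb{P})$ with the usual assumptions (completeness of $\mathcal{F}_0$, right-continuity of $\mathcal{F}_t$), large enough to support countably many independent standard Brownian motions. $\mathbb{E}$ denotes expectation. Noise: $W$ is a cylindrical Brownian motion over $L_2((0,\pi))$, i.e. a linear map $f\mapsto W_f(\cdot)$ from $L_2((0,\pi))$ to zero-mean Gaussian processes with $\mathbb{E}(W_f(t)W_g(s))=\min(t,s)\int_0^\pi f g\,dx$; equivalently $W_f(t)=\sum_{k\ge1}(f,h_k)w_k(t)$, where $h_k(x)=\sqrt{2/\pi}\,\sin(kx)$ and $w_k=W_{h_k}$, $k\ge1$, are independent standard Brownian motions (adapted to $\{\mathcal{F}_t\}$). The space-time white noise is the formal series $\dot W(t)=\sum_{k\ge1}\dot w_k(t)h_k$. Fourier coefficients: the equation is interpreted as the system $du=v\,dt$, $dv=(\theta_1u_{xx}+\theta_2v)\,dt+dW(t)$ with zero initial and boundary conditions, so that the Fourier coefficients $u_k$, $v_k$ of $u$, $v$ with respect to $h_k$ satisfy, for each $k\ge1$ and $t\in[0,T]$, $$u_k(t)=\int_0^tv_k(s)\,ds,\qquad v_k(t)=-\theta_1k^2\int_0^tu_k(s)\,ds+\theta_2\int_0^tv_k(s)\,ds+w_k(t).$$ In particular $v_k=\dot u_k$ is determined by $u_k$. Maximum likelihood estimator: the log-likelihood ratio (the logarithm of the density of the law of $(v_1,\ldots,v_N)$ with respect to the law of $(w_1,\ldots,w_N)$ on the space of continuous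 functions on $[0,T]$, evaluated at the observations) is $$Z_N(\theta_1,\theta_2)=\sum_{k=1}^N\Big(\int_0^T(-\theta_1k^2u_k(t)+\theta_2v_k(t))\,dv_k(t)-\frac12\int_0^T(-\theta_1k^2u_k(t)+\theta_2v_k(t))^2\,dt\Big),$$ and $(\hat\theta_{1,N},\hat\theta_{2,N})$ is the solution of $\partial Z_N/\partial\theta_1=0$, $\partial Z_N/\partial\theta_2=0$ (where $\theta_1,\theta_2$ are treated as free variables). Explicitly, $$\hat\theta_{1,N}=\frac{B_{1,N}J_{2,N}+B_{2,N}J_{12,N}}{J_{1,N}J_{2,N}-J_{12,N}^2},\qquad \hat\theta_{2,N}=\frac{B_{1,N}J_{12,N}+B_{2,N}J_{1,N}}{J_{1,N}J_{2,N}-J_{12,N}^2},$$ where $$J_{1,N}=\sum_{k=1}^Nk^4\int_0^Tu_k^2(t)\,dt,\quad J_{2,N}=\sum_{k=1}^N\int_0^Tv_k^2(t)\,dt,\quad J_{12,N}=\sum_{k=1}^Nk^2\int_0^Tu_k(t)v_k(t)\,dt,$$ $$B_{1,N}=-\sum_{k=1}^Nk^2\int_0^Tu_k(t)\,dv_k(t),\qquad B_{2,N}=\sum_{k=1}^N\int_0^Tv_k(t)\,dv_k(t),$$ and the integrals with respect to $dv_k$ are It\^o integrals. The processes $u_k,v_k$ are those generated with the true parameter values $\theta_1,\theta_2$. *)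

theory Defs
  imports "HOL-Probability.Probability"
begin

section \<open>Stochastic bases and Brownian motion\<close>

text \<open>The filtration is indexed by the type \<^typ>\<open>real\<close>, but only the indices \<open>t \<ge> 0\<close> matter.\<close>

locale stochastic_basis = prob_space M for M :: "'a measure" +
  fixes F :: "real \<Rightarrow> 'a measure"
  assumes subalgebra_F: "\<And>t. 0 \<le> t \<Longrightarrow> subalgebra M (F t)"
    and F_mono: "\<And>s t. 0 \<le> s \<Longrightarrow> s \<le> t \<Longrightarrow> sets (F s) \<subseteq> sets (F t)"
    and F_right_continuous: "\<And>t. 0 \<le> t \<Longrightarrow> sets (F t) = (\<Inter>s\<in>{t<..}. sets (F s))"
    and F_0_complete: "\<And>N A. N \<in> null_sets M \<Longrightarrow> A \<subseteq> N \<Longrightarrow> A \<in> sets (F 0)"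

definition adapted :: "(real \<Rightarrow> 'a measure) \<Rightarrow> real set \<Rightarrow> (real \<Rightarrow> 'a \<Rightarrow> real) \<Rightarrow> bool" where
  "adapted F S X \<longleftrightarrow> (\<forall>t\<in>S. X t \<in> borel_measurable (F t))"

definition brownian_motion ::
    "'a measure \<Rightarrow> (real \<Rightarrow> 'a measure) \<Rightarrow> (real \<Rightarrow> 'a \<Rightarrow> real) \<Rightarrow> bool" where
  "brownian_motion M F w \<longleftrightarrow>
     adapted F {0..} w \<and>
     (AE \<omega> in M. w 0 \<omega> = 0) \<and>
     (AE \<omega> in M. continuous_on {0..} (\<lambda>t. w t \<omega>)) \<and>
     (\<forall>s t. 0 \<le> s \<and> s < t \<longrightarrow>
        distributed M lborel (\<lambda>\<omega>. w t \<omega> - w s \<omega>) (normal_density 0 (sqrt (t - s))) \<and>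
        prob_space.indep_set M (sets (F s))
          {(\<lambda>\<omega>. w t \<omega> - w s \<omega>) -` A \<inter> space M | A. A \<in> sets borel})"

section \<open>The space \<open>L\<^sub>2((0,\<pi>))\<close> and space-time white noise\<close>

definition square_integrable_0_pi :: "(real \<Rightarrow> real) \<Rightarrow> bool" where
  "square_integrable_0_pi f \<longleftrightarrow>
     f \<in> borel_measurable (lebesgue_on {0<..<pi}) \<and>
     integrable (lebesgue_on {0<..<pi}) (\<lambda>x. (f x)\<^sup>2)"

definition inner_0_pi :: "(real \<Rightarrow> real) \<Rightarrow> (real \<Rightarrow> real) \<Rightarrow> real" where
  "inner_0_pi f g = integral\<^sup>L (lebesgue_on {0<..<pi}) (\<lambda>x. f x * g x)"

definition sine_basis :: "nat \<Rightarrow> real \<Rightarrow> real" where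
  "sine_basis k x = sqrt (2 / pi) * sin (real k * x)"

text \<open>A cylindrical Brownian motion \<open>W\<close>, where \<open>W f t\<close> stands for \<open>W\<^sub>f(t)\<close>: the processes
  \<open>w\<^sub>k = W\<^sub>h\<^sub>k\<close>, with \<open>h\<^sub>k\<close> the sine basis and \<open>k \<ge> 1\<close>, are independent Brownian motions, and
  \<open>W\<^sub>f(t) = \<Sum>\<^sub>k (f, h\<^sub>k) w\<^sub>k(t)\<close> with convergence in mean square.\<close>

definition cylindrical_brownian_motion ::
    "'a measure \<Rightarrow> (real \<Rightarrow> 'a measure) \<Rightarrow> ((real \<Rightarrow> real) \<Rightarrow> real \<Rightarrow> 'a \<Rightarrow> real) \<Rightarrow> bool" where
  "cylindrical_brownian_motion M F W \<longleftrightarrow>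
     (\<forall>k\<ge>1. brownian_motion M F (W (sine_basis k))) \<and>
     prob_space.indep_vars M (\<lambda>_. PiM {0..} (\<lambda>_. borel))
       (\<lambda>k \<omega>. \<lambda>t\<in>{0..}. W (sine_basis k) t \<omega>) {1..} \<and>
     (\<forall>f t. square_integrable_0_pi f \<and> 0 \<le> t \<longrightarrow>
        W f t \<in> borel_measurable M \<and>
        (\<lambda>n. \<integral>\<^sup>+\<omega>. ennreal ((W f t \<omega> -
             (\<Sum>k=1..n. inner_0_pi f (sine_basis k) * W (sine_basis k) t \<omega>))\<^sup>2) \<partial>M)
          \<longlonglongrightarrow> 0)"

section \<open>The It\^o integral\<close>

text \<open>\<open>(n, \<tau>, \<xi>)\<close> encodes the elementary process
  \<open>\<Sum>\<^sub>i\<^sub><\<^sub>n \<xi>\<^sub>i 1\<^bsub>(\<tau>\<^sub>i, \<tau>\<^sub>i\<^sub>+\<^sub>1]\<^esub>(t)\<close> on \<open>[0, T]\<close>.\<close>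

definition elementary ::
    "'a measure \<Rightarrow> (real \<Rightarrow> 'a measure) \<Rightarrow> real \<Rightarrow> nat \<Rightarrow> (nat \<Rightarrow> real) \<Rightarrow> (nat \<Rightarrow> 'a \<Rightarrow> real) \<Rightarrow> bool"
  where
  "elementary M F T n \<tau> \<xi> \<longleftrightarrow>
     \<tau> 0 = 0 \<and> \<tau> n = T \<and>
     (\<forall>i<n. \<tau> i \<le> \<tau> (Suc i) \<and> \<xi> i \<in> borel_measurable (F (\<tau> i)) \<and>
            integrable M (\<lambda>\<omega>. (\<xi> i \<omega>)\<^sup>2))"

definition elementary_process ::
    "nat \<Rightarrow> (nat \<Rightarrow> real) \<Rightarrow> (nat \<Rightarrow> 'a \<Rightarrow> real) \<Rightarrow> real \<Rightarrow> 'a \<Rightarrow> real" where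
  "elementary_process n \<tau> \<xi> t \<omega> = (\<Sum>i<n. \<xi> i \<omega> * indicator {\<tau> i<..\<tau> (Suc i)} t)"

definition elementary_integral ::
    "nat \<Rightarrow> (nat \<Rightarrow> real) \<Rightarrow> (nat \<Rightarrow> 'a \<Rightarrow> real) \<Rightarrow> (real \<Rightarrow> 'a \<Rightarrow> real) \<Rightarrow> 'a \<Rightarrow> real" where
  "elementary_integral n \<tau> \<xi> w \<omega> = (\<Sum>i<n. \<xi> i \<omega> * (w (\<tau> (Suc i)) \<omega> - w (\<tau> i) \<omega>))"

text \<open>\<open>I\<close> is a version of \<open>\<integral>\<^sub>0\<^sup>T X dw\<close>: elementary processes converge to \<open>X\<close> in
  \<open>L\<^sub>2([0,T] \<times> \<Omega>)\<close> and their integrals converge to \<open>I\<close> in \<open>L\<^sub>2(\<Omega>)\<close>. The completed product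
  measure is used because processes whose paths are continuous only almost surely need not be
  measurable for the product \<open>\<sigma>\<close>-algebra itself.\<close>

definition has_ito_integral ::
    "'a measure \<Rightarrow> (real \<Rightarrow> 'a measure) \<Rightarrow> (real \<Rightarrow> 'a \<Rightarrow> real) \<Rightarrow> real \<Rightarrow> (real \<Rightarrow> 'a \<Rightarrow> real) \<Rightarrow>
     ('a \<Rightarrow> real) \<Rightarrow> bool" where
  "has_ito_integral M F w T X I \<longleftrightarrow>
     (let TM = completion (restrict_space lborel {0..T} \<Otimes>\<^sub>M M) in
      (\<lambda>(t, \<omega>). X t \<omega>) \<in> borel_measurable TM \<and>
      I \<in> borel_measurable M \<and>
      (\<exists>n \<tau> \<xi>.
         (\<forall>m. elementary M F T (n m) (\<tau> m) (\<xi> m)) \<and>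
         (\<lambda>m. \<integral>\<^sup>+(t, \<omega>). ennreal ((elementary_process (n m) (\<tau> m) (\<xi> m) t \<omega> - X t \<omega>)\<^sup>2) \<partial>TM)
           \<longlonglongrightarrow> 0 \<and>
         (\<lambda>m. \<integral>\<^sup>+\<omega>. ennreal ((elementary_integral (n m) (\<tau> m) (\<xi> m) w \<omega> - I \<omega>)\<^sup>2) \<partial>M)
           \<longlonglongrightarrow> 0))"

definition ito_integral ::
    "'a measure \<Rightarrow> (real \<Rightarrow> 'a measure) \<Rightarrow> (real \<Rightarrow> 'a \<Rightarrow> real) \<Rightarrow> real \<Rightarrow> (real \<Rightarrow> 'a \<Rightarrow> real) \<Rightarrow>
     'a \<Rightarrow> real" where
  "ito_integral M F w T X = (SOME I. has_ito_integral M F w T X I)"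

text \<open>\<open>\<integral>\<^sub>0\<^sup>T X dV\<close> for an It\^o process with stochastic differential \<open>dV = b dt + dw\<close>.\<close>

definition ito_process_integral ::
    "'a measure \<Rightarrow> (real \<Rightarrow> 'a measure) \<Rightarrow> (real \<Rightarrow> 'a \<Rightarrow> real) \<Rightarrow> (real \<Rightarrow> 'a \<Rightarrow> real) \<Rightarrow> real \<Rightarrow>
     (real \<Rightarrow> 'a \<Rightarrow> real) \<Rightarrow> 'a \<Rightarrow> real" where
  "ito_process_integral M F b w T X \<omega> =
     integral {0..T} (\<lambda>t. X t \<omega> * b t \<omega>) + ito_integral M F w T X \<omega>"

section \<open>The stochastic wave equation\<close>

text \<open>The field \<open>u(t, x)\<close> is written \<open>u t x \<omega>\<close>.\<close>

definition fourier_coeff :: "(real \<Rightarrow> real \<Rightarrow> 'a \<Rightarrow> real) \<Rightarrow> nat \<Rightarrow> real \<Rightarrow> 'a \<Rightarrow> real" where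
  "fourier_coeff u k t \<omega> = inner_0_pi (\<lambda>x. u t x \<omega>) (sine_basis k)"

text \<open>The solution of \<open>du = v dt\<close>, \<open>dv = (\<theta>\<^sub>1 u\<^sub>x\<^sub>x + \<theta>\<^sub>2 v) dt + dW\<close> with zero initial and boundary
  conditions. Since \<open>v\<close> takes values in generalized functions only, it is represented by its
  Fourier coefficients \<open>v k\<close>, \<open>k \<ge> 1\<close>. The series \<open>\<Sum>\<^sub>k u\<^sub>k h\<^sub>k\<close> represents \<open>u(t, \<cdot>)\<close> in
  \<open>L\<^sub>2((0,\<pi>))\<close>.\<close>

definition wave_solution ::
    "'a measure \<Rightarrow> (real \<Rightarrow> 'a measure) \<Rightarrow> ((real \<Rightarrow> real) \<Rightarrow> real \<Rightarrow> 'a \<Rightarrow> real) \<Rightarrow> real \<Rightarrow> real \<Rightarrow> real \<Rightarrow>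
     (real \<Rightarrow> real \<Rightarrow> 'a \<Rightarrow> real) \<Rightarrow> (nat \<Rightarrow> real \<Rightarrow> 'a \<Rightarrow> real) \<Rightarrow> bool" where
  "wave_solution M F W T \<theta>1 \<theta>2 u v \<longleftrightarrow>
     (AE \<omega> in M. \<forall>t\<in>{0..T}. square_integrable_0_pi (\<lambda>x. u t x \<omega>)) \<and>
     (\<forall>k\<ge>1.
        adapted F {0..T} (fourier_coeff u k) \<and>
        adapted F {0..T} (v k) \<and>
        (AE \<omega> in M. continuous_on {0..T} (\<lambda>t. fourier_coeff u k t \<omega>) \<and>
                    continuous_on {0..T} (\<lambda>t. v k t \<omega>)) \<and>
        (AE \<omega> in M. \<forall>t\<in>{0..T}.
           fourier_coeff u k t \<omega> = integral {0..t} (\<lambda>s. v k s \<omega>) \<and>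
           v k t \<omega> = - \<theta>1 * (real k)\<^sup>2 * integral {0..t} (\<lambda>s. fourier_coeff u k s \<omega>)
                     + \<theta>2 * integral {0..t} (\<lambda>s. v k s \<omega>) + W (sine_basis k) t \<omega>))"

section \<open>The maximum likelihood estimator\<close>

text \<open>In the log-likelihood, \<open>IU k\<close> and \<open>IV k\<close> are the stochastic integrals \<open>\<integral>\<^sub>0\<^sup>T U\<^sub>k dV\<^sub>k\<close> and
  \<open>\<integral>\<^sub>0\<^sup>T V\<^sub>k dV\<^sub>k\<close>. The integral \<open>\<integral>\<^sub>0\<^sup>T (- a k\<^sup>2 U\<^sub>k + b V\<^sub>k) dV\<^sub>k\<close> is expanded by linearity, which fixes
  one version of it simultaneously for all values of the free parameters \<open>(a, b)\<close>, so that the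
  log-likelihood may be differentiated for each \<open>\<omega>\<close>.\<close>

definition log_likelihood ::
    "real \<Rightarrow> (nat \<Rightarrow> real \<Rightarrow> 'a \<Rightarrow> real) \<Rightarrow> (nat \<Rightarrow> real \<Rightarrow> 'a \<Rightarrow> real) \<Rightarrow> (nat \<Rightarrow> 'a \<Rightarrow> real) \<Rightarrow>
     (nat \<Rightarrow> 'a \<Rightarrow> real) \<Rightarrow> nat \<Rightarrow> 'a \<Rightarrow> real \<Rightarrow> real \<Rightarrow> real" where
  "log_likelihood T U V IU IV N \<omega> a b =
     (\<Sum>k=1..N. (- a * (real k)\<^sup>2 * IU k \<omega> + b * IV k \<omega>)
        - 1/2 * integral {0..T} (\<lambda>t. (- a * (real k)\<^sup>2 * U k t \<omega> + b * V k t \<omega>)\<^sup>2))"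

definition critical_point :: "(real \<Rightarrow> real \<Rightarrow> real) \<Rightarrow> real \<times> real \<Rightarrow> bool" where
  "critical_point Z p \<longleftrightarrow>
     ((\<lambda>a. Z a (snd p)) has_real_derivative 0) (at (fst p)) \<and>
     ((\<lambda>b. Z (fst p) b) has_real_derivative 0) (at (snd p))"

text \<open>The parameters \<open>\<theta>1\<close>, \<open>\<theta>2\<close> are the true values; they enter only through the decomposition
  \<open>dv\<^sub>k = (- \<theta>\<^sub>1 k\<^sup>2 u\<^sub>k + \<theta>\<^sub>2 v\<^sub>k) dt + dw\<^sub>k\<close> of the integrator.\<close>

definition wave_log_likelihood ::
    "'a measure \<Rightarrow> (real \<Rightarrow> 'a measure) \<Rightarrow> ((real \<Rightarrow> real) \<Rightarrow> real \<Rightarrow> 'a \<Rightarrow> real) \<Rightarrow> real \<Rightarrow> real \<Rightarrow> real \<Rightarrow>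
     (real \<Rightarrow> real \<Rightarrow> 'a \<Rightarrow> real) \<Rightarrow> (nat \<Rightarrow> real \<Rightarrow> 'a \<Rightarrow> real) \<Rightarrow> nat \<Rightarrow> 'a \<Rightarrow> real \<Rightarrow> real \<Rightarrow> real" where
  "wave_log_likelihood M F W T \<theta>1 \<theta>2 u v =
     (let drift = (\<lambda>k t \<omega>. - \<theta>1 * (real k)\<^sup>2 * fourier_coeff u k t \<omega> + \<theta>2 * v k t \<omega>);
          int_dv = (\<lambda>X k. ito_process_integral M F (drift k) (W (sine_basis k)) T (X k))
      in log_likelihood T (fourier_coeff u) v (int_dv (fourier_coeff u)) (int_dv v))"

definition wave_mle ::
    "'a measure \<Rightarrow> (real \<Rightarrow> 'a measure) \<Rightarrow> ((real \<Rightarrow> real) \<Rightarrow> real \<Rightarrow> 'a \<Rightarrow> real) \<Rightarrow> real \<Rightarrow> real \<Rightarrow> real \<Rightarrow>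
     (real \<Rightarrow> real \<Rightarrow> 'a \<Rightarrow> real) \<Rightarrow> (nat \<Rightarrow> real \<Rightarrow> 'a \<Rightarrow> real) \<Rightarrow> nat \<Rightarrow> 'a \<Rightarrow> real \<times> real" where
  "wave_mle M F W T \<theta>1 \<theta>2 u v N \<omega> =
     (THE p. critical_point (wave_log_likelihood M F W T \<theta>1 \<theta>2 u v N \<omega>) p)"

text \<open>The critical point of the log-likelihood is unique, and given by the familiar closed
  formula, as soon as the determinant of the linear system does not vanish.\<close>

lemma log_likelihood_quadratic:
  fixes U V :: "nat \<Rightarrow> real \<Rightarrow> 'a \<Rightarrow> real" and IU IV :: "nat \<Rightarrow> 'a \<Rightarrow> real"
  assumes cont: "\<And>k. k \<in> {1..N} \<Longrightarrow> continuous_on {0..T} (\<lambda>t. U k t \<omega>)"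
      "\<And>k. k \<in> {1..N} \<Longrightarrow> continuous_on {0..T} (\<lambda>t. V k t \<omega>)"
  defines "J1 \<equiv> \<Sum>k=1..N. real k ^ 4 * integral {0..T} (\<lambda>t. (U k t \<omega>)\<^sup>2)"
    and "J2 \<equiv> \<Sum>k=1..N. integral {0..T} (\<lambda>t. (V k t \<omega>)\<^sup>2)"
    and "J12 \<equiv> \<Sum>k=1..N. (real k)\<^sup>2 * integral {0..T} (\<lambda>t. U k t \<omega> * V k t \<omega>)"
    and "B1 \<equiv> - (\<Sum>k=1..N. (real k)\<^sup>2 * IU k \<omega>)"
    and "B2 \<equiv> \<Sum>k=1..N. IV k \<omega>"
  shows "log_likelihood T U V IU IV N \<omega> a b
           = a * B1 + b * B2 - 1/2 * (a\<^sup>2 * J1 - 2 * a * b * J12 + b\<^sup>2 * J2)"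
proof -
  have eq: "integral {0..T} (\<lambda>t. (- a * (real k)\<^sup>2 * U k t \<omega> + b * V k t \<omega>)\<^sup>2)
      = a\<^sup>2 * (real k ^ 4 * integral {0..T} (\<lambda>t. (U k t \<omega>)\<^sup>2))
        - 2 * a * b * ((real k)\<^sup>2 * integral {0..T} (\<lambda>t. U k t \<omega> * V k t \<omega>))
        + b\<^sup>2 * integral {0..T} (\<lambda>t. (V k t \<omega>)\<^sup>2)" if k: "k \<in> {1..N}" for k
  proof -
    note c = cont(1)[OF k] cont(2)[OF k]
    have i: "(\<lambda>t. (U k t \<omega>)\<^sup>2) integrable_on {0..T}"
      "(\<lambda>t. U k t \<omega> * V k t \<omega>) integrable_on {0..T}"
      "(\<lambda>t. (V k t \<omega>)\<^sup>2) integrable_on {0..T}"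
      by (intro integrable_continuous_real continuous_intros c)+
    have "((\<lambda>t. (a\<^sup>2 * real k ^ 4) * (U k t \<omega>)\<^sup>2 - (2 * a * b * (real k)\<^sup>2) * (U k t \<omega> * V k t \<omega>)
            + b\<^sup>2 * (V k t \<omega>)\<^sup>2) has_integral
          (a\<^sup>2 * real k ^ 4) * integral {0..T} (\<lambda>t. (U k t \<omega>)\<^sup>2)
          - (2 * a * b * (real k)\<^sup>2) * integral {0..T} (\<lambda>t. U k t \<omega> * V k t \<omega>)
          + b\<^sup>2 * integral {0..T} (\<lambda>t. (V k t \<omega>)\<^sup>2)) {0..T}"
      by (intro has_integral_add has_integral_diff has_integral_mult_right
          integrable_integral i)
    moreover have "(\<lambda>t. (a\<^sup>2 * real k ^ 4) * (U k t \<omega>)\<^sup>2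
            - (2 * a * b * (real k)\<^sup>2) * (U k t \<omega> * V k t \<omega>) + b\<^sup>2 * (V k t \<omega>)\<^sup>2)
          = (\<lambda>t. (- a * (real k)\<^sup>2 * U k t \<omega> + b * V k t \<omega>)\<^sup>2)"
      by (rule ext) algebra
    ultimately show ?thesis
      by (simp add: integral_unique mult.assoc)
  qed
  have "log_likelihood T U V IU IV N \<omega> a b =
     (\<Sum>k=1..N. a * - ((real k)\<^sup>2 * IU k \<omega>) + b * IV k \<omega>
        - 1/2 * (a\<^sup>2 * (real k ^ 4 * integral {0..T} (\<lambda>t. (U k t \<omega>)\<^sup>2))
        - 2 * a * b * ((real k)\<^sup>2 * integral {0..T} (\<lambda>t. U k t \<omega> * V k t \<omega>))
        + b\<^sup>2 * integral {0..T} (\<lambda>t. (V k t \<omega>)\<^sup>2)))"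
    unfolding log_likelihood_def by (rule sum.cong[OF refl]) (subst eq, assumption, simp)
  also have "\<dots> = a * B1 + b * B2 - 1/2 * (a\<^sup>2 * J1 - 2 * a * b * J12 + b\<^sup>2 * J2)"
    unfolding J1_def J2_def J12_def B1_def B2_def
    by (simp only: sum.distrib sum_subtractf sum_distrib_left [symmetric] sum_negf)
  finally show ?thesis .
qed

lemma critical_point_log_likelihood_iff:
  fixes U V :: "nat \<Rightarrow> real \<Rightarrow> 'a \<Rightarrow> real" and IU IV :: "nat \<Rightarrow> 'a \<Rightarrow> real"
  assumes cont: "\<And>k. k \<in> {1..N} \<Longrightarrow> continuous_on {0..T} (\<lambda>t. U k t \<omega>)"
      "\<And>k. k \<in> {1..N} \<Longrightarrow> continuous_on {0..T} (\<lambda>t. V k t \<omega>)"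
  defines "J1 \<equiv> \<Sum>k=1..N. real k ^ 4 * integral {0..T} (\<lambda>t. (U k t \<omega>)\<^sup>2)"
    and "J2 \<equiv> \<Sum>k=1..N. integral {0..T} (\<lambda>t. (V k t \<omega>)\<^sup>2)"
    and "J12 \<equiv> \<Sum>k=1..N. (real k)\<^sup>2 * integral {0..T} (\<lambda>t. U k t \<omega> * V k t \<omega>)"
    and "B1 \<equiv> - (\<Sum>k=1..N. (real k)\<^sup>2 * IU k \<omega>)"
    and "B2 \<equiv> \<Sum>k=1..N. IV k \<omega>"
  assumes det: "J1 * J2 - J12\<^sup>2 \<noteq> 0"
  shows "critical_point (log_likelihood T U V IU IV N \<omega>) p \<longleftrightarrow>
           p = ((B1 * J2 + B2 * J12) / (J1 * J2 - J12\<^sup>2), (B1 * J12 + B2 * J1) / (J1 * J2 - J12\<^sup>2))"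
proof -
  obtain a b where p: "p = (a, b)" by (cases p)
  let ?Z = "log_likelihood T U V IU IV N \<omega>"
  have Z: "?Z = (\<lambda>a b. a * B1 + b * B2 - 1/2 * (a\<^sup>2 * J1 - 2 * a * b * J12 + b\<^sup>2 * J2))"
    unfolding J1_def J2_def J12_def B1_def B2_def
    by (intro ext log_likelihood_quadratic) (fact cont)+
  have d1: "((\<lambda>a. ?Z a b) has_real_derivative (B1 - a * J1 + b * J12)) (at a)"
    unfolding Z by (auto intro!: derivative_eq_intros simp: algebra_simps)
  have d2: "((\<lambda>b. ?Z a b) has_real_derivative (B2 + a * J12 - b * J2)) (at b)"
    unfolding Z by (auto intro!: derivative_eq_intros simp: algebra_simps)
  have "critical_point ?Z p \<longleftrightarrow> B1 - a * J1 + b * J12 = 0 \<and> B2 + a * J12 - b * J2 = 0"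
    unfolding critical_point_def p fst_conv snd_conv
    using d1 d2 by (metis DERIV_unique)
  also have "\<dots> \<longleftrightarrow> a * (J1 * J2 - J12\<^sup>2) = B1 * J2 + B2 * J12 \<and>
                      b * (J1 * J2 - J12\<^sup>2) = B1 * J12 + B2 * J1" (is "?L \<longleftrightarrow> ?R")
  proof
    assume ?L
    then show ?R by algebra
  next
    assume R: ?R
    have "(B1 - a * J1 + b * J12) * (J1 * J2 - J12\<^sup>2) = 0"
      "(B2 + a * J12 - b * J2) * (J1 * J2 - J12\<^sup>2) = 0"
      using R by algebra+
    then show ?L using det by simp
  qed
  also have "\<dots> \<longleftrightarrow> p = ((B1 * J2 + B2 * J12) / (J1 * J2 - J12\<^sup>2),
                           (B1 * J12 + B2 * J1) / (J1 * J2 - J12\<^sup>2))"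
    using det unfolding p by (auto simp: eq_divide_eq)
  finally show ?thesis .
qed

section \<open>Gaussian vectors and convergence in distribution\<close>

definition gaussian_real :: "real \<Rightarrow> real \<Rightarrow> real measure" where
  "gaussian_real m \<sigma> =
     (if \<sigma> = 0 then return borel m else density lborel (\<lambda>x. ennreal (normal_density m \<sigma> x)))"

definition gaussian_measure :: "('b::euclidean_space) measure \<Rightarrow> bool" where
  "gaussian_measure \<mu> \<longleftrightarrow>
     prob_space \<mu> \<and> sets \<mu> = sets borel \<and>
     (\<forall>a. \<exists>m. \<exists>\<sigma>\<ge>0. distr \<mu> borel (\<lambda>x. x \<bullet> a) = gaussian_real m \<sigma>)"

definition zero_mean :: "('b::euclidean_space) measure \<Rightarrow> bool" where
  "zero_mean \<mu> \<longleftrightarrow> (\<forall>a. integrable \<mu> (\<lambda>x. x \<bullet> a) \<and> (\<integral>x. x \<bullet> a \<partial>\<mu>) = 0)"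

text \<open>For a zero-mean Gaussian measure: the covariance matrix is positive definite.\<close>

definition nondegenerate :: "('b::euclidean_space) measure \<Rightarrow> bool" where
  "nondegenerate \<mu> \<longleftrightarrow> (\<forall>a. a \<noteq> 0 \<longrightarrow> 0 < (\<integral>x. (x \<bullet> a)\<^sup>2 \<partial>\<mu>))"

definition converges_in_distribution ::
    "'a measure \<Rightarrow> (nat \<Rightarrow> 'a \<Rightarrow> 'b::topological_space) \<Rightarrow> 'b measure \<Rightarrow> bool" where
  "converges_in_distribution M X \<mu> \<longleftrightarrow>
     (\<forall>n. X n \<in> borel_measurable M) \<and>
     (\<forall>f::'b \<Rightarrow> real. continuous_on UNIV f \<and> bounded (range f) \<longrightarrow>
        (\<lambda>n. \<integral>\<omega>. f (X n \<omega>) \<partial>M) \<longlonglongrightarrow> (\<integral>x. f x \<partial>\<mu>))"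

end

theory Submission
  imports Defs "HOL-Real_Asymp.Real_Asymp"
begin

text \<open>
  The Fourier coefficients decouple the equation. Mode \<open>k\<close> is a damped oscillator with stiffness
  \<open>a = \<theta>\<^sub>1 k\<^sup>2\<close>, driven by a Brownian motion \<open>w\<^sub>k\<close> of its own. With \<open>J\<^sub>1\<close>, \<open>J\<^sub>2\<close>, \<open>J\<^sub>1\<^sub>2\<close> the entries of
  the information and \<open>A\<^sub>1 = \<Sum>\<^sub>k k\<^sup>2 \<integral> u\<^sub>k dw\<^sub>k\<close>, \<open>A\<^sub>2 = \<Sum>\<^sub>k \<integral> v\<^sub>k dw\<^sub>k\<close>, inserting the equation for \<open>dv\<^sub>k\<close>
  into the closed form of the estimator gives its errors exactly: they are
  \<open>(- A\<^sub>1 J\<^sub>2 + A\<^sub>2 J\<^sub>1\<^sub>2) / (J\<^sub>1 J\<^sub>2 - J\<^sub>1\<^sub>2\<^sup>2)\<close> and \<open>(- A\<^sub>1 J\<^sub>1\<^sub>2 + A\<^sub>2 J\<^sub>1) / (J\<^sub>1 J\<^sub>2 - J\<^sub>1\<^sub>2\<^sup>2)\<close>. All five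
  statistics are sums over independent modes, so the theorem follows from moment bounds for one mode
  that are uniform in \<open>k\<close> and from limit theorems for weighted sums of independent variables.

  The processes \<open>u\<^sub>k\<close> and \<open>v\<^sub>k\<close> are Wiener integrals of the impulse response \<open>g\<close> and of its
  derivative (\<open>oscillator_stieltjes_representation\<close>). The energy \<open>a g\<^sup>2 + g'\<^sup>2\<close> is bounded independently of
  \<open>a\<close> (\<open>kernel_energy\<close>), so \<open>sqrt a u\<^sub>k\<close> and \<open>v\<^sub>k\<close> have uniformly bounded eighth moments. As \<open>a\<close> tends to
  infinity the energy is shared equally between position and velocity and the two become orthogonal
  (\<open>oscillator_energy_limits\<close>): the mean values of \<open>a \<integral> u\<^sub>k\<^sup>2\<close> and \<open>\<integral> v\<^sub>k\<^sup>2\<close> tend to the same constant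
  \<open>c > 0\<close>, and that of \<open>sqrt a \<integral> u\<^sub>k v\<^sub>k\<close> tends to zero. Because \<open>k\<^sup>2 u\<^sub>k\<close> is \<open>k / sqrt \<theta>\<^sub>1\<close> times \<open>sqrt a u\<^sub>k\<close>,
  the information grows like \<open>J\<^sub>1 \<sim> N\<^sup>3 c / (3 \<theta>\<^sub>1)\<close>, \<open>J\<^sub>2 \<sim> N c\<close> and \<open>J\<^sub>1\<^sub>2 = o(N\<^sup>2)\<close>. This explains
  both rates and why the limiting covariance is diagonal.

  Fourth moments yield the strong law for the five statistics
  (\<open>strong_law_fourth_moment\<close>). By the Ito isometry the mean information is the covariance of the scores
  \<open>A\<^sub>1\<close>, \<open>A\<^sub>2\<close>, and a central limit theorem for triangular arrays (\<open>clt_triangular_array\<close>) makes the normalized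
  scores asymptotically Gaussian. Slutsky's theorem transfers this to the errors. Weak convergence in the
  plane is deduced from characteristic functions by approximation with trigonometric polynomials
  (\<open>converges_in_distribution_planeI\<close>).

  The Ito integral is defined by a choice among all \<open>L\<^sub>2\<close> limits of elementary integrals.
  The isometry shows that the limit is unique up to null sets (\<open>has_ito_integral_unique\<close>), and for the
  integrands at hand the left-endpoint sums along dyadic partitions converge to it almost surely
  (\<open>ito_integral_dyadic_limit\<close>). Hence the integrals of mode \<open>k\<close> are measurable for the completed
  \<open>\<sigma>\<close>-algebra generated by the path of \<open>w\<^sub>k\<close>, which makes the statistics of different modes independent.
\<close>

section \<open>The impulse response of a damped oscillator\<close>

text \<open>The response \<open>g\<close> of the oscillator \<open>g'' = - a g + b g'\<close> to a
  unit impulse of the velocity, together with its derivative.\<close>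

definition oscillator_kernel :: "real \<Rightarrow> real \<Rightarrow> (real \<Rightarrow> real) \<Rightarrow> (real \<Rightarrow> real) \<Rightarrow> bool" where
  "oscillator_kernel a b g g' \<longleftrightarrow> g 0 = 0 \<and> g' 0 = 1 \<and>
     (\<forall>t. (g has_real_derivative g' t) (at t)) \<and>
     (\<forall>t. (g' has_real_derivative (- a * g t + b * g' t)) (at t))"

text \<open>The substitution \<open>g(t) = exp (b t / 2) f(t)\<close> removes the damping and
  leaves \<open>f'' = - l f\<close> with \<open>l = a - b\<^sup>2 / 4\<close>; the three signs of
  \<open>l\<close> are oscillation, critical damping and overdamping.\<close>

lemma oscillator_kernel_exists: "\<exists>g g'. oscillator_kernel a b g g'"
proof -
  define l where "l = a - b\<^sup>2 / 4"
  have a: "a = l + b\<^sup>2 / 4" by (simp add: l_def)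
  consider "l > 0" | "l = 0" | "l < 0" by linarith
  then show ?thesis
  proof cases
    case 1
    define r where "r = sqrt l"
    have r: "r > 0" "l = r * r" using 1 by (auto simp: r_def)
    have "oscillator_kernel a b (\<lambda>t. exp (b*t/2) * sin (r*t) / r)
       (\<lambda>t. exp (b*t/2) * cos (r*t) + b / (2*r) * (exp (b*t/2) * sin (r*t)))"
      unfolding oscillator_kernel_def a r(2) using r(1)
      by (auto intro!: derivative_eq_intros simp: field_simps power2_eq_square)
    then show ?thesis by blast
  next
    case 2
    have "oscillator_kernel a b (\<lambda>t. t * exp (b*t/2)) (\<lambda>t. exp (b*t/2) + b/2 * (t * exp (b*t/2)))"
      unfolding oscillator_kernel_def a 2
      by (auto intro!: derivative_eq_intros simp: field_simps power2_eq_square)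
    then show ?thesis by blast
  next
    case 3
    define r where "r = sqrt (- l)"
    have "r > 0" "- l = r * r" using 3 by (auto simp: r_def)
    then have r: "r > 0" "l = - (r * r)" by auto
    have "oscillator_kernel a b (\<lambda>t. exp (b*t/2) * sinh (r*t) / r)
       (\<lambda>t. exp (b*t/2) * cosh (r*t) + b / (2*r) * (exp (b*t/2) * sinh (r*t)))"
      unfolding oscillator_kernel_def a r(2) using r(1)
      by (auto intro!: derivative_eq_intros simp: field_simps power2_eq_square)
    then show ?thesis by blast
  qed
qed

lemma oscillator_kernelD:
  assumes "oscillator_kernel a b g g'"
  shows "g 0 = 0" "g' 0 = 1" "(g has_real_derivative g' t) (at t within S)"
    "(g' has_real_derivative (- a * g t + b * g' t)) (at t within S)"
    "continuous_on S g" "continuous_on S g'"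
proof -
  show 1: "g 0 = 0" "g' 0 = 1" "(g has_real_derivative g' t) (at t within S)"
    "(g' has_real_derivative (- a * g t + b * g' t)) (at t within S)" for t S
    using assms unfolding oscillator_kernel_def by (blast intro: has_field_derivative_at_within)+
  show "continuous_on S g" "continuous_on S g'"
    by (rule DERIV_continuous_on, rule 1)+
qed

text \<open>Energy changes only through the damping: its derivative is \<open>2 b
  g'\<^sup>2\<close>, at most \<open>2 \<bar>b\<bar>\<close> times the energy itself. The bound
  does not involve \<open>a\<close>, and this is what makes all moment bounds uniform over the
  modes.\<close>

lemma kernel_energy:
  assumes k: "oscillator_kernel a b g g'" and a: "0 \<le> a" and t: "0 \<le> t"
  shows "a * (g t)\<^sup>2 + (g' t)\<^sup>2 \<le> exp (2 * \<bar>b\<bar> * t)"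
proof -
  define h where "h = (\<lambda>t. (a * (g t)\<^sup>2 + (g' t)\<^sup>2) * exp (- 2 * \<bar>b\<bar> * t))"
  have "h t \<le> h 0"
  proof (rule DERIV_nonpos_imp_nonincreasing[OF t])
    fix x assume "0 \<le> x" "x \<le> t"
    have "(h has_real_derivative
        exp (- 2 * \<bar>b\<bar> * x) * (2 * b * (g' x)\<^sup>2 - 2 * \<bar>b\<bar> * (a * (g x)\<^sup>2 + (g' x)\<^sup>2))) (at x)"
      unfolding h_def
      by (auto intro!: derivative_eq_intros oscillator_kernelD(3,4)[OF k] simp: power2_eq_square algebra_simps)
    moreover have "b * (g' x)\<^sup>2 \<le> \<bar>b\<bar> * (g' x)\<^sup>2" by (intro mult_right_mono) auto
    moreover have "0 \<le> \<bar>b\<bar> * (a * (g x)\<^sup>2)" using a by simp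
    then have "2 * b * (g' x)\<^sup>2 - 2 * \<bar>b\<bar> * (a * (g x)\<^sup>2 + (g' x)\<^sup>2) \<le> 0"
      using \<open>b * (g' x)\<^sup>2 \<le> \<bar>b\<bar> * (g' x)\<^sup>2\<close> by (simp add: distrib_left)
    ultimately show "\<exists>y. (h has_real_derivative y) (at x) \<and> y \<le> 0"
      by (blast intro: mult_nonneg_nonpos exp_ge_zero)
  qed
  then have "(a * (g t)\<^sup>2 + (g' t)\<^sup>2) * exp (- 2 * \<bar>b\<bar> * t) \<le> 1"
    by (simp add: h_def oscillator_kernelD[OF k])
  then show ?thesis by (simp add: exp_minus field_simps)
qed

lemma kernel_bounds:
  assumes k: "oscillator_kernel a b g g'" and a: "0 < a" and t: "0 \<le> t" "t \<le> T"
  shows "\<bar>sqrt a * g t\<bar> \<le> exp (\<bar>b\<bar> * T)" "\<bar>g' t\<bar> \<le> exp (\<bar>b\<bar> * T)"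
proof -
  have e: "a * (g t)\<^sup>2 + (g' t)\<^sup>2 \<le> (exp (\<bar>b\<bar> * T))\<^sup>2"
  proof -
    have "exp (2 * \<bar>b\<bar> * t) \<le> exp (2 * (\<bar>b\<bar> * T))" using t by (simp add: mult_left_mono)
    also have "\<dots> = (exp (\<bar>b\<bar> * T))\<^sup>2" by (simp add: exp_double)
    finally show ?thesis using kernel_energy[OF k _ t(1)] a by simp
  qed
  have "(sqrt a * g t)\<^sup>2 = a * (g t)\<^sup>2" using a by (simp add: power_mult_distrib)
  then have "(sqrt a * g t)\<^sup>2 \<le> (exp (\<bar>b\<bar> * T))\<^sup>2" using e by (smt (verit) zero_le_power2)
  moreover have "(g' t)\<^sup>2 \<le> (exp (\<bar>b\<bar> * T))\<^sup>2" using e a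
    by (smt (verit) zero_le_power2 mult_nonneg_nonneg)
  ultimately show "\<bar>sqrt a * g t\<bar> \<le> exp (\<bar>b\<bar> * T)" "\<bar>g' t\<bar> \<le> exp (\<bar>b\<bar> * T)"
    using abs_le_square_iff by (metis abs_exp_cancel)+
qed

lemma kernel_cross_energy:
  assumes k: "oscillator_kernel a b g g'" and t: "0 \<le> t"
  shows "integral {0..t} (\<lambda>r. g r * g' r) = (g t)\<^sup>2 / 2"
proof -
  have "((\<lambda>r. g r * g' r) has_integral ((g t)\<^sup>2 / 2 - (g 0)\<^sup>2 / 2)) {0..t}"
    by (intro fundamental_theorem_of_calculus[OF t])
      (auto simp: has_real_derivative_iff_has_vector_derivative[symmetric]
        intro!: derivative_eq_intros oscillator_kernelD(3,4)[OF k])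
  then show ?thesis by (simp add: oscillator_kernelD[OF k] integral_unique)
qed

text \<open>For large stiffness the energy is shared equally between position and velocity. The
  function \<open>P = g g' - b g\<^sup>2 / 2\<close> has derivative \<open>g'\<^sup>2 - a
  g\<^sup>2\<close>, so it is the difference of the two integrals, and it is of order \<open>1 /
  sqrt a\<close>. Their sum solves the equation \<open>Y' = 1 + b Y\<close> up to the small
  inhomogeneity \<open>b P\<close>.\<close>

lemma kernel_equipartition:
  assumes k: "oscillator_kernel a b g g'" and a: "1 \<le> a" and T: "0 \<le> t" "t \<le> T"
  defines "K \<equiv> (1 + \<bar>b\<bar> * T * exp (2 * \<bar>b\<bar> * T)) * (exp (2 * \<bar>b\<bar> * T) * (1 + \<bar>b\<bar>))"
  defines "Y \<equiv> integral {0..t} (\<lambda>r. exp (b * r))"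
  shows "\<bar>2 * integral {0..t} (\<lambda>r. (g' r)\<^sup>2) - Y\<bar> \<le> K / sqrt a"
    "\<bar>2 * integral {0..t} (\<lambda>r. (sqrt a * g r)\<^sup>2) - Y\<bar> \<le> K / sqrt a"
proof -
  note kd = oscillator_kernelD[OF k]
  define B where "B = exp (2 * \<bar>b\<bar> * T) * (1 + \<bar>b\<bar>)"
  define P where "P = (\<lambda>t. g t * g' t - b * (g t)\<^sup>2 / 2)"
  have T0: "0 \<le> T" using T by simp
  have Pb: "\<bar>P s\<bar> \<le> B / sqrt a" if "0 \<le> s" "s \<le> T" for s
  proof -
    let ?E = "exp (\<bar>b\<bar> * T)"
    have EE: "?E * ?E = exp (2 * \<bar>b\<bar> * T)" by (simp flip: exp_add)
    have sa: "1 \<le> sqrt a" using a by simp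
    have g: "\<bar>g s\<bar> \<le> ?E / sqrt a" "\<bar>g' s\<bar> \<le> ?E"
      using kernel_bounds[OF k _ that] a by (auto simp: abs_mult field_simps)
    have "?E / sqrt a \<le> ?E / 1" using sa by (intro divide_left_mono) auto
    then have g2: "\<bar>g s\<bar> \<le> ?E" using g(1) by simp
    have "\<bar>g s * g' s\<bar> \<le> ?E / sqrt a * ?E" unfolding abs_mult
      by (intro mult_mono g) (use a in auto)
    moreover have "\<bar>(g s)\<^sup>2\<bar> \<le> ?E / sqrt a * ?E" unfolding power2_eq_square abs_mult
      by (intro mult_mono g g2) (use a in auto)
    then have "\<bar>b * (g s)\<^sup>2 / 2\<bar> \<le> \<bar>b\<bar> * (?E / sqrt a * ?E)"
    proof -
      assume "\<bar>(g s)\<^sup>2\<bar> \<le> ?E / sqrt a * ?E"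
      then have "\<bar>b\<bar> * \<bar>(g s)\<^sup>2\<bar> \<le> \<bar>b\<bar> * (?E / sqrt a * ?E)" by (intro mult_left_mono) auto
      moreover have "\<bar>b * (g s)\<^sup>2 / 2\<bar> \<le> \<bar>b\<bar> * \<bar>(g s)\<^sup>2\<bar>" by (simp add: abs_mult)
      ultimately show ?thesis by linarith
    qed
    moreover have "\<bar>P s\<bar> \<le> \<bar>g s * g' s\<bar> + \<bar>b * (g s)\<^sup>2 / 2\<bar>" unfolding P_def by linarith
    ultimately have "\<bar>P s\<bar> \<le> ?E / sqrt a * ?E + \<bar>b\<bar> * (?E / sqrt a * ?E)" by linarith
    then have "\<bar>P s\<bar> \<le> (1 + \<bar>b\<bar>) * (?E / sqrt a * ?E)" by (simp only: distrib_right mult_1_left)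
    also have "\<dots> = B / sqrt a" unfolding B_def EE[symmetric] by simp
    finally show ?thesis .
  qed
  define G where "G = (\<lambda>t. integral {0..t} (\<lambda>r. (g' r)\<^sup>2))"
  define H where "H = (\<lambda>t. integral {0..t} (\<lambda>r. (sqrt a * g r)\<^sup>2))"
  define Yt where "Yt = (\<lambda>t. integral {0..t} (\<lambda>r. exp (b * r)))"
  have dG: "(G has_real_derivative (g' s)\<^sup>2) (at s within {0..t})"
   and dH: "(H has_real_derivative a * (g s)\<^sup>2) (at s within {0..t})"
   and dY: "(Yt has_real_derivative exp (b * s)) (at s within {0..t})" if "s \<in> {0..t}" for s
  proof -
    show "(G has_real_derivative (g' s)\<^sup>2) (at s within {0..t})" unfolding G_def
      by (intro integral_has_real_derivative that continuous_intros kd)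
    have "(H has_real_derivative (sqrt a * g s)\<^sup>2) (at s within {0..t})" unfolding H_def
      by (intro integral_has_real_derivative that continuous_intros kd)
    then show "(H has_real_derivative a * (g s)\<^sup>2) (at s within {0..t})"
      using a by (simp add: power_mult_distrib)
    show "(Yt has_real_derivative exp (b * s)) (at s within {0..t})" unfolding Yt_def
      by (intro integral_has_real_derivative that continuous_intros)
  qed
  have const: "f s = f 0" if "\<And>x. x \<in> {0..t} \<Longrightarrow> (f has_real_derivative 0) (at x within {0..t})" "s \<in> {0..t}" for f :: "real \<Rightarrow> real" and s
    using has_field_derivative_zero_constant[of "{0..t}" f] that by (metis T(1) atLeastAtMost_iff convex_real_interval(5) order_refl)
  have z: "G 0 = 0" "H 0 = 0" "Yt 0 = 0" by (auto simp: G_def H_def Yt_def)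
  \<comment> \<open>The three conservation laws below are verified by differentiation.\<close>
  have GH: "G s - H s = P s" if "s \<in> {0..t}" for s
  proof -
    have "(\<lambda>s. G s - H s - P s) s = (\<lambda>s. G s - H s - P s) 0"
      by (rule const[OF _ that]) (unfold P_def, auto intro!: derivative_eq_intros dG dH kd simp: power2_eq_square algebra_simps)
    then show ?thesis by (simp add: z P_def kd)
  qed
  have en: "a * (g s)\<^sup>2 + (g' s)\<^sup>2 = 1 + 2 * b * G s" if "s \<in> {0..t}" for s
  proof -
    have "(\<lambda>s. a * (g s)\<^sup>2 + (g' s)\<^sup>2 - 2 * b * G s) s = (\<lambda>s. a * (g s)\<^sup>2 + (g' s)\<^sup>2 - 2 * b * G s) 0"
      by (rule const[OF _ that]) (auto intro!: derivative_eq_intros dG dH kd simp: power2_eq_square algebra_simps)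
    then show ?thesis by (simp add: z P_def kd)
  qed
  have Ye: "exp (b * s) = 1 + b * Yt s" if "s \<in> {0..t}" for s
  proof -
    have "(\<lambda>s. exp (b * s) - b * Yt s) s = (\<lambda>s. exp (b * s) - b * Yt s) 0"
      by (rule const[OF _ that]) (auto intro!: derivative_eq_intros dY simp: algebra_simps)
    then show ?thesis by (simp add: z)
  qed
  define D where "D = (\<lambda>s. G s + H s - Yt s)"
  have dD: "((\<lambda>s. D s * exp (- b * s)) has_real_derivative b * P s * exp (- b * s)) (at s within {0..t})"
    if s: "s \<in> {0..t}" for s
  proof -
    have eq: "(g' s)\<^sup>2 + a * (g s)\<^sup>2 - exp (b * s) - b * D s = b * P s"
      using en[OF s] Ye[OF s] GH[OF s] unfolding D_def by (simp add: algebra_simps)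
    have "((\<lambda>s. D s * exp (- b * s)) has_real_derivative ((g' s)\<^sup>2 + a * (g s)\<^sup>2 - exp (b * s) - b * D s) * exp (- b * s)) (at s within {0..t})"
      unfolding D_def by (auto intro!: derivative_eq_intros dG dH dY s simp: algebra_simps)
    then show ?thesis unfolding eq by simp
  qed
  have eb: "exp (- b * s) \<le> exp (\<bar>b\<bar> * T)" "exp (b * s) \<le> exp (\<bar>b\<bar> * T)" if "s \<in> {0..t}" for s
  proof -
    have "\<bar>b * s\<bar> \<le> \<bar>b\<bar> * T" unfolding abs_mult using that T by (intro mult_left_mono) auto
    then show "exp (- b * s) \<le> exp (\<bar>b\<bar> * T)" "exp (b * s) \<le> exp (\<bar>b\<bar> * T)" by auto
  qed
  have Bs: "0 \<le> B / sqrt a" using a by (auto simp: B_def)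
  have "norm ((\<lambda>s. D s * exp (- b * s)) t - (\<lambda>s. D s * exp (- b * s)) 0) \<le> (\<bar>b\<bar> * (B / sqrt a) * exp (\<bar>b\<bar> * T)) * norm (t - 0)"
  proof (rule field_differentiable_bound[OF _ dD])
    fix s assume s: "s \<in> {0..t}"
    show "norm (b * P s * exp (- b * s)) \<le> \<bar>b\<bar> * (B / sqrt a) * exp (\<bar>b\<bar> * T)"
      unfolding real_norm_def abs_mult using s T eb[OF s] Bs
      by (intro mult_mono Pb mult_nonneg_nonneg) auto
  qed (use T in auto)
  also have "\<dots> \<le> (\<bar>b\<bar> * (B / sqrt a) * exp (\<bar>b\<bar> * T)) * T"
    using T Bs by (intro mult_left_mono mult_nonneg_nonneg) auto
  finally have "\<bar>D t * exp (- b * t)\<bar> \<le> (\<bar>b\<bar> * (B / sqrt a) * exp (\<bar>b\<bar> * T)) * T"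
    by (simp add: D_def z)
  moreover have "\<bar>D t\<bar> = \<bar>D t * exp (- b * t)\<bar> * exp (b * t)"
    by (simp add: abs_mult flip: exp_add)
  moreover have "\<bar>D t * exp (- b * t)\<bar> * exp (b * t) \<le> (\<bar>b\<bar> * (B / sqrt a) * exp (\<bar>b\<bar> * T)) * T * exp (\<bar>b\<bar> * T)"
    by (rule mult_mono) (use eb(2)[of t] T Bs calculation in \<open>auto intro: order_trans[OF abs_ge_zero]\<close>)
  ultimately have "\<bar>D t\<bar> \<le> (\<bar>b\<bar> * (B / sqrt a) * exp (\<bar>b\<bar> * T)) * T * exp (\<bar>b\<bar> * T)"
    by linarith
  also have "\<dots> = \<bar>b\<bar> * T * (exp (\<bar>b\<bar> * T) * exp (\<bar>b\<bar> * T)) * (B / sqrt a)" by simp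
  also have "exp (\<bar>b\<bar> * T) * exp (\<bar>b\<bar> * T) = exp (2 * \<bar>b\<bar> * T)" by (simp flip: exp_add)
  finally have Db: "\<bar>D t\<bar> \<le> \<bar>b\<bar> * T * exp (2 * \<bar>b\<bar> * T) * (B / sqrt a)" .
  have Pt: "\<bar>P t\<bar> \<le> B / sqrt a" using Pb T by simp
  have K: "K / sqrt a = B / sqrt a + \<bar>b\<bar> * T * exp (2 * \<bar>b\<bar> * T) * (B / sqrt a)"
    unfolding K_def B_def[symmetric] by (simp add: distrib_right add_divide_distrib)
  have tt: "t \<in> {0..t}" using T by simp
  have "2 * G t - Yt t = D t + P t" "2 * H t - Yt t = D t - P t"
    using GH[OF tt] by (auto simp: D_def)
  then show "\<bar>2 * integral {0..t} (\<lambda>r. (g' r)\<^sup>2) - Y\<bar> \<le> K / sqrt a"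
    "\<bar>2 * integral {0..t} (\<lambda>r. (sqrt a * g r)\<^sup>2) - Y\<bar> \<le> K / sqrt a"
    using Db Pt K unfolding G_def H_def Y_def Yt_def by linarith+
qed

text \<open>Integrate the equipartition estimate over \<open>t\<close>; the limit is
  \<open>\<integral> Y(t) / 2 dt\<close>. The inner integral of the cross term is \<open>sqrt a
  g\<^sup>2 / 2\<close>, again of order \<open>1 / sqrt a\<close>.\<close>

lemma oscillator_energy_limits:
  fixes b T :: real and a :: "nat \<Rightarrow> real" and g g' :: "nat \<Rightarrow> real \<Rightarrow> real"
  assumes T: "0 < T" and a: "filterlim a at_top sequentially"
    and k: "\<And>n. oscillator_kernel (a n) b (g n) (g' n)"
  obtains c where "0 < c"
    "(\<lambda>n. integral {0..T} (\<lambda>t. integral {0..t} (\<lambda>r. (sqrt (a n) * g n r)\<^sup>2))) \<longlonglongrightarrow> c"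
    "(\<lambda>n. integral {0..T} (\<lambda>t. integral {0..t} (\<lambda>r. (g' n r)\<^sup>2))) \<longlonglongrightarrow> c"
    "(\<lambda>n. integral {0..T} (\<lambda>t. integral {0..t} (\<lambda>r. sqrt (a n) * g n r * g' n r))) \<longlonglongrightarrow> 0"
proof -
  define Y where "Y = (\<lambda>t. integral {0..t} (\<lambda>r. exp (b * r)))"
  define K where "K = (1 + \<bar>b\<bar> * T * exp (2 * \<bar>b\<bar> * T)) * (exp (2 * \<bar>b\<bar> * T) * (1 + \<bar>b\<bar>))"
  have contI: "continuous_on {0..T} (\<lambda>t. integral {0..t} f)" if "continuous_on {0..T} f" for f :: "real \<Rightarrow> real"
    using that by (intro indefinite_integral_continuous_1 integrable_continuous_real)
  have cY: "continuous_on {0..T} Y" unfolding Y_def by (intro contI continuous_intros)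
  note kd = oscillator_kernelD[OF k]
  have lim0: "(\<lambda>n. C / sqrt (a n)) \<longlonglongrightarrow> 0" for C
    by (intro tendsto_divide_0[OF tendsto_const] filterlim_at_top_imp_at_infinity
        filterlim_compose[OF sqrt_at_top a])
  have ev: "\<forall>\<^sub>F n in sequentially. 1 \<le> a n" using a by (simp add: filterlim_at_top)
  have main: "(\<lambda>n. integral {0..T} (\<lambda>t. f n t)) \<longlonglongrightarrow> integral {0..T} h"
    if c: "\<And>n. continuous_on {0..T} (f n)" "continuous_on {0..T} h"
      and b: "\<And>n t. 1 \<le> a n \<Longrightarrow> 0 \<le> t \<Longrightarrow> t \<le> T \<Longrightarrow> \<bar>f n t - h t\<bar> \<le> C / sqrt (a n)" for f :: "nat \<Rightarrow> real \<Rightarrow> real" and h C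
  proof (rule Lim_transform)
    show "(\<lambda>n. integral {0..T} (\<lambda>t. f n t) - integral {0..T} h) \<longlonglongrightarrow> 0"
    proof (rule Lim_null_comparison)
      show "(\<lambda>n. (C / sqrt (a n)) * (T - 0)) \<longlonglongrightarrow> 0" using lim0[of "C * T"] by simp
      show "\<forall>\<^sub>F n in sequentially. norm (integral {0..T} (f n) - integral {0..T} h) \<le> (C / sqrt (a n)) * (T - 0)"
        using ev
      proof eventually_elim
        case (elim n)
        have "integral {0..T} (f n) - integral {0..T} h = integral {0..T} (\<lambda>t. f n t - h t)"
          by (intro integral_diff[symmetric] integrable_continuous_real c)
        then show ?case using T b[OF elim]
          unfolding \<open>integral {0..T} (f n) - integral {0..T} h = _\<close>
          by (intro integral_bound) (auto intro!: continuous_intros c)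
      qed
    qed
  qed simp
  show ?thesis
  proof (rule that)
    have Ypos: "t / exp (\<bar>b\<bar> * T) \<le> Y t" if "t \<in> {0..T}" for t
    proof -
      have "integral {0..t} (\<lambda>r. exp (- (\<bar>b\<bar> * T))) \<le> Y t" unfolding Y_def
      proof (intro integral_le integrable_continuous_real continuous_intros)
        fix r assume r: "r \<in> {0..t}"
        have "\<bar>b * r\<bar> \<le> \<bar>b\<bar> * T" unfolding abs_mult using that r by (intro mult_left_mono) auto
        then show "exp (- (\<bar>b\<bar> * T)) \<le> exp (b * r)" by simp
      qed
      then show ?thesis using that by (simp add: exp_minus field_simps)
    qed
    have "integral {0..T} (\<lambda>t. t / exp (\<bar>b\<bar> * T)) \<le> integral {0..T} Y"
      by (intro integral_le integrable_continuous_real cY Ypos continuous_intros) auto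
    moreover have "((\<lambda>t. t / exp (\<bar>b\<bar> * T)) has_integral (T\<^sup>2 / 2 / exp (\<bar>b\<bar> * T) - 0\<^sup>2 / 2 / exp (\<bar>b\<bar> * T))) {0..T}"
      using T by (intro fundamental_theorem_of_calculus)
       (auto simp: has_real_derivative_iff_has_vector_derivative[symmetric] intro!: derivative_eq_intros)
    then have "integral {0..T} (\<lambda>t. t / exp (\<bar>b\<bar> * T)) = T\<^sup>2 / 2 / exp (\<bar>b\<bar> * T)"
      by (simp only: integral_unique) simp
    ultimately have "T\<^sup>2 / 2 / exp (\<bar>b\<bar> * T) \<le> integral {0..T} Y" by linarith
    moreover have "0 < T\<^sup>2 / 2 / exp (\<bar>b\<bar> * T)" using T by simp
    ultimately show "0 < integral {0..T} (\<lambda>t. Y t / 2)" by simp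
    show "(\<lambda>n. integral {0..T} (\<lambda>t. integral {0..t} (\<lambda>r. (sqrt (a n) * g n r)\<^sup>2))) \<longlonglongrightarrow> integral {0..T} (\<lambda>t. Y t / 2)"
    proof (rule main[where C = K])
      fix n t assume "1 \<le> a n" "0 \<le> t" "t \<le> T"
      from kernel_equipartition(2)[OF k this]
      have "\<bar>2 * integral {0..t} (\<lambda>r. (sqrt (a n) * g n r)\<^sup>2) - Y t\<bar> \<le> K / sqrt (a n)"
        unfolding K_def Y_def .
      then show "\<bar>integral {0..t} (\<lambda>r. (sqrt (a n) * g n r)\<^sup>2) - Y t / 2\<bar> \<le> K / sqrt (a n)" by linarith
    qed (auto intro!: contI continuous_intros cY kd)
    show "(\<lambda>n. integral {0..T} (\<lambda>t. integral {0..t} (\<lambda>r. (g' n r)\<^sup>2))) \<longlonglongrightarrow> integral {0..T} (\<lambda>t. Y t / 2)"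
    proof (rule main[where C = K])
      fix n t assume "1 \<le> a n" "0 \<le> t" "t \<le> T"
      from kernel_equipartition(1)[OF k this]
      have "\<bar>2 * integral {0..t} (\<lambda>r. (g' n r)\<^sup>2) - Y t\<bar> \<le> K / sqrt (a n)"
        unfolding K_def Y_def .
      then show "\<bar>integral {0..t} (\<lambda>r. (g' n r)\<^sup>2) - Y t / 2\<bar> \<le> K / sqrt (a n)" by linarith
    qed (auto intro!: contI continuous_intros cY kd)
    have "(\<lambda>n. integral {0..T} (\<lambda>t. integral {0..t} (\<lambda>r. sqrt (a n) * g n r * g' n r))) \<longlonglongrightarrow> integral {0..T} (\<lambda>t. 0)"
    proof (rule main[where C = "(exp (\<bar>b\<bar> * T))\<^sup>2"])
      fix n t assume t: "1 \<le> a n" "0 \<le> t" "t \<le> T"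
      have "integral {0..t} (\<lambda>r. sqrt (a n) * g n r * g' n r) = sqrt (a n) * integral {0..t} (\<lambda>r. g n r * g' n r)"
        by (simp only: integral_mult_right mult.assoc)
      also have "\<dots> = sqrt (a n) * ((g n t)\<^sup>2 / 2)" by (simp only: kernel_cross_energy[OF k t(2)])
      also have "\<dots> = (sqrt (a n) * g n t)\<^sup>2 / (2 * sqrt (a n))"
        using t(1) by (simp add: power2_eq_square field_simps)
      finally have e: "integral {0..t} (\<lambda>r. sqrt (a n) * g n r * g' n r) = (sqrt (a n) * g n t)\<^sup>2 / (2 * sqrt (a n))" .
      have "(sqrt (a n) * g n t)\<^sup>2 \<le> (exp (\<bar>b\<bar> * T))\<^sup>2"
        using kernel_bounds(1)[OF k _ t(2,3)] t(1) abs_le_square_iff by (metis abs_exp_cancel less_le_trans zero_less_one)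
      then have "(sqrt (a n) * g n t)\<^sup>2 / (2 * sqrt (a n)) \<le> (exp (\<bar>b\<bar> * T))\<^sup>2 / (1 * sqrt (a n))"
        using t(1) by (intro frac_le) auto
      moreover have "0 \<le> (sqrt (a n) * g n t)\<^sup>2 / (2 * sqrt (a n))" using t(1) by simp
      ultimately show "\<bar>integral {0..t} (\<lambda>r. sqrt (a n) * g n r * g' n r) - 0\<bar> \<le> (exp (\<bar>b\<bar> * T))\<^sup>2 / sqrt (a n)"
        unfolding e by simp
    qed (auto intro!: contI continuous_intros cY kd)
    then show "(\<lambda>n. integral {0..T} (\<lambda>t. integral {0..t} (\<lambda>r. sqrt (a n) * g n r * g' n r))) \<longlonglongrightarrow> 0" by simp
  qed
qed

section \<open>Dyadic sums\<close>

definition dyadic :: "real \<Rightarrow> nat \<Rightarrow> nat \<Rightarrow> real" where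
  "dyadic T j i = T * real i / 2 ^ j"

lemma dyadic_simps [simp]: "dyadic T j 0 = 0" "dyadic T j (2 ^ j) = T"
  by (auto simp: dyadic_def)

lemma dyadic_step: "dyadic T j (Suc i) - dyadic T j i = T / 2 ^ j"
  by (simp add: dyadic_def field_simps)

lemma dyadic_Suc_double: "dyadic T (Suc j) (2 * i) = dyadic T j i"
  by (simp add: dyadic_def)

lemma dyadic_mono: "0 \<le> T \<Longrightarrow> i \<le> i' \<Longrightarrow> dyadic T j i \<le> dyadic T j i'"
  by (simp add: dyadic_def divide_right_mono mult_left_mono)

lemma dyadic_nonneg: "0 \<le> T \<Longrightarrow> 0 \<le> dyadic T j i"
  by (simp add: dyadic_def)

lemma dyadic_le: "0 \<le> T \<Longrightarrow> i \<le> 2 ^ j \<Longrightarrow> dyadic T j i \<le> T"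
  using dyadic_mono[of T i "2^j" j] by simp

lemma dyadic_in: "0 \<le> T \<Longrightarrow> i \<le> 2 ^ j \<Longrightarrow> dyadic T j i \<in> {0..T}"
  by (simp add: dyadic_nonneg dyadic_le)

lemma integral_dyadic_sum:
  fixes f :: "real \<Rightarrow> real"
  assumes T: "0 \<le> T" and f: "f integrable_on {0..T}" and n: "n \<le> 2 ^ j"
  shows "integral {0..dyadic T j n} f = (\<Sum>i<n. integral {dyadic T j i..dyadic T j (Suc i)} f)"
  using n
proof (induction n)
  case (Suc n)
  have "integral {0..dyadic T j n} f + integral {dyadic T j n..dyadic T j (Suc n)} f
      = integral {0..dyadic T j (Suc n)} f"
    by (rule Henstock_Kurzweil_Integration.integral_combine)
      (use dyadic_le[OF T Suc.prems] in \<open>auto intro!: dyadic_nonneg dyadic_mono T integrable_subinterval_real[OF f]\<close>)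
  then show ?case using Suc by simp
qed simp

text \<open>Uniform continuity of \<open>f\<close> controls the error on each cell, wherever the
  tag \<open>c\<close> lies in it. Both endpoints of a cell occur as tags, since summation by
  parts turns left endpoints into right ones.\<close>

lemma dyadic_tagged_sum_tendsto:
  fixes f \<rho> :: "real \<Rightarrow> real"
  assumes T: "0 \<le> T" and f: "continuous_on {0..T} f" and \<rho>: "continuous_on {0..T} \<rho>"
    and c: "\<And>j i. i < 2 ^ j \<Longrightarrow> c j i \<in> {dyadic T j i..dyadic T j (Suc i)}"
  shows "(\<lambda>j. \<Sum>i<2^j. f (c j i) * integral {dyadic T j i..dyadic T j (Suc i)} \<rho>)
      \<longlonglongrightarrow> integral {0..T} (\<lambda>s. f s * \<rho> s)"
proof (rule LIMSEQ_I)
  fix e :: real assume e: "0 < e"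
  obtain B0 where B0: "\<And>x. x \<in> {0..T} \<Longrightarrow> norm (\<rho> x) \<le> B0"
    using compact_imp_bounded[OF compact_continuous_image[OF \<rho> compact_Icc]]
    unfolding bounded_iff by blast
  define B where "B = \<bar>B0\<bar> + 1"
  have B: "\<And>x. x \<in> {0..T} \<Longrightarrow> \<bar>\<rho> x\<bar> \<le> B" "0 < B" using B0 by (force simp: B_def)+
  define d where "d = e / (B * T + 1)"
  have BT: "0 < B * T + 1" using B T by (simp add: add_nonneg_pos)
  have d: "0 < d" using e BT by (simp add: d_def)
  have "uniformly_continuous_on {0..T} f" by (intro compact_uniformly_continuous f) simp
  then obtain \<delta> where \<delta>: "0 < \<delta>" "\<And>x y. x \<in> {0..T} \<Longrightarrow> y \<in> {0..T} \<Longrightarrow> \<bar>x - y\<bar> < \<delta> \<Longrightarrow> \<bar>f x - f y\<bar> < d"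
    unfolding uniformly_continuous_on_def dist_real_def using d by metis
  have "(\<lambda>j. T / 2 ^ j) \<longlonglongrightarrow> 0" by real_asymp
  then have "\<forall>\<^sub>F j in sequentially. T / 2 ^ j < \<delta>" using \<delta>(1) by (rule order_tendstoD)
  then obtain J where J: "\<And>j. J \<le> j \<Longrightarrow> T / 2 ^ j < \<delta>" by (auto simp: eventually_sequentially)
  show "\<exists>J. \<forall>j\<ge>J. norm ((\<Sum>i<2^j. f (c j i) * integral {dyadic T j i..dyadic T j (Suc i)} \<rho>) - integral {0..T} (\<lambda>s. f s * \<rho> s)) < e"
  proof (intro exI[of _ J] allI impI)
    fix j assume j: "J \<le> j"
    let ?I = "\<lambda>i. {dyadic T j i..dyadic T j (Suc i)}"
    have sub: "?I i \<subseteq> {0..T}" if "i < 2 ^ j" for i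
      using that by (auto intro!: order_trans[OF dyadic_nonneg[OF T]] elim!: order_trans intro: dyadic_le[OF T])
    have tot: "integral {0..T} (\<lambda>s. f s * \<rho> s) = (\<Sum>i<2^j. integral (?I i) (\<lambda>s. f s * \<rho> s))"
      using integral_dyadic_sum[OF T, of "\<lambda>s. f s * \<rho> s" "2 ^ j" j]
      by (simp add: integrable_continuous_real continuous_on_mult f \<rho>)
    have piece: "\<bar>f (c j i) * integral (?I i) \<rho> - integral (?I i) (\<lambda>s. f s * \<rho> s)\<bar> \<le> d * B * (T / 2 ^ j)"
      if i: "i < 2 ^ j" for i
    proof -
      have cs: "continuous_on (?I i) f" "continuous_on (?I i) \<rho>"
        using f \<rho> sub[OF i] by (auto intro: continuous_on_subset)
      have "f (c j i) * integral (?I i) \<rho> - integral (?I i) (\<lambda>s. f s * \<rho> s)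
          = integral (?I i) (\<lambda>s. (f (c j i) - f s) * \<rho> s)"
        unfolding left_diff_distrib
        by (subst Henstock_Kurzweil_Integration.integral_diff)
          (auto intro!: integrable_continuous_real continuous_intros cs)
      also have "norm \<dots> \<le> (d * B) * (dyadic T j (Suc i) - dyadic T j i)"
      proof (rule integral_bound)
        fix s assume s: "s \<in> ?I i"
        have "\<bar>c j i - s\<bar> \<le> T / 2 ^ j" using c[OF i] s dyadic_step[of T j i] by auto
        then have "\<bar>f (c j i) - f s\<bar> < d"
          using J[OF j] c[OF i] sub[OF i] s by (intro \<delta>) auto
        then show "norm ((f (c j i) - f s) * \<rho> s) \<le> d * B"
          unfolding real_norm_def abs_mult using d B sub[OF i] s by (intro mult_mono) auto
      qed (auto intro!: continuous_intros cs dyadic_mono T)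
      finally show ?thesis by (simp add: dyadic_step)
    qed
    have "norm ((\<Sum>i<2^j. f (c j i) * integral (?I i) \<rho>) - integral {0..T} (\<lambda>s. f s * \<rho> s))
        \<le> (\<Sum>i<2^j::nat. d * B * (T / 2 ^ j))"
      unfolding tot sum_subtractf[symmetric] real_norm_def
      by (rule order_trans[OF sum_abs]) (intro sum_mono piece, simp)
    also have "\<dots> = d * (B * T)" by simp
    also have "\<dots> < d * (B * T + 1)" using d by simp
    also have "\<dots> = e" using BT by (simp add: d_def)
    finally show "norm ((\<Sum>i<2^j. f (c j i) * integral (?I i) \<rho>) - integral {0..T} (\<lambda>s. f s * \<rho> s)) < e" .
  qed
qed

lemma dyadic_Riemann_sum_tendsto:
  fixes f :: "real \<Rightarrow> real"
  assumes T: "0 \<le> T" and f: "continuous_on {0..T} f"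
  shows "(\<lambda>j. \<Sum>i<2^j. f (dyadic T j i) * (T / 2 ^ j)) \<longlonglongrightarrow> integral {0..T} f"
proof -
  have "(\<lambda>j. \<Sum>i<2^j. f (dyadic T j i) * integral {dyadic T j i..dyadic T j (Suc i)} (\<lambda>_. 1))
      \<longlonglongrightarrow> integral {0..T} (\<lambda>s. f s * 1)"
    by (rule dyadic_tagged_sum_tendsto[OF T f]) (auto simp: dyadic_mono T)
  moreover have "integral {dyadic T j i..dyadic T j (Suc i)} (\<lambda>_. 1::real) = T / 2 ^ j" for j i
    using dyadic_mono[OF T, of i "Suc i" j] dyadic_step[of T j i] by simp
  ultimately show ?thesis by simp
qed

definition dyadic_stieltjes_sum :: "real \<Rightarrow> (real \<Rightarrow> real) \<Rightarrow> (real \<Rightarrow> real) \<Rightarrow> nat \<Rightarrow> real" where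
  "dyadic_stieltjes_sum T x w j =
     (\<Sum>i<2^j. x (dyadic T j i) * (w (dyadic T j (Suc i)) - w (dyadic T j i)))"

text \<open>Summation by parts moves the increments from \<open>w\<close> to the smooth function
  \<open>\<kappa>\<close>, so continuity of \<open>w\<close> suffices. In this way Wiener
  integrals of smooth kernels can be evaluated path by path.\<close>

lemma dyadic_stieltjes_sum_tendsto:
  fixes \<kappa> \<kappa>' w :: "real \<Rightarrow> real"
  assumes T: "0 \<le> T" and w: "continuous_on {0..T} w" and \<kappa>': "continuous_on {0..T} \<kappa>'"
    and \<kappa>: "\<And>s. s \<in> {0..T} \<Longrightarrow> (\<kappa> has_real_derivative \<kappa>' s) (at s within {0..T})"
  shows "dyadic_stieltjes_sum T \<kappa> w
    \<longlonglongrightarrow> \<kappa> T * w T - \<kappa> 0 * w 0 - integral {0..T} (\<lambda>s. w s * \<kappa>' s)"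
proof -
  have abel: "(\<Sum>i<n. \<kappa> (dyadic T j i) * (w (dyadic T j (Suc i)) - w (dyadic T j i)))
     = \<kappa> (dyadic T j n) * w (dyadic T j n) - \<kappa> 0 * w 0 -
       (\<Sum>i<n. w (dyadic T j (Suc i)) * (\<kappa> (dyadic T j (Suc i)) - \<kappa> (dyadic T j i)))" for n j
    by (induction n) (auto simp: algebra_simps)
  have ftc: "\<kappa> (dyadic T j (Suc i)) - \<kappa> (dyadic T j i) = integral {dyadic T j i..dyadic T j (Suc i)} \<kappa>'"
    if i: "i < 2 ^ j" for i j
  proof -
    have sub: "{dyadic T j i..dyadic T j (Suc i)} \<subseteq> {0..T}"
      using i by (auto intro!: order_trans[OF dyadic_nonneg[OF T]] elim!: order_trans intro: dyadic_le[OF T])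
    have "(\<kappa>' has_integral (\<kappa> (dyadic T j (Suc i)) - \<kappa> (dyadic T j i))) {dyadic T j i..dyadic T j (Suc i)}"
      by (intro fundamental_theorem_of_calculus dyadic_mono T)
        (use sub in \<open>auto simp: has_real_derivative_iff_has_vector_derivative[symmetric]
          intro!: DERIV_subset[OF \<kappa>]\<close>)
    then show ?thesis by (simp add: integral_unique)
  qed
  have "(\<lambda>j. \<Sum>i<2^j. w (dyadic T j (Suc i)) * integral {dyadic T j i..dyadic T j (Suc i)} \<kappa>')
      \<longlonglongrightarrow> integral {0..T} (\<lambda>s. w s * \<kappa>' s)"
    by (rule dyadic_tagged_sum_tendsto[OF T w \<kappa>']) (auto simp: dyadic_mono T)
  then have "(\<lambda>j. \<kappa> T * w T - \<kappa> 0 * w 0 - (\<Sum>i<2^j. w (dyadic T j (Suc i)) * integral {dyadic T j i..dyadic T j (Suc i)} \<kappa>'))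
      \<longlonglongrightarrow> \<kappa> T * w T - \<kappa> 0 * w 0 - integral {0..T} (\<lambda>s. w s * \<kappa>' s)"
    by (intro tendsto_intros)
  moreover have "dyadic_stieltjes_sum T \<kappa> w j = \<kappa> T * w T - \<kappa> 0 * w 0 - (\<Sum>i<2^j. w (dyadic T j (Suc i)) * integral {dyadic T j i..dyadic T j (Suc i)} \<kappa>')" for j
    unfolding dyadic_stieltjes_sum_def abel by (simp add: ftc)
  then have "dyadic_stieltjes_sum T \<kappa> w = (\<lambda>j. \<kappa> T * w T - \<kappa> 0 * w 0 - (\<Sum>i<2^j. w (dyadic T j (Suc i)) * integral {dyadic T j i..dyadic T j (Suc i)} \<kappa>'))" ..
  ultimately show ?thesis by simp
qed

text \<open>Duhamel's formula, path by path. Let \<open>z = v - w\<close> be the differentiable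
  part of the velocity. The function \<open>H\<close> in the proof is chosen so that the equations
  of \<open>u\<close>, \<open>z\<close> and \<open>\<phi>\<close> reduce its derivative to
  \<open>w(s) \<phi>'(t - s)\<close>, the integrand that remains after summation by parts; the
  stated combination is the boundary term at \<open>s = t\<close>.\<close>

lemma oscillator_stieltjes_representation:
  fixes u v w :: "real \<Rightarrow> real"
  assumes t: "0 \<le> t" "t \<le> T"
    and u: "continuous_on {0..T} u" and v: "continuous_on {0..T} v"
    and equ: "\<And>s. s \<in> {0..T} \<Longrightarrow> u s = integral {0..s} v"
    and eqv: "\<And>s. s \<in> {0..T} \<Longrightarrow> v s = - a * integral {0..s} u + b * integral {0..s} v + w s"
    and w0: "w 0 = 0" and \<phi>: "\<And>s. (\<phi> has_real_derivative \<phi>' s) (at s)"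
      "\<And>s. (\<phi>' has_real_derivative (- a * \<phi> s + b * \<phi>' s)) (at s)"
  shows "dyadic_stieltjes_sum t (\<lambda>r. \<phi> (t - r)) w
    \<longlonglongrightarrow> (\<phi>' 0 - b * \<phi> 0) * u t + \<phi> 0 * v t"
proof -
  let ?I = "{0..t}"
  define z where "z = (\<lambda>s. - a * integral {0..s} u + b * integral {0..s} v)"
  have cu: "continuous_on ?I u" and cv: "continuous_on ?I v"
    using u v t by (auto intro: continuous_on_subset)
  have du: "(u has_real_derivative v s) (at s within ?I)" if "s \<in> ?I" for s
  proof (rule has_field_derivative_transform_within[OF _ zero_less_one that])
    show "((\<lambda>s. integral {0..s} v) has_real_derivative v s) (at s within ?I)"
      by (intro integral_has_real_derivative cv that)
  qed (use equ t in auto)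
  have dz: "(z has_real_derivative (- a * u s + b * v s)) (at s within ?I)" if "s \<in> ?I" for s
    unfolding z_def by (auto intro!: derivative_eq_intros integral_has_real_derivative cu cv that)
  have w: "w s = v s - z s" if "s \<in> ?I" for s using eqv[of s] that t by (auto simp: z_def)
  have z0: "z 0 = 0" "u 0 = 0" using equ[of 0] t by (auto simp: z_def)
  have cz: "continuous_on ?I z" by (rule DERIV_continuous_on, rule dz)
  have cw: "continuous_on ?I w" using cv cz by (subst continuous_on_cong[OF refl w]) (auto intro: continuous_intros)
  have c\<phi>: "continuous_on S \<phi>" "continuous_on S \<phi>'" for S
    by (rule DERIV_continuous_on, rule has_field_derivative_at_within, rule \<phi>)+
  have d\<phi>: "((\<lambda>s. \<phi> (t - s)) has_real_derivative - \<phi>' (t - s)) (at s within S)"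
    "((\<lambda>s. \<phi>' (t - s)) has_real_derivative - (- a * \<phi> (t - s) + b * \<phi>' (t - s))) (at s within S)" for s S
  proof -
    have m: "((\<lambda>s. t - s) has_real_derivative - 1) (at s within S)"
      by (auto intro!: derivative_eq_intros)
    show "((\<lambda>s. \<phi> (t - s)) has_real_derivative - \<phi>' (t - s)) (at s within S)"
      "((\<lambda>s. \<phi>' (t - s)) has_real_derivative - (- a * \<phi> (t - s) + b * \<phi>' (t - s))) (at s within S)"
      using DERIV_chain2[OF \<phi>(1) m] DERIV_chain2[OF \<phi>(2) m] by simp_all
  qed
  define H where "H = (\<lambda>s. \<phi>' (t - s) * u s + \<phi> (t - s) * z s - b * \<phi> (t - s) * u s)"
  have "((\<lambda>s. w s * \<phi>' (t - s)) has_integral (H t - H 0)) {0..t}"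
  proof (rule fundamental_theorem_of_calculus[OF t(1)])
    fix s assume s: "s \<in> {0..t}"
    have "(H has_real_derivative (v s - z s) * \<phi>' (t - s)) (at s within {0..t})"
      unfolding H_def by (auto intro!: derivative_eq_intros d\<phi> du dz s simp: algebra_simps)
    then show "(H has_vector_derivative w s * \<phi>' (t - s)) (at s within {0..t})"
      using w[OF s] by (simp add: has_real_derivative_iff_has_vector_derivative)
  qed
  then have I: "integral {0..t} (\<lambda>s. w s * (- \<phi>' (t - s))) = - (H t - H 0)"
    by (simp add: integral_unique)
  have "dyadic_stieltjes_sum t (\<lambda>r. \<phi> (t - r)) w
    \<longlonglongrightarrow> \<phi> (t - t) * w t - \<phi> (t - 0) * w 0 - integral {0..t} (\<lambda>s. w s * (- \<phi>' (t - s)))"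
    by (rule dyadic_stieltjes_sum_tendsto[OF t(1) cw])
      (auto intro!: continuous_intros continuous_on_compose2[OF c\<phi>(2)] d\<phi>)
  moreover have "w t = v t - z t" using w[of t] t by simp
  ultimately show ?thesis unfolding I by (simp add: H_def z0 w0 algebra_simps)
qed

section \<open>Limits of moments\<close>

lemma integral_Fatou_bound:
  fixes f :: "nat \<Rightarrow> 'a \<Rightarrow> real"
  assumes f: "\<And>n. integrable M (f n)" "\<And>n. AE x in M. 0 \<le> f n x" "\<And>n. integral\<^sup>L M (f n) \<le> K"
    and g: "g \<in> borel_measurable M" and lim: "AE x in M. (\<lambda>n. f n x) \<longlonglongrightarrow> g x"
  shows "integrable M g" "integral\<^sup>L M g \<le> K" "AE x in M. 0 \<le> g x"
proof -
  have nonneg: "AE x in M. \<forall>n. 0 \<le> f n x" using f(2) by (simp add: AE_all_countable)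
  show g0: "AE x in M. 0 \<le> g x"
    using lim nonneg by eventually_elim (auto intro: LIMSEQ_le_const)
  have K: "0 \<le> K" using order_trans[OF integral_nonneg_AE[OF f(2)] f(3)] .
  have "(\<integral>\<^sup>+x. ennreal (g x) \<partial>M) = (\<integral>\<^sup>+x. liminf (\<lambda>n. ennreal (f n x)) \<partial>M)"
    by (rule nn_integral_cong_AE) (use lim in \<open>auto elim!: eventually_mono intro!: lim_imp_Liminf[symmetric]\<close>)
  also have "\<dots> \<le> liminf (\<lambda>n. \<integral>\<^sup>+x. ennreal (f n x) \<partial>M)"
    by (rule nn_integral_liminf) (use f(1) in measurable)
  also have "\<dots> \<le> limsup (\<lambda>n. \<integral>\<^sup>+x. ennreal (f n x) \<partial>M)"
    by (rule Liminf_le_Limsup) simp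
  also have "\<dots> \<le> ennreal K"
    by (rule Limsup_bounded) (simp add: nn_integral_eq_integral f ennreal_leI)
  finally have le: "(\<integral>\<^sup>+x. ennreal (g x) \<partial>M) \<le> ennreal K" .
  have n: "(\<integral>\<^sup>+x. ennreal (norm (g x)) \<partial>M) = (\<integral>\<^sup>+x. ennreal (g x) \<partial>M)"
    by (rule nn_integral_cong_AE) (use g0 in \<open>auto elim!: eventually_mono\<close>)
  show "integrable M g" unfolding integrable_iff_bounded n using g le by (auto simp: less_top[symmetric] top_unique)
  then have "ennreal (integral\<^sup>L M g) = (\<integral>\<^sup>+x. ennreal (g x) \<partial>M)"
    by (rule nn_integral_eq_integral[symmetric]) (rule g0)
  with le have "ennreal (integral\<^sup>L M g) \<le> ennreal K" by simp
  then show "integral\<^sup>L M g \<le> K" using K by (simp add: ennreal_le_iff)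
qed

lemma (in finite_measure) integrable_of_power4:
  fixes f :: "'a \<Rightarrow> real"
  assumes f[measurable]: "f \<in> borel_measurable M" and i: "integrable M (\<lambda>x. f x ^ 4)"
  shows "integrable M f" "integrable M (\<lambda>x. (f x)\<^sup>2)" "integrable M (\<lambda>x. f x ^ 3)"
proof -
  have "integrable M (\<lambda>x. ((f x)\<^sup>2)\<^sup>2)" using i by simp
  then show 2: "integrable M (\<lambda>x. (f x)\<^sup>2)" by (rule square_integrable_imp_integrable[rotated]) simp
  show "integrable M f" by (rule square_integrable_imp_integrable[OF f 2])
  show "integrable M (\<lambda>x. f x ^ 3)"
  proof (rule Bochner_Integration.integrable_bound)
    show "integrable M (\<lambda>x. f x ^ 4 + (f x)\<^sup>2)" by (intro Bochner_Integration.integrable_add i 2)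
    show "AE x in M. norm (f x ^ 3) \<le> norm (f x ^ 4 + (f x)\<^sup>2)"
    proof (intro AE_I2)
      fix x
      have "0 \<le> (\<bar>f x\<bar>\<^sup>2 - \<bar>f x\<bar>)\<^sup>2" by simp
      also have "\<dots> = \<bar>f x\<bar> ^ 4 + \<bar>f x\<bar>\<^sup>2 - 2 * \<bar>f x\<bar> ^ 3"
        by (simp add: power2_eq_square power3_eq_cube power4_eq_xxxx algebra_simps)
      finally have "2 * \<bar>f x\<bar> ^ 3 \<le> f x ^ 4 + (f x)\<^sup>2" by simp
      moreover have "0 \<le> \<bar>f x\<bar> ^ 3" by simp
      ultimately show "norm (f x ^ 3) \<le> norm (f x ^ 4 + (f x)\<^sup>2)" unfolding real_norm_def power_abs by linarith
    qed
  qed simp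
qed

lemma integrable_square_mult:
  fixes f g :: "'a \<Rightarrow> real"
  assumes [measurable]: "f \<in> borel_measurable M" "g \<in> borel_measurable M"
    and i: "integrable M (\<lambda>x. (f x)\<^sup>2)" "integrable M (\<lambda>x. (g x)\<^sup>2)"
  shows "integrable M (\<lambda>x. f x * g x)"
proof (rule Bochner_Integration.integrable_bound)
  show "integrable M (\<lambda>x. (f x)\<^sup>2 + (g x)\<^sup>2)" by (intro Bochner_Integration.integrable_add i)
  show "AE x in M. norm (f x * g x) \<le> norm ((f x)\<^sup>2 + (g x)\<^sup>2)"
  proof (intro AE_I2)
    fix x
    have "0 \<le> (\<bar>f x\<bar> - \<bar>g x\<bar>)\<^sup>2" by simp
    also have "\<dots> = (f x)\<^sup>2 + (g x)\<^sup>2 - 2 * \<bar>f x * g x\<bar>" by (simp add: power2_diff abs_mult)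
    finally show "norm (f x * g x) \<le> norm ((f x)\<^sup>2 + (g x)\<^sup>2)"
      using abs_ge_zero[of "f x * g x"] abs_ge_self[of "(f x)\<^sup>2 + (g x)\<^sup>2"] unfolding real_norm_def by linarith
  qed
qed simp

lemma integrable_square_sum:
  fixes f g :: "'a \<Rightarrow> real"
  assumes [measurable]: "f \<in> borel_measurable M" "g \<in> borel_measurable M"
    and i: "integrable M (\<lambda>x. (f x)\<^sup>2)" "integrable M (\<lambda>x. (g x)\<^sup>2)"
  shows "integrable M (\<lambda>x. (f x + g x)\<^sup>2)"
  unfolding power2_sum using integrable_square_mult[OF assms] i by (simp add: mult.assoc)

lemma power4_sum_le: "(x + y) ^ 4 \<le> 8 * (x ^ 4 + y ^ 4)" for x y :: real
proof -
  have "(x + y)\<^sup>2 \<le> 2 * (x\<^sup>2 + y\<^sup>2)" using sum_squares_bound[of x y] by (simp add: power2_sum)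
  then have "((x + y)\<^sup>2)\<^sup>2 \<le> (2 * (x\<^sup>2 + y\<^sup>2))\<^sup>2" by (intro power_mono) auto
  also have "\<dots> = 4 * (x\<^sup>2 + y\<^sup>2)\<^sup>2" by (simp only: power_mult_distrib) simp
  also have "(x\<^sup>2 + y\<^sup>2)\<^sup>2 \<le> 2 * ((x\<^sup>2)\<^sup>2 + (y\<^sup>2)\<^sup>2)" using sum_squares_bound[of "x\<^sup>2" "y\<^sup>2"] by (simp add: power2_sum)
  finally show ?thesis by simp
qed

lemma integrable_power4_sum:
  fixes f g :: "'a \<Rightarrow> real"
  assumes [measurable]: "f \<in> borel_measurable M" "g \<in> borel_measurable M"
    and i: "integrable M (\<lambda>x. f x ^ 4)" "integrable M (\<lambda>x. g x ^ 4)"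
  shows "integrable M (\<lambda>x. (f x + g x) ^ 4)"
    "integral\<^sup>L M (\<lambda>x. (f x + g x) ^ 4) \<le> 8 * (integral\<^sup>L M (\<lambda>x. f x ^ 4) + integral\<^sup>L M (\<lambda>x. g x ^ 4))"
proof -
  have b: "integrable M (\<lambda>x. 8 * (f x ^ 4 + g x ^ 4))"
    by (intro integrable_mult_right Bochner_Integration.integrable_add i)
  show 1: "integrable M (\<lambda>x. (f x + g x) ^ 4)"
  proof (rule Bochner_Integration.integrable_bound[OF b])
    show "AE x in M. norm ((f x + g x) ^ 4) \<le> norm (8 * (f x ^ 4 + g x ^ 4))"
      using power4_sum_le by (intro AE_I2) (auto intro: order_trans)
  qed simp
  have "integral\<^sup>L M (\<lambda>x. (f x + g x) ^ 4) \<le> integral\<^sup>L M (\<lambda>x. 8 * (f x ^ 4 + g x ^ 4))"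
    by (intro integral_mono 1 b power4_sum_le)
  then show "integral\<^sup>L M (\<lambda>x. (f x + g x) ^ 4) \<le> 8 * (integral\<^sup>L M (\<lambda>x. f x ^ 4) + integral\<^sup>L M (\<lambda>x. g x ^ 4))"
    using i by simp
qed

lemma integrable_mixed_fourth:
  fixes f g :: "'b \<Rightarrow> real"
  assumes [measurable]: "f \<in> borel_measurable N" "g \<in> borel_measurable N"
    and i: "integrable N (\<lambda>x. f x ^ 4)" "integrable N (\<lambda>x. g x ^ 4)"
  shows "integrable N (\<lambda>x. f x ^ 3 * g x)" "integrable N (\<lambda>x. (f x)\<^sup>2 * (g x)\<^sup>2)" "integrable N (\<lambda>x. f x * g x ^ 3)"
proof -
  have b: "integrable N (\<lambda>x. f x ^ 4 + g x ^ 4)" by (intro Bochner_Integration.integrable_add i)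
  have m: "max \<bar>y\<bar> \<bar>z\<bar> ^ 4 \<le> y ^ 4 + z ^ 4" for y z :: real
    by (auto simp: max_def power_even_abs)
  have A: "\<bar>y ^ 3 * z\<bar> \<le> y ^ 4 + z ^ 4" for y z :: real
  proof -
    have "\<bar>y ^ 3 * z\<bar> = \<bar>y\<bar> ^ 3 * \<bar>z\<bar>" by (simp add: abs_mult power_abs)
    also have "\<dots> \<le> max \<bar>y\<bar> \<bar>z\<bar> ^ 3 * max \<bar>y\<bar> \<bar>z\<bar>" by (intro mult_mono power_mono) auto
    also have "\<dots> = max \<bar>y\<bar> \<bar>z\<bar> ^ 4" by (simp add: power4_eq_xxxx power3_eq_cube)
    also have "\<dots> \<le> y ^ 4 + z ^ 4" by (rule m)
    finally show ?thesis .
  qed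
  show "integrable N (\<lambda>x. f x ^ 3 * g x)"
  proof (rule Bochner_Integration.integrable_bound[OF b])
    show "AE x in N. norm (f x ^ 3 * g x) \<le> norm (f x ^ 4 + g x ^ 4)"
      unfolding real_norm_def by (intro AE_I2 order_trans[OF A abs_ge_self])
  qed simp
  show "integrable N (\<lambda>x. f x * g x ^ 3)"
  proof (rule Bochner_Integration.integrable_bound[OF b])
    show "AE x in N. norm (f x * g x ^ 3) \<le> norm (f x ^ 4 + g x ^ 4)"
      unfolding real_norm_def mult.commute[of "f _"] add.commute[of "f _ ^ 4"]
      by (intro AE_I2 order_trans[OF A abs_ge_self])
  qed simp
  show "integrable N (\<lambda>x. (f x)\<^sup>2 * (g x)\<^sup>2)"
    by (rule integrable_square_mult) (use i in simp_all)
qed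

text \<open>Bounded second moments give uniform integrability, through \<open>\<bar>x\<bar> \<le>
  min \<bar>x\<bar> c + x\<^sup>2 / c\<close>: the first term is handled by dominated convergence,
  and the second has integral at most \<open>K / c\<close>.\<close>

lemma (in finite_measure) tendsto_integral_abs_of_bounded_square:
  fixes X :: "nat \<Rightarrow> 'a \<Rightarrow> real"
  assumes m[measurable]: "\<And>n. X n \<in> borel_measurable M"
    and sq: "\<And>n. integrable M (\<lambda>x. (X n x)\<^sup>2)" "\<And>n. integral\<^sup>L M (\<lambda>x. (X n x)\<^sup>2) \<le> K"
    and lim: "AE x in M. (\<lambda>n. X n x) \<longlonglongrightarrow> 0"
  shows "(\<lambda>n. integral\<^sup>L M (\<lambda>x. \<bar>X n x\<bar>)) \<longlonglongrightarrow> 0"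
proof (rule LIMSEQ_I)
  fix e :: real assume e: "0 < e"
  have K: "0 \<le> K" by (rule order_trans[OF _ sq(2)[of 0]]) simp
  define c where "c = 2 * (K + 1) / e"
  have c: "0 < c" "K / c < e / 2" using e K by (auto simp: c_def field_simps)
  have "(\<lambda>n. integral\<^sup>L M (\<lambda>x. min \<bar>X n x\<bar> c)) \<longlonglongrightarrow> integral\<^sup>L M (\<lambda>x. 0)"
  proof (rule integral_dominated_convergence[where w="\<lambda>_. c"])
    show "AE x in M. (\<lambda>n. min \<bar>X n x\<bar> c) \<longlonglongrightarrow> 0"
      using lim
    proof eventually_elim
      case (elim x)
      then have "(\<lambda>n. min \<bar>X n x\<bar> c) \<longlonglongrightarrow> min \<bar>0\<bar> c" by (intro tendsto_intros)
      then show ?case using c by simp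
    qed
  qed (use c in auto)
  then have "(\<lambda>n. integral\<^sup>L M (\<lambda>x. min \<bar>X n x\<bar> c)) \<longlonglongrightarrow> 0" by simp
  then have "\<forall>\<^sub>F n in sequentially. integral\<^sup>L M (\<lambda>x. min \<bar>X n x\<bar> c) < e / 2"
    by (rule order_tendstoD) (use e in simp)
  then obtain N where N: "\<And>n. N \<le> n \<Longrightarrow> integral\<^sup>L M (\<lambda>x. min \<bar>X n x\<bar> c) < e / 2"
    by (auto simp: eventually_sequentially)
  show "\<exists>N. \<forall>n\<ge>N. norm (integral\<^sup>L M (\<lambda>x. \<bar>X n x\<bar>) - 0) < e"
  proof (intro exI[of _ N] allI impI)
    fix n assume n: "N \<le> n"
    have i: "integrable M (\<lambda>x. \<bar>X n x\<bar>)" using square_integrable_imp_integrable[OF m sq(1)] by simp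
    have im: "integrable M (\<lambda>x. min \<bar>X n x\<bar> c)"
      by (rule Bochner_Integration.integrable_bound[OF i]) (use c in auto)
    have "integral\<^sup>L M (\<lambda>x. \<bar>X n x\<bar>) \<le> integral\<^sup>L M (\<lambda>x. min \<bar>X n x\<bar> c + (X n x)\<^sup>2 / c)"
    proof (rule integral_mono[OF i])
      fix x
      show "\<bar>X n x\<bar> \<le> min \<bar>X n x\<bar> c + (X n x)\<^sup>2 / c"
      proof (cases "\<bar>X n x\<bar> \<le> c")
        case False
        then have "\<bar>X n x\<bar> * c \<le> \<bar>X n x\<bar> * \<bar>X n x\<bar>" by (intro mult_left_mono) auto
        then have "\<bar>X n x\<bar> \<le> (X n x)\<^sup>2 / c" using c by (simp add: field_simps power2_eq_square)
        then show ?thesis using c by (auto simp: min_def)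
      qed (use c in auto)
    qed (use im sq in auto)
    also have "\<dots> = integral\<^sup>L M (\<lambda>x. min \<bar>X n x\<bar> c) + integral\<^sup>L M (\<lambda>x. (X n x)\<^sup>2) / c"
      using im sq by simp
    also have "\<dots> < e / 2 + e / 2"
    proof (rule add_strict_mono[OF N[OF n]])
      have "integral\<^sup>L M (\<lambda>x. (X n x)\<^sup>2) / c \<le> K / c" using sq(2) c by (intro divide_right_mono) auto
      then show "integral\<^sup>L M (\<lambda>x. (X n x)\<^sup>2) / c < e / 2" using c(2) by linarith
    qed
    finally show "norm (integral\<^sup>L M (\<lambda>x. \<bar>X n x\<bar>) - 0) < e" by simp
  qed
qed

lemma (in finite_measure) tendsto_integral_of_bounded_square:
  fixes X :: "nat \<Rightarrow> 'a \<Rightarrow> real"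
  assumes m[measurable]: "\<And>n. X n \<in> borel_measurable M" "Y \<in> borel_measurable M"
    and sq: "\<And>n. integrable M (\<lambda>x. (X n x)\<^sup>2)" "\<And>n. integral\<^sup>L M (\<lambda>x. (X n x)\<^sup>2) \<le> K"
    and lim: "AE x in M. (\<lambda>n. X n x) \<longlonglongrightarrow> Y x"
  shows "integrable M (\<lambda>x. (Y x)\<^sup>2)" "integral\<^sup>L M (\<lambda>x. (Y x)\<^sup>2) \<le> K"
    "(\<lambda>n. integral\<^sup>L M (\<lambda>x. \<bar>X n x - Y x\<bar>)) \<longlonglongrightarrow> 0"
    "(\<lambda>n. integral\<^sup>L M (X n)) \<longlonglongrightarrow> integral\<^sup>L M Y"
proof -
  have lim2: "AE x in M. (\<lambda>n. (X n x)\<^sup>2) \<longlonglongrightarrow> (Y x)\<^sup>2"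
    using lim by eventually_elim (intro tendsto_intros)
  show Y2: "integrable M (\<lambda>x. (Y x)\<^sup>2)" "integral\<^sup>L M (\<lambda>x. (Y x)\<^sup>2) \<le> K"
    by (rule integral_Fatou_bound[OF sq(1) _ sq(2) _ lim2]; simp)+
  have D: "(X n x - Y x)\<^sup>2 \<le> 2 * (X n x)\<^sup>2 + 2 * (Y x)\<^sup>2" for n x
    using sum_squares_bound[of "X n x" "- Y x"] by (simp add: power2_diff)
  have Di: "integrable M (\<lambda>x. 2 * (X n x)\<^sup>2 + 2 * (Y x)\<^sup>2)" for n using sq Y2 by simp
  have D2: "integrable M (\<lambda>x. (X n x - Y x)\<^sup>2)" for n
    by (rule Bochner_Integration.integrable_bound[OF Di[of n]]) (use D in auto)
  show L: "(\<lambda>n. integral\<^sup>L M (\<lambda>x. \<bar>X n x - Y x\<bar>)) \<longlonglongrightarrow> 0"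
  proof (rule tendsto_integral_abs_of_bounded_square[OF _ D2, where K = "4 * K"])
    fix n
    have "integral\<^sup>L M (\<lambda>x. (X n x - Y x)\<^sup>2) \<le> integral\<^sup>L M (\<lambda>x. 2 * (X n x)\<^sup>2 + 2 * (Y x)\<^sup>2)"
      by (rule integral_mono[OF D2 Di D])
    also have "\<dots> = 2 * integral\<^sup>L M (\<lambda>x. (X n x)\<^sup>2) + 2 * integral\<^sup>L M (\<lambda>x. (Y x)\<^sup>2)"
      using sq Y2 by simp
    also have "\<dots> \<le> 2 * K + 2 * K" using sq(2)[of n] Y2(2) by linarith
    finally show "integral\<^sup>L M (\<lambda>x. (X n x - Y x)\<^sup>2) \<le> 4 * K" by simp
    show "AE x in M. (\<lambda>n. X n x - Y x) \<longlonglongrightarrow> 0"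
      using lim by eventually_elim (rule LIM_zero)
  qed simp
  have iX: "integrable M (X n)" for n by (rule square_integrable_imp_integrable[OF m(1) sq(1)])
  have iY: "integrable M Y" by (rule square_integrable_imp_integrable[OF m(2) Y2(1)])
  have "(\<lambda>n. integral\<^sup>L M (X n) - integral\<^sup>L M Y) \<longlonglongrightarrow> 0"
  proof (rule Lim_null_comparison[OF always_eventually L], intro allI)
    fix n
    have "integral\<^sup>L M (X n) - integral\<^sup>L M Y = integral\<^sup>L M (\<lambda>x. X n x - Y x)" using iX iY by simp
    then show "norm (integral\<^sup>L M (X n) - integral\<^sup>L M Y) \<le> integral\<^sup>L M (\<lambda>x. \<bar>X n x - Y x\<bar>)"
      using integral_norm_bound[of M "\<lambda>x. X n x - Y x"] by simp
  qed
  then show "(\<lambda>n. integral\<^sup>L M (X n)) \<longlonglongrightarrow> integral\<^sup>L M Y" by (rule LIM_zero_cancel)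
qed

text \<open>Bounded fourth moments make the squares uniformly integrable. This is the passage from
  almost sure limits to moments for stochastic integrals and time integrals.\<close>

lemma (in finite_measure) tendsto_second_moment_of_bounded_fourth:
  fixes X :: "nat \<Rightarrow> 'a \<Rightarrow> real"
  assumes m[measurable]: "\<And>n. X n \<in> borel_measurable M" "Y \<in> borel_measurable M"
    and i4: "\<And>n. integrable M (\<lambda>x. X n x ^ 4)" "\<And>n. integral\<^sup>L M (\<lambda>x. X n x ^ 4) \<le> K"
    and lim: "AE x in M. (\<lambda>n. X n x) \<longlonglongrightarrow> Y x"
  shows "integrable M (\<lambda>x. Y x ^ 4)" "integral\<^sup>L M (\<lambda>x. Y x ^ 4) \<le> K"
    "(\<lambda>n. integral\<^sup>L M (\<lambda>x. (X n x)\<^sup>2)) \<longlonglongrightarrow> integral\<^sup>L M (\<lambda>x. (Y x)\<^sup>2)"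
    "(\<lambda>n. integral\<^sup>L M (\<lambda>x. (X n x - Y x)\<^sup>2)) \<longlonglongrightarrow> 0"
    "(\<lambda>n. integral\<^sup>L M (X n)) \<longlonglongrightarrow> integral\<^sup>L M Y"
proof -
  have e: "(y ^ 4) = (y\<^sup>2)\<^sup>2" for y :: real by simp
  have lim2: "AE x in M. (\<lambda>n. (X n x)\<^sup>2) \<longlonglongrightarrow> (Y x)\<^sup>2"
    using lim by eventually_elim (intro tendsto_intros)
  note S = tendsto_integral_of_bounded_square[OF _ _ i4[unfolded e] lim2]
  show Y4: "integrable M (\<lambda>x. Y x ^ 4)" "integral\<^sup>L M (\<lambda>x. Y x ^ 4) \<le> K"
    unfolding e by (rule S; simp)+
  show L2: "(\<lambda>n. integral\<^sup>L M (\<lambda>x. (X n x)\<^sup>2)) \<longlonglongrightarrow> integral\<^sup>L M (\<lambda>x. (Y x)\<^sup>2)"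
    by (rule S; simp)
  have D4: "integrable M (\<lambda>x. (X n x + (- Y x)) ^ 4)" for n
    by (rule integrable_power4_sum) (use i4 Y4 in auto)
  have D4b: "integral\<^sup>L M (\<lambda>x. (X n x + (- Y x)) ^ 4) \<le> 8 * (K + K)" for n
  proof -
    have "integral\<^sup>L M (\<lambda>x. (X n x + (- Y x)) ^ 4) \<le> 8 * (integral\<^sup>L M (\<lambda>x. X n x ^ 4) + integral\<^sup>L M (\<lambda>x. (- Y x) ^ 4))"
      by (rule integrable_power4_sum) (use i4 Y4 in auto)
    then show ?thesis using i4(2)[of n] Y4(2) by simp
  qed
  have "(\<lambda>n. integral\<^sup>L M (\<lambda>x. \<bar>(X n x + - Y x)\<^sup>2\<bar>)) \<longlonglongrightarrow> 0"
  proof (rule tendsto_integral_abs_of_bounded_square[OF _ D4[unfolded e] D4b[unfolded e]])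
    show "AE x in M. (\<lambda>n. (X n x + - Y x)\<^sup>2) \<longlonglongrightarrow> 0"
      using lim
    proof eventually_elim
      case (elim x)
      then have "(\<lambda>n. (X n x + - Y x)\<^sup>2) \<longlonglongrightarrow> (Y x + - Y x)\<^sup>2" by (intro tendsto_intros)
      then show ?case by simp
    qed
  qed simp
  then show "(\<lambda>n. integral\<^sup>L M (\<lambda>x. (X n x - Y x)\<^sup>2)) \<longlonglongrightarrow> 0" by simp
  have b2: "integral\<^sup>L M (\<lambda>x. (X n x)\<^sup>2) \<le> (K + measure M (space M)) " for n
  proof -
    have "integral\<^sup>L M (\<lambda>x. (X n x)\<^sup>2) \<le> integral\<^sup>L M (\<lambda>x. X n x ^ 4 + 1)"
    proof (rule integral_mono)
      show "integrable M (\<lambda>x. (X n x)\<^sup>2)" using integrable_of_power4[OF m(1) i4(1)] by simp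
      show "integrable M (\<lambda>x. X n x ^ 4 + 1)" using i4 by simp
      fix x
      have "0 \<le> ((X n x)\<^sup>2 - 1)\<^sup>2" by simp
      then have "2 * (X n x)\<^sup>2 \<le> ((X n x)\<^sup>2)\<^sup>2 + 1" by (simp add: power2_diff)
      moreover have "0 \<le> (X n x)\<^sup>2" by simp
      ultimately show "(X n x)\<^sup>2 \<le> X n x ^ 4 + 1" unfolding e by linarith
    qed
    also have "\<dots> = integral\<^sup>L M (\<lambda>x. X n x ^ 4) + measure M (space M)" using i4 by simp
    finally show ?thesis using i4(2)[of n] by simp
  qed
  show "(\<lambda>n. integral\<^sup>L M (X n)) \<longlonglongrightarrow> integral\<^sup>L M Y"
    by (rule tendsto_integral_of_bounded_square[OF m _ b2 lim])
      (use integrable_of_power4[OF m(1) i4(1)] in simp)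
qed

section \<open>Independent sums\<close>

lemma (in prob_space) second_moment_le_of_fourth:
  fixes X :: "'a \<Rightarrow> real" and D :: real
  assumes [measurable]: "X \<in> borel_measurable M" and i: "integrable M (\<lambda>x. X x ^ 4)"
    and b: "expectation (\<lambda>x. X x ^ 4) \<le> D\<^sup>2" and D: "0 \<le> D"
  shows "expectation (\<lambda>x. (X x)\<^sup>2) \<le> D"
proof (cases "D = 0")
  case False
  then have D: "0 < D" using D by simp
  have i2: "integrable M (\<lambda>x. (X x)\<^sup>2)" using integrable_of_power4[OF _ i] by simp
  have "0 \<le> expectation (\<lambda>x. ((X x)\<^sup>2 - D)\<^sup>2)" by simp
  also have "\<dots> = expectation (\<lambda>x. X x ^ 4 + D\<^sup>2 - 2 * D * (X x)\<^sup>2)"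
    by (rule Bochner_Integration.integral_cong) (auto simp: power2_diff)
  also have "\<dots> = expectation (\<lambda>x. X x ^ 4) + D\<^sup>2 - 2 * D * expectation (\<lambda>x. (X x)\<^sup>2)"
    using i i2 by (simp add: prob_space)
  finally have "2 * D * expectation (\<lambda>x. (X x)\<^sup>2) \<le> 2 * D * D" using b by (simp add: power2_eq_square)
  then show ?thesis using D by simp
next
  case True
  have i2: "integrable M (\<lambda>x. (X x)\<^sup>2)" using integrable_of_power4[OF _ i] by simp
  have "expectation (\<lambda>x. X x ^ 4) = 0" using b True by (simp add: antisym)
  then have "AE x in M. X x ^ 4 = 0" using integral_nonneg_eq_0_iff_AE[OF i] by simp
  then have "expectation (\<lambda>x. (X x)\<^sup>2) = expectation (\<lambda>x. 0)"
    by (intro integral_cong_AE) (auto elim!: eventually_mono)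
  then show ?thesis using True by simp
qed

text \<open>The mixed terms with an odd power vanish because the variables are independent and
  centred.\<close>

lemma (in prob_space) indep_fourth_moment_add:
  fixes X Y :: "'a \<Rightarrow> real"
  assumes ind: "indep_var borel X borel Y"
    and i: "integrable M (\<lambda>x. X x ^ 4)" "integrable M (\<lambda>x. Y x ^ 4)"
    and z: "expectation X = 0" "expectation Y = 0"
  shows "expectation (\<lambda>x. (X x + Y x) ^ 4) = expectation (\<lambda>x. X x ^ 4)
      + 6 * expectation (\<lambda>x. (X x)\<^sup>2) * expectation (\<lambda>x. (Y x)\<^sup>2) + expectation (\<lambda>x. Y x ^ 4)"
    "expectation (\<lambda>x. (X x + Y x)\<^sup>2) = expectation (\<lambda>x. (X x)\<^sup>2) + expectation (\<lambda>x. (Y x)\<^sup>2)"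
proof -
  have [measurable]: "X \<in> borel_measurable M" "Y \<in> borel_measurable M"
    using ind by (auto dest: indep_var_rv1 indep_var_rv2)
  note iX = integrable_of_power4[OF \<open>X \<in> _\<close> i(1)] and iY = integrable_of_power4[OF \<open>Y \<in> _\<close> i(2)]
  have p: "integrable M (\<lambda>x. f (X x) * h (Y x))" "expectation (\<lambda>x. f (X x) * h (Y x)) = expectation (\<lambda>x. f (X x)) * expectation (\<lambda>x. h (Y x))"
    if "f \<in> borel_measurable borel" "h \<in> borel_measurable borel" "integrable M (\<lambda>x. f (X x))" "integrable M (\<lambda>x. h (Y x))"
    for f h :: "real \<Rightarrow> real"
  proof -
    have "indep_var borel (f \<circ> X) borel (h \<circ> Y)" using indep_var_compose[OF ind that(1,2)] .
    then have 1: "indep_var borel (\<lambda>x. f (X x)) borel (\<lambda>x. h (Y x))" by (simp add: comp_def)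
    show "integrable M (\<lambda>x. f (X x) * h (Y x))" by (rule indep_var_integrable[OF 1 that(3,4)])
    show "expectation (\<lambda>x. f (X x) * h (Y x)) = expectation (\<lambda>x. f (X x)) * expectation (\<lambda>x. h (Y x))"
      by (rule indep_var_lebesgue_integral[OF 1 that(3,4)])
  qed
  have p11: "integrable M (\<lambda>x. X x * Y x)" "expectation (\<lambda>x. X x * Y x) = expectation X * expectation Y"
    by (rule p[of "\<lambda>x. x" "\<lambda>x. x"]; (rule iX iY | measurable))+
  have p31: "integrable M (\<lambda>x. X x ^ 3 * Y x)" "expectation (\<lambda>x. X x ^ 3 * Y x) = expectation (\<lambda>x. X x ^ 3) * expectation Y"
    by (rule p[of "\<lambda>x. x ^ 3" "\<lambda>x. x"]; (rule iX iY | measurable))+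
  have p22: "integrable M (\<lambda>x. (X x)\<^sup>2 * (Y x)\<^sup>2)"
    "expectation (\<lambda>x. (X x)\<^sup>2 * (Y x)\<^sup>2) = expectation (\<lambda>x. (X x)\<^sup>2) * expectation (\<lambda>x. (Y x)\<^sup>2)"
    by (rule p[of "\<lambda>x. x\<^sup>2" "\<lambda>x. x\<^sup>2"]; (rule iX iY | measurable))+
  have p13: "integrable M (\<lambda>x. X x * Y x ^ 3)" "expectation (\<lambda>x. X x * Y x ^ 3) = expectation X * expectation (\<lambda>x. Y x ^ 3)"
    by (rule p[of "\<lambda>x. x" "\<lambda>x. x ^ 3"]; (rule iX iY | measurable))+
  have "expectation (\<lambda>x. (X x + Y x) ^ 4) = expectation (\<lambda>x. X x ^ 4 + 4 * (X x ^ 3 * Y x) + 6 * ((X x)\<^sup>2 * (Y x)\<^sup>2) + 4 * (X x * Y x ^ 3) + Y x ^ 4)"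
    by (rule Bochner_Integration.integral_cong) (auto simp: power2_eq_square power3_eq_cube power4_eq_xxxx algebra_simps)
  also have "\<dots> = expectation (\<lambda>x. X x ^ 4) + 6 * expectation (\<lambda>x. (X x)\<^sup>2) * expectation (\<lambda>x. (Y x)\<^sup>2) + expectation (\<lambda>x. Y x ^ 4)"
    using i p31 p22 p13 z by simp
  finally show "expectation (\<lambda>x. (X x + Y x) ^ 4) = expectation (\<lambda>x. X x ^ 4)
      + 6 * expectation (\<lambda>x. (X x)\<^sup>2) * expectation (\<lambda>x. (Y x)\<^sup>2) + expectation (\<lambda>x. Y x ^ 4)" .
  have "expectation (\<lambda>x. (X x + Y x)\<^sup>2) = expectation (\<lambda>x. (X x)\<^sup>2 + 2 * (X x * Y x) + (Y x)\<^sup>2)"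
    by (rule Bochner_Integration.integral_cong) (auto simp: power2_eq_square algebra_simps)
  also have "\<dots> = expectation (\<lambda>x. (X x)\<^sup>2) + expectation (\<lambda>x. (Y x)\<^sup>2)"
    using iX iY p11 z by simp
  finally show "expectation (\<lambda>x. (X x + Y x)\<^sup>2) = expectation (\<lambda>x. (X x)\<^sup>2) + expectation (\<lambda>x. (Y x)\<^sup>2)" .
qed

text \<open>The fourth moment of a sum of centred independent variables grows only like
  \<open>n\<^sup>2\<close>, because just the pairings of equal indices survive. The four facts
  form one induction, as each step needs the lower moments of the preceding sum.\<close>

lemma (in prob_space) indep_sum_moments:
  fixes Z :: "nat \<Rightarrow> 'a \<Rightarrow> real"
  assumes ind: "indep_vars (\<lambda>_. borel) Z {1..n}"
    and i: "\<And>k. k \<in> {1..n} \<Longrightarrow> integrable M (\<lambda>x. Z k x ^ 4)"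
    and z: "\<And>k. k \<in> {1..n} \<Longrightarrow> expectation (Z k) = 0"
    and b: "\<And>k. k \<in> {1..n} \<Longrightarrow> expectation (\<lambda>x. Z k x ^ 4) \<le> D\<^sup>2" and D: "0 \<le> D"
  shows "integrable M (\<lambda>x. (\<Sum>k=1..n. Z k x) ^ 4) \<and> expectation (\<lambda>x. \<Sum>k=1..n. Z k x) = 0
     \<and> expectation (\<lambda>x. (\<Sum>k=1..n. Z k x)\<^sup>2) \<le> D * n
     \<and> expectation (\<lambda>x. (\<Sum>k=1..n. Z k x) ^ 4) \<le> 3 * D\<^sup>2 * (real n)\<^sup>2"
  using ind i z b
proof (induction n)
  case (Suc n)
  have sub: "{1..n} \<subseteq> {1..Suc n}" by auto
  define S where "S = (\<lambda>x. \<Sum>k=1..n. Z k x)"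
  have eq: "(\<Sum>k=1..Suc n. Z k x) = S x + Z (Suc n) x" for x by (simp add: S_def)
  have [measurable]: "Z k \<in> borel_measurable M" if "k \<in> {1..Suc n}" for k
    using Suc.prems(1) that by (auto simp: indep_vars_def)
  have [measurable]: "S \<in> borel_measurable M" unfolding S_def by (intro borel_measurable_sum) auto
  have IH: "integrable M (\<lambda>x. S x ^ 4)" "expectation S = 0" "expectation (\<lambda>x. (S x)\<^sup>2) \<le> D * n"
      "expectation (\<lambda>x. S x ^ 4) \<le> 3 * D\<^sup>2 * (real n)\<^sup>2"
    using Suc.IH[OF indep_vars_subset[OF Suc.prems(1) sub]] Suc.prems(2-4) unfolding S_def by auto
  have s: "Suc n \<in> {1..Suc n}" by simp
  note Zn = Suc.prems(2-4)[OF s]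
  have "indep_var borel (Z (Suc n)) borel (\<lambda>\<omega>. \<Sum>i\<in>{1..n}. Z i \<omega>)"
    by (rule indep_vars_sum) (use Suc.prems(1) in \<open>auto simp: atLeastAtMostSuc_conv\<close>)
  then have ind: "indep_var borel (Z (Suc n)) borel S" unfolding S_def .
  note add = indep_fourth_moment_add[OF ind Zn(1) IH(1) Zn(2) IH(2)]
  have Z2: "expectation (\<lambda>x. (Z (Suc n) x)\<^sup>2) \<le> D"
    by (rule second_moment_le_of_fourth[OF _ Zn(1) Zn(3) D]) simp
  have i4: "integrable M (\<lambda>x. (S x + Z (Suc n) x) ^ 4)"
    by (rule integrable_power4_sum) (use IH Zn in auto)
  have z: "expectation (\<lambda>x. S x + Z (Suc n) x) = 0"
    using integrable_of_power4(1)[OF _ IH(1)] integrable_of_power4(1)[OF _ Zn(1)] IH(2) Zn(2) by simp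
  have "expectation (\<lambda>x. (S x + Z (Suc n) x)\<^sup>2) \<le> D * n + D"
    using add(2) IH(3) Z2 by (simp add: add.commute)
  then have 2: "expectation (\<lambda>x. (S x + Z (Suc n) x)\<^sup>2) \<le> D * Suc n" by (simp add: algebra_simps)
  have "expectation (\<lambda>x. (Z (Suc n) x)\<^sup>2) * expectation (\<lambda>x. (S x)\<^sup>2) \<le> D * (D * n)"
    by (rule mult_mono[OF Z2 IH(3) D]) simp
  then have "expectation (\<lambda>x. (S x + Z (Suc n) x) ^ 4) \<le> D\<^sup>2 + 6 * (D * (D * n)) + 3 * D\<^sup>2 * (real n)\<^sup>2"
    using add(1) IH(4) Zn(3) by (simp add: add.commute)
  also have "\<dots> \<le> 3 * D\<^sup>2 * (real (Suc n))\<^sup>2" by (simp add: power2_eq_square algebra_simps)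
  finally have 4: "expectation (\<lambda>x. (S x + Z (Suc n) x) ^ 4) \<le> 3 * D\<^sup>2 * (real (Suc n))\<^sup>2" .
  show ?case unfolding eq using i4 z 2 4 by simp
qed simp

lemma AE_summable_of_summable_integrals:
  fixes f :: "nat \<Rightarrow> 'a \<Rightarrow> real"
  assumes f: "\<And>n. integrable M (f n)" "\<And>n x. 0 \<le> f n x" and s: "summable (\<lambda>n. integral\<^sup>L M (f n))"
  shows "AE x in M. summable (\<lambda>n. f n x)"
proof -
  have "(\<integral>\<^sup>+x. (\<Sum>n. ennreal (f n x)) \<partial>M) = (\<Sum>n. \<integral>\<^sup>+x. ennreal (f n x) \<partial>M)"
    by (rule nn_integral_suminf) (use f in measurable)
  also have "\<dots> = (\<Sum>n. ennreal (integral\<^sup>L M (f n)))"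
    by (intro suminf_cong nn_integral_eq_integral f AE_I2)
  also have "\<dots> \<noteq> \<infinity>" using s f(2) by (simp add: suminf_ennreal2 integral_nonneg_AE)
  finally have "AE x in M. (\<Sum>n. ennreal (f n x)) \<noteq> \<infinity>"
    by (intro nn_integral_noteq_infinite) (use f in measurable)
  then show ?thesis
    by eventually_elim (rule summable_suminf_not_top, use f in auto)
qed

text \<open>The normalized sums have fourth moments of order \<open>1 / n\<^sup>2\<close>, so
  almost surely the series of their fourth powers converges. The exponent \<open>p\<close>
  accommodates summands that carry a weight \<open>k ^ p\<close>.\<close>

lemma (in prob_space) strong_law_fourth_moment:
  fixes Z :: "nat \<Rightarrow> 'a \<Rightarrow> real"
  assumes ind: "indep_vars (\<lambda>_. borel) Z {1..}"
    and i: "\<And>k. 1 \<le> k \<Longrightarrow> integrable M (\<lambda>x. Z k x ^ 4)"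
    and z: "\<And>k. 1 \<le> k \<Longrightarrow> expectation (Z k) = 0"
    and b: "\<And>k. 1 \<le> k \<Longrightarrow> expectation (\<lambda>x. Z k x ^ 4) \<le> C * (real k ^ p) ^ 4"
  shows "AE x in M. (\<lambda>n. (\<Sum>k=1..n. Z k x) / real n ^ (p + 1)) \<longlonglongrightarrow> 0"
proof -
  have C: "0 \<le> C" using order_trans[OF integral_nonneg_AE b[of 1]] by simp
  have m: "integrable M (\<lambda>x. (\<Sum>k=1..n. Z k x) ^ 4)"
    "expectation (\<lambda>x. (\<Sum>k=1..n. Z k x) ^ 4) \<le> 3 * (sqrt C * (real n ^ p)\<^sup>2)\<^sup>2 * (real n)\<^sup>2" for n
  proof -
    have "integrable M (\<lambda>x. (\<Sum>k=1..n. Z k x) ^ 4) \<and> expectation (\<lambda>x. \<Sum>k=1..n. Z k x) = 0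
     \<and> expectation (\<lambda>x. (\<Sum>k=1..n. Z k x)\<^sup>2) \<le> (sqrt C * (real n ^ p)\<^sup>2) * n
     \<and> expectation (\<lambda>x. (\<Sum>k=1..n. Z k x) ^ 4) \<le> 3 * (sqrt C * (real n ^ p)\<^sup>2)\<^sup>2 * (real n)\<^sup>2"
    proof (rule indep_sum_moments)
      show "indep_vars (\<lambda>_. borel) Z {1..n}" by (rule indep_vars_subset[OF ind]) auto
      fix k assume k: "k \<in> {1..n}"
      then show "integrable M (\<lambda>x. Z k x ^ 4)" "expectation (Z k) = 0" using i z by auto
      have "expectation (\<lambda>x. Z k x ^ 4) \<le> C * (real k ^ p) ^ 4" using k by (intro b) auto
      also have "\<dots> \<le> C * (real n ^ p) ^ 4" using k C by (intro mult_left_mono power_mono) auto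
      also have "\<dots> = (sqrt C * (real n ^ p)\<^sup>2)\<^sup>2" using C by (simp add: power_mult_distrib)
      finally show "expectation (\<lambda>x. Z k x ^ 4) \<le> (sqrt C * (real n ^ p)\<^sup>2)\<^sup>2" .
    qed (use C in simp)
    then show "integrable M (\<lambda>x. (\<Sum>k=1..n. Z k x) ^ 4)"
    "expectation (\<lambda>x. (\<Sum>k=1..n. Z k x) ^ 4) \<le> 3 * (sqrt C * (real n ^ p)\<^sup>2)\<^sup>2 * (real n)\<^sup>2" by auto
  qed
  define f where "f = (\<lambda>n x. ((\<Sum>k=1..n. Z k x) / real n ^ (p + 1)) ^ 4)"
  have f: "integrable M (f n)" "0 \<le> f n x" for n x
    unfolding f_def power_divide using m by auto
  have fb: "norm (expectation (f n)) \<le> 3 * C * inverse (real n ^ 2)" for n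
  proof (cases "n = 0")
    case False
    have "expectation (f n) = expectation (\<lambda>x. (\<Sum>k=1..n. Z k x) ^ 4) / (real n ^ (p + 1)) ^ 4"
      unfolding f_def power_divide by simp
    also have "\<dots> \<le> 3 * (sqrt C * (real n ^ p)\<^sup>2)\<^sup>2 * (real n)\<^sup>2 / (real n ^ (p + 1)) ^ 4"
      by (intro divide_right_mono m) simp
    also have "\<dots> = 3 * C * ((real n ^ p) ^ 4 * (real n)\<^sup>2) / ((real n ^ p) ^ 4 * (real n) ^ 4)"
      using C by (simp add: power_mult_distrib)
    also have "\<dots> = 3 * C * inverse (real n ^ 2)"
      using False by (simp add: field_simps power2_eq_square power4_eq_xxxx)
    finally show ?thesis using integral_nonneg_AE[of "f n" M] f by simp
  qed (simp add: f_def)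
  have "summable (\<lambda>n. expectation (f n))"
    by (rule summable_comparison_test'[OF _ fb]) (intro summable_mult inverse_power_summable, simp)
  then have "AE x in M. summable (\<lambda>n. f n x)"
    by (intro AE_summable_of_summable_integrals f)
  then show ?thesis
  proof eventually_elim
    case (elim x)
    then have "(\<lambda>n. f n x) \<longlonglongrightarrow> 0" by (rule summable_LIMSEQ_zero)
    then have "(\<lambda>n. root 4 (f n x)) \<longlonglongrightarrow> root 4 0" by (intro tendsto_real_root)
    moreover have "root 4 (f n x) = \<bar>(\<Sum>k=1..n. Z k x) / real n ^ (p + 1)\<bar>" for n
      unfolding f_def by (subst power_even_abs[of 4, symmetric]) (auto simp: real_root_power_cancel)
    ultimately have "(\<lambda>n. \<bar>(\<Sum>k=1..n. Z k x) / real n ^ (p + 1)\<bar>) \<longlonglongrightarrow> 0" by simp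
    then show ?case by (rule tendsto_rabs_zero_cancel)
  qed
qed

text \<open>Each characteristic function agrees with \<open>exp (- \<sigma> / 2)\<close>, where
  \<open>\<sigma>\<close> is the variance of the summand, up to an error of order \<open>n powr (-
  3/2)\<close>; and two products of \<open>n\<close> numbers in the unit disk differ by at most
  the sum of the differences of the factors.\<close>

lemma (in prob_space) clt_triangular_array:
  fixes Z :: "nat \<Rightarrow> nat \<Rightarrow> 'a \<Rightarrow> real"
  assumes ind: "\<And>n. indep_vars (\<lambda>_. borel) (Z n) {1..n}"
    and i: "\<And>n k. k \<in> {1..n} \<Longrightarrow> integrable M (\<lambda>x. Z n k x ^ 4)"
    and z: "\<And>n k. k \<in> {1..n} \<Longrightarrow> expectation (Z n k) = 0"
    and b: "\<And>n k. k \<in> {1..n} \<Longrightarrow> expectation (\<lambda>x. Z n k x ^ 4) \<le> C / (real n)\<^sup>2"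
    and v: "(\<lambda>n. \<Sum>k=1..n. expectation (\<lambda>x. (Z n k x)\<^sup>2)) \<longlonglongrightarrow> s"
  shows "(\<lambda>n. expectation (\<lambda>x. iexp (\<Sum>k=1..n. Z n k x))) \<longlonglongrightarrow> exp (- s / 2)"
proof -
  have C: "0 \<le> C" using order_trans[OF integral_nonneg_AE b[of 1 1]] by simp
  have [measurable]: "Z n k \<in> borel_measurable M" if "k \<in> {1..n}" for n k
    using ind[of n] that by (auto simp: indep_vars_def)
  define \<sigma> where "\<sigma> = (\<lambda>n k. expectation (\<lambda>x. (Z n k x)\<^sup>2))"
  define \<phi> where "\<phi> = (\<lambda>n k. char (distr M borel (Z n k)) 1)"
  have \<sigma>0: "0 \<le> \<sigma> n k" for n k unfolding \<sigma>_def by simp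
  have \<sigma>b: "\<sigma> n k \<le> sqrt C / n" if k: "k \<in> {1..n}" for n k
    unfolding \<sigma>_def
    by (rule second_moment_le_of_fourth[OF _ i[OF k]]) (use b[OF k] C k in \<open>auto simp: power_divide\<close>)
  have prod: "expectation (\<lambda>x. iexp (\<Sum>k=1..n. Z n k x)) = (\<Prod>k=1..n. \<phi> n k)" for n
  proof -
    have "char (distr M borel (\<lambda>\<omega>. \<Sum>i\<in>{1..n}. Z n i \<omega>)) 1 = (\<Prod>i\<in>{1..n}. char (distr M borel (Z n i)) 1)"
      by (rule char_distr_sum[OF ind])
    then show ?thesis unfolding \<phi>_def char_def
      by (subst (asm) integral_distr) (auto intro!: borel_measurable_sum)
  qed
  have est: "cmod (\<phi> n k - of_real (exp (- \<sigma> n k / 2))) \<le> (C + sqrt C) / (real n powr (3/2)) + C / (real n)\<^sup>2"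
    if k: "k \<in> {1..n}" for n k
  proof -
    note iz = integrable_of_power4[OF _ i[OF k]]
    have n: "0 < real n" using k by simp
    have [measurable]: "Z n k \<in> borel_measurable M" using k by measurable
    have iZ: "integrable M (Z n k)" "integrable M (\<lambda>x. (Z n k x)\<^sup>2)" "integrable M (\<lambda>x. Z n k x ^ 3)"
      by (rule iz, measurable)+
    have var: "variance (Z n k) = \<sigma> n k" using z[OF k] by (simp add: \<sigma>_def)
    have "cmod (\<phi> n k - (1 - 1\<^sup>2 * \<sigma> n k / 2)) \<le> (1\<^sup>2 / 6) * expectation (\<lambda>x. min (6 * (Z n k x)\<^sup>2) (\<bar>1\<bar> * \<bar>Z n k x\<bar>^3))"
      unfolding \<phi>_def by (rule char_approx3'[OF _ iZ(1,2) z[OF k] var refl]) simp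
    also have "\<dots> \<le> 1 * expectation (\<lambda>x. \<bar>Z n k x\<bar>^3)"
    proof (rule mult_mono)
      show "expectation (\<lambda>x. min (6 * (Z n k x)\<^sup>2) (\<bar>1\<bar> * \<bar>Z n k x\<bar>^3)) \<le> expectation (\<lambda>x. \<bar>Z n k x\<bar>^3)"
      proof (rule integral_mono)
        show ai: "integrable M (\<lambda>x. \<bar>Z n k x\<bar>^3)" unfolding power_abs[symmetric] using iZ(3) by simp
        show "integrable M (\<lambda>x. min (6 * (Z n k x)\<^sup>2) (\<bar>1\<bar> * \<bar>Z n k x\<bar>^3))"
          by (rule Bochner_Integration.integrable_bound[OF ai]) auto
      qed simp
    qed auto
    \<comment> \<open>The weight \<open>sqrt n\<close> balances the fourth against the second
      moment: both terms are of order \<open>n powr (- 3/2)\<close>.\<close>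
    also have "\<dots> \<le> 1 * expectation (\<lambda>x. sqrt n * Z n k x ^ 4 + (Z n k x)\<^sup>2 / sqrt n)"
    proof (intro mult_left_mono integral_mono)
      show "integrable M (\<lambda>x. \<bar>Z n k x\<bar>^3)" unfolding power_abs[symmetric] using iZ(3) by simp
      show "integrable M (\<lambda>x. sqrt n * Z n k x ^ 4 + (Z n k x)\<^sup>2 / sqrt n)" using i[OF k] iZ by simp
      fix x
      have "0 \<le> (n * \<bar>Z n k x\<bar> ^ 2 - sqrt n * \<bar>Z n k x\<bar>)\<^sup>2" by simp
      also have "\<dots> = (real n)\<^sup>2 * Z n k x ^ 4 + n * (Z n k x)\<^sup>2 - 2 * (n * sqrt n) * \<bar>Z n k x\<bar> ^ 3"
      proof -
        define r y where "r = sqrt n" and "y = \<bar>Z n k x\<bar>"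
        have "real n = r\<^sup>2" "Z n k x ^ 4 = y ^ 4" "(Z n k x)\<^sup>2 = y\<^sup>2" by (auto simp: r_def y_def)
        moreover have "(r\<^sup>2 * y\<^sup>2 - r * y)\<^sup>2 = (r\<^sup>2)\<^sup>2 * y ^ 4 + r\<^sup>2 * y\<^sup>2 - 2 * (r\<^sup>2 * r) * y ^ 3"
          by (simp add: power2_eq_square power3_eq_cube power4_eq_xxxx algebra_simps)
        ultimately show ?thesis unfolding r_def[symmetric] y_def[symmetric] by (simp only:)
      qed
      finally have "0 \<le> (real n)\<^sup>2 * Z n k x ^ 4 + n * (Z n k x)\<^sup>2 - 2 * (n * sqrt n) * \<bar>Z n k x\<bar> ^ 3" .
      then have "2 * \<bar>Z n k x\<bar> ^ 3 * (n * sqrt n) \<le> (sqrt n * Z n k x ^ 4 + (Z n k x)\<^sup>2 / sqrt n) * (n * sqrt n)"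
      proof -
        have "(sqrt n * Z n k x ^ 4 + (Z n k x)\<^sup>2 / sqrt n) * (n * sqrt n) = (sqrt n * sqrt n) * n * Z n k x ^ 4 + n * (Z n k x)\<^sup>2"
          using n by (simp add: field_simps del: real_sqrt_mult_self)
        also have "\<dots> = (real n)\<^sup>2 * Z n k x ^ 4 + n * (Z n k x)\<^sup>2" by (simp add: power2_eq_square)
        finally show ?thesis using \<open>0 \<le> (real n)\<^sup>2 * Z n k x ^ 4 + n * (Z n k x)\<^sup>2 - 2 * (n * sqrt n) * \<bar>Z n k x\<bar> ^ 3\<close>
          by (simp only: mult_ac)
      qed
      then have "2 * \<bar>Z n k x\<bar> ^ 3 \<le> (sqrt n * Z n k x ^ 4 + (Z n k x)\<^sup>2 / sqrt n)"
        using n by (simp only: mult_le_cancel_right) auto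
      moreover have "0 \<le> \<bar>Z n k x\<bar> ^ 3" by simp
      ultimately show "\<bar>Z n k x\<bar> ^ 3 \<le> sqrt n * Z n k x ^ 4 + (Z n k x)\<^sup>2 / sqrt n" by linarith
    qed simp
    also have "\<dots> = sqrt n * expectation (\<lambda>x. Z n k x ^ 4) + \<sigma> n k / sqrt n"
      using i[OF k] iZ by (simp add: \<sigma>_def)
    also have "\<dots> \<le> sqrt n * (C / (real n)\<^sup>2) + sqrt C / n / sqrt n"
      using b[OF k] \<sigma>b[OF k] by (intro add_mono mult_left_mono divide_right_mono) auto
    also have "\<dots> = (C + sqrt C) / (n * sqrt n)"
    proof -
      have "sqrt n / (real n)\<^sup>2 = 1 / (n * sqrt n)" using n by (simp add: field_simps power2_eq_square)
      moreover have "sqrt n * (C / (real n)\<^sup>2) = C * (sqrt n / (real n)\<^sup>2)" by simp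
      ultimately have "sqrt n * (C / (real n)\<^sup>2) = C / (n * sqrt n)" by simp
      then show ?thesis by (simp add: add_divide_distrib)
    qed
    also have "n * sqrt n = real n powr (3/2)"
      using n powr_add[of "real n" 1 "1/2"] by (simp add: powr_half_sqrt)
    finally have 1: "cmod (\<phi> n k - of_real (1 - \<sigma> n k / 2)) \<le> (C + sqrt C) / (real n powr (3/2))" by simp
    define y where "y = \<sigma> n k / 2"
    have "y \<le> \<sigma> n k" "0 \<le> y" using \<sigma>0[of n k] by (auto simp: y_def)
    then have y: "0 \<le> y" "y \<le> sqrt C / n" using \<sigma>b[OF k] by linarith+
    have "1 - y \<le> exp (- y)" using exp_ge_add_one_self[of "- y"] by simp
    moreover have "exp (- y) \<le> 1 - y + y\<^sup>2"
    proof -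
      have "exp (- y) = 1 / exp y" by (simp add: exp_minus field_simps)
      also have "\<dots> \<le> 1 / (1 + y)" using y exp_ge_add_one_self[of y] by (intro divide_left_mono) auto
      also have "\<dots> \<le> 1 - y + y\<^sup>2"
      proof -
        have "1 \<le> (1 - y + y\<^sup>2) * (1 + y)" using y by (simp add: algebra_simps power2_eq_square)
        then show ?thesis using y by (simp add: field_simps)
      qed
      finally show ?thesis .
    qed
    ultimately have "\<bar>(1 - y) - exp (- y)\<bar> \<le> y\<^sup>2" by linarith
    also have "\<dots> \<le> (sqrt C / n)\<^sup>2" using y by (intro power_mono) auto
    also have "\<dots> = C / (real n)\<^sup>2" using C by (simp add: power_divide)
    finally have 2: "cmod (of_real (1 - \<sigma> n k / 2) - of_real (exp (- \<sigma> n k / 2))) \<le> C / (real n)\<^sup>2"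
      by (simp add: y_def flip: of_real_diff)
    show ?thesis using norm_triangle_le[OF add_mono[OF 1 2]] by simp
  qed
  have pd: "cmod ((\<Prod>k=1..n. \<phi> n k) - (\<Prod>k=1..n. of_real (exp (- \<sigma> n k / 2))))
      \<le> n * ((C + sqrt C) / (real n powr (3/2)) + C / (real n)\<^sup>2)" for n
  proof -
    have "cmod ((\<Prod>k=1..n. \<phi> n k) - (\<Prod>k=1..n. of_real (exp (- \<sigma> n k / 2))))
       \<le> (\<Sum>k=1..n. cmod (\<phi> n k - of_real (exp (- \<sigma> n k / 2))))"
    proof (rule norm_prod_diff)
      fix k assume k: "k \<in> {1..n}"
      have "real_distribution (distr M borel (Z n k))" by (rule real_distribution_distr) (use k in measurable)
      then show "norm (\<phi> n k) \<le> 1" unfolding \<phi>_def by (rule real_distribution.cmod_char_le_1)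
    qed (use \<sigma>0 in simp)
    also have "\<dots> \<le> (\<Sum>k=1..n. (C + sqrt C) / (real n powr (3/2)) + C / (real n)\<^sup>2)"
      by (intro sum_mono est)
    finally show ?thesis by simp
  qed
  have pl: "(\<lambda>n. real n * ((C + sqrt C) / (real n powr (3/2)) + C / (real n)\<^sup>2)) \<longlonglongrightarrow> 0"
    by real_asymp
  have d: "(\<lambda>n. (\<Prod>k=1..n. \<phi> n k) - (\<Prod>k=1..n. of_real (exp (- \<sigma> n k / 2)))) \<longlonglongrightarrow> 0"
    by (rule Lim_null_comparison[OF always_eventually pl], rule allI, rule pd)
  have pe: "(\<Prod>k=1..n. complex_of_real (exp (- \<sigma> n k / 2))) = of_real (exp (- (\<Sum>k=1..n. \<sigma> n k) / 2))" for n
    by (simp add: exp_sum[symmetric] sum_negf sum_divide_distrib flip: of_real_prod)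
  have "(\<lambda>n. complex_of_real (exp (- (\<Sum>k=1..n. \<sigma> n k) / 2))) \<longlonglongrightarrow> of_real (exp (- s / 2))"
    using v unfolding \<sigma>_def by (intro tendsto_intros) auto
  from tendsto_add[OF d[unfolded pe] this] show ?thesis unfolding prod by simp
qed

section \<open>Weak convergence in the plane\<close>

definition plane_wave :: "real \<Rightarrow> real \<Rightarrow> real \<times> real \<Rightarrow> complex" where
  "plane_wave s t z = iexp (s * fst z + t * snd z)"

lemma norm_plane_wave [simp]: "norm (plane_wave s t z) = 1"
  by (simp add: plane_wave_def)

lemma plane_wave_mult: "plane_wave s t z * plane_wave s' t' z = plane_wave (s + s') (t + t') z"
  by (simp add: plane_wave_def exp_add[symmetric] algebra_simps)

lemma plane_wave_0 [simp]: "plane_wave 0 0 z = 1"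
  by (simp add: plane_wave_def)

lemma borel_measurable_plane_wave [measurable]: "plane_wave s t \<in> borel_measurable borel"
  unfolding plane_wave_def by (intro borel_measurable_continuous_onI continuous_intros)

lemma borel_measurable_real_polynomial_function:
  "real_polynomial_function (p :: 'a::euclidean_space \<Rightarrow> real) \<Longrightarrow> p \<in> borel_measurable borel"
  by (intro borel_measurable_continuous_onI continuous_on_polymonial_function)
    (simp add: real_polynomial_function_eq)

text \<open>Call a bounded function good if its product with every plane wave has converging
  expectations. Good functions are closed under linear combinations and under multiplication by
  plane waves, hence also under multiplication by \<open>sin (c x)\<close> and \<open>sin (c
  y)\<close>, each a combination of two plane waves. Induction over the polynomial
  \<open>p\<close> then carries goodness from the constant \<open>1\<close> to the trigonometric
  polynomial.\<close>

lemma (in prob_space) trig_polynomial_expectation_tendsto: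
  fixes X :: "nat \<Rightarrow> 'a \<Rightarrow> real \<times> real" and \<mu> :: "(real \<times> real) measure"
  assumes m[measurable]: "\<And>n. X n \<in> borel_measurable M"
    and \<mu>: "prob_space \<mu>" "sets \<mu> = sets borel"
    and char: "\<And>s t. (\<lambda>n. expectation (\<lambda>x. plane_wave s t (X n x))) \<longlonglongrightarrow> integral\<^sup>L \<mu> (plane_wave s t)"
    and p: "real_polynomial_function p"
  shows "(\<lambda>n. expectation (\<lambda>x. p (sin (c * fst (X n x)), sin (c * snd (X n x)))))
     \<longlonglongrightarrow> integral\<^sup>L \<mu> (\<lambda>z. p (sin (c * fst z), sin (c * snd z)))"
proof -
  interpret \<mu>: prob_space \<mu> by fact
  have [measurable_cong]: "sets \<mu> = sets borel" by fact
  define good where "good = (\<lambda>h :: real \<times> real \<Rightarrow> complex. h \<in> borel_measurable borel \<and> (\<exists>B. \<forall>z. norm (h z) \<le> B) \<and>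
    (\<forall>s t. (\<lambda>n. expectation (\<lambda>x. plane_wave s t (X n x) * h (X n x))) \<longlonglongrightarrow> integral\<^sup>L \<mu> (\<lambda>z. plane_wave s t z * h z)))"
  have int: "integrable M (\<lambda>x. plane_wave s t (X n x) * h (X n x))" "integrable \<mu> (\<lambda>z. plane_wave s t z * h z)"
    if "good h" for h s t n
  proof -
    from that obtain B where [measurable]: "h \<in> borel_measurable borel" and B: "\<And>z. norm (h z) \<le> B"
      unfolding good_def by blast
    show "integrable M (\<lambda>x. plane_wave s t (X n x) * h (X n x))"
      by (rule integrable_const_bound[where B = B]) (auto simp: norm_mult B)
    show "integrable \<mu> (\<lambda>z. plane_wave s t z * h z)"
      by (rule \<mu>.integrable_const_bound[where B = B]) (auto simp: norm_mult B)
  qed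
  have good_cmult: "good (\<lambda>z. a * h z)" if "good h" for a h
  proof -
    from that obtain B where [measurable]: "h \<in> borel_measurable borel" and B: "\<And>z. norm (h z) \<le> B"
      and l: "\<And>s t. (\<lambda>n. expectation (\<lambda>x. plane_wave s t (X n x) * h (X n x))) \<longlonglongrightarrow> integral\<^sup>L \<mu> (\<lambda>z. plane_wave s t z * h z)"
      unfolding good_def by blast
    have "norm (a * h z) \<le> norm a * B" for z by (simp add: norm_mult B mult_left_mono)
    moreover have "(\<lambda>n. expectation (\<lambda>x. plane_wave s t (X n x) * (a * h (X n x)))) \<longlonglongrightarrow> integral\<^sup>L \<mu> (\<lambda>z. plane_wave s t z * (a * h z))" for s t
      unfolding mult.left_commute[of _ a] integral_mult_right_zero by (intro tendsto_intros l)
    ultimately show ?thesis unfolding good_def by (auto intro!: exI[of _ "norm a * B"])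
  qed
  have good_add: "good (\<lambda>z. h z + k z)" if h: "good h" and k: "good k" for h k
  proof -
    from h obtain B where [measurable]: "h \<in> borel_measurable borel" and B: "\<And>z. norm (h z) \<le> B"
      unfolding good_def by blast
    from k obtain C where [measurable]: "k \<in> borel_measurable borel" and C: "\<And>z. norm (k z) \<le> C"
      unfolding good_def by blast
    have "norm (h z + k z) \<le> B + C" for z by (rule norm_triangle_le[OF add_mono[OF B C]])
    moreover have "(\<lambda>n. expectation (\<lambda>x. plane_wave s t (X n x) * (h (X n x) + k (X n x)))) \<longlonglongrightarrow> integral\<^sup>L \<mu> (\<lambda>z. plane_wave s t z * (h z + k z))" for s t
      unfolding distrib_left Bochner_Integration.integral_add[OF int(1)[OF h] int(1)[OF k]]
        Bochner_Integration.integral_add[OF int(2)[OF h] int(2)[OF k]]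
      using h k unfolding good_def by (intro tendsto_intros) auto
    ultimately show ?thesis unfolding good_def by (auto intro!: exI[of _ "B + C"])
  qed
  have good_wave: "good (\<lambda>z. plane_wave s' t' z * h z)" if h: "good h" for s' t' h
  proof -
    from h obtain B where [measurable]: "h \<in> borel_measurable borel" and B: "\<And>z. norm (h z) \<le> B"
      and l: "\<And>s t. (\<lambda>n. expectation (\<lambda>x. plane_wave s t (X n x) * h (X n x))) \<longlonglongrightarrow> integral\<^sup>L \<mu> (\<lambda>z. plane_wave s t z * h z)"
      unfolding good_def by blast
    have e: "plane_wave s t z * (plane_wave s' t' z * h z) = plane_wave (s + s') (t + t') z * h z" for s t z
      by (simp only: plane_wave_mult mult.assoc[symmetric])
    show ?thesis unfolding good_def e using l B by (auto simp: norm_mult)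
  qed
  define mult where "mult = (\<lambda>q :: real \<times> real \<Rightarrow> real. \<forall>h. good h \<longrightarrow> good (\<lambda>z. of_real (q z) * h z))"
  have mult_add: "mult (\<lambda>z. q z + r z)" if "mult q" "mult r" for q r
    using that good_add unfolding mult_def by (simp add: distrib_right)
  have mult_mult: "mult (\<lambda>z. q z * r z)" if "mult q" "mult r" for q r
    using that unfolding mult_def by (simp add: mult.assoc)
  have mult_const: "mult (\<lambda>z. a)" for a using good_cmult unfolding mult_def by simp
  have sin_eq: "complex_of_real (sin y) = (- \<i> / 2) * (iexp y + (- 1) * iexp (- y))" for y
    unfolding exp_Euler by (simp add: complex_eq_iff sin_of_real[symmetric] cos_of_real[symmetric])
  have sfst: "mult (\<lambda>z. sin (c * fst z))" unfolding mult_def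
  proof safe
    fix h assume h: "good h"
    have "good (\<lambda>z. (- \<i> / 2) * (plane_wave c 0 z * h z + (- 1) * (plane_wave (- c) 0 z * h z)))"
      by (intro good_cmult good_add good_wave h)
    moreover have "of_real (sin (c * fst z)) * h z = (- \<i> / 2) * (plane_wave c 0 z * h z + (- 1) * (plane_wave (- c) 0 z * h z))" for z
      unfolding sin_eq plane_wave_def by (simp add: algebra_simps)
    ultimately show "good (\<lambda>z. of_real (sin (c * fst z)) * h z)" by simp
  qed
  have ssnd: "mult (\<lambda>z. sin (c * snd z))" unfolding mult_def
  proof safe
    fix h assume h: "good h"
    have "good (\<lambda>z. (- \<i> / 2) * (plane_wave 0 c z * h z + (- 1) * (plane_wave 0 (- c) z * h z)))"
      by (intro good_cmult good_add good_wave h)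
    moreover have "of_real (sin (c * snd z)) * h z = (- \<i> / 2) * (plane_wave 0 c z * h z + (- 1) * (plane_wave 0 (- c) z * h z))" for z
      unfolding sin_eq plane_wave_def by (simp add: algebra_simps)
    ultimately show "good (\<lambda>z. of_real (sin (c * snd z)) * h z)" by simp
  qed
  have "mult (\<lambda>z. p (sin (c * fst z), sin (c * snd z)))"
    using p
  proof (induction p rule: real_polynomial_function.induct)
    case (linear f)
    interpret f: bounded_linear f by fact
    have "f (a, b) = f (1, 0) * a + f (0, 1) * b" for a b
    proof -
      have "f (a, b) = f (a *\<^sub>R (1, 0) + b *\<^sub>R (0, 1))" by simp
      also have "\<dots> = f (1, 0) * a + f (0, 1) * b" by (simp only: f.add f.scaleR) (simp add: mult.commute)
      finally show ?thesis .
    qed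
    then have "(\<lambda>z. f (sin (c * fst z), sin (c * snd z))) = (\<lambda>z. f (1, 0) * sin (c * fst z) + f (0, 1) * sin (c * snd z))"
      by (intro ext)
    then show ?case using mult_add[OF mult_mult[OF mult_const[of "f (1,0)"] sfst] mult_mult[OF mult_const[of "f (0,1)"] ssnd]]
      by (simp only:)
  qed (auto intro: mult_add mult_mult mult_const)
  moreover have "good (\<lambda>_. 1)" using char unfolding good_def by (auto intro!: exI[of _ 1])
  ultimately have g: "good (\<lambda>z. of_real (p (sin (c * fst z), sin (c * snd z))))"
    unfolding mult_def by force
  then have "(\<lambda>n. expectation (\<lambda>x. plane_wave 0 0 (X n x) * complex_of_real (p (sin (c * fst (X n x)), sin (c * snd (X n x))))))
     \<longlonglongrightarrow> integral\<^sup>L \<mu> (\<lambda>z. plane_wave 0 0 z * complex_of_real (p (sin (c * fst z), sin (c * snd z))))"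
    unfolding good_def by blast
  then show ?thesis by (simp add: tendsto_of_real_iff)
qed

lemma (in prob_space) integral_diff_le_of_close_on_ball:
  fixes f h :: "'b::{real_normed_vector, second_countable_topology} \<Rightarrow> real"
  assumes [measurable]: "Y \<in> borel_measurable M" "f \<in> borel_measurable borel" "h \<in> borel_measurable borel"
    and f: "\<And>z. \<bar>f z\<bar> \<le> B" and h: "\<And>z. \<bar>h z\<bar> \<le> C"
    and close: "\<And>z. \<bar>f z - h z\<bar> \<le> e + K * indicator {z. R < norm z} z"
  shows "\<bar>expectation (\<lambda>x. f (Y x)) - expectation (\<lambda>x. h (Y x))\<bar> \<le> e + K * prob {x \<in> space M. R < norm (Y x)}"
proof -
  have i: "integrable M (\<lambda>x. f (Y x))" "integrable M (\<lambda>x. h (Y x))"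
    by (rule integrable_const_bound[where B = B], use f in simp, measurable)
      (rule integrable_const_bound[where B = C], use h in simp, measurable)
  have ii: "integrable M (\<lambda>x. indicator {x \<in> space M. R < norm (Y x)} x :: real)"
    by (rule integrable_const_bound[where B = 1]) auto
  have "\<bar>expectation (\<lambda>x. f (Y x)) - expectation (\<lambda>x. h (Y x))\<bar> = \<bar>expectation (\<lambda>x. f (Y x) - h (Y x))\<bar>"
    using i by simp
  also have "\<dots> \<le> expectation (\<lambda>x. \<bar>f (Y x) - h (Y x)\<bar>)"
    using integral_norm_bound[of M "\<lambda>x. f (Y x) - h (Y x)"] by simp
  also have "\<dots> \<le> expectation (\<lambda>x. e + K * indicator {x \<in> space M. R < norm (Y x)} x)"
  proof (rule integral_mono)
    fix x assume "x \<in> space M"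
    then show "\<bar>f (Y x) - h (Y x)\<bar> \<le> e + K * indicator {x \<in> space M. R < norm (Y x)} x"
      using close[of "Y x"] by (simp add: indicator_def)
  qed (use i ii in auto)
  also have "\<dots> = e + K * prob {x \<in> space M. R < norm (Y x)}"
    using ii by (simp add: prob_space)
  finally show ?thesis .
qed

text \<open>On the square with corners \<open>(\<plusminus>R, \<plusminus>R)\<close> the
  coordinates are recovered from their sines, \<open>x = (2 R / \<pi>) arcsin (sin (\<pi> x / (2
  R)))\<close>. So \<open>f\<close> is there a continuous function of two sines, which the
  Stone-Weierstrass theorem replaces by a polynomial in them. The resulting trigonometric
  polynomial is bounded on the whole plane, and tightness makes the complement of the square
  negligible.\<close>

lemma (in prob_space) converges_in_distribution_planeI:
  fixes X :: "nat \<Rightarrow> 'a \<Rightarrow> real \<times> real" and \<mu> :: "(real \<times> real) measure"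
  assumes m[measurable]: "\<And>n. X n \<in> borel_measurable M"
    and \<mu>: "prob_space \<mu>" "sets \<mu> = sets borel"
    and char: "\<And>s t. (\<lambda>n. expectation (\<lambda>x. plane_wave s t (X n x))) \<longlonglongrightarrow> integral\<^sup>L \<mu> (plane_wave s t)"
    and tight: "\<And>e. 0 < e \<Longrightarrow> \<exists>R. \<forall>\<^sub>F n in sequentially. prob {x \<in> space M. R < norm (X n x)} \<le> e"
  shows "converges_in_distribution M X \<mu>"
  unfolding converges_in_distribution_def
proof (intro conjI allI impI m; elim conjE)
  fix f :: "real \<times> real \<Rightarrow> real" assume f: "continuous_on UNIV f" and "bounded (range f)"
  then obtain B0 where B0: "\<And>z. \<bar>f z\<bar> \<le> B0" unfolding bounded_iff by auto
  define B where "B = B0 + 1"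
  have B: "\<bar>f z\<bar> \<le> B" "0 < B" for z using B0[of z] by (auto simp: B_def)
  interpret \<mu>: prob_space \<mu> by fact
  have [measurable_cong]: "sets \<mu> = sets borel" by fact
  have sp: "space \<mu> = UNIV" using sets_eq_imp_space_eq[OF \<mu>(2)] by simp
  have [measurable]: "f \<in> borel_measurable borel" by (rule borel_measurable_continuous_onI[OF f])
  show "(\<lambda>n. expectation (\<lambda>x. f (X n x))) \<longlonglongrightarrow> integral\<^sup>L \<mu> f"
  proof (rule LIMSEQ_I)
    fix e0 :: real assume e0: "0 < e0"
    \<comment> \<open>\<open>f\<close> and \<open>h\<close> differ in mean by at most \<open>e +
      (2 * B + 1) * e\<close>, under \<open>X n\<close> and under \<open>\<mu>\<close>, and the
      means of \<open>h\<close> by at most \<open>e\<close>; together this is at most \<open>e *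
      (8 + 4 * B)\<close>.\<close>
    define e where "e = min 1 (e0 / (8 + 4 * B))"
    have "e \<le> e0 / (8 + 4 * B)" by (simp add: e_def)
    then have "e * (8 + 4 * B) \<le> e0" using B(2) by (simp only: pos_le_divide_eq)
    moreover have "0 < e" "e \<le> 1" using e0 B(2) by (auto simp: e_def)
    ultimately have e: "0 < e" "e \<le> 1" "e * (8 + 4 * B) \<le> e0" by auto
    obtain R1 where R1: "\<forall>\<^sub>F n in sequentially. prob {x \<in> space M. R1 < norm (X n x)} \<le> e"
      using tight[OF e(1)] by blast
    have "(\<lambda>n. \<mu>.prob {z \<in> space \<mu>. real n < norm z}) \<longlonglongrightarrow> \<mu>.prob (\<Inter>n. {z \<in> space \<mu>. real n < norm z})"
      by (rule \<mu>.finite_Lim_measure_decseq) (auto simp: decseq_def)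
    also have "(\<Inter>n. {z \<in> space \<mu>. real n < norm z}) = {}"
    proof (rule equals0I)
      fix z assume z: "z \<in> (\<Inter>n. {z \<in> space \<mu>. real n < norm z})"
      obtain n where "norm z < real n" using reals_Archimedean2 by blast
      with z show False by (auto dest: less_asym)
    qed
    finally have "(\<lambda>n. \<mu>.prob {z \<in> space \<mu>. real n < norm z}) \<longlonglongrightarrow> 0" by simp
    then have "\<forall>\<^sub>F n in sequentially. \<mu>.prob {z \<in> space \<mu>. real n < norm z} < e"
      by (rule order_tendstoD) fact
    then obtain n2 where n2: "\<mu>.prob {z \<in> space \<mu>. real n2 < norm z} < e"
      by (auto simp: eventually_sequentially)
    define R where "R = max 1 (max R1 (real n2))"
    have R: "0 < R" by (simp add: R_def)
    define S where "S = {-1..1::real} \<times> {-1..1::real}"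
    define F where "F = (\<lambda>z. f (2 * R / pi * arcsin (fst z), 2 * R / pi * arcsin (snd z)))"
    have "continuous_on S F" unfolding F_def S_def
      by (intro continuous_on_compose2[OF f] continuous_intros) auto
    moreover have "compact S" unfolding S_def by (intro compact_Times compact_Icc)
    ultimately obtain p where p: "real_polynomial_function p" "\<And>z. z \<in> S \<Longrightarrow> \<bar>F z - p z\<bar> < e"
      using Stone_Weierstrass_real_polynomial_function[of S F e] e by blast
    define c where "c = pi / (2 * R)"
    define h where "h = (\<lambda>z. p (sin (c * fst z), sin (c * snd z)))"
    have [measurable]: "p \<in> borel_measurable borel"
      by (rule borel_measurable_real_polynomial_function[OF p(1)])
    have "(\<lambda>z::real \<times> real. (sin (c * fst z), sin (c * snd z))) \<in> borel_measurable borel"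
      by (intro borel_measurable_continuous_onI continuous_intros)
    then have [measurable]: "h \<in> borel_measurable borel" unfolding h_def by (rule measurable_compose) fact
    have inS: "(sin (c * fst z), sin (c * snd z)) \<in> S" for z :: "real \<times> real" by (simp add: S_def)
    have Fb: "\<bar>F z\<bar> \<le> B" for z unfolding F_def by (rule B)
    have hb: "\<bar>h z\<bar> \<le> B + 1" for z
      using p(2)[OF inS[of z]] Fb[of "(sin (c * fst z), sin (c * snd z))"] e(2) unfolding h_def by linarith
    have asin: "2 * R / pi * arcsin (sin (c * y)) = y" if "\<bar>y\<bar> \<le> R" for y
    proof -
      have "\<bar>c * y\<bar> \<le> c * R" unfolding abs_mult using R that by (intro mult_mono) (auto simp: c_def)
      also have "c * R = pi / 2" using R by (simp add: c_def)
      finally have "arcsin (sin (c * y)) = c * y" by (intro arcsin_sin) auto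
      then show ?thesis using R by (simp add: c_def)
    qed
    have close: "\<bar>f z - h z\<bar> \<le> e + (2 * B + 1) * indicator {z. R < norm z} z" for z
    proof (cases "R < norm z")
      case True
      then have "indicator {z. R < norm z} z = (1::real)" by simp
      then show ?thesis using B(1)[of z] hb[of z] e by (simp only: mult_1_right)
    next
      case False
      have "\<bar>fst z\<bar> \<le> R" "\<bar>snd z\<bar> \<le> R"
      proof -
        have "norm (fst z) \<le> norm z" using norm_fst_le[of "fst z" "snd z"] by (simp only: prod.collapse)
        moreover have "norm (snd z) \<le> norm z" using norm_snd_le[of "snd z" "fst z"] by (simp only: prod.collapse)
        ultimately show "\<bar>fst z\<bar> \<le> R" "\<bar>snd z\<bar> \<le> R" using False by (simp_all only: real_norm_def not_less)
      qed
      then have "F (sin (c * fst z), sin (c * snd z)) = f z" unfolding F_def by (simp only: asin fst_conv snd_conv prod.collapse)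
      then show ?thesis using p(2)[OF inS[of z]] False unfolding h_def by simp
    qed
    have approx: "\<bar>integral\<^sup>L N (\<lambda>x. f (Y x)) - integral\<^sup>L N (\<lambda>x. h (Y x))\<bar> \<le> e + (2 * B + 1) * measure N {x \<in> space N. R < norm (Y x)}"
      if "prob_space N" "Y \<in> borel_measurable N" for N :: "'b measure" and Y
      by (rule prob_space.integral_diff_le_of_close_on_ball[OF that \<open>f \<in> borel_measurable borel\<close>
        \<open>h \<in> borel_measurable borel\<close> B(1) hb close])
    have "(\<lambda>n. expectation (\<lambda>x. h (X n x))) \<longlonglongrightarrow> integral\<^sup>L \<mu> h"
      unfolding h_def by (rule trig_polynomial_expectation_tendsto[OF m \<mu> char p(1)])
    then have "\<forall>\<^sub>F n in sequentially. \<bar>expectation (\<lambda>x. h (X n x)) - integral\<^sup>L \<mu> h\<bar> < e"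
      by (auto dest: tendstoD[OF _ e(1)] simp: dist_real_def)
    with R1 have "\<forall>\<^sub>F n in sequentially. norm (expectation (\<lambda>x. f (X n x)) - integral\<^sup>L \<mu> f) < e0"
    proof eventually_elim
      case (elim n)
      have "prob {x \<in> space M. R < norm (X n x)} \<le> prob {x \<in> space M. R1 < norm (X n x)}"
        by (rule finite_measure_mono) (auto simp: R_def)
      then have 1: "prob {x \<in> space M. R < norm (X n x)} \<le> e" using elim(1) by simp
      have "\<mu>.prob {z \<in> space \<mu>. R < norm z} \<le> \<mu>.prob {z \<in> space \<mu>. real n2 < norm z}"
        by (rule \<mu>.finite_measure_mono) (auto simp: R_def)
      then have 2: "\<mu>.prob {z \<in> space \<mu>. R < norm z} \<le> e" using n2 by simp
      have "\<bar>expectation (\<lambda>x. f (X n x)) - expectation (\<lambda>x. h (X n x))\<bar> \<le> e + (2 * B + 1) * e"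
        by (rule order_trans[OF approx[OF prob_space_axioms m] add_left_mono[OF mult_left_mono[OF 1]]]) (use B(2) in simp)
      moreover have "\<bar>integral\<^sup>L \<mu> f - integral\<^sup>L \<mu> h\<bar> \<le> e + (2 * B + 1) * e"
      proof (rule order_trans[OF approx[OF \<mu>(1), of "\<lambda>z. z"] add_left_mono[OF mult_left_mono[OF 2]]])
        show "(\<lambda>z. z) \<in> borel_measurable \<mu>" by measurable
      qed (use B(2) in simp)
      ultimately have "\<bar>expectation (\<lambda>x. f (X n x)) - integral\<^sup>L \<mu> f\<bar> < (e + (2 * B + 1) * e) + (e + (2 * B + 1) * e) + e"
        using elim(2) by linarith
      also have "\<dots> \<le> e * (8 + 4 * B)" using e(1) by (simp add: algebra_simps)
      also have "\<dots> \<le> e0" by fact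
      finally show ?case by simp
    qed
    then show "\<exists>N. \<forall>n\<ge>N. norm (expectation (\<lambda>x. f (X n x)) - integral\<^sup>L \<mu> f) < e0"
      by (simp add: eventually_sequentially)
  qed
qed

section \<open>Gaussian measures on the plane\<close>

definition diagonal_gaussian :: "real \<Rightarrow> real \<Rightarrow> (real \<times> real) measure" where
  "diagonal_gaussian a b = distr (std_normal_distribution \<Otimes>\<^sub>M std_normal_distribution) borel (\<lambda>(x, y). (a * x, b * y))"

lemma prob_space_diagonal_gaussian: "prob_space (diagonal_gaussian a b)" "sets (diagonal_gaussian a b) = sets borel"
proof -
  interpret N: prob_space std_normal_distribution by (intro prob_space_normal_density) simp
  interpret P: pair_prob_space std_normal_distribution std_normal_distribution ..
  show "prob_space (diagonal_gaussian a b)" unfolding diagonal_gaussian_def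
    by (rule P.prob_space_distr) (simp add: borel_prod[symmetric])
  show "sets (diagonal_gaussian a b) = sets borel" unfolding diagonal_gaussian_def by simp
qed

lemma borel_measurable_inner_diagonal_gaussian:
  "(\<lambda>x. x \<bullet> z) \<in> borel_measurable (diagonal_gaussian a b)"
proof -
  have "(\<lambda>x. x \<bullet> z) \<in> borel_measurable borel" by (intro borel_measurable_continuous_onI continuous_intros)
  then show ?thesis using measurable_cong_sets[OF prob_space_diagonal_gaussian(2) refl] by blast
qed

lemma integral_diagonal_gaussian:
  fixes f :: "real \<times> real \<Rightarrow> 'b::{banach, second_countable_topology}"
  assumes "f \<in> borel_measurable borel"
  shows "integral\<^sup>L (diagonal_gaussian a b) f = integral\<^sup>L (std_normal_distribution \<Otimes>\<^sub>M std_normal_distribution) (\<lambda>(x, y). f (a * x, b * y))"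
  unfolding diagonal_gaussian_def using assms
  by (subst integral_distr) (auto simp: borel_prod[symmetric] case_prod_beta')

lemma char_diagonal_gaussian:
  "integral\<^sup>L (diagonal_gaussian a b) (plane_wave s t) = exp (- ((s * a)\<^sup>2 + (t * b)\<^sup>2) / 2)"
proof -
  interpret N: prob_space std_normal_distribution by (intro prob_space_normal_density) simp
  interpret P: pair_prob_space std_normal_distribution std_normal_distribution ..
  let ?N = "std_normal_distribution"
  have "integral\<^sup>L (diagonal_gaussian a b) (plane_wave s t)
    = integral\<^sup>L (?N \<Otimes>\<^sub>M ?N) (\<lambda>(x, y). iexp (s * a * x) * iexp (t * b * y))"
    by (subst integral_diagonal_gaussian)
      (auto simp: plane_wave_def exp_add[symmetric] algebra_simps intro!: Bochner_Integration.integral_cong)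
  also have "\<dots> = integral\<^sup>L ?N (\<lambda>y. integral\<^sup>L ?N (\<lambda>x. iexp (s * a * x) * iexp (t * b * y)))"
    by (subst P.integral_snd[symmetric]) (auto intro!: P.integrable_const_bound[where B = 1] simp: norm_mult)
  also have "\<dots> = char ?N (s * a) * char ?N (t * b)"
    unfolding char_def by simp
  also have "\<dots> = exp (- ((s * a)\<^sup>2 + (t * b)\<^sup>2) / 2)"
    by (simp add: char_std_normal_distribution exp_add[symmetric] add_divide_distrib flip: of_real_mult)
  finally show ?thesis .
qed

lemma gaussian_real_eq_distr:
  assumes "0 < \<sigma>" shows "gaussian_real 0 \<sigma> = distr std_normal_distribution borel (\<lambda>x. \<sigma> * x)"
proof -
  interpret N: prob_space std_normal_distribution by (intro prob_space_normal_density) simp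
  have "distributed std_normal_distribution lborel (\<lambda>x. x) std_normal_density"
    unfolding distributed_def by (auto simp: distr_id2)
  then have "distributed std_normal_distribution lborel (\<lambda>x. 0 + \<sigma> * x) (normal_density (0 + \<sigma> * 0) (\<bar>\<sigma>\<bar> * 1))"
    using assms by (intro N.normal_density_affine) auto
  then have "distr std_normal_distribution lborel (\<lambda>x. \<sigma> * x) = density lborel (normal_density 0 \<sigma>)"
    using assms by (simp add: distributed_def)
  moreover have "distr std_normal_distribution lborel (\<lambda>x. \<sigma> * x) = distr std_normal_distribution borel (\<lambda>x. \<sigma> * x)"
    by (rule distr_cong) auto
  ultimately show ?thesis using assms by (simp add: gaussian_real_def)
qed

text \<open>Levy's uniqueness theorem applies because the characteristic function of \<open>x
  \<bullet> z\<close> at \<open>t\<close> is the integral of a plane wave. For \<open>\<sigma> =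
  0\<close> the measure \<open>gaussian_real\<close> is a point mass, which is treated
  separately.\<close>

lemma distr_inner_diagonal_gaussian:
  assumes "\<sigma> = sqrt ((fst z * a)\<^sup>2 + (snd z * b)\<^sup>2)"
  shows "distr (diagonal_gaussian a b) borel (\<lambda>x. x \<bullet> z) = gaussian_real 0 \<sigma>"
proof -
  interpret D: prob_space "diagonal_gaussian a b" by (rule prob_space_diagonal_gaussian)
  have [measurable_cong]: "sets (diagonal_gaussian a b) = sets borel" by (rule prob_space_diagonal_gaussian)
  have m[measurable]: "(\<lambda>x. x \<bullet> z) \<in> borel_measurable (diagonal_gaussian a b)"
    by (rule borel_measurable_inner_diagonal_gaussian)
  interpret N: prob_space std_normal_distribution by (intro prob_space_normal_density) simp
  have g: "real_distribution (gaussian_real 0 \<sigma>) \<and> char (gaussian_real 0 \<sigma>) = (\<lambda>t. exp (- ((t * \<sigma>)\<^sup>2) / 2))"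
  proof (cases "\<sigma> = 0")
    case True
    then show ?thesis
      by (auto simp: gaussian_real_def char_def integral_return real_distribution_def real_distribution_axioms_def prob_space_return)
  next
    case False
    moreover have "0 \<le> \<sigma>" using assms by simp
    ultimately have "0 < \<sigma>" by linarith
    note e = gaussian_real_eq_distr[OF this]
    have "char (gaussian_real 0 \<sigma>) t = char std_normal_distribution (t * \<sigma>)" for t
      unfolding e char_def by (subst integral_distr) (auto simp: mult_ac)
    moreover have "real_distribution (gaussian_real 0 \<sigma>)" unfolding e by (rule N.real_distribution_distr) simp
    ultimately show ?thesis by (simp add: char_std_normal_distribution fun_eq_iff)
  qed
  show ?thesis
  proof (rule Levy_uniqueness)
    show "real_distribution (distr (diagonal_gaussian a b) borel (\<lambda>x. x \<bullet> z))" by (rule D.real_distribution_distr[OF m])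
    have "char (distr (diagonal_gaussian a b) borel (\<lambda>x. x \<bullet> z)) t = integral\<^sup>L (diagonal_gaussian a b) (plane_wave (t * fst z) (t * snd z))" for t
      unfolding char_def by (subst integral_distr[OF m]) (auto simp: plane_wave_def inner_prod_def algebra_simps intro!: Bochner_Integration.integral_cong)
    then show "char (distr (diagonal_gaussian a b) borel (\<lambda>x. x \<bullet> z)) = char (gaussian_real 0 \<sigma>)"
      using g unfolding char_diagonal_gaussian by (auto simp: fun_eq_iff assms power_mult_distrib algebra_simps)
  qed (use g in blast)
qed

lemma gaussian_measure_diagonal_gaussian:
  "gaussian_measure (diagonal_gaussian a b)"
  unfolding gaussian_measure_def
proof (intro conjI allI)
  fix z :: "real \<times> real"
  show "\<exists>m. \<exists>\<sigma>\<ge>0. distr (diagonal_gaussian a b) borel (\<lambda>x. x \<bullet> z) = gaussian_real m \<sigma>"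
    using distr_inner_diagonal_gaussian[OF refl, of a b z]
    by (intro exI[of _ 0] exI[of _ "sqrt ((fst z * a)\<^sup>2 + (snd z * b)\<^sup>2)"]) auto
qed (rule prob_space_diagonal_gaussian)+

lemma diagonal_gaussian_moments:
  assumes ab: "0 < a" "0 < b" and z: "z \<noteq> 0"
  shows "integrable (diagonal_gaussian a b) (\<lambda>x. x \<bullet> z)" "integral\<^sup>L (diagonal_gaussian a b) (\<lambda>x. x \<bullet> z) = 0"
    "0 < integral\<^sup>L (diagonal_gaussian a b) (\<lambda>x. (x \<bullet> z)\<^sup>2)"
proof -
  define \<sigma> where "\<sigma> = sqrt ((fst z * a)\<^sup>2 + (snd z * b)\<^sup>2)"
  have "fst z * a \<noteq> 0 \<or> snd z * b \<noteq> 0" using ab z by (auto simp: prod_eq_iff)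
  then have "0 < (fst z * a)\<^sup>2 + (snd z * b)\<^sup>2" by (simp only: sum_power2_gt_zero_iff)
  then have \<sigma>: "0 < \<sigma>" by (simp add: \<sigma>_def)
  have [measurable_cong]: "sets (diagonal_gaussian a b) = sets borel" by (rule prob_space_diagonal_gaussian)
  have m[measurable]: "(\<lambda>x. x \<bullet> z) \<in> borel_measurable (diagonal_gaussian a b)"
    by (rule borel_measurable_inner_diagonal_gaussian)
  note d = distr_inner_diagonal_gaussian[OF \<sigma>_def, unfolded gaussian_real_eq_distr[OF \<sigma>]]
  have 1: "integrable (distr (diagonal_gaussian a b) borel (\<lambda>x. x \<bullet> z)) (\<lambda>x. x)"
  proof -
    have "integrable std_normal_distribution (\<lambda>x. \<sigma> * x ^ 1)"
      by (intro integrable_mult_right integrable_std_normal_distribution_moment)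
    then show ?thesis unfolding d by (subst integrable_distr_eq) (simp_all only: power_one_right, measurable)
  qed
  show "integrable (diagonal_gaussian a b) (\<lambda>x. x \<bullet> z)"
    using 1 by (subst (asm) integrable_distr_eq[OF m]) simp_all
  have "integral\<^sup>L (diagonal_gaussian a b) (\<lambda>x. x \<bullet> z) = integral\<^sup>L (distr (diagonal_gaussian a b) borel (\<lambda>x. x \<bullet> z)) (\<lambda>x. x)"
    by (rule integral_distr[OF m, symmetric]) simp
  also have "\<dots> = \<sigma> * integral\<^sup>L std_normal_distribution (\<lambda>x. x ^ 1)"
    unfolding d by (subst integral_distr) simp_all
  also have "\<dots> = 0" by (subst integral_std_normal_distribution_moment_odd) auto
  finally show "integral\<^sup>L (diagonal_gaussian a b) (\<lambda>x. x \<bullet> z) = 0" .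
  have "integral\<^sup>L (diagonal_gaussian a b) (\<lambda>x. (x \<bullet> z)\<^sup>2) = integral\<^sup>L (distr (diagonal_gaussian a b) borel (\<lambda>x. x \<bullet> z)) (\<lambda>x. x\<^sup>2)"
    by (rule integral_distr[OF m, symmetric]) simp
  also have "\<dots> = \<sigma>\<^sup>2 * integral\<^sup>L std_normal_distribution (\<lambda>x. x ^ (2 * 1))"
    unfolding d by (subst integral_distr) (simp_all add: power_mult_distrib)
  also have "\<dots> = \<sigma>\<^sup>2" by (subst std_normal_distribution_even_moments) (simp add: fact_numeral)
  finally show "0 < integral\<^sup>L (diagonal_gaussian a b) (\<lambda>x. (x \<bullet> z)\<^sup>2)" using \<sigma> by simp
qed

lemma diagonal_gaussian_zero_mean_nondegenerate:
  assumes "0 < a" "0 < b"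
  shows "zero_mean (diagonal_gaussian a b)" "nondegenerate (diagonal_gaussian a b)"
proof -
  show "zero_mean (diagonal_gaussian a b)" unfolding zero_mean_def
  proof
    fix z :: "real \<times> real"
    show "integrable (diagonal_gaussian a b) (\<lambda>x. x \<bullet> z) \<and> integral\<^sup>L (diagonal_gaussian a b) (\<lambda>x. x \<bullet> z) = 0"
      using diagonal_gaussian_moments[OF assms] by (cases "z = 0") auto
  qed
  show "nondegenerate (diagonal_gaussian a b)" unfolding nondegenerate_def
    using diagonal_gaussian_moments(3)[OF assms] by blast
qed

section \<open>Measurability up to null sets\<close>

text \<open>With all null sets included, almost sure limits of measurable functions stay
  measurable. The notion covers both a complete measure itself and the
  \<open>\<sigma>\<close>-algebras of the single modes.\<close>

definition null_complete_subalgebra :: "'a measure \<Rightarrow> 'a measure \<Rightarrow> bool" where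
  "null_complete_subalgebra M G \<longleftrightarrow> subalgebra M G \<and> (\<forall>N\<in>null_sets M. \<forall>A. A \<subseteq> N \<longrightarrow> A \<in> sets G)"

lemma null_complete_subalgebra_self: "complete_measure M \<Longrightarrow> null_complete_subalgebra M M"
  by (auto simp: null_complete_subalgebra_def subalgebra_def intro: complete_measure.complete)

lemma borel_measurable_AE_eq_subalgebra:
  fixes f g :: "'a \<Rightarrow> 'b::topological_space"
  assumes G: "null_complete_subalgebra M G" and f: "f \<in> borel_measurable G" and eq: "AE x in M. f x = g x"
  shows "g \<in> borel_measurable G"
proof (rule measurableI)
  have sp: "space G = space M" using G by (simp add: null_complete_subalgebra_def subalgebra_def)
  obtain N where N: "{x \<in> space M. f x \<noteq> g x} \<subseteq> N" "N \<in> null_sets M"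
    using eq unfolding eventually_ae_filter by auto
  fix A :: "'b set" assume A: "A \<in> sets borel"
  have NG: "N \<in> sets G" "g -` A \<inter> space G \<inter> N \<in> sets G"
    using G N(2) unfolding null_complete_subalgebra_def by auto
  have fA: "f -` A \<inter> space G \<in> sets G" by (rule measurable_sets[OF f A])
  have "g -` A \<inter> space G = (f -` A \<inter> space G - N) \<union> (g -` A \<inter> space G \<inter> N)"
    using N(1) sp by auto
  moreover have "(f -` A \<inter> space G - N) \<union> (g -` A \<inter> space G \<inter> N) \<in> sets G"
    by (intro sets.Un sets.Diff fA NG)
  ultimately show "g -` A \<inter> space G \<in> sets G" by (simp only:)
qed simp

lemma borel_measurable_AE_limit_subalgebra:
  fixes f :: "nat \<Rightarrow> 'a \<Rightarrow> real"
  assumes G: "null_complete_subalgebra M G" and f: "\<And>n. f n \<in> borel_measurable G"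
    and lim: "AE x in M. (\<lambda>n. f n x) \<longlonglongrightarrow> g x"
  shows "g \<in> borel_measurable G"
proof (rule borel_measurable_AE_eq_subalgebra[OF G])
  show "(\<lambda>x. lim (\<lambda>n. f n x)) \<in> borel_measurable G" using f by measurable
  show "AE x in M. lim (\<lambda>n. f n x) = g x" using lim by eventually_elim (rule limI)
qed

lemma complete_measure_subalgebra:
  assumes "subalgebra M G" "\<And>N A. N \<in> null_sets M \<Longrightarrow> A \<subseteq> N \<Longrightarrow> A \<in> sets G"
  shows "complete_measure M"
proof
  fix A B assume "B \<subseteq> A" "A \<in> null_sets M"
  then show "B \<in> sets M" using assms by (auto simp: subalgebra_def)
qed

context stochastic_basis begin

lemma complete_measure_M: "complete_measure M"
  by (rule complete_measure_subalgebra[OF subalgebra_F[of 0] F_0_complete]) auto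

lemma borel_measurable_F_M: "0 \<le> t \<Longrightarrow> f \<in> borel_measurable (F t) \<Longrightarrow> f \<in> borel_measurable M"
  by (rule measurable_from_subalg[OF subalgebra_F])

lemma borel_measurable_F_mono:
  assumes "0 \<le> s" "s \<le> t" "f \<in> borel_measurable (F s)" shows "f \<in> borel_measurable (F t)"
proof (rule measurable_from_subalg[OF _ assms(3)])
  show "subalgebra (F t) (F s)"
    using subalgebra_F[of s] subalgebra_F[of t] F_mono[OF assms(1,2)] assms(1,2) by (simp add: subalgebra_def)
qed

end

section \<open>Increments of an adapted Brownian motion\<close>

locale adapted_brownian_motion = stochastic_basis M F for M :: "'a measure" and F +
  fixes w :: "real \<Rightarrow> 'a \<Rightarrow> real"
  assumes brownian: "brownian_motion M F w"
begin

lemma w_F: "0 \<le> t \<Longrightarrow> w t \<in> borel_measurable (F t)"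
  using brownian by (auto simp: brownian_motion_def adapted_def)

lemma w_M: "0 \<le> t \<Longrightarrow> w t \<in> borel_measurable M"
  by (rule borel_measurable_F_M[OF _ w_F])

definition incr :: "real \<Rightarrow> real \<Rightarrow> 'a \<Rightarrow> real" where
  "incr s t \<omega> = w t \<omega> - w s \<omega>"

lemma incr_M: "0 \<le> s \<Longrightarrow> s \<le> t \<Longrightarrow> incr s t \<in> borel_measurable M"
  unfolding incr_def by (intro borel_measurable_diff w_M) auto

lemma incr_F: "0 \<le> s \<Longrightarrow> s \<le> t \<Longrightarrow> incr s t \<in> borel_measurable (F t)"
  unfolding incr_def by (intro borel_measurable_diff w_F borel_measurable_F_mono[OF _ _ w_F]) auto

lemma incr_self: "incr s s = (\<lambda>_. 0)"
  by (simp add: incr_def fun_eq_iff)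

lemma incr_distributed:
  "0 \<le> s \<Longrightarrow> s < t \<Longrightarrow> distributed M lborel (incr s t) (normal_density 0 (sqrt (t - s)))"
  using brownian unfolding brownian_motion_def incr_def by auto

lemma incr_moments:
  assumes st: "0 \<le> s" "s \<le> t"
  shows "integrable M (\<lambda>\<omega>. incr s t \<omega> ^ k)"
    "expectation (incr s t) = 0" "expectation (\<lambda>\<omega>. (incr s t \<omega>)\<^sup>2) = t - s"
    "expectation (\<lambda>\<omega>. incr s t \<omega> ^ 3) = 0" "expectation (\<lambda>\<omega>. incr s t \<omega> ^ 4) = 3 * (t - s)\<^sup>2"
    "integrable M (\<lambda>\<omega>. exp (c * incr s t \<omega>))"
    "expectation (\<lambda>\<omega>. exp (c * incr s t \<omega>)) = exp (c\<^sup>2 * (t - s) / 2)"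
proof -
  have "integrable M (\<lambda>\<omega>. incr s t \<omega> ^ k) \<and>
    expectation (incr s t) = 0 \<and> expectation (\<lambda>\<omega>. (incr s t \<omega>)\<^sup>2) = t - s \<and>
    expectation (\<lambda>\<omega>. incr s t \<omega> ^ 3) = 0 \<and> expectation (\<lambda>\<omega>. incr s t \<omega> ^ 4) = 3 * (t - s)\<^sup>2 \<and>
    integrable M (\<lambda>\<omega>. exp (c * incr s t \<omega>)) \<and>
    expectation (\<lambda>\<omega>. exp (c * incr s t \<omega>)) = exp (c\<^sup>2 * (t - s) / 2)"
  proof (cases "s = t")
    case True
    then show ?thesis by (simp add: incr_self prob_space)
  next
    case False
    define \<sigma> where "\<sigma> = sqrt (t - s)"
    have \<sigma>: "0 < \<sigma>" "\<sigma>\<^sup>2 = t - s" using False st by (auto simp: \<sigma>_def)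
    have D: "distributed M lborel (incr s t) (normal_density 0 \<sigma>)"
      unfolding \<sigma>_def using False st by (intro incr_distributed) auto
    have p: "integrable M (\<lambda>\<omega>. incr s t \<omega> ^ k)" "expectation (\<lambda>\<omega>. incr s t \<omega> ^ k) = (\<integral>x. normal_density 0 \<sigma> x * x ^ k \<partial>lborel)" for k
    proof -
      show "integrable M (\<lambda>\<omega>. incr s t \<omega> ^ k)"
        using distributed_integrable[OF D, of "\<lambda>x. x ^ k"] integrable_normal_moment[OF \<sigma>(1), of 0 k] by simp
      show "expectation (\<lambda>\<omega>. incr s t \<omega> ^ k) = (\<integral>x. normal_density 0 \<sigma> x * x ^ k \<partial>lborel)"
        using distributed_integral[OF D, of "\<lambda>x. x ^ k"] by simp
    qed
    \<comment> \<open>Completing the square turns the tilted density into a shifted one.\<close>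
    have e: "normal_density 0 \<sigma> x * exp (c * x) = exp (c\<^sup>2 * \<sigma>\<^sup>2 / 2) * normal_density (c * \<sigma>\<^sup>2) \<sigma> x" for x
    proof -
      have "- (x\<^sup>2) / (2 * \<sigma>\<^sup>2) + c * x = c\<^sup>2 * \<sigma>\<^sup>2 / 2 + - (x - c * \<sigma>\<^sup>2)\<^sup>2 / (2 * \<sigma>\<^sup>2)"
        using \<sigma>(1) by (simp add: field_simps power2_eq_square)
      then have "exp (- (x\<^sup>2) / (2 * \<sigma>\<^sup>2)) * exp (c * x) = exp (c\<^sup>2 * \<sigma>\<^sup>2 / 2) * exp (- (x - c * \<sigma>\<^sup>2)\<^sup>2 / (2 * \<sigma>\<^sup>2))"
        unfolding exp_add[symmetric] by simp
      then show ?thesis unfolding normal_density_def by simp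
    qed
    have "integrable M (\<lambda>\<omega>. exp (c * incr s t \<omega>))"
      using distributed_integrable[OF D, of "\<lambda>x. exp (c * x)"] \<sigma>(1) by (simp add: e)
    moreover have "expectation (\<lambda>\<omega>. exp (c * incr s t \<omega>)) = exp (c\<^sup>2 * (t - s) / 2)"
      using distributed_integral[OF D, of "\<lambda>x. exp (c * x)"] \<sigma> by (simp add: e)
    moreover have "expectation (\<lambda>\<omega>. incr s t \<omega> ^ (2 * 0 + 1)) = 0" "expectation (\<lambda>\<omega>. incr s t \<omega> ^ (2 * 1 + 1)) = 0"
      unfolding p(2) using integral_normal_moment_odd[OF \<sigma>(1), of 0 0] integral_normal_moment_odd[OF \<sigma>(1), of 0 1] by (simp_all only: diff_zero)
    moreover have "expectation (\<lambda>\<omega>. incr s t \<omega> ^ (2 * 1)) = t - s" "expectation (\<lambda>\<omega>. incr s t \<omega> ^ (2 * 2)) = 3 * (t - s)\<^sup>2"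
      unfolding p(2) using integral_normal_moment_even[OF \<sigma>(1), of 0 1] integral_normal_moment_even[OF \<sigma>(1), of 0 2] \<sigma>
      by (simp_all add: fact_numeral power_divide)
    ultimately show ?thesis using p(1)[of k] by (simp add: numeral_3_eq_3)
  qed
  then show "integrable M (\<lambda>\<omega>. incr s t \<omega> ^ k)"
    "expectation (incr s t) = 0" "expectation (\<lambda>\<omega>. (incr s t \<omega>)\<^sup>2) = t - s"
    "expectation (\<lambda>\<omega>. incr s t \<omega> ^ 3) = 0" "expectation (\<lambda>\<omega>. incr s t \<omega> ^ 4) = 3 * (t - s)\<^sup>2"
    "integrable M (\<lambda>\<omega>. exp (c * incr s t \<omega>))"
    "expectation (\<lambda>\<omega>. exp (c * incr s t \<omega>)) = exp (c\<^sup>2 * (t - s) / 2)" by blast+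
qed

text \<open>Independence of \<open>F s\<close> is part of the definition of a Brownian motion for
  \<open>s < t\<close>; for \<open>s = t\<close> the increment is constant.\<close>

lemma incr_indep:
  fixes h :: "real \<Rightarrow> real"
  assumes st: "0 \<le> s" "s \<le> t" and Z: "Z \<in> borel_measurable (F s)" and iZ: "integrable M Z"
    and h: "h \<in> borel_measurable borel" and ih: "integrable M (\<lambda>\<omega>. h (incr s t \<omega>))"
  shows "integrable M (\<lambda>\<omega>. Z \<omega> * h (incr s t \<omega>))"
    "expectation (\<lambda>\<omega>. Z \<omega> * h (incr s t \<omega>)) = expectation Z * expectation (\<lambda>\<omega>. h (incr s t \<omega>))"
proof -
  have "integrable M (\<lambda>\<omega>. Z \<omega> * h (incr s t \<omega>)) \<and>
    expectation (\<lambda>\<omega>. Z \<omega> * h (incr s t \<omega>)) = expectation Z * expectation (\<lambda>\<omega>. h (incr s t \<omega>))"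
  proof (cases "s = t")
    case True
    then show ?thesis using iZ by (simp add: incr_self prob_space)
  next
    case False
    let ?D = "{incr s t -` A \<inter> space M | A. A \<in> sets borel}"
    have ind: "indep_set (sets (F s)) ?D"
      using brownian False st unfolding brownian_motion_def incr_def by auto
    have rZ: "random_variable borel Z" by (rule borel_measurable_F_M[OF st(1) Z])
    have sp: "space (F s) = space M" using subalgebra_F[OF st(1)] by (simp add: subalgebra_def)
    have "indep_var borel Z borel (incr s t)"
      unfolding indep_var_eq
    proof (intro conjI rZ incr_M st)
      have "sigma_sets (space M) {Z -` A \<inter> space M | A. A \<in> sets borel} \<subseteq> sets (F s)"
        unfolding sp[symmetric] by (rule sets.sigma_sets_subset) (use Z in \<open>auto intro: measurable_sets\<close>)
      moreover have "sigma_sets (space M) ?D = ?D"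
        by (rule sigma_sets_vimage_commute[of "incr s t" "space M" UNIV "sets borel", simplified, symmetric, THEN trans])
          (auto simp: sets.sigma_sets_eq[of borel, simplified])
      ultimately show "indep_set (sigma_sets (space M) {Z -` A \<inter> space M | A. A \<in> sets borel}) (sigma_sets (space M) ?D)"
        using ind unfolding indep_set_def
        by (intro indep_sets_mono_sets[OF ind[unfolded indep_set_def]]) (auto split: bool.split)
    qed
    then have "indep_var borel ((\<lambda>x. x) \<circ> Z) borel (h \<circ> incr s t)"
      by (rule indep_var_compose) (use h in auto)
    then have "indep_var borel Z borel (\<lambda>\<omega>. h (incr s t \<omega>))" by (simp add: comp_def)
    from indep_var_integrable[OF this iZ ih] indep_var_lebesgue_integral[OF this iZ ih] show ?thesis by blast
  qed
  then show "integrable M (\<lambda>\<omega>. Z \<omega> * h (incr s t \<omega>))"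
    "expectation (\<lambda>\<omega>. Z \<omega> * h (incr s t \<omega>)) = expectation Z * expectation (\<lambda>\<omega>. h (incr s t \<omega>))" by blast+
qed

lemma incr_indep_power:
  assumes st: "0 \<le> s" "s \<le> t" and Z: "Z \<in> borel_measurable (F s)" and iZ: "integrable M Z"
  shows "integrable M (\<lambda>\<omega>. Z \<omega> * incr s t \<omega> ^ k)"
    "expectation (\<lambda>\<omega>. Z \<omega> * incr s t \<omega> ^ k) = expectation Z * expectation (\<lambda>\<omega>. incr s t \<omega> ^ k)"
  by (rule incr_indep[OF st Z iZ, of "\<lambda>x. x ^ k"]; use incr_moments(1)[OF st] in simp)+

lemma incr_indep_1:
  assumes st: "0 \<le> s" "s \<le> t" and Z: "Z \<in> borel_measurable (F s)" and iZ: "integrable M Z"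
  shows "integrable M (\<lambda>\<omega>. Z \<omega> * incr s t \<omega>)" "expectation (\<lambda>\<omega>. Z \<omega> * incr s t \<omega>) = 0"
  using incr_indep_power[OF st Z iZ, of 1] incr_moments(2)[OF st] by simp_all

lemma incr_indep_2:
  assumes st: "0 \<le> s" "s \<le> t" and Z: "Z \<in> borel_measurable (F s)" and iZ: "integrable M Z"
  shows "integrable M (\<lambda>\<omega>. Z \<omega> * (incr s t \<omega>)\<^sup>2)" "expectation (\<lambda>\<omega>. Z \<omega> * (incr s t \<omega>)\<^sup>2) = expectation Z * (t - s)"
  using incr_indep_power[OF st Z iZ, of 2] incr_moments(3)[OF st] by simp_all

lemma integrable_square_mult_incr:
  assumes st: "0 \<le> s" "s \<le> t" and \<xi>: "\<xi> \<in> borel_measurable (F s)" and i: "integrable M (\<lambda>\<omega>. (\<xi> \<omega>)\<^sup>2)"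
  shows "integrable M (\<lambda>\<omega>. (\<xi> \<omega> * incr s t \<omega>)\<^sup>2)"
  using incr_indep_2(1)[OF st _ i] \<xi> by (simp add: power_mult_distrib)

section \<open>The Ito isometry\<close>

text \<open>Split both intervals at \<open>c\<close> and at \<open>e = min b d\<close>. A product
  whose latest increment occurs only once has mean zero; only the square of the increment over the
  overlap \<open>[c, e]\<close> contributes, by its length.\<close>

lemma ito_isometry_pair_ordered:
  assumes ab: "0 \<le> a" "a \<le> b" and cd: "0 \<le> c" "c \<le> d" and ac: "a \<le> c"
    and \<xi>: "\<xi> \<in> borel_measurable (F a)" "integrable M (\<lambda>\<omega>. (\<xi> \<omega>)\<^sup>2)"
    and \<eta>: "\<eta> \<in> borel_measurable (F c)" "integrable M (\<lambda>\<omega>. (\<eta> \<omega>)\<^sup>2)"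
  shows "expectation (\<lambda>\<omega>. (\<xi> \<omega> * incr a b \<omega>) * (\<eta> \<omega> * incr c d \<omega>))
    = expectation (\<lambda>\<omega>. \<xi> \<omega> * \<eta> \<omega>) * max 0 (min b d - max a c)"
proof -
  have \<xi>c: "\<xi> \<in> borel_measurable (F c)" by (rule borel_measurable_F_mono[OF ab(1) ac \<xi>(1)])
  have \<xi>M: "\<xi> \<in> borel_measurable M" and \<eta>M: "\<eta> \<in> borel_measurable M"
    using borel_measurable_F_M \<xi> \<eta> ab cd by auto
  have i\<xi>\<eta>: "integrable M (\<lambda>\<omega>. \<xi> \<omega> * \<eta> \<omega>)" by (rule integrable_square_mult[OF \<xi>M \<eta>M \<xi>(2) \<eta>(2)])
  have m\<xi>\<eta>: "(\<lambda>\<omega>. \<xi> \<omega> * \<eta> \<omega>) \<in> borel_measurable (F c)" using \<xi>c \<eta>(1) by measurable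
  have past: "integrable M (\<lambda>\<omega>. (\<xi> \<omega> * incr a r \<omega> * \<eta> \<omega>) * incr c d \<omega>)"
      "expectation (\<lambda>\<omega>. (\<xi> \<omega> * incr a r \<omega> * \<eta> \<omega>) * incr c d \<omega>) = 0" if r: "a \<le> r" "r \<le> c" for r
  proof -
    have mm: "incr a r \<in> borel_measurable (F c)"
      by (rule borel_measurable_F_mono[OF _ _ incr_F]) (use r ab in auto)
    have "integrable M (\<lambda>\<omega>. (\<xi> \<omega> * incr a r \<omega>) * \<eta> \<omega>)"
      by (rule integrable_square_mult[OF _ \<eta>M integrable_square_mult_incr \<eta>(2)])
        (use r ab \<xi> \<xi>M incr_M in auto)
    moreover have "(\<lambda>\<omega>. \<xi> \<omega> * incr a r \<omega> * \<eta> \<omega>) \<in> borel_measurable (F c)"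
      using mm \<xi>c \<eta>(1) by measurable
    ultimately show "integrable M (\<lambda>\<omega>. (\<xi> \<omega> * incr a r \<omega> * \<eta> \<omega>) * incr c d \<omega>)"
      "expectation (\<lambda>\<omega>. (\<xi> \<omega> * incr a r \<omega> * \<eta> \<omega>) * incr c d \<omega>) = 0"
      using incr_indep_1[OF cd] by blast+
  qed
  show ?thesis
  proof (cases "b \<le> c")
    case True
    then have "max 0 (min b d - max a c) = 0" using ac cd by auto
    then show ?thesis using past(2)[OF ab(2) True] by (simp add: mult_ac)
  next
    case False
    define e where "e = min b d"
    have e: "c \<le> e" "e \<le> b" "e \<le> d" using False cd by (auto simp: e_def)
    have m: "max 0 (min b d - max a c) = e - c" using e ac by (auto simp: e_def max_def)
    have sq: "integrable M (\<lambda>\<omega>. (\<xi> \<omega> * \<eta> \<omega>) * (incr c e \<omega>)\<^sup>2)"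
      "expectation (\<lambda>\<omega>. (\<xi> \<omega> * \<eta> \<omega>) * (incr c e \<omega>)\<^sup>2) = expectation (\<lambda>\<omega>. \<xi> \<omega> * \<eta> \<omega>) * (e - c)"
      using incr_indep_2[OF cd(1) e(1) m\<xi>\<eta> i\<xi>\<eta>] by blast+
    have "integrable M (\<lambda>\<omega>. (\<xi> \<omega> * \<eta> \<omega>) * incr c e \<omega>)"
      using incr_indep_1[OF cd(1) e(1) m\<xi>\<eta> i\<xi>\<eta>] by blast
    moreover have "(\<lambda>\<omega>. (\<xi> \<omega> * \<eta> \<omega>) * incr c e \<omega>) \<in> borel_measurable (F e)"
      using borel_measurable_F_mono[OF cd(1) e(1) m\<xi>\<eta>] incr_F[OF cd(1) e(1)] by measurable
    ultimately have cr: "integrable M (\<lambda>\<omega>. ((\<xi> \<omega> * \<eta> \<omega>) * incr c e \<omega>) * incr e f \<omega>)"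
      "expectation (\<lambda>\<omega>. ((\<xi> \<omega> * \<eta> \<omega>) * incr c e \<omega>) * incr e f \<omega>) = 0" if "e \<le> f" for f
      using incr_indep_1[of e f] that cd(1) e(1) by auto
    have "(\<xi> \<omega> * incr a b \<omega>) * (\<eta> \<omega> * incr c d \<omega>) =
      (\<xi> \<omega> * incr a c \<omega> * \<eta> \<omega>) * incr c d \<omega> + (\<xi> \<omega> * \<eta> \<omega>) * (incr c e \<omega>)\<^sup>2
        + ((\<xi> \<omega> * \<eta> \<omega>) * incr c e \<omega>) * incr e b \<omega> + ((\<xi> \<omega> * \<eta> \<omega>) * incr c e \<omega>) * incr e d \<omega>" for \<omega>
    proof -
      have "incr e b \<omega> * incr e d \<omega> = 0" using False cd by (auto simp: e_def incr_self min_def)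
      then have z: "\<xi> \<omega> * \<eta> \<omega> * (incr e b \<omega> * incr e d \<omega>) = 0" by simp
      have "incr a b \<omega> = incr a c \<omega> + incr c e \<omega> + incr e b \<omega>" "incr c d \<omega> = incr c e \<omega> + incr e d \<omega>"
        by (auto simp: incr_def)
      then show ?thesis using z by (simp add: algebra_simps power2_eq_square)
    qed
    then have "expectation (\<lambda>\<omega>. (\<xi> \<omega> * incr a b \<omega>) * (\<eta> \<omega> * incr c d \<omega>)) =
      expectation (\<lambda>\<omega>. (\<xi> \<omega> * incr a c \<omega> * \<eta> \<omega>) * incr c d \<omega> + (\<xi> \<omega> * \<eta> \<omega>) * (incr c e \<omega>)\<^sup>2
        + ((\<xi> \<omega> * \<eta> \<omega>) * incr c e \<omega>) * incr e b \<omega> + ((\<xi> \<omega> * \<eta> \<omega>) * incr c e \<omega>) * incr e d \<omega>)"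
      by simp
    also have "\<dots> = expectation (\<lambda>\<omega>. \<xi> \<omega> * \<eta> \<omega>) * (e - c)"
      using past[OF ac order_refl] sq cr[OF e(2)] cr[OF e(3)]
      by (simp only: Bochner_Integration.integral_add Bochner_Integration.integrable_add)
    finally show ?thesis unfolding m .
  qed
qed

lemma ito_isometry_pair:
  assumes ab: "0 \<le> a" "a \<le> b" and cd: "0 \<le> c" "c \<le> d"
    and \<xi>: "\<xi> \<in> borel_measurable (F a)" "integrable M (\<lambda>\<omega>. (\<xi> \<omega>)\<^sup>2)"
    and \<eta>: "\<eta> \<in> borel_measurable (F c)" "integrable M (\<lambda>\<omega>. (\<eta> \<omega>)\<^sup>2)"
  shows "expectation (\<lambda>\<omega>. (\<xi> \<omega> * incr a b \<omega>) * (\<eta> \<omega> * incr c d \<omega>))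
    = expectation (\<lambda>\<omega>. \<xi> \<omega> * \<eta> \<omega>) * max 0 (min b d - max a c)"
proof (cases "a \<le> c")
  case False
  then have ca: "c \<le> a" by simp
  have 1: "(\<lambda>\<omega>. (\<xi> \<omega> * incr a b \<omega>) * (\<eta> \<omega> * incr c d \<omega>)) = (\<lambda>\<omega>. (\<eta> \<omega> * incr c d \<omega>) * (\<xi> \<omega> * incr a b \<omega>))"
    "(\<lambda>\<omega>. \<xi> \<omega> * \<eta> \<omega>) = (\<lambda>\<omega>. \<eta> \<omega> * \<xi> \<omega>)"
    by (rule ext, rule mult.commute)+
  show ?thesis unfolding 1 min.commute[of b] max.commute[of a]
    by (rule ito_isometry_pair_ordered[OF cd ab ca \<eta> \<xi>])
qed (rule ito_isometry_pair_ordered[OF ab cd _ \<xi> \<eta>])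

text \<open>The intervals may overlap in any way, so two sums over unrelated partitions can be
  compared without a common refinement.\<close>

lemma ito_isometry_sum:
  fixes \<xi> :: "'i \<Rightarrow> 'a \<Rightarrow> real"
  assumes A: "finite A" and ab: "\<And>i. i \<in> A \<Longrightarrow> 0 \<le> a i" "\<And>i. i \<in> A \<Longrightarrow> a i \<le> b i"
    and \<xi>: "\<And>i. i \<in> A \<Longrightarrow> \<xi> i \<in> borel_measurable (F (a i))" "\<And>i. i \<in> A \<Longrightarrow> integrable M (\<lambda>\<omega>. (\<xi> i \<omega>)\<^sup>2)"
  shows "integrable M (\<lambda>\<omega>. (\<Sum>i\<in>A. \<xi> i \<omega> * incr (a i) (b i) \<omega>)\<^sup>2)"
   "expectation (\<lambda>\<omega>. (\<Sum>i\<in>A. \<xi> i \<omega> * incr (a i) (b i) \<omega>)\<^sup>2) =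
    (\<Sum>i\<in>A. \<Sum>j\<in>A. expectation (\<lambda>\<omega>. \<xi> i \<omega> * \<xi> j \<omega>) * max 0 (min (b i) (b j) - max (a i) (a j)))"
proof -
  have m: "(\<lambda>\<omega>. \<xi> i \<omega> * incr (a i) (b i) \<omega>) \<in> borel_measurable M" if "i \<in> A" for i
    using borel_measurable_F_M[OF ab(1) \<xi>(1)] incr_M[OF ab] that by auto
  have i: "integrable M (\<lambda>\<omega>. (\<xi> i \<omega> * incr (a i) (b i) \<omega>) * (\<xi> j \<omega> * incr (a j) (b j) \<omega>))" if "i \<in> A" "j \<in> A" for i j
    using that by (intro integrable_square_mult m integrable_square_mult_incr ab \<xi>)
  show "integrable M (\<lambda>\<omega>. (\<Sum>i\<in>A. \<xi> i \<omega> * incr (a i) (b i) \<omega>)\<^sup>2)"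
    unfolding power2_eq_square sum_product by (intro Bochner_Integration.integrable_sum i)
  have "expectation (\<lambda>\<omega>. (\<Sum>i\<in>A. \<xi> i \<omega> * incr (a i) (b i) \<omega>)\<^sup>2) =
     (\<Sum>i\<in>A. \<Sum>j\<in>A. expectation (\<lambda>\<omega>. (\<xi> i \<omega> * incr (a i) (b i) \<omega>) * (\<xi> j \<omega> * incr (a j) (b j) \<omega>)))"
    unfolding power2_eq_square sum_product
    by (subst Bochner_Integration.integral_sum, intro Bochner_Integration.integrable_sum i, assumption+,
        intro sum.cong refl Bochner_Integration.integral_sum i)
  also have "\<dots> = (\<Sum>i\<in>A. \<Sum>j\<in>A. expectation (\<lambda>\<omega>. \<xi> i \<omega> * \<xi> j \<omega>) * max 0 (min (b i) (b j) - max (a i) (a j)))"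
    by (intro sum.cong refl ito_isometry_pair ab \<xi>)
  finally show "expectation (\<lambda>\<omega>. (\<Sum>i\<in>A. \<xi> i \<omega> * incr (a i) (b i) \<omega>)\<^sup>2) =
    (\<Sum>i\<in>A. \<Sum>j\<in>A. expectation (\<lambda>\<omega>. \<xi> i \<omega> * \<xi> j \<omega>) * max 0 (min (b i) (b j) - max (a i) (a j)))" .
qed

abbreviation time_product :: "real \<Rightarrow> (real \<times> 'a) measure" where
  "time_product T \<equiv> restrict_space lborel {0..T} \<Otimes>\<^sub>M M"

lemma indicator_time_measurable [measurable]:
  "indicator {a<..b} \<in> borel_measurable (restrict_space lborel {0..T::real})"
  by (rule measurable_restrict_space1) simp

text \<open>Fubini's theorem reduces the right-hand side to the same double sum as
  \<open>ito_isometry_sum\<close>, since the product of two indicators integrates to the length of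
  the overlap. Nonnegative integrals are the form in which the definition of the Ito integral
  measures distances.\<close>

lemma ito_isometry_nn:
  fixes \<xi> :: "'i \<Rightarrow> 'a \<Rightarrow> real"
  assumes A: "finite A" and ab: "\<And>i. i \<in> A \<Longrightarrow> 0 \<le> a i" "\<And>i. i \<in> A \<Longrightarrow> a i \<le> b i" "\<And>i. i \<in> A \<Longrightarrow> b i \<le> T"
    and \<xi>: "\<And>i. i \<in> A \<Longrightarrow> \<xi> i \<in> borel_measurable (F (a i))" "\<And>i. i \<in> A \<Longrightarrow> integrable M (\<lambda>\<omega>. (\<xi> i \<omega>)\<^sup>2)"
  shows "(\<integral>\<^sup>+\<omega>. ennreal ((\<Sum>i\<in>A. \<xi> i \<omega> * incr (a i) (b i) \<omega>)\<^sup>2) \<partial>M) =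
     (\<integral>\<^sup>+z. ennreal ((\<Sum>i\<in>A. \<xi> i (snd z) * indicator {a i<..b i} (fst z))\<^sup>2) \<partial>time_product T)"
proof -
  have m[measurable]: "\<xi> i \<in> borel_measurable M" if "i \<in> A" for i
    using borel_measurable_F_M[OF ab(1) \<xi>(1)] that by auto
  have i: "integrable M (\<lambda>\<omega>. \<xi> i \<omega> * \<xi> j \<omega>)" if "i \<in> A" "j \<in> A" for i j
    using that by (intro integrable_square_mult m \<xi>)
  define \<phi> where "\<phi> = (\<lambda>t::real. \<Sum>i\<in>A. \<Sum>j\<in>A. expectation (\<lambda>\<omega>. \<xi> i \<omega> * \<xi> j \<omega>) * indicator ({a i<..b i} \<inter> {a j<..b j}) t)"
  have inner: "integrable M (\<lambda>\<omega>. (\<Sum>i\<in>A. \<xi> i \<omega> * indicator {a i<..b i} t)\<^sup>2)"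
    "expectation (\<lambda>\<omega>. (\<Sum>i\<in>A. \<xi> i \<omega> * indicator {a i<..b i} t)\<^sup>2) = \<phi> t" for t
  proof -
    have e: "(\<Sum>i\<in>A. \<xi> i \<omega> * indicator {a i<..b i} t)\<^sup>2 = (\<Sum>i\<in>A. \<Sum>j\<in>A. (\<xi> i \<omega> * \<xi> j \<omega>) * indicator ({a i<..b i} \<inter> {a j<..b j}) t)" for \<omega>
      unfolding power2_eq_square sum_product indicator_inter_arith by (simp add: mult_ac)
    show "integrable M (\<lambda>\<omega>. (\<Sum>i\<in>A. \<xi> i \<omega> * indicator {a i<..b i} t)\<^sup>2)"
      unfolding e by (intro Bochner_Integration.integrable_sum integrable_mult_left i)
    show "expectation (\<lambda>\<omega>. (\<Sum>i\<in>A. \<xi> i \<omega> * indicator {a i<..b i} t)\<^sup>2) = \<phi> t"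
      unfolding e \<phi>_def
      by (subst Bochner_Integration.integral_sum, intro Bochner_Integration.integrable_sum integrable_mult_left i, assumption+,
        intro sum.cong refl, subst Bochner_Integration.integral_sum, intro integrable_mult_left i, assumption+, simp)
  qed
  have \<phi>0: "0 \<le> \<phi> t" for t unfolding inner(2)[symmetric] by (rule Bochner_Integration.integral_nonneg) simp
  have iI: "integrable lborel (\<lambda>t. indicator ({a i<..b i} \<inter> {a j<..b j}) t :: real)"
    "(\<integral>t. indicator ({a i<..b i} \<inter> {a j<..b j}) t \<partial>lborel) = max 0 (min (b i) (b j) - max (a i) (a j))" for i j
  proof -
    have e: "{a i<..b i} \<inter> {a j<..b j} = {max (a i) (a j)<..min (b i) (b j)}" by auto
    show "integrable lborel (\<lambda>t. indicator ({a i<..b i} \<inter> {a j<..b j}) t :: real)" unfolding e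
      by (cases "max (a i) (a j) \<le> min (b i) (b j)") (auto intro!: integrable_real_indicator)
    show "(\<integral>t. indicator ({a i<..b i} \<inter> {a j<..b j}) t \<partial>lborel) = max 0 (min (b i) (b j) - max (a i) (a j))"
      unfolding e by (cases "max (a i) (a j) \<le> min (b i) (b j)") auto
  qed
  have \<phi>i: "integrable lborel \<phi>" unfolding \<phi>_def
    by (intro Bochner_Integration.integrable_sum integrable_mult_right iI)
  have \<phi>I: "integral\<^sup>L lborel \<phi> = (\<Sum>i\<in>A. \<Sum>j\<in>A. expectation (\<lambda>\<omega>. \<xi> i \<omega> * \<xi> j \<omega>) * max 0 (min (b i) (b j) - max (a i) (a j)))"
    unfolding \<phi>_def
    by (subst Bochner_Integration.integral_sum, intro Bochner_Integration.integrable_sum integrable_mult_right iI,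
        intro sum.cong refl, subst Bochner_Integration.integral_sum, intro integrable_mult_right iI, simp only: integral_mult_right_zero iI(2))
  have supp: "\<phi> t * indicator {0..T} t = \<phi> t" for t
  proof (cases "t \<in> {0..T}")
    case False
    then have "\<phi> t = 0" unfolding \<phi>_def using ab by (intro sum.neutral ballI) (fastforce simp: indicator_def)
    then show ?thesis by simp
  qed simp
  have "(\<integral>\<^sup>+z. ennreal ((\<Sum>i\<in>A. \<xi> i (snd z) * indicator {a i<..b i} (fst z))\<^sup>2) \<partial>time_product T)
     = (\<integral>\<^sup>+t. \<integral>\<^sup>+\<omega>. ennreal ((\<Sum>i\<in>A. \<xi> i \<omega> * indicator {a i<..b i} t)\<^sup>2) \<partial>M \<partial>restrict_space lborel {0..T})"
    by (subst nn_integral_fst[symmetric]) (auto intro!: borel_measurable_sum)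
  also have "\<dots> = (\<integral>\<^sup>+t. ennreal (\<phi> t) \<partial>restrict_space lborel {0..T})"
    by (subst nn_integral_eq_integral[OF inner(1)]) (auto simp: inner(2))
  also have "\<dots> = (\<integral>\<^sup>+t. ennreal (\<phi> t) * indicator {0..T} t \<partial>lborel)"
    by (rule nn_integral_restrict_space) simp
  also have "\<dots> = (\<integral>\<^sup>+t. ennreal (\<phi> t) \<partial>lborel)"
    by (rule nn_integral_cong) (metis supp indicator_simps mult_zero_right mult_1_right ennreal_0)
  also have "\<dots> = ennreal (integral\<^sup>L lborel \<phi>)"
    by (rule nn_integral_eq_integral[OF \<phi>i]) (simp add: \<phi>0)
  also have "\<dots> = ennreal (expectation (\<lambda>\<omega>. (\<Sum>i\<in>A. \<xi> i \<omega> * incr (a i) (b i) \<omega>)\<^sup>2))"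
    unfolding \<phi>I by (subst ito_isometry_sum(2)[OF A ab(1,2) \<xi>]) auto
  also have "\<dots> = (\<integral>\<^sup>+\<omega>. ennreal ((\<Sum>i\<in>A. \<xi> i \<omega> * incr (a i) (b i) \<omega>)\<^sup>2) \<partial>M)"
    by (rule nn_integral_eq_integral[symmetric]) (use ito_isometry_sum(1)[OF A ab(1,2) \<xi>] in auto)
  finally show ?thesis by simp
qed

end

section \<open>Uniqueness of the Ito integral\<close>

lemma nn_integral_square_triangle:
  fixes f g h :: "'b \<Rightarrow> real"
  assumes [measurable]: "f \<in> borel_measurable N" "g \<in> borel_measurable N" "h \<in> borel_measurable N"
  shows "(\<integral>\<^sup>+x. ennreal ((f x - h x)\<^sup>2) \<partial>N) \<le> 2 * (\<integral>\<^sup>+x. ennreal ((f x - g x)\<^sup>2) \<partial>N) + 2 * (\<integral>\<^sup>+x. ennreal ((g x - h x)\<^sup>2) \<partial>N)"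
proof -
  have "(\<integral>\<^sup>+x. ennreal ((f x - h x)\<^sup>2) \<partial>N) \<le> (\<integral>\<^sup>+x. 2 * ennreal ((f x - g x)\<^sup>2) + 2 * ennreal ((g x - h x)\<^sup>2) \<partial>N)"
  proof (rule nn_integral_mono)
    fix x
    have "(f x - h x)\<^sup>2 \<le> 2 * (f x - g x)\<^sup>2 + 2 * (g x - h x)\<^sup>2"
      using sum_squares_bound[of "f x - g x" "g x - h x"] by (simp add: power2_eq_square algebra_simps)
    then have "ennreal ((f x - h x)\<^sup>2) \<le> ennreal (2 * (f x - g x)\<^sup>2 + 2 * (g x - h x)\<^sup>2)" by (rule ennreal_leI)
    then show "ennreal ((f x - h x)\<^sup>2) \<le> 2 * ennreal ((f x - g x)\<^sup>2) + 2 * ennreal ((g x - h x)\<^sup>2)"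
      by (simp add: ennreal_mult)
  qed
  also have "\<dots> = 2 * (\<integral>\<^sup>+x. ennreal ((f x - g x)\<^sup>2) \<partial>N) + 2 * (\<integral>\<^sup>+x. ennreal ((g x - h x)\<^sup>2) \<partial>N)"
    by (subst nn_integral_add) (simp_all add: nn_integral_cmult)
  finally show ?thesis .
qed

lemma elementary_partition:
  assumes e: "elementary M F T n \<tau> \<xi>"
  shows "i < n \<Longrightarrow> 0 \<le> \<tau> i" "i < n \<Longrightarrow> \<tau> i \<le> \<tau> (Suc i)" "i < n \<Longrightarrow> \<tau> (Suc i) \<le> T"
    "i < n \<Longrightarrow> \<xi> i \<in> borel_measurable (F (\<tau> i))" "i < n \<Longrightarrow> integrable M (\<lambda>\<omega>. (\<xi> i \<omega>)\<^sup>2)"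
proof -
  have 0: "\<tau> 0 = 0" "\<tau> n = T" and st: "\<And>i. i < n \<Longrightarrow> \<tau> i \<le> \<tau> (Suc i)"
    using e by (auto simp: elementary_def)
  have mono: "\<tau> i \<le> \<tau> j" if "i \<le> j" "j \<le> n" for i j
    using that by (induction j rule: dec_induct) (auto intro: order_trans[OF _ st])
  show "i < n \<Longrightarrow> 0 \<le> \<tau> i" using mono[of 0 i] 0 by simp
  show "i < n \<Longrightarrow> \<tau> (Suc i) \<le> T" using mono[of "Suc i" n] 0 by simp
  show "i < n \<Longrightarrow> \<tau> i \<le> \<tau> (Suc i)" by (rule st)
  show "i < n \<Longrightarrow> \<xi> i \<in> borel_measurable (F (\<tau> i))" "i < n \<Longrightarrow> integrable M (\<lambda>\<omega>. (\<xi> i \<omega>)\<^sup>2)"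
    using e by (auto simp: elementary_def)
qed

context adapted_brownian_motion begin

lemma elementary_process_measurable:
  assumes e: "elementary M F T n \<tau> \<xi>"
  shows "(\<lambda>z. elementary_process n \<tau> \<xi> (fst z) (snd z)) \<in> borel_measurable (time_product T)"
proof -
  have [measurable]: "\<xi> i \<in> borel_measurable M" if "i < n" for i
    using that elementary_partition[OF e] borel_measurable_F_M by blast
  show ?thesis unfolding elementary_process_def by (intro borel_measurable_sum) auto
qed

lemma elementary_integral_incr:
  "elementary_integral n \<tau> \<xi> w \<omega> = (\<Sum>i<n. \<xi> i \<omega> * incr (\<tau> i) (\<tau> (Suc i)) \<omega>)"
  by (simp add: elementary_integral_def incr_def)

lemma elementary_integral_measurable:
  assumes e: "elementary M F T n \<tau> \<xi>"
  shows "elementary_integral n \<tau> \<xi> w \<in> borel_measurable M"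
proof -
  have [measurable]: "\<xi> i \<in> borel_measurable M" "incr (\<tau> i) (\<tau> (Suc i)) \<in> borel_measurable M" if "i < n" for i
    using that elementary_partition[OF e] borel_measurable_F_M incr_M by blast+
  show ?thesis unfolding elementary_integral_incr[abs_def] by (intro borel_measurable_sum) auto
qed

text \<open>The difference is a single sum over the disjoint union of the two index sets, with the
  second integrand negated.\<close>

lemma elementary_isometry_diff:
  assumes e: "elementary M F T n \<tau> \<xi>" and e': "elementary M F T n' \<tau>' \<xi>'"
  shows "(\<integral>\<^sup>+\<omega>. ennreal ((elementary_integral n \<tau> \<xi> w \<omega> - elementary_integral n' \<tau>' \<xi>' w \<omega>)\<^sup>2) \<partial>M)
    = (\<integral>\<^sup>+z. ennreal ((elementary_process n \<tau> \<xi> (fst z) (snd z) - elementary_process n' \<tau>' \<xi>' (fst z) (snd z))\<^sup>2) \<partial>time_product T)"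
proof -
  note p = elementary_partition[OF e] and p' = elementary_partition[OF e']
  let ?A = "{..<n} <+> {..<n'}"
  let ?x = "case_sum \<xi> (\<lambda>i \<omega>. - \<xi>' i \<omega>)"
  let ?a = "case_sum \<tau> \<tau>'" and ?b = "case_sum (\<lambda>i. \<tau> (Suc i)) (\<lambda>i. \<tau>' (Suc i))"
  have 1: "elementary_integral n \<tau> \<xi> w \<omega> - elementary_integral n' \<tau>' \<xi>' w \<omega> = (\<Sum>i\<in>?A. ?x i \<omega> * incr (?a i) (?b i) \<omega>)" for \<omega>
    by (simp add: elementary_integral_incr sum.Plus comp_def sum_negf)
  have 2: "elementary_process n \<tau> \<xi> t \<omega> - elementary_process n' \<tau>' \<xi>' t \<omega> = (\<Sum>i\<in>?A. ?x i \<omega> * indicator {?a i<..?b i} t)" for t \<omega>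
    unfolding elementary_process_def sum.Plus[OF finite_lessThan finite_lessThan] comp_def sum.case
    by (simp only: mult_minus_left sum_negf)
  show ?thesis unfolding 1 2
    by (rule ito_isometry_nn) (use p p' in \<open>auto intro: borel_measurable_uminus\<close>)
qed

text \<open>By the isometry the integrals of two approximating sequences are as close as the
  sequences themselves, which both approach \<open>X\<close>. Hence the choice in the definition
  of the Ito integral only selects a version.\<close>

lemma has_ito_integral_unique:
  assumes I: "has_ito_integral M F w T X I" and J: "has_ito_integral M F w T X J"
  shows "AE \<omega> in M. I \<omega> = J \<omega>"
proof -
  let ?TM = "completion (time_product T)"
  have cp: "(\<integral>\<^sup>+(t, \<omega>). f t \<omega> \<partial>?TM) = (\<integral>\<^sup>+z. f (fst z) (snd z) \<partial>?TM)" for f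
    by (simp add: case_prod_beta')
  obtain n \<tau> \<xi> where e: "\<And>m. elementary M F T (n m) (\<tau> m) (\<xi> m)"
    and 1: "(\<lambda>m. \<integral>\<^sup>+z. ennreal ((elementary_process (n m) (\<tau> m) (\<xi> m) (fst z) (snd z) - X (fst z) (snd z))\<^sup>2) \<partial>?TM) \<longlonglongrightarrow> 0"
    and 2: "(\<lambda>m. \<integral>\<^sup>+\<omega>. ennreal ((elementary_integral (n m) (\<tau> m) (\<xi> m) w \<omega> - I \<omega>)\<^sup>2) \<partial>M) \<longlonglongrightarrow> 0"
    using I unfolding has_ito_integral_def Let_def cp by blast
  obtain n' \<tau>' \<xi>' where e': "\<And>m. elementary M F T (n' m) (\<tau>' m) (\<xi>' m)"
    and q1: "(\<lambda>m. \<integral>\<^sup>+z. ennreal ((elementary_process (n' m) (\<tau>' m) (\<xi>' m) (fst z) (snd z) - X (fst z) (snd z))\<^sup>2) \<partial>?TM) \<longlonglongrightarrow> 0"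
    and q2: "(\<lambda>m. \<integral>\<^sup>+\<omega>. ennreal ((elementary_integral (n' m) (\<tau>' m) (\<xi>' m) w \<omega> - J \<omega>)\<^sup>2) \<partial>M) \<longlonglongrightarrow> 0"
    using J unfolding has_ito_integral_def Let_def cp by blast
  have mX: "(\<lambda>z. X (fst z) (snd z)) \<in> borel_measurable ?TM" and mI: "I \<in> borel_measurable M" and mJ: "J \<in> borel_measurable M"
    using I J by (auto simp: has_ito_integral_def Let_def case_prod_beta')
  define a where "a = (\<lambda>m. \<integral>\<^sup>+\<omega>. ennreal ((elementary_integral (n m) (\<tau> m) (\<xi> m) w \<omega> - I \<omega>)\<^sup>2) \<partial>M)"
  define a' where "a' = (\<lambda>m. \<integral>\<^sup>+\<omega>. ennreal ((elementary_integral (n' m) (\<tau>' m) (\<xi>' m) w \<omega> - J \<omega>)\<^sup>2) \<partial>M)"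
  define b where "b = (\<lambda>m. \<integral>\<^sup>+z. ennreal ((elementary_process (n m) (\<tau> m) (\<xi> m) (fst z) (snd z) - X (fst z) (snd z))\<^sup>2) \<partial>?TM)"
  define b' where "b' = (\<lambda>m. \<integral>\<^sup>+z. ennreal ((elementary_process (n' m) (\<tau>' m) (\<xi>' m) (fst z) (snd z) - X (fst z) (snd z))\<^sup>2) \<partial>?TM)"
  have le: "(\<integral>\<^sup>+\<omega>. ennreal ((I \<omega> - J \<omega>)\<^sup>2) \<partial>M) \<le> 2 * a m + 2 * (2 * (2 * b m + 2 * b' m) + 2 * a' m)" for m
  proof -
    let ?S = "elementary_integral (n m) (\<tau> m) (\<xi> m) w" and ?S' = "elementary_integral (n' m) (\<tau>' m) (\<xi>' m) w"
    let ?X = "\<lambda>z. elementary_process (n m) (\<tau> m) (\<xi> m) (fst z) (snd z)" and ?X' = "\<lambda>z. elementary_process (n' m) (\<tau>' m) (\<xi>' m) (fst z) (snd z)"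
    note mS = elementary_integral_measurable[OF e] elementary_integral_measurable[OF e']
    note mP = measurable_completion[OF elementary_process_measurable[OF e]] measurable_completion[OF elementary_process_measurable[OF e']]
    have "(\<integral>\<^sup>+\<omega>. ennreal ((?S \<omega> - ?S' \<omega>)\<^sup>2) \<partial>M) = (\<integral>\<^sup>+z. ennreal ((?X z - ?X' z)\<^sup>2) \<partial>?TM)"
      unfolding elementary_isometry_diff[OF e e'] nn_integral_completion ..
    also have "\<dots> \<le> 2 * b m + 2 * (\<integral>\<^sup>+z. ennreal ((X (fst z) (snd z) - ?X' z)\<^sup>2) \<partial>?TM)"
      unfolding b_def by (rule nn_integral_square_triangle[OF mP(1) mX mP(2)])
    also have "(\<integral>\<^sup>+z. ennreal ((X (fst z) (snd z) - ?X' z)\<^sup>2) \<partial>?TM) = b' m"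
      unfolding b'_def by (simp only: power2_commute)
    finally have SS: "(\<integral>\<^sup>+\<omega>. ennreal ((?S \<omega> - ?S' \<omega>)\<^sup>2) \<partial>M) \<le> 2 * b m + 2 * b' m" .
    have "(\<integral>\<^sup>+\<omega>. ennreal ((I \<omega> - J \<omega>)\<^sup>2) \<partial>M) \<le> 2 * (\<integral>\<^sup>+\<omega>. ennreal ((I \<omega> - ?S \<omega>)\<^sup>2) \<partial>M) + 2 * (\<integral>\<^sup>+\<omega>. ennreal ((?S \<omega> - J \<omega>)\<^sup>2) \<partial>M)"
      by (rule nn_integral_square_triangle[OF mI mS(1) mJ])
    also have "(\<integral>\<^sup>+\<omega>. ennreal ((I \<omega> - ?S \<omega>)\<^sup>2) \<partial>M) = a m"
      unfolding a_def by (simp only: power2_commute)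
    also have "(\<integral>\<^sup>+\<omega>. ennreal ((?S \<omega> - J \<omega>)\<^sup>2) \<partial>M) \<le> 2 * (\<integral>\<^sup>+\<omega>. ennreal ((?S \<omega> - ?S' \<omega>)\<^sup>2) \<partial>M) + 2 * a' m"
      unfolding a'_def by (rule nn_integral_square_triangle[OF mS(1) mS(2) mJ])
    also have "2 * (\<integral>\<^sup>+\<omega>. ennreal ((?S \<omega> - ?S' \<omega>)\<^sup>2) \<partial>M) + 2 * a' m \<le> 2 * (2 * b m + 2 * b' m) + 2 * a' m"
      by (intro add_right_mono mult_left_mono SS) simp
    finally show ?thesis by (simp add: add_left_mono mult_left_mono)
  qed
  have "(\<lambda>m. 2 * a m + 2 * (2 * (2 * b m + 2 * b' m) + 2 * a' m)) \<longlonglongrightarrow> 2 * 0 + 2 * (2 * (2 * 0 + 2 * 0) + 2 * 0)"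
    using 1 2 q1 q2 unfolding a_def a'_def b_def b'_def
    by (intro tendsto_add ennreal_tendsto_cmult) auto
  then have "(\<integral>\<^sup>+\<omega>. ennreal ((I \<omega> - J \<omega>)\<^sup>2) \<partial>M) \<le> 0"
    using le by (intro LIMSEQ_le_const[where X = "\<lambda>m. 2 * a m + 2 * (2 * (2 * b m + 2 * b' m) + 2 * a' m)"]) auto
  then have "AE \<omega> in M. ennreal ((I \<omega> - J \<omega>)\<^sup>2) = 0"
    using mI mJ by (subst nn_integral_0_iff_AE[symmetric]) auto
  then show ?thesis by eventually_elim auto
qed

section \<open>Moments of stochastic sums\<close>

text \<open>Expand \<open>(S + \<xi> D)\<^sup>4\<close> for the new increment \<open>D\<close>.
  Odd powers of \<open>D\<close> drop out, and the remaining ones are at most multiples of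
  \<open>E S\<^sup>4 + K\<close>, which gives a discrete Gronwall inequality for this quantity.
  For a partition of \<open>[0, T]\<close> into \<open>n\<close> cells of length \<open>h = T /
  n\<close> the exponent stays bounded under refinement.\<close>

lemma ito_sum_fourth_moment:
  fixes \<tau> :: "nat \<Rightarrow> real" and \<xi> :: "nat \<Rightarrow> 'a \<Rightarrow> real"
  assumes \<tau>: "0 \<le> \<tau> 0" "\<And>i. i < n \<Longrightarrow> \<tau> i \<le> \<tau> (Suc i)" "\<And>i. i < n \<Longrightarrow> \<tau> (Suc i) - \<tau> i \<le> h"
    and \<xi>: "\<And>i. i < n \<Longrightarrow> \<xi> i \<in> borel_measurable (F (\<tau> i))" "\<And>i. i < n \<Longrightarrow> integrable M (\<lambda>\<omega>. \<xi> i \<omega> ^ 4)"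
      "\<And>i. i < n \<Longrightarrow> expectation (\<lambda>\<omega>. \<xi> i \<omega> ^ 4) \<le> K"
    and h: "0 \<le> h" and K: "0 \<le> K"
  shows "integrable M (\<lambda>\<omega>. (\<Sum>i<n. \<xi> i \<omega> * incr (\<tau> i) (\<tau> (Suc i)) \<omega>) ^ 4)
    \<and> (\<lambda>\<omega>. \<Sum>i<n. \<xi> i \<omega> * incr (\<tau> i) (\<tau> (Suc i)) \<omega>) \<in> borel_measurable (F (\<tau> n))
    \<and> 0 \<le> \<tau> n \<and> expectation (\<lambda>\<omega>. \<Sum>i<n. \<xi> i \<omega> * incr (\<tau> i) (\<tau> (Suc i)) \<omega>) = 0
    \<and> expectation (\<lambda>\<omega>. (\<Sum>i<n. \<xi> i \<omega> * incr (\<tau> i) (\<tau> (Suc i)) \<omega>) ^ 4) + K \<le> K * exp ((3 * h + 3 * h\<^sup>2) * n)"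
  using \<tau>(2,3) \<xi>
proof (induction n)
  case 0
  then show ?case using \<tau>(1) by simp
next
  case (Suc n)
  define S where "S = (\<lambda>\<omega>. \<Sum>i<n. \<xi> i \<omega> * incr (\<tau> i) (\<tau> (Suc i)) \<omega>)"
  define D where "D = incr (\<tau> n) (\<tau> (Suc n))"
  have IH: "integrable M (\<lambda>\<omega>. S \<omega> ^ 4)" "S \<in> borel_measurable (F (\<tau> n))" "0 \<le> \<tau> n" "expectation S = 0"
      "expectation (\<lambda>\<omega>. S \<omega> ^ 4) + K \<le> K * exp ((3 * h + 3 * h\<^sup>2) * n)"
    using Suc.IH Suc.prems unfolding S_def by auto
  have t: "0 \<le> \<tau> n" "\<tau> n \<le> \<tau> (Suc n)" "\<tau> (Suc n) - \<tau> n \<le> h" using IH Suc.prems by auto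
  define d where "d = \<tau> (Suc n) - \<tau> n"
  have d: "0 \<le> d" "d \<le> h" using t by (auto simp: d_def)
  note x = Suc.prems(3-5)[of n, simplified]
  have xM[measurable]: "\<xi> n \<in> borel_measurable M" and SM[measurable]: "S \<in> borel_measurable M"
    using borel_measurable_F_M[OF t(1)] x(1) IH(2) by auto
  have xF[measurable]: "\<xi> n \<in> borel_measurable (F (\<tau> n))" "S \<in> borel_measurable (F (\<tau> n))" by fact+
  note mx = integrable_mixed_fourth[OF SM xM IH(1) x(2)]
  note moms = incr_moments[OF t(1,2)]
  have P: "integrable M (\<lambda>\<omega>. Z \<omega> * D \<omega> ^ k)" "expectation (\<lambda>\<omega>. Z \<omega> * D \<omega> ^ k) = expectation Z * expectation (\<lambda>\<omega>. D \<omega> ^ k)"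
    if "Z \<in> borel_measurable (F (\<tau> n))" "integrable M Z" for Z k
    using incr_indep_power[OF t(1,2) that] unfolding D_def by auto
  have D: "expectation D = 0" "expectation (\<lambda>\<omega>. (D \<omega>)\<^sup>2) = d" "expectation (\<lambda>\<omega>. D \<omega> ^ 3) = 0" "expectation (\<lambda>\<omega>. D \<omega> ^ 4) = 3 * d\<^sup>2"
    unfolding D_def d_def using moms by auto
  have p1: "integrable M (\<lambda>\<omega>. (S \<omega> ^ 3 * \<xi> n \<omega>) * D \<omega> ^ 1)" "expectation (\<lambda>\<omega>. (S \<omega> ^ 3 * \<xi> n \<omega>) * D \<omega> ^ 1) = 0"
    by (rule P, measurable, rule mx) (subst P, measurable, rule mx, simp add: D)
  have p2: "integrable M (\<lambda>\<omega>. ((S \<omega>)\<^sup>2 * (\<xi> n \<omega>)\<^sup>2) * (D \<omega>)\<^sup>2)"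
    "expectation (\<lambda>\<omega>. ((S \<omega>)\<^sup>2 * (\<xi> n \<omega>)\<^sup>2) * (D \<omega>)\<^sup>2) = expectation (\<lambda>\<omega>. (S \<omega>)\<^sup>2 * (\<xi> n \<omega>)\<^sup>2) * d"
    by (rule P, measurable, rule mx) (subst P, measurable, rule mx, simp add: D)
  have p3: "integrable M (\<lambda>\<omega>. (S \<omega> * \<xi> n \<omega> ^ 3) * D \<omega> ^ 3)" "expectation (\<lambda>\<omega>. (S \<omega> * \<xi> n \<omega> ^ 3) * D \<omega> ^ 3) = 0"
    by (rule P, measurable, rule mx) (subst P, measurable, rule mx, simp add: D)
  have p4: "integrable M (\<lambda>\<omega>. \<xi> n \<omega> ^ 4 * D \<omega> ^ 4)" "expectation (\<lambda>\<omega>. \<xi> n \<omega> ^ 4 * D \<omega> ^ 4) = expectation (\<lambda>\<omega>. \<xi> n \<omega> ^ 4) * (3 * d\<^sup>2)"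
    by (rule P, measurable, rule x) (subst P, measurable, rule x, simp add: D)
  have e: "(S \<omega> + \<xi> n \<omega> * D \<omega>) ^ 4 = S \<omega> ^ 4 + 4 * ((S \<omega> ^ 3 * \<xi> n \<omega>) * D \<omega> ^ 1) + 6 * (((S \<omega>)\<^sup>2 * (\<xi> n \<omega>)\<^sup>2) * (D \<omega>)\<^sup>2)
      + 4 * ((S \<omega> * \<xi> n \<omega> ^ 3) * D \<omega> ^ 3) + \<xi> n \<omega> ^ 4 * D \<omega> ^ 4" for \<omega>
    by (simp add: power2_eq_square power3_eq_cube power4_eq_xxxx algebra_simps)
  have 1: "integrable M (\<lambda>\<omega>. (S \<omega> + \<xi> n \<omega> * D \<omega>) ^ 4)" unfolding e
    by (intro Bochner_Integration.integrable_add integrable_mult_right IH(1) p1 p2 p3 p4)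
  have "expectation (\<lambda>\<omega>. (S \<omega> + \<xi> n \<omega> * D \<omega>) ^ 4) = expectation (\<lambda>\<omega>. S \<omega> ^ 4) + 6 * (expectation (\<lambda>\<omega>. (S \<omega>)\<^sup>2 * (\<xi> n \<omega>)\<^sup>2) * d)
     + expectation (\<lambda>\<omega>. \<xi> n \<omega> ^ 4) * (3 * d\<^sup>2)" (is "?l = ?A + 6 * (?B * d) + ?C * (3 * d\<^sup>2)")
    unfolding e
    by (simp only: Bochner_Integration.integral_add Bochner_Integration.integrable_add integrable_mult_right integral_mult_right_zero
       IH(1) p1 p2 p3 p4 mult_zero_right add_0_right)
  moreover have "?B \<le> (?A + K) / 2"
  proof -
    have "?B \<le> expectation (\<lambda>\<omega>. (S \<omega> ^ 4 + \<xi> n \<omega> ^ 4) / 2)"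
    proof (rule integral_mono[OF mx(2)])
      show "integrable M (\<lambda>\<omega>. (S \<omega> ^ 4 + \<xi> n \<omega> ^ 4) / 2)" using IH(1) x(2) by simp
      show "(S \<omega>)\<^sup>2 * (\<xi> n \<omega>)\<^sup>2 \<le> (S \<omega> ^ 4 + \<xi> n \<omega> ^ 4) / 2" for \<omega>
        using sum_squares_bound[of "(S \<omega>)\<^sup>2" "(\<xi> n \<omega>)\<^sup>2"] by simp
    qed
    also have "\<dots> = (?A + ?C) / 2" using IH(1) x(2) by simp
    finally show ?thesis using x(3) by simp
  qed
  then have "6 * (?B * d) \<le> 6 * ((?A + K) / 2 * d)" using d by (intro mult_left_mono mult_right_mono) auto
  moreover have "?C * (3 * d\<^sup>2) \<le> (?A + K) * (3 * d\<^sup>2)"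
    using x(3) by (intro mult_right_mono) (auto intro: order_trans[of _ K])
  ultimately have "?l + K \<le> (?A + K) * (1 + (3 * d + 3 * d\<^sup>2))" by (simp add: algebra_simps)
  also have "\<dots> \<le> (?A + K) * (1 + (3 * h + 3 * h\<^sup>2))"
    using d K by (intro mult_left_mono add_left_mono add_mono power_mono) auto
  also have "\<dots> \<le> (?A + K) * exp (3 * h + 3 * h\<^sup>2)"
    using K by (intro mult_left_mono exp_ge_add_one_self) auto
  also have "\<dots> \<le> (K * exp ((3 * h + 3 * h\<^sup>2) * n)) * exp (3 * h + 3 * h\<^sup>2)"
    by (intro mult_right_mono IH(5)) simp
  also have "\<dots> = K * exp ((3 * h + 3 * h\<^sup>2) * Suc n)"
    by (simp add: exp_add[symmetric] distrib_left add.commute mult.assoc)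
  finally have 2: "?l + K \<le> K * exp ((3 * h + 3 * h\<^sup>2) * Suc n)" .
  have 3: "(\<lambda>\<omega>. S \<omega> + \<xi> n \<omega> * D \<omega>) \<in> borel_measurable (F (\<tau> (Suc n)))"
    unfolding D_def by (intro borel_measurable_add borel_measurable_times incr_F t borel_measurable_F_mono[OF t(1,2)] xF)
  have iS: "integrable M S" by (rule integrable_of_power4(1)[OF SM IH(1)])
  have ix: "integrable M (\<xi> n)" by (rule integrable_of_power4(1)[OF xM x(2)])
  have "integrable M (\<lambda>\<omega>. \<xi> n \<omega> * D \<omega> ^ 1)" "expectation (\<lambda>\<omega>. \<xi> n \<omega> * D \<omega> ^ 1) = 0"
    using P[OF xF(1) ix, of 1] D by simp_all
  then have 4: "expectation (\<lambda>\<omega>. S \<omega> + \<xi> n \<omega> * D \<omega>) = 0" using iS IH(4) by simp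
  show ?case unfolding sum.lessThan_Suc S_def[symmetric] D_def[symmetric]
    using 1 2 3 4 t by (simp add: S_def D_def)
qed

lemma wiener_sum_mgf:
  fixes \<tau> :: "nat \<Rightarrow> real" and c :: "nat \<Rightarrow> real"
  assumes \<tau>: "0 \<le> \<tau> 0" "\<And>i. i < n \<Longrightarrow> \<tau> i \<le> \<tau> (Suc i)"
  shows "integrable M (\<lambda>\<omega>. exp (\<Sum>i<n. c i * incr (\<tau> i) (\<tau> (Suc i)) \<omega>))
    \<and> (\<lambda>\<omega>. \<Sum>i<n. c i * incr (\<tau> i) (\<tau> (Suc i)) \<omega>) \<in> borel_measurable (F (\<tau> n)) \<and> 0 \<le> \<tau> n
    \<and> expectation (\<lambda>\<omega>. exp (\<Sum>i<n. c i * incr (\<tau> i) (\<tau> (Suc i)) \<omega>)) = exp ((\<Sum>i<n. (c i)\<^sup>2 * (\<tau> (Suc i) - \<tau> i)) / 2)"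
  using \<tau>(2)
proof (induction n)
  case 0
  then show ?case using \<tau>(1) by (simp add: prob_space)
next
  case (Suc n)
  define S where "S = (\<lambda>\<omega>. \<Sum>i<n. c i * incr (\<tau> i) (\<tau> (Suc i)) \<omega>)"
  have IH: "integrable M (\<lambda>\<omega>. exp (S \<omega>))" "S \<in> borel_measurable (F (\<tau> n))" "0 \<le> \<tau> n"
      "expectation (\<lambda>\<omega>. exp (S \<omega>)) = exp ((\<Sum>i<n. (c i)\<^sup>2 * (\<tau> (Suc i) - \<tau> i)) / 2)"
    using Suc unfolding S_def by auto
  have t: "0 \<le> \<tau> n" "\<tau> n \<le> \<tau> (Suc n)" using IH Suc.prems by auto
  have m: "(\<lambda>\<omega>. exp (S \<omega>)) \<in> borel_measurable (F (\<tau> n))" using IH(2) by measurable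
  note p = incr_indep[OF t m IH(1), of "\<lambda>x. exp (c n * x)", OF _ incr_moments(6)[OF t]]
  have "integrable M (\<lambda>\<omega>. exp (S \<omega> + c n * incr (\<tau> n) (\<tau> (Suc n)) \<omega>))"
    unfolding exp_add by (rule p) measurable
  moreover have "(\<lambda>\<omega>. S \<omega> + c n * incr (\<tau> n) (\<tau> (Suc n)) \<omega>) \<in> borel_measurable (F (\<tau> (Suc n)))"
    by (intro borel_measurable_add borel_measurable_times borel_measurable_const incr_F t borel_measurable_F_mono[OF t] IH(2))
  moreover have "expectation (\<lambda>\<omega>. exp (S \<omega> + c n * incr (\<tau> n) (\<tau> (Suc n)) \<omega>)) =
     exp ((\<Sum>i<n. (c i)\<^sup>2 * (\<tau> (Suc i) - \<tau> i)) / 2) * exp ((c n)\<^sup>2 * (\<tau> (Suc n) - \<tau> n) / 2)"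
    unfolding exp_add by (subst p(2)) (simp_all add: IH(4) incr_moments(7)[OF t])
  ultimately show ?case unfolding sum.lessThan_Suc
    using t by (simp add: S_def exp_add[symmetric] add_divide_distrib)
qed

end

section \<open>Ito integrals as limits of dyadic sums\<close>

text \<open>Cells are open on the left, like the intervals of elementary processes, so time
  \<open>0\<close> lies in no cell.\<close>

lemma dyadic_cell:
  assumes t: "0 < t" "t \<le> T"
  obtains i where "i < 2 ^ j" "dyadic T j i < t" "t \<le> dyadic T j (Suc i)"
    "\<And>c :: nat \<Rightarrow> real. (\<Sum>k<2^j. c k * indicator {dyadic T j k<..dyadic T j (Suc k)} t) = c i"
proof -
  have T: "0 \<le> T" using t by simp
  define n where "n = (LEAST n. t \<le> dyadic T j n)"
  have ex: "t \<le> dyadic T j (2 ^ j)" using t by simp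
  have n: "t \<le> dyadic T j n" unfolding n_def by (rule LeastI[of _ "2^j"]) (rule ex)
  have nle: "n \<le> 2 ^ j" unfolding n_def by (rule Least_le) (rule ex)
  have "n \<noteq> 0" using n t by (intro notI) simp
  then obtain i where i: "n = Suc i" by (cases n) auto
  have lt: "dyadic T j i < t" using not_less_Least[of i "\<lambda>n. t \<le> dyadic T j n"] i unfolding n_def by simp
  have i2: "i < 2 ^ j" using nle i by simp
  have "(\<Sum>k<2^j. c k * indicator {dyadic T j k<..dyadic T j (Suc k)} t) = c i" for c :: "nat \<Rightarrow> real"
  proof -
    have "(\<Sum>k<2^j. c k * indicator {dyadic T j k<..dyadic T j (Suc k)} t) = (\<Sum>k<2^j. if k = i then c i else 0)"
    proof (rule sum.cong[OF refl])
      fix k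
      consider "k = i" | "Suc k \<le> i" | "Suc i \<le> k" by linarith
      then show "c k * indicator {dyadic T j k<..dyadic T j (Suc k)} t = (if k = i then c i else 0)"
      proof cases
        case 1 then show ?thesis using lt n i by simp
      next
        case 2 then show ?thesis using dyadic_mono[OF T 2, of j] lt by (auto simp: indicator_def)
      next
        case 3 then show ?thesis using dyadic_mono[OF T 3, of j] n i by (auto simp: indicator_def)
      qed
    qed
    also have "\<dots> = c i" using i2 by simp
    finally show ?thesis .
  qed
  then show ?thesis using that i2 lt n i by blast
qed

lemma dyadic_step_function_tendsto:
  fixes x :: "real \<Rightarrow> real"
  assumes x: "continuous_on {0..T} x" and t: "0 < t" "t \<le> T"
  shows "(\<lambda>j. \<Sum>k<2^j. x (dyadic T j k) * indicator {dyadic T j k<..dyadic T j (Suc k)} t) \<longlonglongrightarrow> x t"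
proof -
  have T: "0 \<le> T" using t by simp
  have "\<exists>s. 0 \<le> s \<and> s \<le> T \<and> \<bar>s - t\<bar> \<le> T / 2 ^ j \<and>
      (\<Sum>k<2^j. x (dyadic T j k) * indicator {dyadic T j k<..dyadic T j (Suc k)} t) = x s" for j
  proof -
    obtain i where i: "i < 2 ^ j" "dyadic T j i < t" "t \<le> dyadic T j (Suc i)"
      and s: "\<And>c :: nat \<Rightarrow> real. (\<Sum>k<2^j. c k * indicator {dyadic T j k<..dyadic T j (Suc k)} t) = c i"
      using dyadic_cell[OF t] by blast
    show ?thesis
      by (rule exI[of _ "dyadic T j i"]) (use i t dyadic_step[of T j i] dyadic_nonneg[OF T, of j i] in \<open>simp add: s\<close>)
  qed
  then obtain s where s: "\<And>j. 0 \<le> s j" "\<And>j. s j \<le> T" "\<And>j. \<bar>s j - t\<bar> \<le> T / 2 ^ j"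
      and e: "\<And>j. (\<Sum>k<2^j. x (dyadic T j k) * indicator {dyadic T j k<..dyadic T j (Suc k)} t) = x (s j)"
    by metis
  have "(\<lambda>j. T / 2 ^ j) \<longlonglongrightarrow> 0" by real_asymp
  then have "(\<lambda>j. s j - t) \<longlonglongrightarrow> 0"
    by (rule Lim_null_comparison[OF always_eventually, rotated]) (simp add: s)
  then have "s \<longlonglongrightarrow> t" by (rule LIM_zero_cancel)
  then have "(\<lambda>j. x (s j)) \<longlonglongrightarrow> x t"
    using s t by (intro continuous_on_tendsto_compose[OF x]) (auto intro!: always_eventually)
  then show ?thesis unfolding e .
qed

lemma sum_lessThan_double: "(\<Sum>i<2 * n. f i) = (\<Sum>i<n. f (2 * i) + f (Suc (2 * i)) :: real)"
  by (induction n) simp_all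

lemma (in prob_space) expectation_abs_le_of_square:
  fixes X :: "'a \<Rightarrow> real"
  assumes m: "X \<in> borel_measurable M" and i: "integrable M (\<lambda>x. (X x)\<^sup>2)" and b: "expectation (\<lambda>x. (X x)\<^sup>2) \<le> D\<^sup>2" and D: "0 < D"
  shows "expectation (\<lambda>x. \<bar>X x\<bar>) \<le> D"
proof -
  have iX: "integrable M (\<lambda>x. \<bar>X x\<bar>)" using square_integrable_imp_integrable[OF m i] by simp
  have "expectation (\<lambda>x. 2 * D * \<bar>X x\<bar>) \<le> expectation (\<lambda>x. (X x)\<^sup>2 + D\<^sup>2)"
  proof (rule integral_mono)
    show "2 * D * \<bar>X x\<bar> \<le> (X x)\<^sup>2 + D\<^sup>2" for x
      using sum_squares_bound[of D "\<bar>X x\<bar>"] by simp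
  qed (use iX i in auto)
  also have "\<dots> = expectation (\<lambda>x. (X x)\<^sup>2) + D\<^sup>2" using i by (simp add: prob_space)
  also have "\<dots> \<le> D\<^sup>2 + D\<^sup>2" using b by simp
  finally have "D * (2 * expectation (\<lambda>x. \<bar>X x\<bar>)) \<le> D * (2 * D)" by (simp add: power2_eq_square)
  then show ?thesis using D by simp
qed

context adapted_brownian_motion begin

lemma ito_isometry_disjoint:
  fixes \<xi> :: "'i \<Rightarrow> 'a \<Rightarrow> real"
  assumes A: "finite A" and ab: "\<And>i. i \<in> A \<Longrightarrow> 0 \<le> a i" "\<And>i. i \<in> A \<Longrightarrow> a i \<le> b i"
    and \<xi>: "\<And>i. i \<in> A \<Longrightarrow> \<xi> i \<in> borel_measurable (F (a i))" "\<And>i. i \<in> A \<Longrightarrow> integrable M (\<lambda>\<omega>. (\<xi> i \<omega>)\<^sup>2)"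
    and disj: "\<And>i j. i \<in> A \<Longrightarrow> j \<in> A \<Longrightarrow> i \<noteq> j \<Longrightarrow> b i \<le> a j \<or> b j \<le> a i"
  shows "integrable M (\<lambda>\<omega>. (\<Sum>i\<in>A. \<xi> i \<omega> * incr (a i) (b i) \<omega>)\<^sup>2)"
   "expectation (\<lambda>\<omega>. (\<Sum>i\<in>A. \<xi> i \<omega> * incr (a i) (b i) \<omega>)\<^sup>2) =
    (\<Sum>i\<in>A. expectation (\<lambda>\<omega>. (\<xi> i \<omega>)\<^sup>2) * (b i - a i))"
proof -
  show "integrable M (\<lambda>\<omega>. (\<Sum>i\<in>A. \<xi> i \<omega> * incr (a i) (b i) \<omega>)\<^sup>2)" by (rule ito_isometry_sum(1)[OF A ab \<xi>])
  have "(\<Sum>j\<in>A. expectation (\<lambda>\<omega>. \<xi> i \<omega> * \<xi> j \<omega>) * max 0 (min (b i) (b j) - max (a i) (a j))) = expectation (\<lambda>\<omega>. (\<xi> i \<omega>)\<^sup>2) * (b i - a i)"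
    if i: "i \<in> A" for i
  proof -
    have "(\<Sum>j\<in>A. expectation (\<lambda>\<omega>. \<xi> i \<omega> * \<xi> j \<omega>) * max 0 (min (b i) (b j) - max (a i) (a j)))
       = (\<Sum>j\<in>{i}. expectation (\<lambda>\<omega>. \<xi> i \<omega> * \<xi> j \<omega>) * max 0 (min (b i) (b j) - max (a i) (a j)))"
    proof (rule sum.mono_neutral_right[OF A])
      show "\<forall>j\<in>A - {i}. expectation (\<lambda>\<omega>. \<xi> i \<omega> * \<xi> j \<omega>) * max 0 (min (b i) (b j) - max (a i) (a j)) = 0"
      proof
        fix j assume j: "j \<in> A - {i}"
        then have "min (b i) (b j) \<le> max (a i) (a j)" using disj[OF i, of j] by auto
        then show "expectation (\<lambda>\<omega>. \<xi> i \<omega> * \<xi> j \<omega>) * max 0 (min (b i) (b j) - max (a i) (a j)) = 0" by simp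
      qed
    qed (use i in auto)
    also have "\<dots> = expectation (\<lambda>\<omega>. (\<xi> i \<omega>)\<^sup>2) * (b i - a i)" using ab(2)[OF i] by (simp add: power2_eq_square)
    finally show ?thesis .
  qed
  then show "expectation (\<lambda>\<omega>. (\<Sum>i\<in>A. \<xi> i \<omega> * incr (a i) (b i) \<omega>)\<^sup>2) = (\<Sum>i\<in>A. expectation (\<lambda>\<omega>. (\<xi> i \<omega>)\<^sup>2) * (b i - a i))"
    by (subst ito_isometry_sum(2)[OF A ab \<xi>]) (auto intro: sum.cong)
qed

definition dyadic_ito_sum :: "real \<Rightarrow> (real \<Rightarrow> 'a \<Rightarrow> real) \<Rightarrow> nat \<Rightarrow> 'a \<Rightarrow> real" where
  "dyadic_ito_sum T X j \<omega> = (\<Sum>i<2^j. X (dyadic T j i) \<omega> * incr (dyadic T j i) (dyadic T j (Suc i)) \<omega>)"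

lemma dyadic_ito_sum_stieltjes:
  "dyadic_ito_sum T X j \<omega> = dyadic_stieltjes_sum T (\<lambda>t. X t \<omega>) (\<lambda>t. w t \<omega>) j"
  by (simp add: dyadic_ito_sum_def dyadic_stieltjes_sum_def incr_def)

lemma dyadic_ito_sum_elementary:
  "dyadic_ito_sum T X j \<omega> = elementary_integral (2^j) (dyadic T j) (\<lambda>i. X (dyadic T j i)) w \<omega>"
  by (simp add: dyadic_ito_sum_def elementary_integral_incr)

text \<open>Conditions under which the dyadic sums converge almost surely: fourth moments bounded
  by \<open>K\<close>, and mean square increments at most \<open>C\<close> times the elapsed time,
  the order of Brownian motion itself.\<close>

definition ito_regular :: "real \<Rightarrow> (real \<Rightarrow> 'a \<Rightarrow> real) \<Rightarrow> real \<Rightarrow> real \<Rightarrow> bool" where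
  "ito_regular T X K C \<longleftrightarrow>
     (\<forall>t\<in>{0..T}. X t \<in> borel_measurable (F t) \<and> integrable M (\<lambda>\<omega>. X t \<omega> ^ 4) \<and> expectation (\<lambda>\<omega>. X t \<omega> ^ 4) \<le> K) \<and>
     (\<forall>s t. 0 \<le> s \<longrightarrow> s \<le> t \<longrightarrow> t \<le> T \<longrightarrow> expectation (\<lambda>\<omega>. (X t \<omega> - X s \<omega>)\<^sup>2) \<le> C * (t - s))"

lemma ito_regularD:
  assumes "ito_regular T X K C" "0 \<le> t" "t \<le> T"
  shows "X t \<in> borel_measurable (F t)" "X t \<in> borel_measurable M" "integrable M (\<lambda>\<omega>. X t \<omega> ^ 4)"
    "expectation (\<lambda>\<omega>. X t \<omega> ^ 4) \<le> K" "integrable M (\<lambda>\<omega>. (X t \<omega>)\<^sup>2)" "0 \<le> K"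
proof -
  show 1: "X t \<in> borel_measurable (F t)" "integrable M (\<lambda>\<omega>. X t \<omega> ^ 4)" "expectation (\<lambda>\<omega>. X t \<omega> ^ 4) \<le> K"
    using assms by (auto simp: ito_regular_def)
  show 2: "X t \<in> borel_measurable M" by (rule borel_measurable_F_M[OF assms(2) 1(1)])
  show "integrable M (\<lambda>\<omega>. (X t \<omega>)\<^sup>2)" by (rule integrable_of_power4(2)[OF 2 1(2)])
  show "0 \<le> K" by (rule order_trans[OF _ 1(3)]) simp
qed

lemma elementary_dyadic:
  assumes T: "0 \<le> T" and X: "ito_regular T X K C"
  shows "elementary M F T (2^j) (dyadic T j) (\<lambda>i. X (dyadic T j i))"
  unfolding elementary_def
  using ito_regularD[OF X dyadic_nonneg[OF T] dyadic_le[OF T]] by (auto simp: dyadic_mono[OF T])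

lemma dyadic_ito_sum_measurable:
  assumes T: "0 \<le> T" and X: "ito_regular T X K C"
  shows "dyadic_ito_sum T X j \<in> borel_measurable M"
  unfolding dyadic_ito_sum_elementary[abs_def] by (rule elementary_integral_measurable[OF elementary_dyadic[OF T X]])

lemma dyadic_ito_sum_moments:
  assumes T: "0 \<le> T" and X: "ito_regular T X K C"
  shows "integrable M (\<lambda>\<omega>. dyadic_ito_sum T X j \<omega> ^ 4)"
    "expectation (\<lambda>\<omega>. dyadic_ito_sum T X j \<omega> ^ 4) \<le> K * exp (3 * T + 3 * T\<^sup>2)"
    "expectation (dyadic_ito_sum T X j) = 0"
    "expectation (\<lambda>\<omega>. (dyadic_ito_sum T X j \<omega>)\<^sup>2) = (\<Sum>i<2^j. expectation (\<lambda>\<omega>. (X (dyadic T j i) \<omega>)\<^sup>2) * (T / 2 ^ j))"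
proof -
  have K: "0 \<le> K" using ito_regularD(6)[OF X order_refl T] .
  note XD = ito_regularD[OF X dyadic_nonneg[OF T] dyadic_le[OF T]]
  have *: "integrable M (\<lambda>\<omega>. (\<Sum>i<2^j. X (dyadic T j i) \<omega> * incr (dyadic T j i) (dyadic T j (Suc i)) \<omega>) ^ 4)
    \<and> (\<lambda>\<omega>. \<Sum>i<2^j. X (dyadic T j i) \<omega> * incr (dyadic T j i) (dyadic T j (Suc i)) \<omega>) \<in> borel_measurable (F (dyadic T j (2^j)))
    \<and> 0 \<le> dyadic T j (2^j) \<and> expectation (\<lambda>\<omega>. \<Sum>i<2^j. X (dyadic T j i) \<omega> * incr (dyadic T j i) (dyadic T j (Suc i)) \<omega>) = 0
    \<and> expectation (\<lambda>\<omega>. (\<Sum>i<2^j. X (dyadic T j i) \<omega> * incr (dyadic T j i) (dyadic T j (Suc i)) \<omega>) ^ 4) + K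
       \<le> K * exp ((3 * (T / 2 ^ j) + 3 * (T / 2 ^ j)\<^sup>2) * real (2 ^ j))"
    by (rule ito_sum_fourth_moment) (use T K XD in \<open>auto simp: dyadic_step dyadic_mono\<close>)
  show "integrable M (\<lambda>\<omega>. dyadic_ito_sum T X j \<omega> ^ 4)" "expectation (dyadic_ito_sum T X j) = 0"
    unfolding dyadic_ito_sum_def[abs_def] using * by blast+
  have "(3 * (T / 2 ^ j) + 3 * (T / 2 ^ j)\<^sup>2) * real (2 ^ j) = 3 * T + 3 * T\<^sup>2 / 2 ^ j"
    by (simp add: field_simps power2_eq_square)
  also have "3 * T\<^sup>2 / 2 ^ j \<le> 3 * T\<^sup>2 / 1" by (intro divide_left_mono) auto
  finally have "K * exp ((3 * (T / 2 ^ j) + 3 * (T / 2 ^ j)\<^sup>2) * real (2 ^ j)) \<le> K * exp (3 * T + 3 * T\<^sup>2)"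
    using K by (intro mult_left_mono) auto
  then show "expectation (\<lambda>\<omega>. dyadic_ito_sum T X j \<omega> ^ 4) \<le> K * exp (3 * T + 3 * T\<^sup>2)"
    unfolding dyadic_ito_sum_def[abs_def] using * K by linarith
  have "expectation (\<lambda>\<omega>. (dyadic_ito_sum T X j \<omega>)\<^sup>2) = (\<Sum>i<2^j. expectation (\<lambda>\<omega>. (X (dyadic T j i) \<omega>)\<^sup>2) * (dyadic T j (Suc i) - dyadic T j i))"
    unfolding dyadic_ito_sum_def
  proof (rule ito_isometry_disjoint(2))
    fix i k :: nat assume "i \<noteq> k"
    then consider "Suc i \<le> k" | "Suc k \<le> i" by linarith
    then show "dyadic T j (Suc i) \<le> dyadic T j k \<or> dyadic T j (Suc k) \<le> dyadic T j i"
      by cases (auto intro: dyadic_mono[OF T])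
  qed (use XD in \<open>auto simp: dyadic_mono dyadic_nonneg T\<close>)
  then show "expectation (\<lambda>\<omega>. (dyadic_ito_sum T X j \<omega>)\<^sup>2) = (\<Sum>i<2^j. expectation (\<lambda>\<omega>. (X (dyadic T j i) \<omega>)\<^sup>2) * (T / 2 ^ j))"
    by (simp only: dyadic_step)
qed

text \<open>Refinement changes the sum only on the right half of each cell, where the value of the
  integrand at the left endpoint is replaced by that at the midpoint. The halves are disjoint, so
  the isometry has no mixed terms.\<close>

lemma dyadic_ito_sum_refine:
  assumes T: "0 \<le> T" and X: "ito_regular T X K C" and C: "0 \<le> C"
  shows "integrable M (\<lambda>\<omega>. (dyadic_ito_sum T X (Suc j) \<omega> - dyadic_ito_sum T X j \<omega>)\<^sup>2)"
    "expectation (\<lambda>\<omega>. (dyadic_ito_sum T X (Suc j) \<omega> - dyadic_ito_sum T X j \<omega>)\<^sup>2) \<le> C * T\<^sup>2 / 2 ^ j"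
proof -
  let ?a = "\<lambda>i. dyadic T (Suc j) (Suc (2 * i))" and ?b = "\<lambda>i. dyadic T (Suc j) (2 * Suc i)" and ?t = "\<lambda>i. dyadic T (Suc j) (2 * i)"
  let ?x = "\<lambda>i \<omega>. X (?a i) \<omega> - X (?t i) \<omega>"
  have le: "?t i \<le> ?a i" "?a i \<le> ?b i" "0 \<le> ?t i" for i using T by (auto intro!: dyadic_mono dyadic_nonneg)
  have leT: "?a i \<le> T" "?b i \<le> T" if "i < 2 ^ j" for i using T that by (auto intro!: dyadic_le)
  have in0: "0 \<le> ?a i" for i using T by (rule dyadic_nonneg)
  have eq: "dyadic_ito_sum T X (Suc j) \<omega> - dyadic_ito_sum T X j \<omega> = (\<Sum>i<2^j. ?x i \<omega> * incr (?a i) (?b i) \<omega>)" for \<omega>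
  proof -
    have "dyadic_ito_sum T X (Suc j) \<omega> = (\<Sum>i<2^j. X (?t i) \<omega> * incr (?t i) (?a i) \<omega> + X (?a i) \<omega> * incr (?a i) (?b i) \<omega>)"
      unfolding dyadic_ito_sum_def power_Suc sum_lessThan_double by simp
    moreover have "dyadic_ito_sum T X j \<omega> = (\<Sum>i<2^j. X (?t i) \<omega> * incr (?t i) (?b i) \<omega>)"
      unfolding dyadic_ito_sum_def by (simp only: dyadic_Suc_double)
    ultimately show ?thesis
      by (simp only: sum_subtractf[symmetric], intro sum.cong refl) (simp add: incr_def algebra_simps)
  qed
  have xF: "?x i \<in> borel_measurable (F (?a i))" if "i < 2 ^ j" for i
  proof (rule borel_measurable_diff)
    show "X (?a i) \<in> borel_measurable (F (?a i))" by (rule ito_regularD(1)[OF X in0 leT(1)[OF that]])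
    show "X (?t i) \<in> borel_measurable (F (?a i))"
      by (rule borel_measurable_F_mono[OF le(3,1) ito_regularD(1)[OF X le(3)]]) (rule order_trans[OF le(1) leT(1)[OF that]])
  qed
  have xi: "integrable M (\<lambda>\<omega>. (?x i \<omega>)\<^sup>2)" if i: "i < 2 ^ j" for i
  proof -
    note a = ito_regularD[OF X in0 leT(1)[OF i]] and t = ito_regularD[OF X le(3) order_trans[OF le(1) leT(1)[OF i]]]
    have "integrable M (\<lambda>\<omega>. (X (?a i) \<omega> + - X (?t i) \<omega>)\<^sup>2)"
      by (rule integrable_square_sum) (use a t in simp_all)
    then show ?thesis by simp
  qed
  have xb: "expectation (\<lambda>\<omega>. (?x i \<omega>)\<^sup>2) \<le> C * (T / 2 ^ Suc j)" if "i < 2 ^ j" for i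
  proof -
    have "expectation (\<lambda>\<omega>. (?x i \<omega>)\<^sup>2) \<le> C * (?a i - ?t i)"
      using X le leT(1)[OF that] unfolding ito_regular_def by blast
    then show ?thesis by (simp only: dyadic_step)
  qed
  have disj: "?b i \<le> ?a k \<or> ?b k \<le> ?a i" if "i \<noteq> k" for i k
  proof -
    from that consider "i < k" | "k < i" by linarith
    then show ?thesis
    proof cases
      case 1
      then have "2 * Suc i \<le> Suc (2 * k)" by simp
      then show ?thesis using dyadic_mono[OF T] by blast
    next
      case 2
      then have "2 * Suc k \<le> Suc (2 * i)" by simp
      then show ?thesis using dyadic_mono[OF T] by blast
    qed
  qed
  have ds: "?b i - ?a i = T / 2 ^ Suc j" for i using dyadic_step[of T "Suc j" "Suc (2 * i)"] by simp
  show "integrable M (\<lambda>\<omega>. (dyadic_ito_sum T X (Suc j) \<omega> - dyadic_ito_sum T X j \<omega>)\<^sup>2)"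
    unfolding eq by (rule ito_isometry_disjoint(1)[OF _ in0 le(2) xF xi disj]) auto
  have "expectation (\<lambda>\<omega>. (dyadic_ito_sum T X (Suc j) \<omega> - dyadic_ito_sum T X j \<omega>)\<^sup>2)
     = (\<Sum>i<2^j. expectation (\<lambda>\<omega>. (?x i \<omega>)\<^sup>2) * (?b i - ?a i))"
    unfolding eq by (rule ito_isometry_disjoint(2)[OF _ in0 le(2) xF xi disj]) auto
  also have "\<dots> \<le> (\<Sum>i<2^j::nat. C * (T / 2 ^ Suc j) * (T / 2 ^ Suc j))"
    unfolding ds using T by (intro sum_mono mult_right_mono xb) auto
  also have "\<dots> = C * T\<^sup>2 / 2 ^ j / 4" by (simp add: field_simps power2_eq_square)
  also have "\<dots> \<le> C * T\<^sup>2 / 2 ^ j / 1" using C by (intro divide_left_mono) auto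
  also have "\<dots> = C * T\<^sup>2 / 2 ^ j" by simp
  finally show "expectation (\<lambda>\<omega>. (dyadic_ito_sum T X (Suc j) \<omega> - dyadic_ito_sum T X j \<omega>)\<^sup>2) \<le> C * T\<^sup>2 / 2 ^ j" .
qed

text \<open>The expected absolute differences of successive sums are dominated by a geometric
  series of ratio \<open>1 / sqrt 2\<close>, so almost every path has summable
  differences.\<close>

lemma dyadic_ito_sum_AE_convergent:
  assumes T: "0 \<le> T" and X: "ito_regular T X K C"
  shows "AE \<omega> in M. convergent (\<lambda>j. dyadic_ito_sum T X j \<omega>)"
proof -
  define C' where "C' = max C 0"
  have X': "ito_regular T X K C'" using X unfolding ito_regular_def C'_def
    by (auto intro!: order_trans[OF _ mult_right_mono[OF max.cobounded1]])
  have C': "0 \<le> C'" by (simp add: C'_def)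
  \<comment> \<open>The summand 1 makes \<open>A\<close> positive.\<close>
  define A where "A = sqrt (C' * T\<^sup>2) + 1"
  define f where "f = (\<lambda>j \<omega>. \<bar>dyadic_ito_sum T X (Suc j) \<omega> - dyadic_ito_sum T X j \<omega>\<bar>)"
  note m[measurable] = dyadic_ito_sum_measurable[OF T X]
  note r = dyadic_ito_sum_refine[OF T X' C']
  have mf: "(\<lambda>\<omega>. dyadic_ito_sum T X (Suc j) \<omega> - dyadic_ito_sum T X j \<omega>) \<in> borel_measurable M" for j by measurable
  have A: "0 < A" "C' * T\<^sup>2 \<le> A\<^sup>2"
  proof -
    have "0 \<le> sqrt (C' * T\<^sup>2)" using C' by simp
    then show "0 < A" unfolding A_def by linarith
    have "(sqrt (C' * T\<^sup>2))\<^sup>2 \<le> A\<^sup>2" using C' by (intro power_mono) (auto simp: A_def)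
    then show "C' * T\<^sup>2 \<le> A\<^sup>2" using C' by simp
  qed
  have fb: "expectation (f j) \<le> A * (1 / sqrt 2) ^ j" for j
    unfolding f_def
  proof (rule expectation_abs_le_of_square[OF mf r(1)])
    have "(A * (1 / sqrt 2) ^ j)\<^sup>2 = A\<^sup>2 * ((1 / sqrt 2)\<^sup>2) ^ j"
      by (simp only: power_mult_distrib power_mult[symmetric] mult.commute[of j])
    also have "\<dots> = A\<^sup>2 / 2 ^ j" by (simp add: power_divide)
    finally have e: "(A * (1 / sqrt 2) ^ j)\<^sup>2 = A\<^sup>2 / 2 ^ j" .
    show "expectation (\<lambda>\<omega>. (dyadic_ito_sum T X (Suc j) \<omega> - dyadic_ito_sum T X j \<omega>)\<^sup>2) \<le> (A * (1 / sqrt 2) ^ j)\<^sup>2"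
      unfolding e by (rule order_trans[OF r(2) divide_right_mono[OF A(2)]]) simp
  qed (use A in simp)
  have i: "integrable M (f j)" for j unfolding f_def by (intro integrable_abs square_integrable_imp_integrable[OF mf r(1)])
  have "summable (\<lambda>j. expectation (f j))"
  proof (rule summable_comparison_test')
    show "summable (\<lambda>j. A * (1 / sqrt 2) ^ j)" by (intro summable_mult summable_geometric) simp
    show "norm (expectation (f j)) \<le> A * (1 / sqrt 2) ^ j" for j
      using fb[of j] by (simp add: f_def)
  qed
  then have "AE \<omega> in M. summable (\<lambda>j. f j \<omega>)"
    by (intro AE_summable_of_summable_integrals i) (auto simp: f_def)
  then show ?thesis
  proof eventually_elim
    case (elim \<omega>)
    then have "summable (\<lambda>j. dyadic_ito_sum T X (Suc j) \<omega> - dyadic_ito_sum T X j \<omega>)"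
      unfolding f_def by (rule summable_rabs_cancel)
    then have "convergent (\<lambda>n. \<Sum>j<n. (dyadic_ito_sum T X (Suc j) \<omega> - dyadic_ito_sum T X j \<omega>))"
      by (simp add: summable_iff_convergent)
    then have "convergent (\<lambda>n. dyadic_ito_sum T X n \<omega> - dyadic_ito_sum T X 0 \<omega>)"
      by (simp only: sum_lessThan_telescope[of "\<lambda>j. dyadic_ito_sum T X j \<omega>"])
    then have "convergent (\<lambda>n. (dyadic_ito_sum T X n \<omega> - dyadic_ito_sum T X 0 \<omega>) + dyadic_ito_sum T X 0 \<omega>)"
      by (intro convergent_add convergent_const)
    then show ?case by simp
  qed
qed

lemma ito_limit_moments:
  assumes T: "0 \<le> T" and X: "ito_regular T X K C" and I: "I \<in> borel_measurable M"
    and lim: "AE \<omega> in M. (\<lambda>j. dyadic_ito_sum T X j \<omega>) \<longlonglongrightarrow> I \<omega>"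
  shows "integrable M (\<lambda>\<omega>. I \<omega> ^ 4)" "expectation (\<lambda>\<omega>. I \<omega> ^ 4) \<le> K * exp (3 * T + 3 * T\<^sup>2)"
    "expectation I = 0"
    "(\<lambda>j. \<Sum>i<2^j. expectation (\<lambda>\<omega>. (X (dyadic T j i) \<omega>)\<^sup>2) * (T / 2 ^ j)) \<longlonglongrightarrow> expectation (\<lambda>\<omega>. (I \<omega>)\<^sup>2)"
    "(\<lambda>j. expectation (\<lambda>\<omega>. (dyadic_ito_sum T X j \<omega> - I \<omega>)\<^sup>2)) \<longlonglongrightarrow> 0"
proof -
  note m = dyadic_ito_sum_moments[OF T X]
  note r = tendsto_second_moment_of_bounded_fourth[OF dyadic_ito_sum_measurable[OF T X] I m(1,2) lim]
  show "integrable M (\<lambda>\<omega>. I \<omega> ^ 4)" "expectation (\<lambda>\<omega>. I \<omega> ^ 4) \<le> K * exp (3 * T + 3 * T\<^sup>2)" by (rule r)+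
  show "(\<lambda>j. expectation (\<lambda>\<omega>. (dyadic_ito_sum T X j \<omega> - I \<omega>)\<^sup>2)) \<longlonglongrightarrow> 0" by (rule r)
  show "(\<lambda>j. \<Sum>i<2^j. expectation (\<lambda>\<omega>. (X (dyadic T j i) \<omega>)\<^sup>2) * (T / 2 ^ j)) \<longlonglongrightarrow> expectation (\<lambda>\<omega>. (I \<omega>)\<^sup>2)"
    using r(3) unfolding m(4) .
  show "expectation I = 0" using r(5) unfolding m(3) by (simp add: LIMSEQ_const_iff)
qed

text \<open>Time \<open>0\<close> is discarded along with the exceptional paths, because the step
  functions that approximate an integrand vanish there.\<close>

lemma AE_time_product:
  assumes "AE \<omega> in M. P \<omega>"
  shows "AE z in time_product T. 0 < fst z \<and> P (snd z)"
proof -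
  obtain N where N: "{\<omega> \<in> space M. \<not> P \<omega>} \<subseteq> N" "N \<in> null_sets M" using assms unfolding eventually_ae_filter by auto
  let ?L = "restrict_space lborel {0..T}"
  have sp: "space ?L = {0..T}" by (simp add: space_restrict_space)
  have z: "emeasure ?L ({0..T} \<inter> {0}) = 0"
    by (subst emeasure_restrict_space) (auto intro: order_antisym[OF order_trans[OF emeasure_mono[of _ "{0}"]]])
  have m0: "{0..T} \<inter> {0} \<in> sets ?L" by (auto simp: sets_restrict_space)
  have n1: "({0..T} \<inter> {0}) \<times> space M \<in> null_sets (time_product T)"
    using z m0 by (auto intro!: null_setsI simp: emeasure_pair_measure_Times)
  have n2: "space ?L \<times> N \<in> null_sets (time_product T)"
  proof (rule null_setsI)
    have N': "N \<in> sets M" "emeasure M N = 0" using N(2) by auto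
    show "emeasure (time_product T) (space ?L \<times> N) = 0"
      using N' by (subst emeasure_pair_measure_Times[OF sets.top]) auto
    show "space ?L \<times> N \<in> sets (time_product T)"
      by (rule pair_measureI[OF sets.top N'(1)])
  qed
  show ?thesis
  proof (rule AE_I')
    show "({0..T} \<inter> {0}) \<times> space M \<union> space ?L \<times> N \<in> null_sets (time_product T)" using n1 n2 by auto
    show "{z \<in> space (time_product T). \<not> (0 < fst z \<and> P (snd z))} \<subseteq> ({0..T} \<inter> {0}) \<times> space M \<union> space ?L \<times> N"
      using N(1) by (auto simp: space_pair_measure sp)
  qed
qed

lemma finite_measure_time_product: "finite_measure (completion (time_product T))"
proof
  have "emeasure (time_product T) (space (time_product T)) = emeasure lborel {0..T} * emeasure M (space M)"
  proof -
    let ?L = "restrict_space lborel {0..T}"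
    have "emeasure (time_product T) (space ?L \<times> space M) = emeasure ?L (space ?L) * emeasure M (space M)"
      by (rule emeasure_pair_measure_Times[OF sets.top sets.top])
    also have "emeasure ?L (space ?L) = emeasure lborel {0..T}"
      by (subst emeasure_restrict_space) (auto simp: space_restrict_space)
    finally show ?thesis by (simp add: space_pair_measure)
  qed
  also have "\<dots> < \<infinity>" by (simp add: emeasure_space_1 emeasure_lborel_Icc_eq)
  finally show "emeasure (completion (time_product T)) (space (completion (time_product T))) \<noteq> \<infinity>" by simp
qed

text \<open>Along continuous paths the step functions converge at every positive time, and their
  fourth moments over \<open>[0, T] \<times> \<Omega>\<close> are at most \<open>K T\<close>;
  hence they converge in mean square. Being an almost everywhere limit, the integrand is
  measurable for the completed product.\<close>

lemma elementary_dyadic_tendsto: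
  assumes T: "0 \<le> T" and X: "ito_regular T X K C" and c: "AE \<omega> in M. continuous_on {0..T} (\<lambda>t. X t \<omega>)"
  defines "E \<equiv> \<lambda>j z. elementary_process (2^j) (dyadic T j) (\<lambda>i. X (dyadic T j i)) (fst z) (snd z)"
  shows "(\<lambda>z. X (fst z) (snd z)) \<in> borel_measurable (completion (time_product T))"
    "(\<lambda>j. \<integral>\<^sup>+z. ennreal ((E j z - X (fst z) (snd z))\<^sup>2) \<partial>completion (time_product T)) \<longlonglongrightarrow> 0"
proof -
  let ?TM = "completion (time_product T)"
  interpret TM: finite_measure ?TM by (rule finite_measure_time_product)
  have m: "E j \<in> borel_measurable (time_product T)" for j
    unfolding E_def by (rule elementary_process_measurable[OF elementary_dyadic[OF T X]])
  note mc = measurable_completion[OF m]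
  have sp: "AE z in time_product T. fst z \<le> T"
    by (rule AE_I2) (auto simp: space_pair_measure space_restrict_space)
  have lim: "AE z in ?TM. (\<lambda>j. E j z) \<longlonglongrightarrow> X (fst z) (snd z)"
    using AE_time_product[OF c, of T] sp
  proof (intro AE_completion, eventually_elim)
    case (elim z)
    then show ?case unfolding E_def elementary_process_def
      by (intro dyadic_step_function_tendsto[of T "\<lambda>t. X t (snd z)"]) auto
  qed
  show mX: "(\<lambda>z. X (fst z) (snd z)) \<in> borel_measurable ?TM"
    by (rule borel_measurable_AE_limit_subalgebra[OF null_complete_subalgebra_self[OF completion.complete_measure_axioms] mc lim])
  have K: "0 \<le> K" using ito_regularD(6)[OF X order_refl T] .
  have inner: "(\<integral>\<^sup>+\<omega>. ennreal (E j (t, \<omega>) ^ 4) \<partial>M) \<le> ennreal K" if t: "t \<in> {0..T}" for j t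
  proof (cases "t = 0")
    case True
    have "indicator {dyadic T j i<..dyadic T j (Suc i)} (0::real) = (0::real)" for i
      using dyadic_nonneg[OF T, of j i] by (simp add: indicator_def)
    then have "E j (t, \<omega>) = 0" for \<omega>
      unfolding E_def elementary_process_def True fst_conv snd_conv by (simp only: mult_zero_right sum.neutral_const)
    then show ?thesis by simp
  next
    case False
    then have "0 < t" "t \<le> T" using t by auto
    then obtain i where i: "i < 2 ^ j"
      and s: "\<And>c :: nat \<Rightarrow> real. (\<Sum>k<2^j. c k * indicator {dyadic T j k<..dyadic T j (Suc k)} t) = c i"
      using dyadic_cell by blast
    have e: "E j (t, \<omega>) = X (dyadic T j i) \<omega>" for \<omega> unfolding E_def elementary_process_def fst_conv snd_conv by (rule s)
    note XD = ito_regularD[OF X dyadic_nonneg[OF T] dyadic_le[OF T less_imp_le[OF i]]]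
    show ?thesis unfolding e using XD by (subst nn_integral_eq_integral) (auto intro: ennreal_leI)
  qed
  have fin: "(\<integral>\<^sup>+z. ennreal (E j z ^ 4) \<partial>?TM) \<le> ennreal (K * T)" for j
  proof -
    have "(\<integral>\<^sup>+z. ennreal (E j z ^ 4) \<partial>?TM) = (\<integral>\<^sup>+t. \<integral>\<^sup>+\<omega>. ennreal (E j (t, \<omega>) ^ 4) \<partial>M \<partial>restrict_space lborel {0..T})"
      unfolding nn_integral_completion by (subst nn_integral_fst) (use m in measurable)
    also have "\<dots> \<le> (\<integral>\<^sup>+t. ennreal K \<partial>restrict_space lborel {0..T})"
      by (rule nn_integral_mono) (use inner in \<open>auto simp: space_restrict_space\<close>)
    also have "\<dots> = ennreal (K * T)"
      using T K by (simp add: emeasure_restrict_space space_restrict_space ennreal_mult)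
    finally show ?thesis .
  qed
  have i4: "integrable ?TM (\<lambda>z. E j z ^ 4)" for j
    unfolding integrable_iff_bounded using fin[of j] mc[of j] by (auto simp: top_unique less_top[symmetric])
  have b4: "integral\<^sup>L ?TM (\<lambda>z. E j z ^ 4) \<le> K * T" for j
  proof -
    have "ennreal (integral\<^sup>L ?TM (\<lambda>z. E j z ^ 4)) \<le> ennreal (K * T)"
      using fin[of j] by (subst nn_integral_eq_integral[symmetric, OF i4]) auto
    then show ?thesis using T K by (simp add: ennreal_le_iff)
  qed
  note r = TM.tendsto_second_moment_of_bounded_fourth[OF mc mX i4 b4 lim]
  have "integrable ?TM (\<lambda>z. (E j z + - X (fst z) (snd z)) ^ 4)" for j
    by (rule integrable_power4_sum) (use mc mX i4 r(1) in simp_all)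
  then have "integrable ?TM (\<lambda>z. (E j z - X (fst z) (snd z))\<^sup>2)" for j
    using TM.integrable_of_power4(2)[of "\<lambda>z. E j z - X (fst z) (snd z)"] mc mX by simp
  then have e: "(\<integral>\<^sup>+z. ennreal ((E j z - X (fst z) (snd z))\<^sup>2) \<partial>?TM) = ennreal (integral\<^sup>L ?TM (\<lambda>z. (E j z - X (fst z) (snd z))\<^sup>2))" for j
    by (rule nn_integral_eq_integral) simp
  show "(\<lambda>j. \<integral>\<^sup>+z. ennreal ((E j z - X (fst z) (snd z))\<^sup>2) \<partial>?TM) \<longlonglongrightarrow> 0"
    unfolding e using tendsto_ennrealI[OF r(4)] by simp
qed

lemma has_ito_integral_dyadic_limit:
  assumes T: "0 \<le> T" and X: "ito_regular T X K C" and c: "AE \<omega> in M. continuous_on {0..T} (\<lambda>t. X t \<omega>)"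
    and I: "I \<in> borel_measurable M" and lim: "AE \<omega> in M. (\<lambda>j. dyadic_ito_sum T X j \<omega>) \<longlonglongrightarrow> I \<omega>"
  shows "has_ito_integral M F w T X I"
proof -
  note m = dyadic_ito_sum_moments[OF T X] and l = ito_limit_moments[OF T X I lim]
  have mS: "dyadic_ito_sum T X j \<in> borel_measurable M" for j by (rule dyadic_ito_sum_measurable[OF T X])
  have "integrable M (\<lambda>\<omega>. (dyadic_ito_sum T X j \<omega> + - I \<omega>) ^ 4)" for j
    by (rule integrable_power4_sum) (use mS I m(1) l(1) in simp_all)
  then have "integrable M (\<lambda>\<omega>. (dyadic_ito_sum T X j \<omega> - I \<omega>)\<^sup>2)" for j
    using integrable_of_power4(2)[of "\<lambda>\<omega>. dyadic_ito_sum T X j \<omega> - I \<omega>"] mS I by simp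
  then have e: "(\<integral>\<^sup>+\<omega>. ennreal ((dyadic_ito_sum T X j \<omega> - I \<omega>)\<^sup>2) \<partial>M) = ennreal (expectation (\<lambda>\<omega>. (dyadic_ito_sum T X j \<omega> - I \<omega>)\<^sup>2))" for j
    by (rule nn_integral_eq_integral) simp
  have 2: "(\<lambda>j. \<integral>\<^sup>+\<omega>. ennreal ((elementary_integral (2^j) (dyadic T j) (\<lambda>i. X (dyadic T j i)) w \<omega> - I \<omega>)\<^sup>2) \<partial>M) \<longlonglongrightarrow> 0"
    unfolding dyadic_ito_sum_elementary[symmetric] e using tendsto_ennrealI[OF l(5)] by simp
  note 1 = elementary_dyadic_tendsto[OF T X c]
  show ?thesis unfolding has_ito_integral_def Let_def case_prod_beta'
    using 1 2 I elementary_dyadic[OF T X]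
    by (intro conjI exI[of _ "\<lambda>j. 2 ^ j"] exI[of _ "\<lambda>j. dyadic T j"] exI[of _ "\<lambda>j i. X (dyadic T j i)"] allI) auto
qed

text \<open>The almost sure limit of the dyadic sums is one version of the integral, and versions
  are unique. So the integral can be handled path by path as a limit of finite sums, which
  provides its linearity, its moments and its measurability.\<close>

theorem ito_integral_dyadic_limit:
  assumes T: "0 \<le> T" and X: "ito_regular T X K C" and c: "AE \<omega> in M. continuous_on {0..T} (\<lambda>t. X t \<omega>)"
  shows "ito_integral M F w T X \<in> borel_measurable M"
    "AE \<omega> in M. (\<lambda>j. dyadic_ito_sum T X j \<omega>) \<longlonglongrightarrow> ito_integral M F w T X \<omega>"
proof -
  define I where "I = (\<lambda>\<omega>. lim (\<lambda>j. dyadic_ito_sum T X j \<omega>))"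
  have I: "I \<in> borel_measurable M" unfolding I_def using dyadic_ito_sum_measurable[OF T X] by measurable
  have lim: "AE \<omega> in M. (\<lambda>j. dyadic_ito_sum T X j \<omega>) \<longlonglongrightarrow> I \<omega>"
    using dyadic_ito_sum_AE_convergent[OF T X] by eventually_elim (simp add: I_def convergent_LIMSEQ_iff)
  have hI: "has_ito_integral M F w T X I" by (rule has_ito_integral_dyadic_limit[OF T X c I lim])
  have h: "has_ito_integral M F w T X (ito_integral M F w T X)"
    unfolding ito_integral_def by (rule someI[of _ I]) (rule hI)
  then show "ito_integral M F w T X \<in> borel_measurable M" by (simp add: has_ito_integral_def Let_def)
  show "AE \<omega> in M. (\<lambda>j. dyadic_ito_sum T X j \<omega>) \<longlonglongrightarrow> ito_integral M F w T X \<omega>"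
    using lim has_ito_integral_unique[OF hI h] by eventually_elim simp
qed

end

section \<open>Moments of Wiener integrals and of time integrals\<close>

text \<open>The constant comes from raising \<open>x / 8 \<le> exp (x / 8)\<close> to the eighth
  power.\<close>

lemma power8_le_exp: "y ^ 8 \<le> 8 ^ 8 * (exp y + exp (- y))" for y :: real
proof -
  have p: "x ^ 8 \<le> 8 ^ 8 * exp x" if "0 \<le> x" for x :: real
  proof -
    have "x / 8 \<le> exp (x / 8)" using exp_ge_add_one_self[of "x / 8"] by linarith
    then have "(x / 8) ^ 8 \<le> exp (x / 8) ^ 8" using that by (intro power_mono) auto
    also have "exp (x / 8) ^ 8 = exp x" by (simp flip: exp_of_nat_mult)
    finally show ?thesis by (simp add: power_divide field_simps)
  qed
  show ?thesis
  proof (cases "0 \<le> y")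
    case True
    then have "y ^ 8 \<le> 8 ^ 8 * exp y" by (rule p)
    also have "\<dots> \<le> 8 ^ 8 * (exp y + exp (- y))" by (intro mult_left_mono) auto
    finally show ?thesis .
  next
    case False
    then have "(- y) ^ 8 \<le> 8 ^ 8 * exp (- y)" by (intro p) simp
    also have "\<dots> \<le> 8 ^ 8 * (exp y + exp (- y))" by (intro mult_left_mono) auto
    finally show ?thesis by simp
  qed
qed

lemma power4_le_power8: "y ^ 4 \<le> y ^ 8 + 1" for y :: real
proof -
  have "2 * y ^ 4 \<le> (y ^ 4)\<^sup>2 + 1" using sum_squares_bound[of "y ^ 4" 1] by simp
  moreover have "(y ^ 4)\<^sup>2 = y ^ 8" "0 \<le> y ^ 4" by simp_all
  ultimately show ?thesis by linarith
qed

lemma (in prob_space) fourth_moment_of_eighth: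
  fixes X :: "'a \<Rightarrow> real"
  assumes m: "X \<in> borel_measurable M" and i: "integrable M (\<lambda>x. X x ^ 8)" and b: "expectation (\<lambda>x. X x ^ 8) \<le> K"
  shows "integrable M (\<lambda>x. X x ^ 4)" "expectation (\<lambda>x. X x ^ 4) \<le> K + 1"
proof -
  have i1: "integrable M (\<lambda>x. X x ^ 8 + 1)" using i by simp
  show i4: "integrable M (\<lambda>x. X x ^ 4)"
  proof (rule Bochner_Integration.integrable_bound[OF i1])
    show "AE x in M. norm (X x ^ 4) \<le> norm (X x ^ 8 + 1)"
      using power4_le_power8 by (intro AE_I2) (simp add: power_even_abs)
  qed (use m in measurable)
  have "expectation (\<lambda>x. X x ^ 4) \<le> expectation (\<lambda>x. X x ^ 8 + 1)"
    by (rule integral_mono[OF i4 i1 power4_le_power8])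
  also have "\<dots> = expectation (\<lambda>x. X x ^ 8) + 1" using i by (simp add: prob_space)
  finally show "expectation (\<lambda>x. X x ^ 4) \<le> K + 1" using b by simp
qed

text \<open>Jensen's inequality for the uniform distribution on the cells, obtained from two
  applications of the Cauchy-Schwarz inequality.\<close>

lemma power4_dyadic_Riemann_sum_le:
  fixes y :: "nat \<Rightarrow> real"
  assumes T: "0 \<le> T"
  shows "(\<Sum>i<2^j. y i * (T / 2 ^ j)) ^ 4 \<le> (\<Sum>i<2^j. T ^ 4 / 2 ^ j * y i ^ 4)"
proof -
  let ?n = "2 ^ j :: real"
  have "(\<Sum>i<2^j::nat. y i)\<^sup>2 \<le> (\<Sum>i<2^j. (y i)\<^sup>2) * ?n"
    using sum_squared_le_sum_of_squares[of y "{..<2^j::nat}"] by simp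
  then have "((\<Sum>i<2^j::nat. y i)\<^sup>2)\<^sup>2 \<le> ((\<Sum>i<2^j. (y i)\<^sup>2) * ?n)\<^sup>2"
    by (intro power_mono) simp_all
  also have "\<dots> = (\<Sum>i<2^j. (y i)\<^sup>2)\<^sup>2 * ?n\<^sup>2" by (simp only: power_mult_distrib)
  also have "\<dots> \<le> ((\<Sum>i<2^j. ((y i)\<^sup>2)\<^sup>2) * ?n) * ?n\<^sup>2"
    using sum_squared_le_sum_of_squares[of "\<lambda>i. (y i)\<^sup>2" "{..<2^j::nat}"] by (intro mult_right_mono) simp_all
  finally have "(\<Sum>i<2^j::nat. y i) ^ 4 \<le> (\<Sum>i<2^j. y i ^ 4) * ?n ^ 3"
    by (simp add: power3_eq_cube power2_eq_square mult.assoc power4_eq_xxxx)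
  then have "(\<Sum>i<2^j::nat. y i) ^ 4 * (T / ?n) ^ 4 \<le> ((\<Sum>i<2^j. y i ^ 4) * ?n ^ 3) * (T / ?n) ^ 4"
    by (intro mult_right_mono) auto
  also have "\<dots> = (\<Sum>i<2^j. y i ^ 4) * (?n ^ 3 * (T / ?n) ^ 4)" by (simp only: mult.assoc)
  also have "?n ^ 3 * (T / ?n) ^ 4 = T ^ 4 / ?n"
    by (simp add: power_divide power4_eq_xxxx power3_eq_cube)
  finally show ?thesis
    by (simp only: sum_distrib_right[symmetric] power_mult_distrib sum_distrib_left[symmetric] mult.commute[of "T ^ 4 / ?n"])
qed

text \<open>On continuous paths the integral is a limit of Riemann sums, and Jensen's inequality
  bounds the fourth moments of these. Completeness of the measure passes measurability on to the
  limit.\<close>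

lemma (in prob_space) time_integral_moments:
  fixes Y :: "real \<Rightarrow> 'a \<Rightarrow> real"
  assumes T: "0 \<le> T" and cM: "complete_measure M"
    and m: "\<And>t. t \<in> {0..T} \<Longrightarrow> Y t \<in> borel_measurable M"
    and i: "\<And>t. t \<in> {0..T} \<Longrightarrow> integrable M (\<lambda>\<omega>. Y t \<omega> ^ 4)" "\<And>t. t \<in> {0..T} \<Longrightarrow> expectation (\<lambda>\<omega>. Y t \<omega> ^ 4) \<le> K"
    and c: "AE \<omega> in M. continuous_on {0..T} (\<lambda>t. Y t \<omega>)"
  defines "J \<equiv> \<lambda>\<omega>. integral {0..T} (\<lambda>t. Y t \<omega>)"
  shows "AE \<omega> in M. (\<lambda>j. \<Sum>i<2^j. Y (dyadic T j i) \<omega> * (T / 2 ^ j)) \<longlonglongrightarrow> J \<omega>"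
    "J \<in> borel_measurable M" "integrable M (\<lambda>\<omega>. J \<omega> ^ 4)" "expectation (\<lambda>\<omega>. J \<omega> ^ 4) \<le> T ^ 4 * K"
    "(\<lambda>j. \<Sum>i<2^j. expectation (Y (dyadic T j i)) * (T / 2 ^ j)) \<longlonglongrightarrow> expectation J"
proof -
  define R where "R = (\<lambda>j \<omega>. \<Sum>i<2^j. Y (dyadic T j i) \<omega> * (T / 2 ^ j))"
  have mD: "Y (dyadic T j i) \<in> borel_measurable M" "integrable M (\<lambda>\<omega>. Y (dyadic T j i) \<omega> ^ 4)"
    "expectation (\<lambda>\<omega>. Y (dyadic T j i) \<omega> ^ 4) \<le> K" if "i < 2 ^ j" for i j
    using m i dyadic_in[OF T less_imp_le[OF that]] by blast+
  have mR: "R j \<in> borel_measurable M" for j unfolding R_def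
    by (intro borel_measurable_sum borel_measurable_times mD borel_measurable_const) simp
  show lim: "AE \<omega> in M. (\<lambda>j. \<Sum>i<2^j. Y (dyadic T j i) \<omega> * (T / 2 ^ j)) \<longlonglongrightarrow> J \<omega>"
    using c by eventually_elim (unfold J_def, rule dyadic_Riemann_sum_tendsto[OF T])
  show mJ: "J \<in> borel_measurable M"
    by (rule borel_measurable_AE_limit_subalgebra[OF null_complete_subalgebra_self[OF cM] mR]) (use lim in \<open>simp add: R_def\<close>)
  have iB: "integrable M (\<lambda>\<omega>. \<Sum>i<2^j. T ^ 4 / 2 ^ j * Y (dyadic T j i) \<omega> ^ 4)" for j
    by (intro Bochner_Integration.integrable_sum integrable_mult_right mD) simp
  have le: "R j \<omega> ^ 4 \<le> (\<Sum>i<2^j. T ^ 4 / 2 ^ j * Y (dyadic T j i) \<omega> ^ 4)" for j \<omega>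
    unfolding R_def by (rule power4_dyadic_Riemann_sum_le[OF T])
  have i4: "integrable M (\<lambda>\<omega>. R j \<omega> ^ 4)" for j
  proof (rule Bochner_Integration.integrable_bound[OF iB])
    show "AE \<omega> in M. norm (R j \<omega> ^ 4) \<le> norm (\<Sum>i<2^j. T ^ 4 / 2 ^ j * Y (dyadic T j i) \<omega> ^ 4)"
    proof (intro AE_I2)
      fix \<omega>
      have "norm (R j \<omega> ^ 4) = R j \<omega> ^ 4" by simp
      also note le[of j \<omega>]
      also note abs_ge_self
      finally show "norm (R j \<omega> ^ 4) \<le> norm (\<Sum>i<2^j. T ^ 4 / 2 ^ j * Y (dyadic T j i) \<omega> ^ 4)" by simp
    qed
  qed (use mR in measurable)
  have b4: "expectation (\<lambda>\<omega>. R j \<omega> ^ 4) \<le> T ^ 4 * K" for j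
  proof -
    have "expectation (\<lambda>\<omega>. R j \<omega> ^ 4) \<le> expectation (\<lambda>\<omega>. \<Sum>i<2^j. T ^ 4 / 2 ^ j * Y (dyadic T j i) \<omega> ^ 4)"
      by (rule integral_mono[OF i4 iB le])
    also have "\<dots> = (\<Sum>i<2^j. T ^ 4 / 2 ^ j * expectation (\<lambda>\<omega>. Y (dyadic T j i) \<omega> ^ 4))"
      by (subst Bochner_Integration.integral_sum) (use mD in auto)
    also have "\<dots> \<le> (\<Sum>i<2^j::nat. T ^ 4 / 2 ^ j * K)"
      by (intro sum_mono mult_left_mono mD) auto
    finally show ?thesis by simp
  qed
  have limR: "AE \<omega> in M. (\<lambda>j. R j \<omega>) \<longlonglongrightarrow> J \<omega>" unfolding R_def by (rule lim)
  note r = tendsto_second_moment_of_bounded_fourth[OF mR mJ i4 b4 limR]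
  show "integrable M (\<lambda>\<omega>. J \<omega> ^ 4)" "expectation (\<lambda>\<omega>. J \<omega> ^ 4) \<le> T ^ 4 * K" by (rule r)+
  have "expectation (R j) = (\<Sum>i<2^j. expectation (Y (dyadic T j i)) * (T / 2 ^ j))" for j
    unfolding R_def
    by (subst Bochner_Integration.integral_sum) (use integrable_of_power4(1)[OF mD(1,2)] in auto)
  then show "(\<lambda>j. \<Sum>i<2^j. expectation (Y (dyadic T j i)) * (T / 2 ^ j)) \<longlonglongrightarrow> expectation J"
    using r(5) by simp
qed

text \<open>For a deterministic integrand the sums have explicit exponential moments, and these
  bound the eighth moments. Eighth moments of \<open>X\<close> correspond to fourth moments of the
  quadratic statistics that make up the information.\<close>

lemma (in adapted_brownian_motion) wiener_integral_moments:
  fixes \<phi> :: "real \<Rightarrow> real"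
  assumes t: "0 \<le> t" and \<phi>: "continuous_on {0..t} \<phi>" "\<And>s. s \<in> {0..t} \<Longrightarrow> \<bar>\<phi> s\<bar> \<le> B"
    and X: "X \<in> borel_measurable M" and lim: "AE \<omega> in M. dyadic_stieltjes_sum t \<phi> (\<lambda>s. w s \<omega>) \<longlonglongrightarrow> X \<omega>"
  shows "integrable M (\<lambda>\<omega>. X \<omega> ^ 8)" "expectation (\<lambda>\<omega>. X \<omega> ^ 8) \<le> 2 * 8 ^ 8 * exp (B\<^sup>2 * t / 2)"
    "expectation (\<lambda>\<omega>. (X \<omega>)\<^sup>2) = integral {0..t} (\<lambda>s. (\<phi> s)\<^sup>2)"
proof -
  define S where "S = (\<lambda>j. dyadic_ito_sum t (\<lambda>s \<omega>. \<phi> s) j)"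
  have lim: "AE \<omega> in M. (\<lambda>j. S j \<omega>) \<longlonglongrightarrow> X \<omega>"
    using lim unfolding S_def dyadic_ito_sum_stieltjes .
  have step: "0 \<le> dyadic t j i" "dyadic t j i \<le> dyadic t j (Suc i)" for j i
    using t by (auto intro: dyadic_nonneg dyadic_mono)
  have Se: "S j \<omega> = (\<Sum>i<2^j. \<phi> (dyadic t j i) * incr (dyadic t j i) (dyadic t j (Suc i)) \<omega>)" for j \<omega>
    by (simp add: S_def dyadic_ito_sum_def)
  have mS: "S j \<in> borel_measurable M" for j
    unfolding Se[abs_def] by (intro borel_measurable_sum borel_measurable_times borel_measurable_const incr_M step)
  have mgf: "integrable M (\<lambda>\<omega>. exp (c * S j \<omega>))" "expectation (\<lambda>\<omega>. exp (c * S j \<omega>)) \<le> exp (B\<^sup>2 * t / 2)" if "\<bar>c\<bar> = 1" for c j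
  proof -
    have c2: "c\<^sup>2 = 1" using that by (metis abs_1 power2_abs power_one)
    have e: "c * S j \<omega> = (\<Sum>i<2^j. (c * \<phi> (dyadic t j i)) * incr (dyadic t j i) (dyadic t j (Suc i)) \<omega>)" for \<omega>
      unfolding Se sum_distrib_left by (simp add: mult.assoc)
    note w = wiener_sum_mgf[of "dyadic t j" "2^j" "\<lambda>i. c * \<phi> (dyadic t j i)", OF step(1) step(2)]
    show "integrable M (\<lambda>\<omega>. exp (c * S j \<omega>))" unfolding e using w by blast
    have "expectation (\<lambda>\<omega>. exp (c * S j \<omega>)) = exp ((\<Sum>i<2^j. (c * \<phi> (dyadic t j i))\<^sup>2 * (t / 2 ^ j)) / 2)"
      unfolding e using w by (simp only: dyadic_step)
    also have "(\<Sum>i<2^j. (c * \<phi> (dyadic t j i))\<^sup>2 * (t / 2 ^ j)) \<le> (\<Sum>i<2^j::nat. B\<^sup>2 * (t / 2 ^ j))"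
    proof (intro sum_mono mult_right_mono)
      fix i assume "i \<in> {..<2^j::nat}"
      then have "\<bar>\<phi> (dyadic t j i)\<bar> \<le> B" by (intro \<phi> dyadic_in t) auto
      then have "\<bar>\<phi> (dyadic t j i)\<bar>\<^sup>2 \<le> B\<^sup>2" by (intro power_mono) auto
      then show "(c * \<phi> (dyadic t j i))\<^sup>2 \<le> B\<^sup>2" by (simp add: power_mult_distrib c2)
    qed (use t in simp)
    also have "\<dots> = B\<^sup>2 * t" by simp
    finally show "expectation (\<lambda>\<omega>. exp (c * S j \<omega>)) \<le> exp (B\<^sup>2 * t / 2)" by simp
  qed
  have iE: "integrable M (\<lambda>\<omega>. 8 ^ 8 * (exp (1 * S j \<omega>) + exp (- 1 * S j \<omega>)))" for j
    by (intro integrable_mult_right Bochner_Integration.integrable_add mgf) auto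
  have le: "S j \<omega> ^ 8 \<le> 8 ^ 8 * (exp (1 * S j \<omega>) + exp (- 1 * S j \<omega>))" for j \<omega>
    using power8_le_exp[of "S j \<omega>"] by simp
  have i8: "integrable M (\<lambda>\<omega>. S j \<omega> ^ 8)" for j
  proof (rule Bochner_Integration.integrable_bound[OF iE])
    show "AE \<omega> in M. norm (S j \<omega> ^ 8) \<le> norm (8 ^ 8 * (exp (1 * S j \<omega>) + exp (- 1 * S j \<omega>)))"
    proof (intro AE_I2)
      fix \<omega>
      have "norm (S j \<omega> ^ 8) = S j \<omega> ^ 8" by simp
      also note le[of j \<omega>]
      also note abs_ge_self
      finally show "norm (S j \<omega> ^ 8) \<le> norm (8 ^ 8 * (exp (1 * S j \<omega>) + exp (- 1 * S j \<omega>)))" by simp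
    qed
  qed (use mS in measurable)
  have b8: "expectation (\<lambda>\<omega>. S j \<omega> ^ 8) \<le> 2 * 8 ^ 8 * exp (B\<^sup>2 * t / 2)" for j
  proof -
    have "expectation (\<lambda>\<omega>. S j \<omega> ^ 8) \<le> expectation (\<lambda>\<omega>. 8 ^ 8 * (exp (1 * S j \<omega>) + exp (- 1 * S j \<omega>)))"
      by (rule integral_mono[OF i8 iE le])
    also have "\<dots> = 8 ^ 8 * (expectation (\<lambda>\<omega>. exp (1 * S j \<omega>)) + expectation (\<lambda>\<omega>. exp (- 1 * S j \<omega>)))"
      using mgf(1)[of 1 j] mgf(1)[of "- 1" j] by simp
    also have "\<dots> \<le> 8 ^ 8 * (exp (B\<^sup>2 * t / 2) + exp (B\<^sup>2 * t / 2))"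
      by (intro mult_left_mono add_mono mgf) auto
    finally show ?thesis by simp
  qed
  have lim8: "AE \<omega> in M. (\<lambda>j. S j \<omega> ^ 8) \<longlonglongrightarrow> X \<omega> ^ 8"
    using lim by eventually_elim (intro tendsto_intros)
  show "integrable M (\<lambda>\<omega>. X \<omega> ^ 8)" "expectation (\<lambda>\<omega>. X \<omega> ^ 8) \<le> 2 * 8 ^ 8 * exp (B\<^sup>2 * t / 2)"
    by (rule integral_Fatou_bound[OF i8 _ b8 _ lim8]; use X in simp)+
  note i4 = fourth_moment_of_eighth[OF mS i8 b8]
  note r = tendsto_second_moment_of_bounded_fourth[OF mS X i4 lim]
  have S2: "expectation (\<lambda>\<omega>. (S j \<omega>)\<^sup>2) = (\<Sum>i<2^j. (\<phi> (dyadic t j i))\<^sup>2 * (t / 2 ^ j))" for j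
  proof -
    have "expectation (\<lambda>\<omega>. (S j \<omega>)\<^sup>2) = (\<Sum>i<2^j. expectation (\<lambda>\<omega>. (\<phi> (dyadic t j i))\<^sup>2) * (dyadic t j (Suc i) - dyadic t j i))"
      unfolding Se
    proof (rule ito_isometry_disjoint(2))
      fix i k :: nat assume "i \<noteq> k"
      then consider "Suc i \<le> k" | "Suc k \<le> i" by linarith
      then show "dyadic t j (Suc i) \<le> dyadic t j k \<or> dyadic t j (Suc k) \<le> dyadic t j i"
        by cases (auto intro: dyadic_mono[OF t])
    qed (use step in auto)
    then show ?thesis by (simp add: dyadic_step prob_space)
  qed
  have "(\<lambda>j. expectation (\<lambda>\<omega>. (S j \<omega>)\<^sup>2)) \<longlonglongrightarrow> integral {0..t} (\<lambda>s. (\<phi> s)\<^sup>2)"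
    unfolding S2 by (rule dyadic_Riemann_sum_tendsto[OF t]) (intro continuous_intros \<phi>)
  with r(3) show "expectation (\<lambda>\<omega>. (X \<omega>)\<^sup>2) = integral {0..t} (\<lambda>s. (\<phi> s)\<^sup>2)"
    by (rule LIMSEQ_unique)
qed

lemma integral_reflect_interval:
  fixes f :: "real \<Rightarrow> real"
  shows "integral {0..t} (\<lambda>s. f (t - s)) = integral {0..t} f"
proof -
  have "integral {0..t} (\<lambda>s. f (t - s)) = integral {- t..- 0} (\<lambda>s. f (t - (- s)))"
    using Henstock_Kurzweil_Integration.integral_reflect_real[of t 0 "\<lambda>s. f (t - s)"] by simp
  also have "\<dots> = integral {- t..0} (f \<circ> (+) t)" by (simp add: comp_def)
  also have "\<dots> = integral {0..t} f" unfolding integral_shift_Icc_real by simp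
  finally show ?thesis .
qed

section \<open>One Fourier mode\<close>

text \<open>One Fourier mode. For mode \<open>k\<close> the stiffness is \<open>a =
  \<theta>\<^sub>1 k\<^sup>2\<close> and the damping is \<open>b =
  \<theta>\<^sub>2\<close>.\<close>

locale wave_mode = adapted_brownian_motion M F w for M :: "'a measure" and F w +
  fixes T a b :: real and u v :: "real \<Rightarrow> 'a \<Rightarrow> real" and g g' :: "real \<Rightarrow> real"
  assumes T: "0 < T" and a: "0 < a"
    and adapted_u: "adapted F {0..T} u" and adapted_v: "adapted F {0..T} v"
    and cont: "AE \<omega> in M. continuous_on {0..T} (\<lambda>t. u t \<omega>) \<and> continuous_on {0..T} (\<lambda>t. v t \<omega>)"
    and eqs: "AE \<omega> in M. \<forall>t\<in>{0..T}. u t \<omega> = integral {0..t} (\<lambda>s. v s \<omega>) \<and>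
       v t \<omega> = - a * integral {0..t} (\<lambda>s. u s \<omega>) + b * integral {0..t} (\<lambda>s. v s \<omega>) + w t \<omega>"
    and kernel: "oscillator_kernel a b g g'"
begin

lemma T0: "0 \<le> T" using T by simp

text \<open>Treating all linear combinations of \<open>u\<close> and \<open>v\<close> at once
  gives covariances by polarization.\<close>

definition X :: "real \<Rightarrow> real \<Rightarrow> real \<Rightarrow> 'a \<Rightarrow> real" where
  "X \<alpha> \<beta> t \<omega> = \<alpha> * u t \<omega> + \<beta> * v t \<omega>"

definition \<phi> :: "real \<Rightarrow> real \<Rightarrow> real \<Rightarrow> real" where
  "\<phi> \<alpha> \<beta> s = \<alpha> * g s + \<beta> * g' s"

lemma u_F: "t \<in> {0..T} \<Longrightarrow> u t \<in> borel_measurable (F t)" and v_F: "t \<in> {0..T} \<Longrightarrow> v t \<in> borel_measurable (F t)"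
  using adapted_u adapted_v by (auto simp: adapted_def)

lemma X_F: "t \<in> {0..T} \<Longrightarrow> X \<alpha> \<beta> t \<in> borel_measurable (F t)"
  unfolding X_def using u_F v_F by measurable

lemma X_M: "t \<in> {0..T} \<Longrightarrow> X \<alpha> \<beta> t \<in> borel_measurable M"
  by (rule borel_measurable_F_M[OF _ X_F]) auto

lemma X_continuous: "AE \<omega> in M. continuous_on {0..T} (\<lambda>t. X \<alpha> \<beta> t \<omega>)"
  using cont by eventually_elim (auto simp: X_def intro!: continuous_intros)

text \<open>The kernel \<open>\<phi>\<close> solves the homogeneous equation with \<open>\<phi>(0)
  = \<beta>\<close> and \<open>\<phi>'(0) = \<alpha> + b \<beta>\<close>, exactly the initial
  values for which Duhamel's formula returns \<open>\<alpha> u + \<beta> v\<close>.\<close>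

lemma X_wiener:
  "AE \<omega> in M. \<forall>t\<in>{0..T}. dyadic_stieltjes_sum t (\<lambda>r. \<phi> \<alpha> \<beta> (t - r)) (\<lambda>s. w s \<omega>) \<longlonglongrightarrow> X \<alpha> \<beta> t \<omega>"
proof -
  have w0: "AE \<omega> in M. w 0 \<omega> = 0" using brownian by (simp add: brownian_motion_def)
  define \<psi> where "\<psi> = (\<lambda>s. \<alpha> * g' s + \<beta> * (- a * g s + b * g' s))"
  note kd = oscillator_kernelD[OF kernel]
  have d\<phi>: "(\<phi> \<alpha> \<beta> has_real_derivative \<psi> s) (at s)" "(\<psi> has_real_derivative (- a * \<phi> \<alpha> \<beta> s + b * \<psi> s)) (at s)" for s
    unfolding \<phi>_def[abs_def] \<psi>_def
    by (auto intro!: derivative_eq_intros kd simp: algebra_simps)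
  have \<phi>0: "\<phi> \<alpha> \<beta> 0 = \<beta>" "\<psi> 0 - b * \<phi> \<alpha> \<beta> 0 = \<alpha>" by (auto simp: \<phi>_def \<psi>_def kd)
  show ?thesis
    using w0 cont eqs
  proof eventually_elim
    case (elim \<omega>)
    show ?case
    proof
      fix t assume t: "t \<in> {0..T}"
      have "dyadic_stieltjes_sum t (\<lambda>r. \<phi> \<alpha> \<beta> (t - r)) (\<lambda>s. w s \<omega>)
        \<longlonglongrightarrow> (\<psi> 0 - b * \<phi> \<alpha> \<beta> 0) * u t \<omega> + \<phi> \<alpha> \<beta> 0 * v t \<omega>"
        by (rule oscillator_stieltjes_representation[where T = T and a = a and b = b])
          (use elim t d\<phi> in auto)
      then show "dyadic_stieltjes_sum t (\<lambda>r. \<phi> \<alpha> \<beta> (t - r)) (\<lambda>s. w s \<omega>) \<longlonglongrightarrow> X \<alpha> \<beta> t \<omega>"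
        unfolding \<phi>0(2) unfolding \<phi>0(1) X_def .
    qed
  qed
qed

lemma \<phi>_continuous: "continuous_on S (\<phi> \<alpha> \<beta>)"
  unfolding \<phi>_def[abs_def] by (intro continuous_intros oscillator_kernelD[OF kernel])

lemma X_moments:
  assumes t: "t \<in> {0..T}" and B: "\<And>s. s \<in> {0..T} \<Longrightarrow> \<bar>\<phi> \<alpha> \<beta> s\<bar> \<le> B"
  shows "integrable M (\<lambda>\<omega>. X \<alpha> \<beta> t \<omega> ^ 8)" "expectation (\<lambda>\<omega>. X \<alpha> \<beta> t \<omega> ^ 8) \<le> 2 * 8 ^ 8 * exp (B\<^sup>2 * T / 2)"
    "expectation (\<lambda>\<omega>. (X \<alpha> \<beta> t \<omega>)\<^sup>2) = integral {0..t} (\<lambda>s. (\<phi> \<alpha> \<beta> s)\<^sup>2)"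
proof -
  have t0: "0 \<le> t" using t by simp
  have lim: "AE \<omega> in M. dyadic_stieltjes_sum t (\<lambda>r. \<phi> \<alpha> \<beta> (t - r)) (\<lambda>s. w s \<omega>) \<longlonglongrightarrow> X \<alpha> \<beta> t \<omega>"
    using X_wiener by eventually_elim (use t in blast)
  have c: "continuous_on {0..t} (\<lambda>r. \<phi> \<alpha> \<beta> (t - r))"
    by (intro continuous_on_compose2[OF \<phi>_continuous[of UNIV]] continuous_intros) auto
  note r = wiener_integral_moments[OF t0 c _ X_M[OF t] lim, of B]
  have b: "\<bar>\<phi> \<alpha> \<beta> (t - s)\<bar> \<le> B" if "s \<in> {0..t}" for s using that t by (intro B) auto
  show "integrable M (\<lambda>\<omega>. X \<alpha> \<beta> t \<omega> ^ 8)" by (rule r[OF b])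
  have "expectation (\<lambda>\<omega>. X \<alpha> \<beta> t \<omega> ^ 8) \<le> 2 * 8 ^ 8 * exp (B\<^sup>2 * t / 2)" by (rule r[OF b])
  also have "\<dots> \<le> 2 * 8 ^ 8 * exp (B\<^sup>2 * T / 2)"
  proof -
    have "B\<^sup>2 * t \<le> B\<^sup>2 * T" using t by (intro mult_left_mono) auto
    then show ?thesis by (simp del: mult_le_cancel_left)
  qed
  finally show "expectation (\<lambda>\<omega>. X \<alpha> \<beta> t \<omega> ^ 8) \<le> 2 * 8 ^ 8 * exp (B\<^sup>2 * T / 2)" .
  have "expectation (\<lambda>\<omega>. (X \<alpha> \<beta> t \<omega>)\<^sup>2) = integral {0..t} (\<lambda>s. (\<phi> \<alpha> \<beta> (t - s))\<^sup>2)" by (rule r[OF b])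
  also have "\<dots> = integral {0..t} (\<lambda>s. (\<phi> \<alpha> \<beta> s)\<^sup>2)"
    by (rule integral_reflect_interval[of t "\<lambda>s. (\<phi> \<alpha> \<beta> s)\<^sup>2"])
  finally show "expectation (\<lambda>\<omega>. (X \<alpha> \<beta> t \<omega>)\<^sup>2) = integral {0..t} (\<lambda>s. (\<phi> \<alpha> \<beta> s)\<^sup>2)" .
qed

lemma \<phi>_bounded: "\<exists>B. \<forall>s\<in>{0..T}. \<bar>\<phi> \<alpha> \<beta> s\<bar> \<le> B"
  using compact_imp_bounded[OF compact_continuous_image[OF \<phi>_continuous compact_Icc]]
  unfolding bounded_iff by auto

lemma X_fourth_moment_bounded:
  "\<exists>K. \<forall>t\<in>{0..T}. integrable M (\<lambda>\<omega>. X \<alpha> \<beta> t \<omega> ^ 4) \<and> expectation (\<lambda>\<omega>. X \<alpha> \<beta> t \<omega> ^ 4) \<le> K"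
proof -
  obtain B where B: "\<And>s. s \<in> {0..T} \<Longrightarrow> \<bar>\<phi> \<alpha> \<beta> s\<bar> \<le> B" using \<phi>_bounded by blast
  show ?thesis
    using fourth_moment_of_eighth[OF X_M X_moments(1)[OF _ B] X_moments(2)[OF _ B]] by blast
qed

text \<open>The second moment is of order \<open>(t - s)\<^sup>2\<close>; the factor
  \<open>T\<close> absorbs one of the two powers, to match the order of the Brownian
  increment.\<close>

lemma time_integral_increment:
  assumes st: "0 \<le> s" "s \<le> t" "t \<le> T"
    and K: "\<And>r. r \<in> {0..T} \<Longrightarrow> integrable M (\<lambda>\<omega>. X \<alpha> \<beta> r \<omega> ^ 4) \<and> expectation (\<lambda>\<omega>. X \<alpha> \<beta> r \<omega> ^ 4) \<le> K"
  defines "J \<equiv> \<lambda>\<omega>. integral {s..t} (\<lambda>r. X \<alpha> \<beta> r \<omega>)"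
  shows "J \<in> borel_measurable M" "integrable M (\<lambda>\<omega>. (J \<omega>)\<^sup>2)" "expectation (\<lambda>\<omega>. (J \<omega>)\<^sup>2) \<le> sqrt K * T * (t - s)"
proof -
  have K0: "0 \<le> K" using K[of 0] T by (intro order_trans[OF _ K[of 0, THEN conjunct2]]) auto
  have sh: "integral {s..t} f = integral {0..t - s} (\<lambda>r. f (s + r))" for f :: "real \<Rightarrow> real"
    using integral_shift_Icc_real[of 0 "t - s" f s] by (simp add: comp_def)
  have ts: "0 \<le> t - s" using st by simp
  have inn: "s + r \<in> {0..T}" if "r \<in> {0..t - s}" for r using that st by auto
  have c: "AE \<omega> in M. continuous_on {0..t - s} (\<lambda>r. X \<alpha> \<beta> (s + r) \<omega>)"
    using X_continuous[of \<alpha> \<beta>]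
  proof eventually_elim
    case (elim \<omega>)
    show ?case by (rule continuous_on_compose2[OF elim]) (use st in \<open>auto intro!: continuous_intros\<close>)
  qed
  note r = time_integral_moments[OF ts complete_measure_M X_M[OF inn] K[OF inn, THEN conjunct1] K[OF inn, THEN conjunct2] c]
  have Je: "J = (\<lambda>\<omega>. integral {0..t - s} (\<lambda>r. X \<alpha> \<beta> (s + r) \<omega>))" unfolding J_def sh ..
  have JM: "J \<in> borel_measurable M" unfolding Je by (rule r(2))
  have J4: "integrable M (\<lambda>\<omega>. J \<omega> ^ 4)" unfolding Je by (rule r(3))
  have "expectation (\<lambda>\<omega>. J \<omega> ^ 4) \<le> (t - s) ^ 4 * K" unfolding Je by (rule r(4))
  also have "\<dots> = ((t - s)\<^sup>2 * sqrt K)\<^sup>2" using K0 by (simp add: power_mult_distrib)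
  finally have J4b: "expectation (\<lambda>\<omega>. J \<omega> ^ 4) \<le> ((t - s)\<^sup>2 * sqrt K)\<^sup>2" .
  show "J \<in> borel_measurable M" by (rule JM)
  show "integrable M (\<lambda>\<omega>. (J \<omega>)\<^sup>2)" by (rule integrable_of_power4(2)[OF JM J4])
  have "expectation (\<lambda>\<omega>. (J \<omega>)\<^sup>2) \<le> (t - s)\<^sup>2 * sqrt K"
    by (rule second_moment_le_of_fourth[OF JM J4 J4b]) (use K0 in simp)
  also have "\<dots> = (t - s) * (sqrt K * (t - s))" by (simp add: power2_eq_square)
  also have "\<dots> \<le> T * (sqrt K * (t - s))" using st K0 by (intro mult_right_mono) auto
  finally show "expectation (\<lambda>\<omega>. (J \<omega>)\<^sup>2) \<le> sqrt K * T * (t - s)" by (simp add: mult_ac)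
qed

text \<open>By the equations of motion the increment of \<open>X\<close> is the time integral of
  another combination of \<open>u\<close> and \<open>v\<close> plus \<open>\<beta>\<close> times
  the increment of \<open>w\<close>.\<close>

lemma X_increment:
  "\<exists>C. \<forall>s t. 0 \<le> s \<longrightarrow> s \<le> t \<longrightarrow> t \<le> T \<longrightarrow> expectation (\<lambda>\<omega>. (X \<alpha> \<beta> t \<omega> - X \<alpha> \<beta> s \<omega>)\<^sup>2) \<le> C * (t - s)"
proof -
  \<comment> \<open>The drift of \<open>\<alpha> u + \<beta> v\<close> is \<open>\<alpha> v +
    \<beta> (- a u + b v)\<close>.\<close>
  define \<alpha>' \<beta>' where "\<alpha>' = - \<beta> * a" and "\<beta>' = \<alpha> + \<beta> * b"
  obtain K where K: "\<And>r. r \<in> {0..T} \<Longrightarrow> integrable M (\<lambda>\<omega>. X \<alpha>' \<beta>' r \<omega> ^ 4) \<and> expectation (\<lambda>\<omega>. X \<alpha>' \<beta>' r \<omega> ^ 4) \<le> K"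
    using X_fourth_moment_bounded by blast
  show ?thesis
  proof (intro exI[of _ "2 * (sqrt K * T) + 2 * \<beta>\<^sup>2"] allI impI)
    fix s t assume st: "0 \<le> s" "s \<le> t" "t \<le> T"
    define J where "J = (\<lambda>\<omega>. integral {s..t} (\<lambda>r. X \<alpha>' \<beta>' r \<omega>))"
    have j: "J \<in> borel_measurable M" "integrable M (\<lambda>\<omega>. (J \<omega>)\<^sup>2)" "expectation (\<lambda>\<omega>. (J \<omega>)\<^sup>2) \<le> sqrt K * T * (t - s)"
      unfolding J_def by (rule time_integral_increment[OF st K], assumption)+
    have eq: "AE \<omega> in M. X \<alpha> \<beta> t \<omega> - X \<alpha> \<beta> s \<omega> = J \<omega> + \<beta> * incr s t \<omega>"
      using cont eqs
    proof eventually_elim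
      case (elim \<omega>)
      have i: "(\<lambda>t. u t \<omega>) integrable_on {0..T}" "(\<lambda>t. v t \<omega>) integrable_on {0..T}"
        using elim by (auto intro: integrable_continuous_real)
      have ist: "(\<lambda>t. u t \<omega>) integrable_on {s..t}" "(\<lambda>t. v t \<omega>) integrable_on {s..t}"
        "(\<lambda>t. u t \<omega>) integrable_on {0..t}" "(\<lambda>t. v t \<omega>) integrable_on {0..t}"
        using st by (auto intro: integrable_subinterval_real[OF i(1)] integrable_subinterval_real[OF i(2)])
      have sp: "integral {0..t} (\<lambda>r. u r \<omega>) = integral {0..s} (\<lambda>r. u r \<omega>) + integral {s..t} (\<lambda>r. u r \<omega>)"
        "integral {0..t} (\<lambda>r. v r \<omega>) = integral {0..s} (\<lambda>r. v r \<omega>) + integral {s..t} (\<lambda>r. v r \<omega>)"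
        using st ist by (auto simp: Henstock_Kurzweil_Integration.integral_combine)
      have J: "J \<omega> = \<alpha>' * integral {s..t} (\<lambda>r. u r \<omega>) + \<beta>' * integral {s..t} (\<lambda>r. v r \<omega>)"
        unfolding J_def X_def using ist
        by (subst Henstock_Kurzweil_Integration.integral_add) (auto intro: integrable_on_mult_right)
      have e: "u t \<omega> = integral {0..t} (\<lambda>r. v r \<omega>)" "u s \<omega> = integral {0..s} (\<lambda>r. v r \<omega>)"
        "v t \<omega> = - a * integral {0..t} (\<lambda>r. u r \<omega>) + b * integral {0..t} (\<lambda>r. v r \<omega>) + w t \<omega>"
        "v s \<omega> = - a * integral {0..s} (\<lambda>r. u r \<omega>) + b * integral {0..s} (\<lambda>r. v r \<omega>) + w s \<omega>"
        using elim st by auto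
      have d: "u t \<omega> - u s \<omega> = integral {s..t} (\<lambda>r. v r \<omega>)"
        "v t \<omega> - v s \<omega> = - a * integral {s..t} (\<lambda>r. u r \<omega>) + b * integral {s..t} (\<lambda>r. v r \<omega>) + incr s t \<omega>"
        using e sp by (simp_all add: incr_def algebra_simps)
      have dX: "X \<alpha> \<beta> t \<omega> - X \<alpha> \<beta> s \<omega> = \<alpha> * (u t \<omega> - u s \<omega>) + \<beta> * (v t \<omega> - v s \<omega>)"
        by (simp add: X_def algebra_simps)
      show ?case unfolding dX d J \<alpha>'_def \<beta>'_def by (simp add: algebra_simps)
    qed
    have mX: "X \<alpha> \<beta> t \<in> borel_measurable M" "X \<alpha> \<beta> s \<in> borel_measurable M" using st by (auto intro: X_M)
    have mI: "incr s t \<in> borel_measurable M" using st by (intro incr_M) auto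
    have "expectation (\<lambda>\<omega>. (X \<alpha> \<beta> t \<omega> - X \<alpha> \<beta> s \<omega>)\<^sup>2) = expectation (\<lambda>\<omega>. (J \<omega> + \<beta> * incr s t \<omega>)\<^sup>2)"
      by (rule integral_cong_AE) (use mX mI j(1) eq in \<open>auto elim!: eventually_mono\<close>)
    also have "\<dots> \<le> expectation (\<lambda>\<omega>. 2 * (J \<omega>)\<^sup>2 + 2 * (\<beta>\<^sup>2 * (incr s t \<omega>)\<^sup>2))"
    proof (rule integral_mono')
      show "integrable M (\<lambda>\<omega>. 2 * (J \<omega>)\<^sup>2 + 2 * (\<beta>\<^sup>2 * (incr s t \<omega>)\<^sup>2))"
        using j(2) incr_moments(1)[OF st(1,2), of 2] by simp
      show "(J \<omega> + \<beta> * incr s t \<omega>)\<^sup>2 \<le> 2 * (J \<omega>)\<^sup>2 + 2 * (\<beta>\<^sup>2 * (incr s t \<omega>)\<^sup>2)" for \<omega>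
        using sum_squares_bound[of "J \<omega>" "\<beta> * incr s t \<omega>"] by (simp add: power2_sum power_mult_distrib)
    qed simp
    also have "\<dots> = 2 * expectation (\<lambda>\<omega>. (J \<omega>)\<^sup>2) + 2 * (\<beta>\<^sup>2 * (t - s))"
      using j(2) incr_moments(1)[OF st(1,2), of 2] incr_moments(3)[OF st(1,2)] by simp
    also have "\<dots> \<le> 2 * (sqrt K * T * (t - s)) + 2 * (\<beta>\<^sup>2 * (t - s))" using j(3) by simp
    finally show "expectation (\<lambda>\<omega>. (X \<alpha> \<beta> t \<omega> - X \<alpha> \<beta> s \<omega>)\<^sup>2) \<le> (2 * (sqrt K * T) + 2 * \<beta>\<^sup>2) * (t - s)"
      by (simp add: algebra_simps)
  qed
qed

lemma X_ito_regular:
  assumes "\<And>t. t \<in> {0..T} \<Longrightarrow> expectation (\<lambda>\<omega>. X \<alpha> \<beta> t \<omega> ^ 4) \<le> K"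
  obtains C where "ito_regular T (X \<alpha> \<beta>) K C"
proof -
  obtain C where "\<forall>s t. 0 \<le> s \<longrightarrow> s \<le> t \<longrightarrow> t \<le> T \<longrightarrow> expectation (\<lambda>\<omega>. (X \<alpha> \<beta> t \<omega> - X \<alpha> \<beta> s \<omega>)\<^sup>2) \<le> C * (t - s)"
    using X_increment by blast
  then have "ito_regular T (X \<alpha> \<beta>) K C"
    unfolding ito_regular_def using X_F X_fourth_moment_bounded[of \<alpha> \<beta>] assms by blast
  then show ?thesis by (rule that)
qed

end

section \<open>Independence of completed sigma-algebras\<close>

text \<open>The null sets make functionals of \<open>f\<close> that are defined only almost
  surely, such as stochastic integrals, measurable.\<close>

definition completed_vimage_algebra :: "'a measure \<Rightarrow> 'b measure \<Rightarrow> ('a \<Rightarrow> 'b) \<Rightarrow> 'a measure" where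
  "completed_vimage_algebra M N f = sigma (space M)
     ({f -` B \<inter> space M | B. B \<in> sets N} \<union> {A. \<exists>Z\<in>null_sets M. A \<subseteq> Z})"

text \<open>Up to a null set, each set of the completed algebra is a preimage under
  \<open>f\<close>: this property passes to complements and to countable unions.\<close>

lemma (in complete_measure) completed_vimage_algebra:
  assumes f: "f \<in> measurable M N"
  shows "null_complete_subalgebra M (completed_vimage_algebra M N f)"
    "f \<in> measurable (completed_vimage_algebra M N f) N"
    "A \<in> sets (completed_vimage_algebra M N f) \<Longrightarrow> \<exists>B\<in>sets N. AE x in M. x \<in> A \<longleftrightarrow> f x \<in> B"
proof -
  let ?A = "{f -` B \<inter> space M | B. B \<in> sets N} \<union> {A. \<exists>Z\<in>null_sets M. A \<subseteq> Z}"
  have AM: "?A \<subseteq> sets M" using f complete2 by (auto intro: measurable_sets)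
  then have Pow: "?A \<subseteq> Pow (space M)" using sets.space_closed by blast
  have sets: "sets (completed_vimage_algebra M N f) = sigma_sets (space M) ?A"
    unfolding completed_vimage_algebra_def by (rule sets_measure_of[OF Pow])
  have sp: "space (completed_vimage_algebra M N f) = space M"
    unfolding completed_vimage_algebra_def by (rule space_measure_of[OF Pow])
  show "null_complete_subalgebra M (completed_vimage_algebra M N f)"
    unfolding null_complete_subalgebra_def subalgebra_def sets sp
    using sets.sigma_sets_subset[OF AM] by (auto intro!: sigma_sets.Basic)
  show "f \<in> measurable (completed_vimage_algebra M N f) N"
  proof (rule measurableI)
    show "x \<in> space (completed_vimage_algebra M N f) \<Longrightarrow> f x \<in> space N" for x
      using measurable_space[OF f] by (simp add: sp)
    show "B \<in> sets N \<Longrightarrow> f -` B \<inter> space (completed_vimage_algebra M N f) \<in> sets (completed_vimage_algebra M N f)" for B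
      unfolding sets sp by (rule sigma_sets.Basic) auto
  qed
  show "\<exists>B\<in>sets N. AE x in M. x \<in> A \<longleftrightarrow> f x \<in> B" if "A \<in> sets (completed_vimage_algebra M N f)"
    using that unfolding sets
  proof induction
    case (Basic A)
    then show ?case
    proof
      assume "A \<in> {f -` B \<inter> space M | B. B \<in> sets N}"
      then obtain B where "B \<in> sets N" "A = f -` B \<inter> space M" by auto
      then show ?thesis by (intro bexI[of _ B]) (auto intro!: AE_I2)
    next
      assume "A \<in> {A. \<exists>Z\<in>null_sets M. A \<subseteq> Z}"
      then obtain Z where Z: "Z \<in> null_sets M" "A \<subseteq> Z" by auto
      have "AE x in M. x \<notin> Z" by (rule AE_not_in[OF Z(1)])
      then have "AE x in M. x \<in> A \<longleftrightarrow> f x \<in> {}" by eventually_elim (use Z in auto)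
      then show ?thesis by (intro bexI[of _ "{}"]) auto
    qed
  next
    case Empty
    show ?case by (intro bexI[of _ "{}"]) auto
  next
    case (Compl A)
    then obtain B where B: "B \<in> sets N" "AE x in M. x \<in> A \<longleftrightarrow> f x \<in> B" by auto
    have "AE x in M. x \<in> space M - A \<longleftrightarrow> f x \<in> space N - B"
      using B(2) AE_space by eventually_elim (use measurable_space[OF f] in auto)
    then show ?case using B(1) by (intro bexI[of _ "space N - B"]) auto
  next
    case (Union A)
    then have "\<forall>i. \<exists>B\<in>sets N. AE x in M. x \<in> A i \<longleftrightarrow> f x \<in> B" by auto
    then obtain B where B: "\<And>i. B i \<in> sets N" "\<And>i. AE x in M. x \<in> A i \<longleftrightarrow> f x \<in> B i" by metis
    have "AE x in M. \<forall>i. x \<in> A i \<longleftrightarrow> f x \<in> B i" using B(2) by (simp add: AE_all_countable)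
    then have "AE x in M. x \<in> (\<Union>i. A i) \<longleftrightarrow> f x \<in> (\<Union>i. B i)" by eventually_elim auto
    then show ?case using B(1) by (intro bexI[of _ "\<Union>i. B i"]) auto
  qed
qed

text \<open>Probabilities ignore null sets, so each set of a completed algebra may be replaced by
  the preimage that it equals almost surely.\<close>

lemma (in prob_space) indep_sets_completed_vimage_algebra:
  assumes cM: "complete_measure M" and ind: "indep_vars (\<lambda>_. N) f I"
  shows "indep_sets (\<lambda>k. sets (completed_vimage_algebra M N (f k))) I"
proof (rule indep_setsI)
  have f: "f k \<in> measurable M N" if "k \<in> I" for k using ind that by (auto simp: indep_vars_def)
  note c = complete_measure.completed_vimage_algebra[OF cM f]
  show sub: "sets (completed_vimage_algebra M N (f k)) \<subseteq> events" if "k \<in> I" for k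
    using c(1)[OF that] by (simp add: null_complete_subalgebra_def subalgebra_def)
  fix A J assume J: "J \<noteq> {}" "J \<subseteq> I" "finite J" and A: "\<forall>k\<in>J. A k \<in> sets (completed_vimage_algebra M N (f k))"
  have "\<forall>k\<in>J. \<exists>B\<in>sets N. AE x in M. x \<in> A k \<longleftrightarrow> f k x \<in> B"
    using c(3) A J(2) by blast
  then obtain B where B: "\<And>k. k \<in> J \<Longrightarrow> B k \<in> sets N" "\<And>k. k \<in> J \<Longrightarrow> AE x in M. x \<in> A k \<longleftrightarrow> f k x \<in> B k" by metis
  have AM: "A k \<in> events" if "k \<in> J" for k using sub A J(2) that by blast
  have BM: "f k -` B k \<inter> space M \<in> events" if "k \<in> J" for k using measurable_sets[OF f B(1)] J(2) that by blast
  have ae: "AE x in M. \<forall>k\<in>J. x \<in> A k \<longleftrightarrow> f k x \<in> B k" using B(2) J(3) by (intro AE_finite_allI) auto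
  have "prob (\<Inter>k\<in>J. A k) = prob (\<Inter>k\<in>J. f k -` B k \<inter> space M)"
  proof (rule finite_measure_eq_AE)
    show "AE x in M. x \<in> (\<Inter>k\<in>J. A k) \<longleftrightarrow> x \<in> (\<Inter>k\<in>J. f k -` B k \<inter> space M)"
      using ae AE_space by eventually_elim (use J(1) in auto)
    show "(\<Inter>k\<in>J. f k -` B k \<inter> space M) \<in> events"
      by (rule sets.finite_INT[OF J(3,1) BM])
    show "(\<Inter>k\<in>J. A k) \<in> events" by (rule sets.finite_INT[OF J(3,1) AM])
  qed
  also have "\<dots> = (\<Prod>k\<in>J. prob (f k -` B k \<inter> space M))"
    using ind J B(1) unfolding indep_vars_def2 by (intro indep_setsD[of "\<lambda>i. {f i -` A \<inter> space M | A. A \<in> sets N}" I]) auto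
  also have "\<dots> = (\<Prod>k\<in>J. prob (A k))"
  proof (rule prod.cong[OF refl])
    fix k assume k: "k \<in> J"
    show "prob (f k -` B k \<inter> space M) = prob (A k)"
    proof (rule finite_measure_eq_AE[OF _ BM[OF k] AM[OF k]])
      show "AE x in M. x \<in> f k -` B k \<inter> space M \<longleftrightarrow> x \<in> A k"
        using B(2)[OF k] AE_space by eventually_elim auto
    qed
  qed
  finally show "prob (\<Inter>k\<in>J. A k) = (\<Prod>k\<in>J. prob (A k))" .
qed

lemma (in prob_space) indep_vars_of_indep_sets:
  fixes X :: "'i \<Rightarrow> 'a \<Rightarrow> real"
  assumes ind: "indep_sets (\<lambda>k. sets (G k)) I" and G: "\<And>k. k \<in> I \<Longrightarrow> subalgebra M (G k)"
    and X: "\<And>k. k \<in> I \<Longrightarrow> X k \<in> borel_measurable (G k)"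
  shows "indep_vars (\<lambda>_. borel) X I"
  unfolding indep_vars_def2
proof (intro conjI ballI)
  show "random_variable borel (X k)" if "k \<in> I" for k by (rule measurable_from_subalg[OF G X]) fact+
  show "indep_sets (\<lambda>i. {X i -` A \<inter> space M | A. A \<in> sets borel}) I"
  proof (rule indep_sets_mono_sets[OF ind])
    fix k assume k: "k \<in> I"
    have "space (G k) = space M" using G[OF k] by (simp add: subalgebra_def)
    then show "{X k -` A \<inter> space M | A. A \<in> sets borel} \<subseteq> sets (G k)" using measurable_sets[OF X[OF k]] by auto
  qed
qed

section \<open>The statistics of one mode\<close>

context wave_mode begin

definition \<xi> :: "'a \<Rightarrow> real" where "\<xi> = ito_integral M F w T u"
definition \<eta> :: "'a \<Rightarrow> real" where "\<eta> = ito_integral M F w T v"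

lemma X_unit: "X 1 0 = u" "X 0 1 = v"
  by (auto simp: X_def fun_eq_iff)

lemma X_fourth_moment:
  assumes t: "t \<in> {0..T}" and B: "\<And>s. s \<in> {0..T} \<Longrightarrow> \<bar>\<phi> \<alpha> \<beta> s\<bar> \<le> B"
  shows "expectation (\<lambda>\<omega>. X \<alpha> \<beta> t \<omega> ^ 4) \<le> 2 * 8 ^ 8 * exp (B\<^sup>2 * T / 2) + 1"
  by (rule fourth_moment_of_eighth[OF X_M[OF t] X_moments(1)[OF t B] X_moments(2)[OF t B]])

lemma ito_measurable: "\<xi> \<in> borel_measurable M" "\<eta> \<in> borel_measurable M"
  and ito_limit: "AE \<omega> in M. (\<lambda>j. dyadic_ito_sum T u j \<omega>) \<longlonglongrightarrow> \<xi> \<omega>"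
    "AE \<omega> in M. (\<lambda>j. dyadic_ito_sum T v j \<omega>) \<longlonglongrightarrow> \<eta> \<omega>"
proof -
  have *: "ito_integral M F w T (X \<alpha> \<beta>) \<in> borel_measurable M \<and>
    (AE \<omega> in M. (\<lambda>j. dyadic_ito_sum T (X \<alpha> \<beta>) j \<omega>) \<longlonglongrightarrow> ito_integral M F w T (X \<alpha> \<beta>) \<omega>)" for \<alpha> \<beta>
  proof -
    obtain B where B: "\<And>s. s \<in> {0..T} \<Longrightarrow> \<bar>\<phi> \<alpha> \<beta> s\<bar> \<le> B" using \<phi>_bounded by blast
    obtain C where "ito_regular T (X \<alpha> \<beta>) (2 * 8 ^ 8 * exp (B\<^sup>2 * T / 2) + 1) C"
      using X_ito_regular[OF X_fourth_moment[OF _ B]] by blast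
    from ito_integral_dyadic_limit[OF T0 this X_continuous] show ?thesis by blast
  qed
  show "\<xi> \<in> borel_measurable M" "AE \<omega> in M. (\<lambda>j. dyadic_ito_sum T u j \<omega>) \<longlonglongrightarrow> \<xi> \<omega>"
    using *[of 1 0] unfolding X_unit \<xi>_def by blast+
  show "\<eta> \<in> borel_measurable M" "AE \<omega> in M. (\<lambda>j. dyadic_ito_sum T v j \<omega>) \<longlonglongrightarrow> \<eta> \<omega>"
    using *[of 0 1] unfolding X_unit \<eta>_def by blast+
qed

text \<open>Linearity of the integral, inherited from the dyadic sums.\<close>

lemma ito_combination_limit:
  "AE \<omega> in M. (\<lambda>j. dyadic_ito_sum T (X \<alpha> \<beta>) j \<omega>) \<longlonglongrightarrow> \<alpha> * \<xi> \<omega> + \<beta> * \<eta> \<omega>"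
  using ito_limit
proof eventually_elim
  case (elim \<omega>)
  have "dyadic_ito_sum T (X \<alpha> \<beta>) j \<omega> = \<alpha> * dyadic_ito_sum T u j \<omega> + \<beta> * dyadic_ito_sum T v j \<omega>" for j
    unfolding dyadic_ito_sum_def X_def sum_distrib_left sum.distrib[symmetric]
    by (intro sum.cong refl) (simp add: algebra_simps)
  then show ?case using elim by (auto intro!: tendsto_intros)
qed

lemma \<phi>_product_integral_continuous:
  "continuous_on {0..T} (\<lambda>t. integral {0..t} (\<lambda>s. \<phi> \<alpha> \<beta> s * \<phi> \<gamma> \<delta> s))"
  by (intro indefinite_integral_continuous_1 integrable_continuous_real continuous_intros \<phi>_continuous)

lemma ito_combination_moments:
  assumes B: "\<And>s. s \<in> {0..T} \<Longrightarrow> \<bar>\<phi> \<alpha> \<beta> s\<bar> \<le> B"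
  defines "K \<equiv> (2 * 8 ^ 8 * exp (B\<^sup>2 * T / 2) + 1) * exp (3 * T + 3 * T\<^sup>2)"
  shows "integrable M (\<lambda>\<omega>. (\<alpha> * \<xi> \<omega> + \<beta> * \<eta> \<omega>) ^ 4)" "expectation (\<lambda>\<omega>. (\<alpha> * \<xi> \<omega> + \<beta> * \<eta> \<omega>) ^ 4) \<le> K"
    "expectation (\<lambda>\<omega>. \<alpha> * \<xi> \<omega> + \<beta> * \<eta> \<omega>) = 0"
    "expectation (\<lambda>\<omega>. (\<alpha> * \<xi> \<omega> + \<beta> * \<eta> \<omega>)\<^sup>2) = integral {0..T} (\<lambda>t. integral {0..t} (\<lambda>s. (\<phi> \<alpha> \<beta> s)\<^sup>2))"
proof -
  obtain C where reg: "ito_regular T (X \<alpha> \<beta>) (2 * 8 ^ 8 * exp (B\<^sup>2 * T / 2) + 1) C"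
    using X_ito_regular[OF X_fourth_moment[OF _ B]] by blast
  have m: "(\<lambda>\<omega>. \<alpha> * \<xi> \<omega> + \<beta> * \<eta> \<omega>) \<in> borel_measurable M" using ito_measurable by measurable
  note r = ito_limit_moments[OF T0 reg m ito_combination_limit]
  show "integrable M (\<lambda>\<omega>. (\<alpha> * \<xi> \<omega> + \<beta> * \<eta> \<omega>) ^ 4)" "expectation (\<lambda>\<omega>. (\<alpha> * \<xi> \<omega> + \<beta> * \<eta> \<omega>) ^ 4) \<le> K"
    "expectation (\<lambda>\<omega>. \<alpha> * \<xi> \<omega> + \<beta> * \<eta> \<omega>) = 0"
    using r(1-3) unfolding K_def by blast+
  have "(\<Sum>i<2^j. expectation (\<lambda>\<omega>. (X \<alpha> \<beta> (dyadic T j i) \<omega>)\<^sup>2) * (T / 2 ^ j))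
     = (\<Sum>i<2^j. integral {0..dyadic T j i} (\<lambda>s. \<phi> \<alpha> \<beta> s * \<phi> \<alpha> \<beta> s) * (T / 2 ^ j))" for j
  proof (intro sum.cong refl)
    fix i assume "i \<in> {..<2^j::nat}"
    then have "expectation (\<lambda>\<omega>. (X \<alpha> \<beta> (dyadic T j i) \<omega>)\<^sup>2) = integral {0..dyadic T j i} (\<lambda>s. (\<phi> \<alpha> \<beta> s)\<^sup>2)"
      by (intro X_moments(3)[OF dyadic_in[OF T0] B]) auto
    then show "expectation (\<lambda>\<omega>. (X \<alpha> \<beta> (dyadic T j i) \<omega>)\<^sup>2) * (T / 2 ^ j) = integral {0..dyadic T j i} (\<lambda>s. \<phi> \<alpha> \<beta> s * \<phi> \<alpha> \<beta> s) * (T / 2 ^ j)"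
      by (simp only: power2_eq_square)
  qed
  moreover have "(\<lambda>j. \<Sum>i<2^j. integral {0..dyadic T j i} (\<lambda>s. \<phi> \<alpha> \<beta> s * \<phi> \<alpha> \<beta> s) * (T / 2 ^ j))
     \<longlonglongrightarrow> integral {0..T} (\<lambda>t. integral {0..t} (\<lambda>s. \<phi> \<alpha> \<beta> s * \<phi> \<alpha> \<beta> s))"
    by (rule dyadic_Riemann_sum_tendsto[OF T0 \<phi>_product_integral_continuous])
  ultimately show "expectation (\<lambda>\<omega>. (\<alpha> * \<xi> \<omega> + \<beta> * \<eta> \<omega>)\<^sup>2) = integral {0..T} (\<lambda>t. integral {0..t} (\<lambda>s. (\<phi> \<alpha> \<beta> s)\<^sup>2))"
    using LIMSEQ_unique[OF r(4)] by (simp add: power2_eq_square)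
qed

text \<open>Polarization of the variance formula.\<close>

lemma X_covariance:
  assumes t: "t \<in> {0..T}"
  shows "expectation (\<lambda>\<omega>. X \<alpha> \<beta> t \<omega> * X \<gamma> \<delta> t \<omega>) = integral {0..t} (\<lambda>s. \<phi> \<alpha> \<beta> s * \<phi> \<gamma> \<delta> s)"
proof -
  have sq: "integrable M (\<lambda>\<omega>. (X \<alpha> \<beta> t \<omega>)\<^sup>2)" "expectation (\<lambda>\<omega>. (X \<alpha> \<beta> t \<omega>)\<^sup>2) = integral {0..t} (\<lambda>s. (\<phi> \<alpha> \<beta> s)\<^sup>2)" for \<alpha> \<beta>
  proof -
    obtain B where B: "\<And>s. s \<in> {0..T} \<Longrightarrow> \<bar>\<phi> \<alpha> \<beta> s\<bar> \<le> B" using \<phi>_bounded by blast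
    show "expectation (\<lambda>\<omega>. (X \<alpha> \<beta> t \<omega>)\<^sup>2) = integral {0..t} (\<lambda>s. (\<phi> \<alpha> \<beta> s)\<^sup>2)" by (rule X_moments(3)[OF t B])
    show "integrable M (\<lambda>\<omega>. (X \<alpha> \<beta> t \<omega>)\<^sup>2)"
      using X_fourth_moment_bounded[of \<alpha> \<beta>] t integrable_of_power4(2)[OF X_M[OF t]] by blast
  qed
  have e: "X \<alpha> \<beta> t \<omega> * X \<gamma> \<delta> t \<omega> = ((X (\<alpha> + \<gamma>) (\<beta> + \<delta>) t \<omega>)\<^sup>2 - (X (\<alpha> - \<gamma>) (\<beta> - \<delta>) t \<omega>)\<^sup>2) / 4" for \<omega>
    by (simp add: X_def power2_eq_square algebra_simps)
  have f: "\<phi> \<alpha> \<beta> s * \<phi> \<gamma> \<delta> s = ((\<phi> (\<alpha> + \<gamma>) (\<beta> + \<delta>) s)\<^sup>2 - (\<phi> (\<alpha> - \<gamma>) (\<beta> - \<delta>) s)\<^sup>2) / 4" for s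
    by (simp add: \<phi>_def power2_eq_square algebra_simps)
  have i: "(\<lambda>s. (\<phi> \<alpha> \<beta> s)\<^sup>2) integrable_on {0..t}" for \<alpha> \<beta>
    by (intro integrable_continuous_real continuous_intros \<phi>_continuous)
  have "expectation (\<lambda>\<omega>. X \<alpha> \<beta> t \<omega> * X \<gamma> \<delta> t \<omega>) = (integral {0..t} (\<lambda>s. (\<phi> (\<alpha> + \<gamma>) (\<beta> + \<delta>) s)\<^sup>2) - integral {0..t} (\<lambda>s. (\<phi> (\<alpha> - \<gamma>) (\<beta> - \<delta>) s)\<^sup>2)) / 4"
    unfolding e using sq by simp
  also have "\<dots> = integral {0..t} (\<lambda>s. \<phi> \<alpha> \<beta> s * \<phi> \<gamma> \<delta> s)"
    unfolding f by (simp only: Henstock_Kurzweil_Integration.integral_divide Henstock_Kurzweil_Integration.integral_diff[OF i i])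
  finally show ?thesis .
qed

text \<open>The entries of the information of the mode are instances of \<open>Q\<close>, up to
  normalization.\<close>

definition Q :: "real \<Rightarrow> real \<Rightarrow> real \<Rightarrow> real \<Rightarrow> 'a \<Rightarrow> real" where
  "Q \<alpha> \<beta> \<gamma> \<delta> \<omega> = integral {0..T} (\<lambda>t. X \<alpha> \<beta> t \<omega> * X \<gamma> \<delta> t \<omega>)"

lemma time_product_moments:
  assumes B: "\<And>s. s \<in> {0..T} \<Longrightarrow> \<bar>\<phi> \<alpha> \<beta> s\<bar> \<le> B" "\<And>s. s \<in> {0..T} \<Longrightarrow> \<bar>\<phi> \<gamma> \<delta> s\<bar> \<le> B"
  shows "AE \<omega> in M. (\<lambda>j. \<Sum>i<2^j. (X \<alpha> \<beta> (dyadic T j i) \<omega> * X \<gamma> \<delta> (dyadic T j i) \<omega>) * (T / 2 ^ j)) \<longlonglongrightarrow> Q \<alpha> \<beta> \<gamma> \<delta> \<omega>"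
    "Q \<alpha> \<beta> \<gamma> \<delta> \<in> borel_measurable M" "integrable M (\<lambda>\<omega>. Q \<alpha> \<beta> \<gamma> \<delta> \<omega> ^ 4)"
    "expectation (\<lambda>\<omega>. Q \<alpha> \<beta> \<gamma> \<delta> \<omega> ^ 4) \<le> T ^ 4 * (2 * 8 ^ 8 * exp (B\<^sup>2 * T / 2))"
    "expectation (Q \<alpha> \<beta> \<gamma> \<delta>) = integral {0..T} (\<lambda>t. integral {0..t} (\<lambda>s. \<phi> \<alpha> \<beta> s * \<phi> \<gamma> \<delta> s))"
proof -
  define Y where "Y = (\<lambda>t \<omega>. X \<alpha> \<beta> t \<omega> * X \<gamma> \<delta> t \<omega>)"
  define K where "K = 2 * 8 ^ 8 * exp (B\<^sup>2 * T / 2)"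
  have mY: "Y t \<in> borel_measurable M" if "t \<in> {0..T}" for t unfolding Y_def
    by (intro borel_measurable_times X_M that)
  have Y4: "integrable M (\<lambda>\<omega>. Y t \<omega> ^ 4)" "expectation (\<lambda>\<omega>. Y t \<omega> ^ 4) \<le> K" if t: "t \<in> {0..T}" for t
  proof -
    note x = X_moments(1,2)[OF t B(1), folded K_def] and y = X_moments(1,2)[OF t B(2), folded K_def]
    have iB: "integrable M (\<lambda>\<omega>. (X \<alpha> \<beta> t \<omega> ^ 8 + X \<gamma> \<delta> t \<omega> ^ 8) / 2)" using x y by simp
    have le: "Y t \<omega> ^ 4 \<le> (X \<alpha> \<beta> t \<omega> ^ 8 + X \<gamma> \<delta> t \<omega> ^ 8) / 2" for \<omega>
      using sum_squares_bound[of "X \<alpha> \<beta> t \<omega> ^ 4" "X \<gamma> \<delta> t \<omega> ^ 4"] by (simp add: Y_def power_mult_distrib)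
    show i: "integrable M (\<lambda>\<omega>. Y t \<omega> ^ 4)"
    proof (rule Bochner_Integration.integrable_bound[OF iB])
      show "AE \<omega> in M. norm (Y t \<omega> ^ 4) \<le> norm ((X \<alpha> \<beta> t \<omega> ^ 8 + X \<gamma> \<delta> t \<omega> ^ 8) / 2)"
      proof (intro AE_I2)
        fix \<omega>
        have "norm (Y t \<omega> ^ 4) = Y t \<omega> ^ 4" by simp
        also note le[of \<omega>]
        also note abs_ge_self
        finally show "norm (Y t \<omega> ^ 4) \<le> norm ((X \<alpha> \<beta> t \<omega> ^ 8 + X \<gamma> \<delta> t \<omega> ^ 8) / 2)" by simp
      qed
    qed (use mY[OF t] in measurable)
    have "expectation (\<lambda>\<omega>. Y t \<omega> ^ 4) \<le> expectation (\<lambda>\<omega>. (X \<alpha> \<beta> t \<omega> ^ 8 + X \<gamma> \<delta> t \<omega> ^ 8) / 2)"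
      by (rule integral_mono[OF i iB le])
    also have "\<dots> = (expectation (\<lambda>\<omega>. X \<alpha> \<beta> t \<omega> ^ 8) + expectation (\<lambda>\<omega>. X \<gamma> \<delta> t \<omega> ^ 8)) / 2" using x y by simp
    also have "\<dots> \<le> K" using x(2) y(2) by simp
    finally show "expectation (\<lambda>\<omega>. Y t \<omega> ^ 4) \<le> K" .
  qed
  have c: "AE \<omega> in M. continuous_on {0..T} (\<lambda>t. Y t \<omega>)"
    using X_continuous[of \<alpha> \<beta>] X_continuous[of \<gamma> \<delta>] by eventually_elim (auto simp: Y_def intro!: continuous_intros)
  have Qe: "Q \<alpha> \<beta> \<gamma> \<delta> = (\<lambda>\<omega>. integral {0..T} (\<lambda>t. Y t \<omega>))" by (simp add: Q_def Y_def fun_eq_iff)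
  note r = time_integral_moments[OF T0 complete_measure_M mY Y4 c]
  show "AE \<omega> in M. (\<lambda>j. \<Sum>i<2^j. (X \<alpha> \<beta> (dyadic T j i) \<omega> * X \<gamma> \<delta> (dyadic T j i) \<omega>) * (T / 2 ^ j)) \<longlonglongrightarrow> Q \<alpha> \<beta> \<gamma> \<delta> \<omega>"
    using r(1) unfolding Qe Y_def .
  show "Q \<alpha> \<beta> \<gamma> \<delta> \<in> borel_measurable M" "integrable M (\<lambda>\<omega>. Q \<alpha> \<beta> \<gamma> \<delta> \<omega> ^ 4)"
    unfolding Qe by (rule r(2); assumption) (rule r(3); assumption)
  show "expectation (\<lambda>\<omega>. Q \<alpha> \<beta> \<gamma> \<delta> \<omega> ^ 4) \<le> T ^ 4 * (2 * 8 ^ 8 * exp (B\<^sup>2 * T / 2))"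
    unfolding Qe K_def[symmetric] by (rule r)
  have "(\<Sum>i<2^j. expectation (Y (dyadic T j i)) * (T / 2 ^ j))
     = (\<Sum>i<2^j. integral {0..dyadic T j i} (\<lambda>s. \<phi> \<alpha> \<beta> s * \<phi> \<gamma> \<delta> s) * (T / 2 ^ j))" for j
    unfolding Y_def by (intro sum.cong refl) (simp add: X_covariance[OF dyadic_in[OF T0]])
  moreover have "(\<lambda>j. \<Sum>i<2^j. integral {0..dyadic T j i} (\<lambda>s. \<phi> \<alpha> \<beta> s * \<phi> \<gamma> \<delta> s) * (T / 2 ^ j))
     \<longlonglongrightarrow> integral {0..T} (\<lambda>t. integral {0..t} (\<lambda>s. \<phi> \<alpha> \<beta> s * \<phi> \<gamma> \<delta> s))"
    by (rule dyadic_Riemann_sum_tendsto[OF T0 \<phi>_product_integral_continuous])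
  ultimately show "expectation (Q \<alpha> \<beta> \<gamma> \<delta>) = integral {0..T} (\<lambda>t. integral {0..t} (\<lambda>s. \<phi> \<alpha> \<beta> s * \<phi> \<gamma> \<delta> s))"
    unfolding Qe using LIMSEQ_unique[OF r(5)] by simp
qed

text \<open>All these variables are almost sure limits of expressions in finitely many values of
  the Brownian motion. For the completed \<open>\<sigma>\<close>-algebra generated by the path of
  \<open>w\<^sub>k\<close> this yields the independence of the modes.\<close>

lemma mode_measurable_subalgebra:
  assumes G: "null_complete_subalgebra M G" and w: "\<And>t. 0 \<le> t \<Longrightarrow> w t \<in> borel_measurable G"
  shows "\<xi> \<in> borel_measurable G" "\<eta> \<in> borel_measurable G" "Q \<alpha> \<beta> \<gamma> \<delta> \<in> borel_measurable G"
proof -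
  have X: "X \<alpha> \<beta> t \<in> borel_measurable G" if t: "t \<in> {0..T}" for \<alpha> \<beta> t
  proof (rule borel_measurable_AE_limit_subalgebra[OF G])
    show "AE \<omega> in M. (\<lambda>j. dyadic_stieltjes_sum t (\<lambda>r. \<phi> \<alpha> \<beta> (t - r)) (\<lambda>s. w s \<omega>) j) \<longlonglongrightarrow> X \<alpha> \<beta> t \<omega>"
      using X_wiener by eventually_elim (use t in blast)
    show "(\<lambda>\<omega>. dyadic_stieltjes_sum t (\<lambda>r. \<phi> \<alpha> \<beta> (t - r)) (\<lambda>s. w s \<omega>) j) \<in> borel_measurable G" for j
      unfolding dyadic_stieltjes_sum_def
      by (intro borel_measurable_sum borel_measurable_times borel_measurable_diff borel_measurable_const w dyadic_nonneg)
        (use t in auto)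
  qed
  have S: "dyadic_ito_sum T (X \<alpha> \<beta>) j \<in> borel_measurable G" for \<alpha> \<beta> j
    unfolding dyadic_ito_sum_def[abs_def] incr_def
    by (intro borel_measurable_sum borel_measurable_times borel_measurable_diff w X dyadic_nonneg T0 dyadic_in) auto
  show "\<xi> \<in> borel_measurable G"
    by (rule borel_measurable_AE_limit_subalgebra[OF G S[of 1 0]]) (use ito_limit(1) in \<open>simp add: X_unit\<close>)
  show "\<eta> \<in> borel_measurable G"
    by (rule borel_measurable_AE_limit_subalgebra[OF G S[of 0 1]]) (use ito_limit(2) in \<open>simp add: X_unit\<close>)
  obtain B1 where B1: "\<And>s. s \<in> {0..T} \<Longrightarrow> \<bar>\<phi> \<alpha> \<beta> s\<bar> \<le> B1" using \<phi>_bounded by blast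
  obtain B2 where B2: "\<And>s. s \<in> {0..T} \<Longrightarrow> \<bar>\<phi> \<gamma> \<delta> s\<bar> \<le> B2" using \<phi>_bounded by blast
  have B: "\<bar>\<phi> \<alpha> \<beta> s\<bar> \<le> max B1 B2" "\<bar>\<phi> \<gamma> \<delta> s\<bar> \<le> max B1 B2" if "s \<in> {0..T}" for s
    using B1[OF that] B2[OF that] by auto
  show "Q \<alpha> \<beta> \<gamma> \<delta> \<in> borel_measurable G"
  proof (rule borel_measurable_AE_limit_subalgebra[OF G _ time_product_moments(1)[OF B]])
    show "(\<lambda>\<omega>. \<Sum>i<2^j. X \<alpha> \<beta> (dyadic T j i) \<omega> * X \<gamma> \<delta> (dyadic T j i) \<omega> * (T / 2 ^ j)) \<in> borel_measurable G" for j
      by (intro borel_measurable_sum borel_measurable_times borel_measurable_const X dyadic_in T0) auto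
  qed
qed

end

section \<open>Weighted averages\<close>

lemma cesaro_null:
  fixes d :: "nat \<Rightarrow> real"
  assumes d: "d \<longlonglongrightarrow> 0"
  shows "(\<lambda>n. (\<Sum>k=1..n. \<bar>d k\<bar>) / n) \<longlonglongrightarrow> 0"
proof (rule LIMSEQ_I)
  fix e :: real assume e: "0 < e"
  obtain N where N: "\<And>k. N \<le> k \<Longrightarrow> \<bar>d k\<bar> < e / 2"
    using LIMSEQ_D[OF d, of "e / 2"] e by auto
  define A where "A = (\<Sum>k<N. \<bar>d k\<bar>)"
  have "(\<lambda>n. A / real n) \<longlonglongrightarrow> 0" by real_asymp
  then have "\<forall>\<^sub>F n in sequentially. A / real n < e / 2" by (rule order_tendstoD) (use e in simp)
  then obtain N' where N': "\<And>n. N' \<le> n \<Longrightarrow> A / real n < e / 2" by (auto simp: eventually_sequentially)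
  show "\<exists>N. \<forall>n\<ge>N. norm ((\<Sum>k=1..n. \<bar>d k\<bar>) / n - 0) < e"
  proof (intro exI[of _ "max 1 N'"] allI impI)
    fix n assume n: "max 1 N' \<le> n"
    have "(\<Sum>k=1..n. \<bar>d k\<bar>) \<le> (\<Sum>k=1..n. (if k < N then \<bar>d k\<bar> else 0) + e / 2)"
      by (intro sum_mono) (use N e in \<open>auto simp: not_less less_imp_le\<close>)
    also have "\<dots> = (\<Sum>k=1..n. if k < N then \<bar>d k\<bar> else 0) + n * (e / 2)" by (simp add: sum.distrib)
    also have "(\<Sum>k=1..n. if k < N then \<bar>d k\<bar> else 0) = (\<Sum>k\<in>{1..n} \<inter> {..<N}. \<bar>d k\<bar>)"
      by (subst sum.inter_restrict) (auto intro: sum.cong)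
    also have "\<dots> \<le> A" unfolding A_def by (rule sum_mono2) auto
    finally have "(\<Sum>k=1..n. \<bar>d k\<bar>) / n \<le> (A + n * (e / 2)) / n" using n by (intro divide_right_mono) auto
    also have "\<dots> = A / n + e / 2" using n by (simp add: add_divide_distrib)
    also have "\<dots> < e" using N'[of n] n by linarith
    finally show "norm ((\<Sum>k=1..n. \<bar>d k\<bar>) / n - 0) < e" by (simp add: sum_nonneg)
  qed
qed

lemma weighted_cesaro_null:
  fixes d :: "nat \<Rightarrow> real"
  assumes d: "d \<longlonglongrightarrow> 0"
  shows "(\<lambda>n. (\<Sum>k=1..n. real k ^ p * d k) / real n ^ (p + 1)) \<longlonglongrightarrow> 0"
proof (rule Lim_null_comparison[OF always_eventually cesaro_null[OF d]], intro allI)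
  fix n
  show "norm ((\<Sum>k=1..n. real k ^ p * d k) / real n ^ (p + 1)) \<le> (\<Sum>k=1..n. \<bar>d k\<bar>) / n"
  proof (cases "n = 0")
    case False
    have "\<bar>\<Sum>k=1..n. real k ^ p * d k\<bar> \<le> (\<Sum>k=1..n. \<bar>real k ^ p * d k\<bar>)" by (rule sum_abs)
    also have "\<dots> \<le> (\<Sum>k=1..n. real n ^ p * \<bar>d k\<bar>)"
      by (intro sum_mono) (auto simp: abs_mult intro!: mult_right_mono power_mono)
    finally have "\<bar>\<Sum>k=1..n. real k ^ p * d k\<bar> / real n ^ (p + 1) \<le> (\<Sum>k=1..n. real n ^ p * \<bar>d k\<bar>) / real n ^ (p + 1)"
      by (intro divide_right_mono) auto
    also have "\<dots> = (\<Sum>k=1..n. \<bar>d k\<bar>) / n" using False by (simp add: sum_distrib_left[symmetric])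
    finally show ?thesis by simp
  qed simp
qed

lemma sum_squares_over_cube: "(\<lambda>n. (\<Sum>k=1..n. real k ^ 2) / real n ^ 3) \<longlonglongrightarrow> 1 / 3"
proof -
  have "(\<Sum>k=1..n. real k ^ 2) = real n * (real n + 1) * (2 * real n + 1) / 6" for n
    by (induction n) (auto simp: power2_eq_square field_simps)
  moreover have "(\<lambda>n. real n * (real n + 1) * (2 * real n + 1) / 6 / real n ^ 3) \<longlonglongrightarrow> 1 / 3" by real_asymp
  ultimately show ?thesis by (simp only:)
qed

lemma weighted_cesaro_square:
  fixes m :: "nat \<Rightarrow> real"
  assumes m: "m \<longlonglongrightarrow> c"
  shows "(\<lambda>n. (\<Sum>k=1..n. real k ^ 2 * m k) / real n ^ 3) \<longlonglongrightarrow> c / 3"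
proof -
  have "(\<lambda>k. m k - c) \<longlonglongrightarrow> 0" using m by (rule LIM_zero)
  from tendsto_add[OF weighted_cesaro_null[OF this, of 2] tendsto_mult[OF sum_squares_over_cube tendsto_const[of c]]]
  have "(\<lambda>n. (\<Sum>k=1..n. real k ^ 2 * (m k - c)) / real n ^ (2 + 1) + (\<Sum>k=1..n. real k ^ 2) / real n ^ 3 * c) \<longlonglongrightarrow> 0 + 1 / 3 * c" .
  moreover have "(\<Sum>k=1..n. real k ^ 2 * (m k - c)) / real n ^ (2 + 1) + (\<Sum>k=1..n. real k ^ 2) / real n ^ 3 * c = (\<Sum>k=1..n. real k ^ 2 * m k) / real n ^ 3" for n
    by (simp add: right_diff_distrib sum_subtractf diff_divide_distrib sum_distrib_right)
  ultimately show ?thesis by simp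
qed

lemma cesaro:
  fixes m :: "nat \<Rightarrow> real"
  assumes m: "m \<longlonglongrightarrow> c"
  shows "(\<lambda>n. (\<Sum>k=1..n. m k) / n) \<longlonglongrightarrow> c"
proof -
  have "(\<lambda>k. m k - c) \<longlonglongrightarrow> 0" using m by (rule LIM_zero)
  then have 1: "(\<lambda>n. (\<Sum>k=1..n. real k ^ 0 * (m k - c)) / real n ^ (0 + 1)) \<longlonglongrightarrow> 0" by (rule weighted_cesaro_null)
  have 2: "(\<lambda>n. real n / real n * c) \<longlonglongrightarrow> c" by real_asymp
  have "(\<Sum>k=1..n. real k ^ 0 * (m k - c)) / real n ^ (0 + 1) + real n / real n * c = (\<Sum>k=1..n. m k) / n" for n
    by (simp add: sum_subtractf diff_divide_distrib)
  with tendsto_add[OF 1 2] show ?thesis by simp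
qed

section \<open>Random normalization of an asymptotically Gaussian vector\<close>

lemma norm_iexp_diff_le: "cmod (iexp x - iexp y) \<le> min 2 \<bar>x - y\<bar>"
proof -
  have e: "iexp x - iexp y = iexp y * (iexp (x - y) - 1)"
    by (simp add: right_diff_distrib exp_add[symmetric] algebra_simps)
  have "cmod (iexp x - iexp y) = cmod (iexp (x - y) - 1)" unfolding e norm_mult by simp
  also have "\<dots> \<le> \<bar>x - y\<bar>" using iexp_approx1[of "x - y" 0] by simp
  finally have "cmod (iexp x - iexp y) \<le> \<bar>x - y\<bar>" .
  moreover have "cmod (iexp x - iexp y) \<le> 2" using norm_triangle_ineq4[of "iexp x" "iexp y"] by simp
  ultimately show ?thesis by simp
qed

text \<open>Where \<open>\<bar>Y\<bar> \<le> L\<close> the product is small by dominated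
  convergence, and by Chebyshev's inequality the complement has probability at most \<open>K /
  L\<^sup>2\<close>.\<close>

lemma (in prob_space) expectation_min_product_null:
  fixes \<delta> Y :: "nat \<Rightarrow> 'a \<Rightarrow> real"
  assumes m[measurable]: "\<And>n. \<delta> n \<in> borel_measurable M" "\<And>n. Y n \<in> borel_measurable M"
    and Y: "\<And>n. integrable M (\<lambda>x. (Y n x)\<^sup>2)" "\<And>n. expectation (\<lambda>x. (Y n x)\<^sup>2) \<le> K"
    and \<delta>: "AE x in M. (\<lambda>n. \<delta> n x) \<longlonglongrightarrow> 0"
  shows "(\<lambda>n. expectation (\<lambda>x. min 2 \<bar>\<delta> n x * Y n x\<bar>)) \<longlonglongrightarrow> 0"
proof (rule LIMSEQ_I)
  fix e :: real assume e: "0 < e"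
  have K: "0 \<le> K" by (rule order_trans[OF _ Y(2)[of 0]]) simp
  define L where "L = sqrt (4 * (K + 1) / e)"
  have L: "0 < L" "L\<^sup>2 = 4 * (K + 1) / e" using e K by (auto simp: L_def)
  have KL: "2 * K / L\<^sup>2 < e / 2 + e / 4"
  proof -
    have "2 * K / L\<^sup>2 = (e / 2) * (K / (K + 1))" using e K unfolding L(2) by (simp add: field_simps)
    also have "\<dots> \<le> (e / 2) * 1" using e K by (intro mult_left_mono) (auto simp: field_simps)
    finally show ?thesis using e by simp
  qed
  have "(\<lambda>n. expectation (\<lambda>x. min 2 (\<bar>\<delta> n x\<bar> * L))) \<longlonglongrightarrow> expectation (\<lambda>x. 0)"
  proof (rule integral_dominated_convergence[where w="\<lambda>_. 2"])
    show "AE x in M. (\<lambda>n. min 2 (\<bar>\<delta> n x\<bar> * L)) \<longlonglongrightarrow> 0"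
      using \<delta>
    proof eventually_elim
      case (elim x)
      then have "(\<lambda>n. min 2 (\<bar>\<delta> n x\<bar> * L)) \<longlonglongrightarrow> min 2 (\<bar>0\<bar> * L)" by (intro tendsto_intros)
      then show ?case by simp
    qed
  qed (use L in auto)
  then have "(\<lambda>n. expectation (\<lambda>x. min 2 (\<bar>\<delta> n x\<bar> * L))) \<longlonglongrightarrow> 0" by simp
  then have "\<forall>\<^sub>F n in sequentially. expectation (\<lambda>x. min 2 (\<bar>\<delta> n x\<bar> * L)) < e / 4"
    by (rule order_tendstoD) (use e in simp)
  then obtain N where N: "\<And>n. N \<le> n \<Longrightarrow> expectation (\<lambda>x. min 2 (\<bar>\<delta> n x\<bar> * L)) < e / 4"
    by (auto simp: eventually_sequentially)
  show "\<exists>N. \<forall>n\<ge>N. norm (expectation (\<lambda>x. min 2 \<bar>\<delta> n x * Y n x\<bar>) - 0) < e"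
  proof (intro exI[of _ N] allI impI)
    fix n assume n: "N \<le> n"
    have i1: "integrable M (\<lambda>x. min 2 \<bar>\<delta> n x * Y n x\<bar>)" "integrable M (\<lambda>x. min 2 (\<bar>\<delta> n x\<bar> * L))"
      using L by (auto intro!: integrable_const_bound[where B = 2])
    have le: "min 2 \<bar>\<delta> n x * Y n x\<bar> \<le> min 2 (\<bar>\<delta> n x\<bar> * L) + 2 * (Y n x)\<^sup>2 / L\<^sup>2" for x
    proof (cases "\<bar>Y n x\<bar> \<le> L")
      case True
      then have "\<bar>\<delta> n x * Y n x\<bar> \<le> \<bar>\<delta> n x\<bar> * L" unfolding abs_mult by (intro mult_left_mono) auto
      moreover have "0 \<le> 2 * (Y n x)\<^sup>2 / L\<^sup>2" by simp
      ultimately show ?thesis by linarith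
    next
      case False
      then have "L\<^sup>2 \<le> \<bar>Y n x\<bar>\<^sup>2" using L by (intro power_mono) auto
      then have "1 \<le> (Y n x)\<^sup>2 / L\<^sup>2" using L(1) by (subst pos_le_divide_eq) simp_all
      then have "2 * 1 \<le> 2 * ((Y n x)\<^sup>2 / L\<^sup>2)" by (intro mult_left_mono) auto
      then have "2 \<le> 2 * (Y n x)\<^sup>2 / L\<^sup>2" by simp
      moreover have "0 \<le> min 2 (\<bar>\<delta> n x\<bar> * L)" using L by simp
      ultimately show ?thesis by linarith
    qed
    have "expectation (\<lambda>x. min 2 \<bar>\<delta> n x * Y n x\<bar>) \<le> expectation (\<lambda>x. min 2 (\<bar>\<delta> n x\<bar> * L) + 2 * (Y n x)\<^sup>2 / L\<^sup>2)"
      by (rule integral_mono[OF i1(1) _ le]) (use i1 Y in simp)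
    also have "\<dots> = expectation (\<lambda>x. min 2 (\<bar>\<delta> n x\<bar> * L)) + 2 * expectation (\<lambda>x. (Y n x)\<^sup>2) / L\<^sup>2"
      using i1 Y by simp
    also have "\<dots> < e / 4 + (e / 2 + e / 4)"
    proof (rule add_strict_mono[OF N[OF n]])
      have "2 * expectation (\<lambda>x. (Y n x)\<^sup>2) / L\<^sup>2 \<le> 2 * K / L\<^sup>2" using Y(2) by (intro divide_right_mono mult_left_mono) auto
      then show "2 * expectation (\<lambda>x. (Y n x)\<^sup>2) / L\<^sup>2 < e / 2 + e / 4" using KL by linarith
    qed
    finally have "expectation (\<lambda>x. min 2 \<bar>\<delta> n x * Y n x\<bar>) < e" by simp
    moreover have "0 \<le> expectation (\<lambda>x. min 2 \<bar>\<delta> n x * Y n x\<bar>)" by (rule Bochner_Integration.integral_nonneg) simp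
    ultimately show "norm (expectation (\<lambda>x. min 2 \<bar>\<delta> n x * Y n x\<bar>) - 0) < e" by simp
  qed
qed

text \<open>Replacing the random coefficients by their limits changes each coordinate by at most
  \<open>\<delta> Y\<close>, where \<open>\<delta>\<close> tends to zero almost surely and
  \<open>Y\<close> is bounded in \<open>L\<^sub>2\<close>. Such a change affects neither the
  limits of the characteristic functions nor tightness.\<close>

lemma (in prob_space) slutsky_diagonal_gaussian:
  fixes X :: "nat \<Rightarrow> 'a \<Rightarrow> real \<times> real" and a b p q r s :: "nat \<Rightarrow> 'a \<Rightarrow> real" and p0 s0 \<alpha> \<beta> :: real
  assumes mX[measurable]: "\<And>n. X n \<in> borel_measurable M"
    and m[measurable]: "\<And>n. a n \<in> borel_measurable M" "\<And>n. b n \<in> borel_measurable M" "\<And>n. p n \<in> borel_measurable M"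
      "\<And>n. q n \<in> borel_measurable M" "\<And>n. r n \<in> borel_measurable M" "\<And>n. s n \<in> borel_measurable M"
    and eq: "\<And>n. 1 \<le> n \<Longrightarrow> AE x in M. X n x = (p n x * a n x + q n x * b n x, r n x * a n x + s n x * b n x)"
    and sq: "\<And>n. integrable M (\<lambda>x. (a n x)\<^sup>2)" "\<And>n. expectation (\<lambda>x. (a n x)\<^sup>2) \<le> K"
      "\<And>n. integrable M (\<lambda>x. (b n x)\<^sup>2)" "\<And>n. expectation (\<lambda>x. (b n x)\<^sup>2) \<le> K"
    and lim: "AE x in M. (\<lambda>n. p n x) \<longlonglongrightarrow> p0" "AE x in M. (\<lambda>n. q n x) \<longlonglongrightarrow> 0"
      "AE x in M. (\<lambda>n. r n x) \<longlonglongrightarrow> 0" "AE x in M. (\<lambda>n. s n x) \<longlonglongrightarrow> s0"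
    and char: "\<And>\<sigma> \<tau>. (\<lambda>n. expectation (\<lambda>x. iexp (\<sigma> * a n x + \<tau> * b n x))) \<longlonglongrightarrow> exp (- ((\<sigma> * \<alpha>)\<^sup>2 + (\<tau> * \<beta>)\<^sup>2) / 2)"
  shows "converges_in_distribution M X (diagonal_gaussian (p0 * \<alpha>) (s0 * \<beta>))"
proof (rule converges_in_distribution_planeI[OF mX prob_space_diagonal_gaussian])
  define Y where "Y = (\<lambda>n x. \<bar>a n x\<bar> + \<bar>b n x\<bar>)"
  define \<delta> where "\<delta> = (\<lambda>n x. \<bar>p n x - p0\<bar> + \<bar>q n x\<bar> + \<bar>r n x\<bar> + \<bar>s n x - s0\<bar>)"
  have mY[measurable]: "Y n \<in> borel_measurable M" and m\<delta>[measurable]: "\<delta> n \<in> borel_measurable M" for n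
    unfolding Y_def \<delta>_def by measurable
  have Y0: "0 \<le> Y n x" and \<delta>0: "0 \<le> \<delta> n x" for n x by (auto simp: Y_def \<delta>_def)
  have Yle: "(Y n x)\<^sup>2 \<le> 2 * (a n x)\<^sup>2 + 2 * (b n x)\<^sup>2" for n x
    using sum_squares_bound[of "\<bar>a n x\<bar>" "\<bar>b n x\<bar>"] by (simp add: Y_def power2_sum)
  have iB: "integrable M (\<lambda>x. 2 * (a n x)\<^sup>2 + 2 * (b n x)\<^sup>2)" for n using sq by simp
  have iY: "integrable M (\<lambda>x. (Y n x)\<^sup>2)" for n
    by (rule Bochner_Integration.integrable_bound[OF iB[of n]]) (use Yle in auto)
  have EY: "expectation (\<lambda>x. (Y n x)\<^sup>2) \<le> 4 * K" for n
  proof -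
    have "expectation (\<lambda>x. (Y n x)\<^sup>2) \<le> expectation (\<lambda>x. 2 * (a n x)\<^sup>2 + 2 * (b n x)\<^sup>2)"
      by (rule integral_mono[OF iY iB Yle])
    also have "\<dots> = 2 * expectation (\<lambda>x. (a n x)\<^sup>2) + 2 * expectation (\<lambda>x. (b n x)\<^sup>2)" using sq by simp
    also have "\<dots> \<le> 4 * K" using sq(2)[of n] sq(4)[of n] by simp
    finally show ?thesis .
  qed
  have null: "(\<lambda>n. expectation (\<lambda>x. min 2 \<bar>(C * \<delta> n x) * Y n x\<bar>)) \<longlonglongrightarrow> 0" for C
  proof (rule expectation_min_product_null[OF _ mY iY EY])
    show "AE x in M. (\<lambda>n. C * \<delta> n x) \<longlonglongrightarrow> 0"
      using lim
    proof eventually_elim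
      case (elim x)
      have "(\<lambda>n. C * (\<bar>p n x - p0\<bar> + \<bar>q n x\<bar> + \<bar>r n x\<bar> + \<bar>s n x - s0\<bar>)) \<longlonglongrightarrow> C * (\<bar>p0 - p0\<bar> + \<bar>0\<bar> + \<bar>0\<bar> + \<bar>s0 - s0\<bar>)"
        by (intro tendsto_intros elim)
      then show ?case by (simp add: \<delta>_def)
    qed
  qed measurable
  have comp: "\<bar>(p n x * a n x + q n x * b n x) - p0 * a n x\<bar> \<le> \<delta> n x * Y n x"
    "\<bar>(r n x * a n x + s n x * b n x) - s0 * b n x\<bar> \<le> \<delta> n x * Y n x" for n x
  proof -
    have prod: "\<bar>y * z\<bar> \<le> \<bar>y\<bar> * Y n x" if "\<bar>z\<bar> \<le> Y n x" for y z
      unfolding abs_mult using that by (intro mult_left_mono) auto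
    have ab: "\<bar>a n x\<bar> \<le> Y n x" "\<bar>b n x\<bar> \<le> Y n x" by (auto simp: Y_def)
    have "(p n x * a n x + q n x * b n x) - p0 * a n x = (p n x - p0) * a n x + q n x * b n x" by (simp add: algebra_simps)
    also have "\<bar>\<dots>\<bar> \<le> \<bar>(p n x - p0) * a n x\<bar> + \<bar>q n x * b n x\<bar>" by (rule abs_triangle_ineq)
    also have "\<dots> \<le> \<bar>p n x - p0\<bar> * Y n x + \<bar>q n x\<bar> * Y n x" by (intro add_mono prod ab)
    also have "\<dots> \<le> \<delta> n x * Y n x" unfolding distrib_right[symmetric] using Y0 by (intro mult_right_mono) (auto simp: \<delta>_def)
    finally show "\<bar>(p n x * a n x + q n x * b n x) - p0 * a n x\<bar> \<le> \<delta> n x * Y n x" .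
    have "(r n x * a n x + s n x * b n x) - s0 * b n x = r n x * a n x + (s n x - s0) * b n x" by (simp add: algebra_simps)
    also have "\<bar>\<dots>\<bar> \<le> \<bar>r n x * a n x\<bar> + \<bar>(s n x - s0) * b n x\<bar>" by (rule abs_triangle_ineq)
    also have "\<dots> \<le> \<bar>r n x\<bar> * Y n x + \<bar>s n x - s0\<bar> * Y n x" by (intro add_mono prod ab)
    also have "\<dots> \<le> \<delta> n x * Y n x" unfolding distrib_right[symmetric] using Y0 by (intro mult_right_mono) (auto simp: \<delta>_def)
    finally show "\<bar>(r n x * a n x + s n x * b n x) - s0 * b n x\<bar> \<le> \<delta> n x * Y n x" .
  qed
  show "(\<lambda>n. expectation (\<lambda>x. plane_wave \<sigma> \<tau> (X n x))) \<longlonglongrightarrow> integral\<^sup>L (diagonal_gaussian (p0 * \<alpha>) (s0 * \<beta>)) (plane_wave \<sigma> \<tau>)" for \<sigma> \<tau>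
  proof -
    define E where "E = (\<lambda>n. expectation (\<lambda>x. iexp ((\<sigma> * p0) * a n x + (\<tau> * s0) * b n x)))"
    have i1: "integrable M (\<lambda>x. plane_wave \<sigma> \<tau> (X n x))" for n
      by (rule integrable_const_bound[where B = 1]) auto
    have i2: "integrable M (\<lambda>x. iexp ((\<sigma> * p0) * a n x + (\<tau> * s0) * b n x))" for n
      by (rule integrable_iexp) auto
    have "(\<lambda>n. expectation (\<lambda>x. plane_wave \<sigma> \<tau> (X n x)) - E n) \<longlonglongrightarrow> 0"
    proof (rule Lim_null_comparison[OF _ null[of "\<bar>\<sigma>\<bar> + \<bar>\<tau>\<bar>"]])
      show "\<forall>\<^sub>F n in sequentially. norm (expectation (\<lambda>x. plane_wave \<sigma> \<tau> (X n x)) - E n) \<le> expectation (\<lambda>x. min 2 \<bar>((\<bar>\<sigma>\<bar> + \<bar>\<tau>\<bar>) * \<delta> n x) * Y n x\<bar>)"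
      proof (rule eventually_sequentiallyI[of 1])
        fix n :: nat assume n: "1 \<le> n"
        have "norm (expectation (\<lambda>x. plane_wave \<sigma> \<tau> (X n x)) - E n)
          = norm (expectation (\<lambda>x. plane_wave \<sigma> \<tau> (X n x) - iexp ((\<sigma> * p0) * a n x + (\<tau> * s0) * b n x)))"
          unfolding E_def using i1 i2 by (simp only: Bochner_Integration.integral_diff)
        also have "\<dots> \<le> expectation (\<lambda>x. norm (plane_wave \<sigma> \<tau> (X n x) - iexp ((\<sigma> * p0) * a n x + (\<tau> * s0) * b n x)))"
          by (rule integral_norm_bound)
        also have "\<dots> \<le> expectation (\<lambda>x. min 2 \<bar>((\<bar>\<sigma>\<bar> + \<bar>\<tau>\<bar>) * \<delta> n x) * Y n x\<bar>)"
        proof (rule integral_mono_AE)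
          show "integrable M (\<lambda>x. norm (plane_wave \<sigma> \<tau> (X n x) - iexp ((\<sigma> * p0) * a n x + (\<tau> * s0) * b n x)))"
            using i1 i2 by (intro integrable_norm Bochner_Integration.integrable_diff)
          show "integrable M (\<lambda>x. min 2 \<bar>((\<bar>\<sigma>\<bar> + \<bar>\<tau>\<bar>) * \<delta> n x) * Y n x\<bar>)"
            by (rule integrable_const_bound[where B = 2]) auto
          show "AE x in M. norm (plane_wave \<sigma> \<tau> (X n x) - iexp ((\<sigma> * p0) * a n x + (\<tau> * s0) * b n x)) \<le> min 2 \<bar>((\<bar>\<sigma>\<bar> + \<bar>\<tau>\<bar>) * \<delta> n x) * Y n x\<bar>"
            using eq[OF n]
          proof eventually_elim
            case (elim x)
            let ?f = "p n x * a n x + q n x * b n x" and ?s = "r n x * a n x + s n x * b n x"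
            have "\<bar>(\<sigma> * ?f + \<tau> * ?s) - ((\<sigma> * p0) * a n x + (\<tau> * s0) * b n x)\<bar> = \<bar>\<sigma> * (?f - p0 * a n x) + \<tau> * (?s - s0 * b n x)\<bar>"
              by (simp add: algebra_simps)
            also have "\<dots> \<le> \<bar>\<sigma> * (?f - p0 * a n x)\<bar> + \<bar>\<tau> * (?s - s0 * b n x)\<bar>" by (rule abs_triangle_ineq)
            also have "\<dots> \<le> \<bar>\<sigma>\<bar> * (\<delta> n x * Y n x) + \<bar>\<tau>\<bar> * (\<delta> n x * Y n x)"
              unfolding abs_mult[of \<sigma>] abs_mult[of \<tau>] by (intro add_mono mult_left_mono comp) auto
            also have "\<dots> = ((\<bar>\<sigma>\<bar> + \<bar>\<tau>\<bar>) * \<delta> n x) * Y n x" by (simp only: distrib_right mult.assoc)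
            also have "\<dots> \<le> \<bar>((\<bar>\<sigma>\<bar> + \<bar>\<tau>\<bar>) * \<delta> n x) * Y n x\<bar>" by (rule abs_ge_self)
            finally have "\<bar>(\<sigma> * ?f + \<tau> * ?s) - ((\<sigma> * p0) * a n x + (\<tau> * s0) * b n x)\<bar> \<le> \<bar>((\<bar>\<sigma>\<bar> + \<bar>\<tau>\<bar>) * \<delta> n x) * Y n x\<bar>" .
            then have "min 2 \<bar>(\<sigma> * ?f + \<tau> * ?s) - ((\<sigma> * p0) * a n x + (\<tau> * s0) * b n x)\<bar> \<le> min 2 \<bar>((\<bar>\<sigma>\<bar> + \<bar>\<tau>\<bar>) * \<delta> n x) * Y n x\<bar>"
              by (intro min.mono order_refl)
            then show ?case unfolding elim plane_wave_def fst_conv snd_conv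
              using norm_iexp_diff_le order_trans by blast
          qed
        qed
        finally show "norm (expectation (\<lambda>x. plane_wave \<sigma> \<tau> (X n x)) - E n) \<le> expectation (\<lambda>x. min 2 \<bar>((\<bar>\<sigma>\<bar> + \<bar>\<tau>\<bar>) * \<delta> n x) * Y n x\<bar>)" .
      qed
    qed
    from tendsto_add[OF this char[of "\<sigma> * p0" "\<tau> * s0", folded E_def]]
    show ?thesis by (simp add: char_diagonal_gaussian mult.assoc)
  qed
  fix e :: real assume e: "0 < e"
  define c where "c = \<bar>p0\<bar> + \<bar>s0\<bar> + 1"
  have c: "0 < c" by (simp add: c_def)
  \<comment> \<open>With this \<open>L\<close>, Chebyshev's inequality bounds the probability of
    \<open>L < Y\<close> by \<open>4 * K / L\<^sup>2 \<le> e / 2\<close>.\<close>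
  define L where "L = sqrt (8 * (K + 1) / e)"
  have K: "0 \<le> K" by (rule order_trans[OF _ sq(2)[of 0]]) simp
  have L: "0 < L" "L\<^sup>2 = 8 * (K + 1) / e" using e K by (auto simp: L_def)
  have KL: "4 * K / L\<^sup>2 \<le> e / 2"
  proof -
    have "4 * K / L\<^sup>2 = (e / 2) * (K / (K + 1))" using e K unfolding L(2) by (simp add: field_simps)
    also have "\<dots> \<le> (e / 2) * 1" using e K by (intro mult_left_mono) (auto simp: field_simps)
    finally show ?thesis by simp
  qed
  have "\<forall>\<^sub>F n in sequentially. expectation (\<lambda>x. min 2 \<bar>(2 * \<delta> n x) * Y n x\<bar>) < e / 2"
    using null[of 2] by (rule order_tendstoD) (use e in simp)
  then have "\<forall>\<^sub>F n in sequentially. prob {x \<in> space M. c * L + 1 < norm (X n x)} \<le> e"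
    using eventually_ge_at_top[of 1]
  proof eventually_elim
    case (elim n)
    have i1: "integrable M (\<lambda>x. indicator {x \<in> space M. c * L + 1 < norm (X n x)} x :: real)"
      by (rule integrable_const_bound[where B = 1]) auto
    have i2: "integrable M (\<lambda>x. min 2 \<bar>(2 * \<delta> n x) * Y n x\<bar>)"
      by (rule integrable_const_bound[where B = 2]) auto
    have "prob {x \<in> space M. c * L + 1 < norm (X n x)} = expectation (\<lambda>x. indicator {x \<in> space M. c * L + 1 < norm (X n x)} x)"
      by simp
    also have "\<dots> \<le> expectation (\<lambda>x. (Y n x)\<^sup>2 / L\<^sup>2 + min 2 \<bar>(2 * \<delta> n x) * Y n x\<bar>)"
    proof (rule integral_mono_AE[OF i1])
      show "integrable M (\<lambda>x. (Y n x)\<^sup>2 / L\<^sup>2 + min 2 \<bar>(2 * \<delta> n x) * Y n x\<bar>)" using iY i2 by simp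
      show "AE x in M. indicator {x \<in> space M. c * L + 1 < norm (X n x)} x \<le> (Y n x)\<^sup>2 / L\<^sup>2 + min 2 \<bar>(2 * \<delta> n x) * Y n x\<bar>"
        using eq[OF elim(2)]
      proof eventually_elim
        case (elim x)
        let ?f = "p n x * a n x + q n x * b n x" and ?s = "r n x * a n x + s n x * b n x"
        have nn: "0 \<le> (Y n x)\<^sup>2 / L\<^sup>2" "0 \<le> min 2 \<bar>(2 * \<delta> n x) * Y n x\<bar>" by simp_all
        show ?case
        proof (cases "c * L + 1 < norm (X n x)")
          case True
          have ab: "\<bar>a n x\<bar> \<le> Y n x" "\<bar>b n x\<bar> \<le> Y n x" by (auto simp: Y_def)
          have "norm (X n x) \<le> norm ?f + norm ?s" unfolding elim by (rule norm_Pair_le)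
          also have "norm ?f \<le> \<bar>p0 * a n x\<bar> + \<delta> n x * Y n x" using comp(1)[of n x] by simp
          also have "norm ?s \<le> \<bar>s0 * b n x\<bar> + \<delta> n x * Y n x" using comp(2)[of n x] by simp
          also have "\<bar>p0 * a n x\<bar> \<le> \<bar>p0\<bar> * Y n x" unfolding abs_mult by (intro mult_left_mono ab) auto
          also have "\<bar>s0 * b n x\<bar> \<le> \<bar>s0\<bar> * Y n x" unfolding abs_mult by (intro mult_left_mono ab) auto
          finally have "norm (X n x) \<le> (\<bar>p0\<bar> + \<bar>s0\<bar>) * Y n x + (2 * \<delta> n x) * Y n x" by (simp add: algebra_simps)
          also have "(\<bar>p0\<bar> + \<bar>s0\<bar>) * Y n x \<le> c * Y n x" using Y0 by (intro mult_right_mono) (auto simp: c_def)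
          finally have "c * L + 1 < c * Y n x + (2 * \<delta> n x) * Y n x" using True by simp
          then consider "c * L < c * Y n x" | "1 < (2 * \<delta> n x) * Y n x" by linarith
          then have "1 \<le> (Y n x)\<^sup>2 / L\<^sup>2 + min 2 \<bar>(2 * \<delta> n x) * Y n x\<bar>"
          proof cases
            case 1
            then have "L < Y n x" using c by simp
            then have "L\<^sup>2 \<le> (Y n x)\<^sup>2" using L by (intro power_mono) auto
            then have "1 \<le> (Y n x)\<^sup>2 / L\<^sup>2" using L(1) by (subst pos_le_divide_eq) simp_all
            then show ?thesis using nn by linarith
          next
            case 2
            then have "1 \<le> min 2 \<bar>(2 * \<delta> n x) * Y n x\<bar>" by simp
            then show ?thesis using nn by linarith
          qed
          then show ?thesis by (simp add: indicator_def)
        next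
          case False
          then show ?thesis using nn by (simp add: indicator_def)
        qed
      qed
    qed
    also have "\<dots> = expectation (\<lambda>x. (Y n x)\<^sup>2) / L\<^sup>2 + expectation (\<lambda>x. min 2 \<bar>(2 * \<delta> n x) * Y n x\<bar>)"
      using iY i2 by simp
    also have "\<dots> \<le> 4 * K / L\<^sup>2 + e / 2"
      using EY[of n] elim(1) by (intro add_mono divide_right_mono) auto
    also have "\<dots> \<le> e" using KL by simp
    finally show ?case .
  qed
  then show "\<exists>R. \<forall>\<^sub>F n in sequentially. prob {x \<in> space M. R < norm (X n x)} \<le> e" by blast
qed

section \<open>Estimation from independent modes\<close>

text \<open>The properties of the modes on which the asymptotics of the estimator rest, in
  normalized form: \<open>x\<close> and \<open>y\<close> stand for the stochastic integrals
  \<open>sqrt a \<integral> u dw\<close> and \<open>\<integral> v dw\<close>; \<open>q11\<close>,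
  \<open>q12\<close> and \<open>q22\<close> stand for \<open>a \<integral> u\<^sup>2\<close>,
  \<open>sqrt a \<integral> u v\<close> and \<open>\<integral> v\<^sup>2\<close>. The constant
  \<open>r\<close> is \<open>sqrt \<theta>\<^sub>1\<close>, so the weight \<open>k / r\<close>
  turns \<open>sqrt a u\<close> into \<open>k\<^sup>2 u\<close>. The assumption on the covariance
  is the Ito isometry: the covariance of the scores is the mean information.\<close>

locale independent_modes = prob_space M for M :: "'a measure" +
  fixes G :: "nat \<Rightarrow> 'a measure" and x y q11 q12 q22 :: "nat \<Rightarrow> 'a \<Rightarrow> real"
    and m11 m12 m22 :: "nat \<Rightarrow> real" and r c K :: real
  assumes indep: "indep_sets (\<lambda>k. sets (G k)) {1..}"
    and sub: "\<And>k. 1 \<le> k \<Longrightarrow> subalgebra M (G k)"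
    and meas: "\<And>k. 1 \<le> k \<Longrightarrow> x k \<in> borel_measurable (G k)" "\<And>k. 1 \<le> k \<Longrightarrow> y k \<in> borel_measurable (G k)"
      "\<And>k. 1 \<le> k \<Longrightarrow> q11 k \<in> borel_measurable (G k)" "\<And>k. 1 \<le> k \<Longrightarrow> q12 k \<in> borel_measurable (G k)"
      "\<And>k. 1 \<le> k \<Longrightarrow> q22 k \<in> borel_measurable (G k)"
    and fourth_integrable: "\<And>k. 1 \<le> k \<Longrightarrow> integrable M (\<lambda>\<omega>. x k \<omega> ^ 4)" "\<And>k. 1 \<le> k \<Longrightarrow> integrable M (\<lambda>\<omega>. y k \<omega> ^ 4)"
      "\<And>k. 1 \<le> k \<Longrightarrow> integrable M (\<lambda>\<omega>. q11 k \<omega> ^ 4)" "\<And>k. 1 \<le> k \<Longrightarrow> integrable M (\<lambda>\<omega>. q12 k \<omega> ^ 4)"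
      "\<And>k. 1 \<le> k \<Longrightarrow> integrable M (\<lambda>\<omega>. q22 k \<omega> ^ 4)"
    and fourth_bound: "\<And>k. 1 \<le> k \<Longrightarrow> expectation (\<lambda>\<omega>. x k \<omega> ^ 4) \<le> K" "\<And>k. 1 \<le> k \<Longrightarrow> expectation (\<lambda>\<omega>. y k \<omega> ^ 4) \<le> K"
      "\<And>k. 1 \<le> k \<Longrightarrow> expectation (\<lambda>\<omega>. q11 k \<omega> ^ 4) \<le> K" "\<And>k. 1 \<le> k \<Longrightarrow> expectation (\<lambda>\<omega>. q12 k \<omega> ^ 4) \<le> K"
      "\<And>k. 1 \<le> k \<Longrightarrow> expectation (\<lambda>\<omega>. q22 k \<omega> ^ 4) \<le> K"
    and mean: "\<And>k. 1 \<le> k \<Longrightarrow> expectation (x k) = 0" "\<And>k. 1 \<le> k \<Longrightarrow> expectation (y k) = 0"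
      "\<And>k. 1 \<le> k \<Longrightarrow> expectation (q11 k) = m11 k" "\<And>k. 1 \<le> k \<Longrightarrow> expectation (q12 k) = m12 k"
      "\<And>k. 1 \<le> k \<Longrightarrow> expectation (q22 k) = m22 k"
    and covariance: "\<And>k \<alpha> \<beta>. 1 \<le> k \<Longrightarrow> expectation (\<lambda>\<omega>. (\<alpha> * x k \<omega> + \<beta> * y k \<omega>)\<^sup>2) = \<alpha>\<^sup>2 * m11 k + 2 * \<alpha> * \<beta> * m12 k + \<beta>\<^sup>2 * m22 k"
    and limits: "m11 \<longlonglongrightarrow> c" "m12 \<longlonglongrightarrow> 0" "m22 \<longlonglongrightarrow> c"
    and r: "0 < r" and c: "0 < c"
begin

definition "A1 n \<omega> = (\<Sum>k=1..n. real k / r * x k \<omega>)"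
definition "A2 n \<omega> = (\<Sum>k=1..n. y k \<omega>)"
definition "J1 n \<omega> = (\<Sum>k=1..n. (real k / r)\<^sup>2 * q11 k \<omega>)"
definition "J12 n \<omega> = (\<Sum>k=1..n. real k / r * q12 k \<omega>)"
definition "J2 n \<omega> = (\<Sum>k=1..n. q22 k \<omega>)"

lemma meas_M:
  assumes "1 \<le> k"
  shows "x k \<in> borel_measurable M" "y k \<in> borel_measurable M" "q11 k \<in> borel_measurable M"
    "q12 k \<in> borel_measurable M" "q22 k \<in> borel_measurable M"
  using measurable_from_subalg[OF sub[OF assms]] meas[OF assms] by blast+

lemma statistics_measurable [measurable]:
  "A1 n \<in> borel_measurable M" "A2 n \<in> borel_measurable M" "J1 n \<in> borel_measurable M"
  "J12 n \<in> borel_measurable M" "J2 n \<in> borel_measurable M"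
  unfolding A1_def[abs_def] A2_def[abs_def] J1_def[abs_def] J12_def[abs_def] J2_def[abs_def]
  by (intro borel_measurable_sum borel_measurable_times borel_measurable_const meas_M; simp)+

lemma indep_vars_modes:
  assumes "\<And>k. 1 \<le> k \<Longrightarrow> Z k \<in> borel_measurable (G k)"
  shows "indep_vars (\<lambda>_. borel) (Z :: nat \<Rightarrow> 'a \<Rightarrow> real) {1..}"
  by (rule indep_vars_of_indep_sets[OF indep sub]) (use assms in auto)

text \<open>The constant 16 comes from \<open>(x + y)\<^sup>4 \<le> 8 (x\<^sup>4 +
  y\<^sup>4)\<close>, where both fourth moments are at most \<open>K\<close>.\<close>

lemma centred_weighted_strong_law:
  fixes f :: "nat \<Rightarrow> 'a \<Rightarrow> real"
  assumes f: "\<And>k. 1 \<le> k \<Longrightarrow> f k \<in> borel_measurable (G k)" "\<And>k. 1 \<le> k \<Longrightarrow> integrable M (\<lambda>\<omega>. f k \<omega> ^ 4)"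
    "\<And>k. 1 \<le> k \<Longrightarrow> expectation (\<lambda>\<omega>. f k \<omega> ^ 4) \<le> K"
  shows "AE \<omega> in M. (\<lambda>n. (\<Sum>k=1..n. real k ^ p * (f k \<omega> - expectation (f k))) / real n ^ (p + 1)) \<longlonglongrightarrow> 0"
proof (rule strong_law_fourth_moment[where C = "16 * K"])
  have fM: "f k \<in> borel_measurable M" if "1 \<le> k" for k using measurable_from_subalg[OF sub f(1)] that by blast
  have K: "0 \<le> K" by (rule order_trans[OF _ f(3)[of 1]]) auto
  show "indep_vars (\<lambda>_. borel) (\<lambda>k \<omega>. real k ^ p * (f k \<omega> - expectation (f k))) {1..}"
    by (rule indep_vars_modes) (intro borel_measurable_times borel_measurable_diff borel_measurable_const f(1))
  fix k :: nat assume k: "1 \<le> k"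
  note i = integrable_of_power4[OF fM[OF k] f(2)[OF k]]
  show "expectation (\<lambda>\<omega>. real k ^ p * (f k \<omega> - expectation (f k))) = 0"
    using i(1) by (simp add: prob_space)
  note s = integrable_power4_sum[OF fM[OF k] borel_measurable_const[of "- expectation (f k)"] f(2)[OF k], OF integrable_const]
  have i4: "integrable M (\<lambda>\<omega>. (f k \<omega> - expectation (f k)) ^ 4)" using s(1) by simp
  show "integrable M (\<lambda>\<omega>. (real k ^ p * (f k \<omega> - expectation (f k))) ^ 4)"
    unfolding power_mult_distrib by (intro integrable_mult_right i4)
  have e2: "expectation (\<lambda>\<omega>. (f k \<omega>)\<^sup>2) \<le> sqrt K"
    by (rule second_moment_le_of_fourth[OF fM[OF k] f(2)[OF k]]) (use f(3)[OF k] K in auto)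
  have "(expectation (f k))\<^sup>2 \<le> expectation (\<lambda>\<omega>. (f k \<omega>)\<^sup>2)"
    using variance_eq[OF i(1) i(2)] variance_positive[of "f k"] by linarith
  then have "((expectation (f k))\<^sup>2)\<^sup>2 \<le> (sqrt K)\<^sup>2" using e2 by (intro power_mono) auto
  then have m4: "expectation (f k) ^ 4 \<le> K" using K by simp
  have "expectation (\<lambda>\<omega>. (f k \<omega> - expectation (f k)) ^ 4) \<le> 8 * (expectation (\<lambda>\<omega>. f k \<omega> ^ 4) + expectation (f k) ^ 4)"
    using s(2) by (simp add: prob_space)
  also have "\<dots> \<le> 16 * K" using f(3)[OF k] m4 by simp
  finally have b: "expectation (\<lambda>\<omega>. (f k \<omega> - expectation (f k)) ^ 4) \<le> 16 * K" .
  have "expectation (\<lambda>\<omega>. (real k ^ p * (f k \<omega> - expectation (f k))) ^ 4) = (real k ^ p) ^ 4 * expectation (\<lambda>\<omega>. (f k \<omega> - expectation (f k)) ^ 4)"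
    unfolding power_mult_distrib by simp
  also have "\<dots> \<le> (real k ^ p) ^ 4 * (16 * K)" by (intro mult_left_mono b) simp
  finally show "expectation (\<lambda>\<omega>. (real k ^ p * (f k \<omega> - expectation (f k))) ^ 4) \<le> 16 * K * (real k ^ p) ^ 4"
    by (simp only: mult.commute)
qed

lemma weighted_strong_law:
  fixes f :: "nat \<Rightarrow> 'a \<Rightarrow> real"
  assumes f: "\<And>k. 1 \<le> k \<Longrightarrow> f k \<in> borel_measurable (G k)" "\<And>k. 1 \<le> k \<Longrightarrow> integrable M (\<lambda>\<omega>. f k \<omega> ^ 4)"
    "\<And>k. 1 \<le> k \<Longrightarrow> expectation (\<lambda>\<omega>. f k \<omega> ^ 4) \<le> K" and m: "\<And>k. 1 \<le> k \<Longrightarrow> expectation (f k) = m k"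
    and L: "(\<lambda>n. (\<Sum>k=1..n. real k ^ p * m k) / real n ^ (p + 1)) \<longlonglongrightarrow> L"
  shows "AE \<omega> in M. (\<lambda>n. (\<Sum>k=1..n. real k ^ p * f k \<omega>) / real n ^ (p + 1)) \<longlonglongrightarrow> L"
proof -
  have "AE \<omega> in M. (\<lambda>n. (\<Sum>k=1..n. real k ^ p * (f k \<omega> - expectation (f k))) / real n ^ (p + 1)) \<longlonglongrightarrow> 0"
    by (rule centred_weighted_strong_law; rule f)
  then show ?thesis
  proof eventually_elim
    case (elim \<omega>)
    have "(\<Sum>k=1..n. real k ^ p * (f k \<omega> - expectation (f k))) / real n ^ (p + 1) + (\<Sum>k=1..n. real k ^ p * m k) / real n ^ (p + 1)
       = (\<Sum>k=1..n. real k ^ p * f k \<omega>) / real n ^ (p + 1)" for n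
      unfolding add_divide_distrib[symmetric] sum.distrib[symmetric]
      by (intro arg_cong2[where f = "(/)"] sum.cong refl) (simp add: m algebra_simps)
    with tendsto_add[OF elim L] show ?case by simp
  qed
qed

text \<open>The weights \<open>k\<^sup>2\<close>, \<open>k\<close> and \<open>1\<close> lead to
  the orders \<open>n\<^sup>3\<close>, \<open>n\<^sup>2\<close> and \<open>n\<close>. The
  off-diagonal entry of the information is of smaller order, as its normalized mean values tend to
  zero.\<close>

lemma statistics_limits:
  "AE \<omega> in M. (\<lambda>n. J1 n \<omega> / real n ^ 3) \<longlonglongrightarrow> c / (3 * r\<^sup>2)"
  "AE \<omega> in M. (\<lambda>n. J2 n \<omega> / real n) \<longlonglongrightarrow> c"
  "AE \<omega> in M. (\<lambda>n. J12 n \<omega> / real n ^ 2) \<longlonglongrightarrow> 0"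
  "AE \<omega> in M. (\<lambda>n. A1 n \<omega> / real n ^ 2) \<longlonglongrightarrow> 0"
  "AE \<omega> in M. (\<lambda>n. A2 n \<omega> / real n) \<longlonglongrightarrow> 0"
proof -
  have "AE \<omega> in M. (\<lambda>n. (\<Sum>k=1..n. real k ^ 2 * q11 k \<omega>) / real n ^ (2 + 1)) \<longlonglongrightarrow> c / 3"
    by (rule weighted_strong_law[OF meas(3) fourth_integrable(3) fourth_bound(3) mean(3)])
      (use weighted_cesaro_square[OF limits(1)] in simp_all)
  then show "AE \<omega> in M. (\<lambda>n. J1 n \<omega> / real n ^ 3) \<longlonglongrightarrow> c / (3 * r\<^sup>2)"
  proof eventually_elim
    case (elim \<omega>)
    have "(\<lambda>n. (\<Sum>k=1..n. real k ^ 2 * q11 k \<omega>) / real n ^ (2 + 1) * (1 / r\<^sup>2)) \<longlonglongrightarrow> c / 3 * (1 / r\<^sup>2)"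
      by (intro tendsto_intros elim)
    moreover have "(\<Sum>k=1..n. real k ^ 2 * q11 k \<omega>) / real n ^ (2 + 1) * (1 / r\<^sup>2) = J1 n \<omega> / real n ^ 3" for n
    proof -
      have "J1 n \<omega> = (\<Sum>k=1..n. real k ^ 2 * q11 k \<omega>) * (1 / r\<^sup>2)"
        unfolding J1_def sum_distrib_right by (intro sum.cong refl) (simp add: power_divide)
      then show ?thesis by simp
    qed
    ultimately show ?case by simp
  qed
  have "AE \<omega> in M. (\<lambda>n. (\<Sum>k=1..n. real k ^ 0 * q22 k \<omega>) / real n ^ (0 + 1)) \<longlonglongrightarrow> c"
    by (rule weighted_strong_law[OF meas(5) fourth_integrable(5) fourth_bound(5) mean(5)])
      (use cesaro[OF limits(3)] in simp_all)
  then show "AE \<omega> in M. (\<lambda>n. J2 n \<omega> / real n) \<longlonglongrightarrow> c"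
    by eventually_elim (simp add: J2_def)
  have "AE \<omega> in M. (\<lambda>n. (\<Sum>k=1..n. real k ^ 1 * q12 k \<omega>) / real n ^ (1 + 1)) \<longlonglongrightarrow> 0"
    by (rule weighted_strong_law[OF meas(4) fourth_integrable(4) fourth_bound(4) mean(4)])
      (use weighted_cesaro_null[OF limits(2), of 1] in simp_all)
  then show "AE \<omega> in M. (\<lambda>n. J12 n \<omega> / real n ^ 2) \<longlonglongrightarrow> 0"
  proof eventually_elim
    case (elim \<omega>)
    have "(\<lambda>n. (\<Sum>k=1..n. real k ^ 1 * q12 k \<omega>) / real n ^ (1 + 1) * (1 / r)) \<longlonglongrightarrow> 0 * (1 / r)"
      by (intro tendsto_intros elim)
    moreover have "(\<Sum>k=1..n. real k ^ 1 * q12 k \<omega>) / real n ^ (1 + 1) * (1 / r) = J12 n \<omega> / real n ^ 2" for n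
    proof -
      have "J12 n \<omega> = (\<Sum>k=1..n. real k ^ 1 * q12 k \<omega>) * (1 / r)"
        unfolding J12_def sum_distrib_right by (intro sum.cong refl) simp
      then show ?thesis by (simp add: power2_eq_square)
    qed
    ultimately show ?case by simp
  qed
  have "AE \<omega> in M. (\<lambda>n. (\<Sum>k=1..n. real k ^ 1 * x k \<omega>) / real n ^ (1 + 1)) \<longlonglongrightarrow> 0"
    by (rule weighted_strong_law[OF meas(1) fourth_integrable(1) fourth_bound(1) mean(1)]) simp_all
  then show "AE \<omega> in M. (\<lambda>n. A1 n \<omega> / real n ^ 2) \<longlonglongrightarrow> 0"
  proof eventually_elim
    case (elim \<omega>)
    have "(\<lambda>n. (\<Sum>k=1..n. real k ^ 1 * x k \<omega>) / real n ^ (1 + 1) * (1 / r)) \<longlonglongrightarrow> 0 * (1 / r)"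
      by (intro tendsto_intros elim)
    moreover have "(\<Sum>k=1..n. real k ^ 1 * x k \<omega>) / real n ^ (1 + 1) * (1 / r) = A1 n \<omega> / real n ^ 2" for n
    proof -
      have "A1 n \<omega> = (\<Sum>k=1..n. real k ^ 1 * x k \<omega>) * (1 / r)"
        unfolding A1_def sum_distrib_right by (intro sum.cong refl) simp
      then show ?thesis by (simp add: power2_eq_square)
    qed
    ultimately show ?case by simp
  qed
  have "AE \<omega> in M. (\<lambda>n. (\<Sum>k=1..n. real k ^ 0 * y k \<omega>) / real n ^ (0 + 1)) \<longlonglongrightarrow> 0"
    by (rule weighted_strong_law[OF meas(2) fourth_integrable(2) fourth_bound(2) mean(2)]) simp_all
  then show "AE \<omega> in M. (\<lambda>n. A2 n \<omega> / real n) \<longlonglongrightarrow> 0"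
    by eventually_elim (simp add: A2_def)
qed

lemma score_second_moments:
  "integrable M (\<lambda>\<omega>. (A1 n \<omega> / (real n * sqrt n))\<^sup>2)" "expectation (\<lambda>\<omega>. (A1 n \<omega> / (real n * sqrt n))\<^sup>2) \<le> sqrt K / r\<^sup>2"
  "integrable M (\<lambda>\<omega>. (A2 n \<omega> / sqrt n)\<^sup>2)" "expectation (\<lambda>\<omega>. (A2 n \<omega> / sqrt n)\<^sup>2) \<le> sqrt K"
proof -
  have K: "0 \<le> K" by (rule order_trans[OF _ fourth_bound(1)[of 1]]) auto
  have kr: "(real k / r) ^ 4 \<le> ((real n)\<^sup>2 / r\<^sup>2)\<^sup>2" if "k \<in> {1..n}" for k
  proof -
    have "(real k / r) ^ 4 \<le> (real n / r) ^ 4" using that r by (intro power_mono divide_right_mono) auto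
    then show ?thesis by (simp add: power_divide)
  qed
  have *: "integrable M (\<lambda>\<omega>. (\<Sum>k=1..n. real k / r * x k \<omega>) ^ 4) \<and> expectation (\<lambda>\<omega>. \<Sum>k=1..n. real k / r * x k \<omega>) = 0
     \<and> expectation (\<lambda>\<omega>. (\<Sum>k=1..n. real k / r * x k \<omega>)\<^sup>2) \<le> (sqrt K * ((real n)\<^sup>2 / r\<^sup>2)) * n
     \<and> expectation (\<lambda>\<omega>. (\<Sum>k=1..n. real k / r * x k \<omega>) ^ 4) \<le> 3 * (sqrt K * ((real n)\<^sup>2 / r\<^sup>2))\<^sup>2 * (real n)\<^sup>2"
  proof (rule indep_sum_moments)
    show "indep_vars (\<lambda>_. borel) (\<lambda>k \<omega>. real k / r * x k \<omega>) {1..n}"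
    proof (rule indep_vars_subset[OF indep_vars_modes])
      show "(\<lambda>\<omega>. real k / r * x k \<omega>) \<in> borel_measurable (G k)" if "1 \<le> k" for k
        by (intro borel_measurable_times borel_measurable_const meas that)
    qed auto
    fix k assume k: "k \<in> {1..n}"
    then have k1: "1 \<le> k" by simp
    show "integrable M (\<lambda>\<omega>. (real k / r * x k \<omega>) ^ 4)" unfolding power_mult_distrib
      by (intro integrable_mult_right fourth_integrable k1)
    show "expectation (\<lambda>\<omega>. real k / r * x k \<omega>) = 0" using mean(1)[OF k1] by simp
    have "expectation (\<lambda>\<omega>. (real k / r * x k \<omega>) ^ 4) = (real k / r) ^ 4 * expectation (\<lambda>\<omega>. x k \<omega> ^ 4)"
      unfolding power_mult_distrib by simp
    also have "\<dots> \<le> ((real n)\<^sup>2 / r\<^sup>2)\<^sup>2 * K" by (intro mult_mono kr k fourth_bound k1) auto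
    also have "\<dots> = (sqrt K * ((real n)\<^sup>2 / r\<^sup>2))\<^sup>2" using K by (simp only: power_mult_distrib real_sqrt_pow2 mult.commute)
    finally show "expectation (\<lambda>\<omega>. (real k / r * x k \<omega>) ^ 4) \<le> (sqrt K * ((real n)\<^sup>2 / r\<^sup>2))\<^sup>2" .
  qed (use K in simp)
  have A4: "integrable M (\<lambda>\<omega>. A1 n \<omega> ^ 4)" and A2b: "expectation (\<lambda>\<omega>. (A1 n \<omega>)\<^sup>2) \<le> (sqrt K * ((real n)\<^sup>2 / r\<^sup>2)) * n"
    using * unfolding A1_def by blast+
  have i2: "integrable M (\<lambda>\<omega>. (A1 n \<omega>)\<^sup>2)" by (rule integrable_of_power4(2)[OF _ A4]) simp
  show "integrable M (\<lambda>\<omega>. (A1 n \<omega> / (real n * sqrt n))\<^sup>2)" unfolding power_divide using i2 by simp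
  show "expectation (\<lambda>\<omega>. (A1 n \<omega> / (real n * sqrt n))\<^sup>2) \<le> sqrt K / r\<^sup>2"
  proof (cases "n = 0")
    case False
    have "expectation (\<lambda>\<omega>. (A1 n \<omega> / (real n * sqrt n))\<^sup>2) = expectation (\<lambda>\<omega>. (A1 n \<omega>)\<^sup>2) / (real n * sqrt n)\<^sup>2"
      unfolding power_divide by simp
    also have "\<dots> \<le> (sqrt K * ((real n)\<^sup>2 / r\<^sup>2)) * n / (real n * sqrt n)\<^sup>2" by (intro divide_right_mono A2b) simp
    also have "\<dots> = sqrt K / r\<^sup>2" using False by (simp add: power_mult_distrib)
    finally show ?thesis .
  qed (use K in simp)
  have **: "integrable M (\<lambda>\<omega>. (\<Sum>k=1..n. y k \<omega>) ^ 4) \<and> expectation (\<lambda>\<omega>. \<Sum>k=1..n. y k \<omega>) = 0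
     \<and> expectation (\<lambda>\<omega>. (\<Sum>k=1..n. y k \<omega>)\<^sup>2) \<le> sqrt K * n
     \<and> expectation (\<lambda>\<omega>. (\<Sum>k=1..n. y k \<omega>) ^ 4) \<le> 3 * (sqrt K)\<^sup>2 * (real n)\<^sup>2"
  proof (rule indep_sum_moments)
    show "indep_vars (\<lambda>_. borel) y {1..n}"
      by (rule indep_vars_subset[OF indep_vars_modes]) (auto intro!: meas)
  qed (use K fourth_integrable(2) fourth_bound(2) mean(2) in auto)
  have B4: "integrable M (\<lambda>\<omega>. A2 n \<omega> ^ 4)" and B2b: "expectation (\<lambda>\<omega>. (A2 n \<omega>)\<^sup>2) \<le> sqrt K * n"
    using ** unfolding A2_def by blast+
  have j2: "integrable M (\<lambda>\<omega>. (A2 n \<omega>)\<^sup>2)" by (rule integrable_of_power4(2)[OF _ B4]) simp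
  show "integrable M (\<lambda>\<omega>. (A2 n \<omega> / sqrt n)\<^sup>2)" unfolding power_divide using j2 by simp
  show "expectation (\<lambda>\<omega>. (A2 n \<omega> / sqrt n)\<^sup>2) \<le> sqrt K"
  proof (cases "n = 0")
    case False
    have "expectation (\<lambda>\<omega>. (A2 n \<omega> / sqrt n)\<^sup>2) = expectation (\<lambda>\<omega>. (A2 n \<omega>)\<^sup>2) / n"
      unfolding power_divide by simp
    also have "\<dots> \<le> sqrt K * n / n" by (intro divide_right_mono B2b) simp
    also have "\<dots> = sqrt K" using False by simp
    finally show ?thesis .
  qed (use K in simp)
qed

text \<open>Every linear combination of the two scores is again a sum over the independent modes,
  so the one-dimensional central limit theorem suffices.\<close>

lemma score_characteristic_function:
  "(\<lambda>n. expectation (\<lambda>\<omega>. iexp (\<sigma> * (A1 n \<omega> / (real n * sqrt n)) + \<tau> * (A2 n \<omega> / sqrt n))))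
     \<longlonglongrightarrow> exp (- (\<sigma>\<^sup>2 * (c / (3 * r\<^sup>2)) + \<tau>\<^sup>2 * c) / 2)"
proof -
  have K: "0 \<le> K" by (rule order_trans[OF _ fourth_bound(1)[of 1]]) auto
  define \<alpha> where "\<alpha> = (\<lambda>n k. \<sigma> * (real k / r) / (real n * sqrt n))"
  define \<beta> where "\<beta> = (\<lambda>n::nat. \<tau> / sqrt n)"
  define Z where "Z = (\<lambda>n k \<omega>. \<alpha> n k * x k \<omega> + \<beta> n * y k \<omega>)"
  have ZG: "Z n k \<in> borel_measurable (G k)" if "1 \<le> k" for n k
    unfolding Z_def by (intro borel_measurable_add borel_measurable_times borel_measurable_const meas that)
  have eq: "\<sigma> * (A1 n \<omega> / (real n * sqrt n)) + \<tau> * (A2 n \<omega> / sqrt n) = (\<Sum>k=1..n. Z n k \<omega>)" for n \<omega>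
    unfolding A1_def A2_def Z_def \<alpha>_def \<beta>_def sum.distrib
    by (simp add: sum_distrib_left sum_divide_distrib mult.assoc)
  have var: "expectation (\<lambda>\<omega>. (Z n k \<omega>)\<^sup>2) = (\<alpha> n k)\<^sup>2 * m11 k + 2 * \<alpha> n k * \<beta> n * m12 k + (\<beta> n)\<^sup>2 * m22 k" if "1 \<le> k" for n k
    unfolding Z_def by (rule covariance[OF that])
  show ?thesis unfolding eq
  proof (rule clt_triangular_array[where C = "8 * ((\<sigma> / r) ^ 4 + \<tau> ^ 4) * K"])
    show "indep_vars (\<lambda>_. borel) (Z n) {1..n}" for n
      by (rule indep_vars_subset[OF indep_vars_modes[OF ZG]]) auto
    fix n k :: nat assume k: "k \<in> {1..n}"
    then have k1: "1 \<le> k" and n: "0 < real n" by auto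
    have xx: "integrable M (\<lambda>\<omega>. (\<alpha> n k * x k \<omega>) ^ 4)" "integrable M (\<lambda>\<omega>. (\<beta> n * y k \<omega>) ^ 4)"
      unfolding power_mult_distrib by (intro integrable_mult_right fourth_integrable k1)+
    have mm: "(\<lambda>\<omega>. \<alpha> n k * x k \<omega>) \<in> borel_measurable M" "(\<lambda>\<omega>. \<beta> n * y k \<omega>) \<in> borel_measurable M"
      using meas_M[OF k1] by measurable
    note s = integrable_power4_sum[OF mm xx]
    show "integrable M (\<lambda>\<omega>. Z n k \<omega> ^ 4)" unfolding Z_def by (rule s)
    have "integrable M (x k)" "integrable M (y k)"
      using integrable_of_power4(1)[OF meas_M(1)[OF k1] fourth_integrable(1)[OF k1]]
        integrable_of_power4(1)[OF meas_M(2)[OF k1] fourth_integrable(2)[OF k1]] .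
    then show "expectation (Z n k) = 0" unfolding Z_def using mean(1,2)[OF k1] by simp
    have a4: "\<alpha> n k ^ 4 \<le> (\<sigma> / r) ^ 4 / (real n)\<^sup>2"
    proof -
      have "\<alpha> n k = (\<sigma> / r) * (real k / real n) / sqrt n" unfolding \<alpha>_def by simp
      then have "\<alpha> n k ^ 4 = (\<sigma> / r) ^ 4 * (real k / real n) ^ 4 / (sqrt n) ^ 4"
        by (simp only: power_divide power_mult_distrib)
      also have "(sqrt n) ^ 4 = (real n)\<^sup>2" using n by (simp add: power4_eq_xxxx power2_eq_square)
      also have "(\<sigma> / r) ^ 4 * (real k / real n) ^ 4 / (real n)\<^sup>2 \<le> (\<sigma> / r) ^ 4 * 1 / (real n)\<^sup>2"
        using k by (intro divide_right_mono mult_left_mono power_le_one) auto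
      finally show ?thesis by simp
    qed
    have b4: "\<beta> n ^ 4 = \<tau> ^ 4 / (real n)\<^sup>2"
    proof -
      have "(sqrt n) ^ 4 = (real n)\<^sup>2" using n by (simp add: power4_eq_xxxx power2_eq_square)
      then show ?thesis by (simp only: \<beta>_def power_divide)
    qed
    have "expectation (\<lambda>\<omega>. Z n k \<omega> ^ 4) \<le> 8 * (expectation (\<lambda>\<omega>. (\<alpha> n k * x k \<omega>) ^ 4) + expectation (\<lambda>\<omega>. (\<beta> n * y k \<omega>) ^ 4))"
      unfolding Z_def by (rule s)
    also have "\<dots> = 8 * (\<alpha> n k ^ 4 * expectation (\<lambda>\<omega>. x k \<omega> ^ 4) + \<beta> n ^ 4 * expectation (\<lambda>\<omega>. y k \<omega> ^ 4))"
      unfolding power_mult_distrib by simp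
    also have "\<dots> \<le> 8 * ((\<sigma> / r) ^ 4 / (real n)\<^sup>2 * K + \<tau> ^ 4 / (real n)\<^sup>2 * K)"
      unfolding b4 by (intro mult_left_mono add_mono mult_mono a4 fourth_bound k1) auto
    also have "\<dots> = 8 * ((\<sigma> / r) ^ 4 + \<tau> ^ 4) * K / (real n)\<^sup>2" by (simp add: field_simps add_divide_distrib)
    finally show "expectation (\<lambda>\<omega>. Z n k \<omega> ^ 4) \<le> 8 * ((\<sigma> / r) ^ 4 + \<tau> ^ 4) * K / (real n)\<^sup>2" .
  next
    have "(\<Sum>k=1..n. expectation (\<lambda>\<omega>. (Z n k \<omega>)\<^sup>2)) =
      (\<sigma> / r)\<^sup>2 * ((\<Sum>k=1..n. real k ^ 2 * m11 k) / real n ^ 3) + 2 * (\<sigma> / r) * \<tau> * ((\<Sum>k=1..n. real k ^ 1 * m12 k) / real n ^ (1 + 1))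
        + \<tau>\<^sup>2 * ((\<Sum>k=1..n. m22 k) / n)" for n
    proof (cases "n = 0")
      case False
      then have n: "0 < real n" by simp
      have s: "sqrt n * sqrt n = real n" by simp
      have "(\<alpha> n k)\<^sup>2 * m11 k + 2 * \<alpha> n k * \<beta> n * m12 k + (\<beta> n)\<^sup>2 * m22 k =
         (\<sigma> / r)\<^sup>2 * (real k ^ 2 * m11 k / real n ^ 3) + 2 * (\<sigma> / r) * \<tau> * (real k ^ 1 * m12 k / real n ^ (1 + 1)) + \<tau>\<^sup>2 * (m22 k / n)" for k
      proof -
        have "(\<alpha> n k)\<^sup>2 = (\<sigma> / r)\<^sup>2 * (real k ^ 2 / real n ^ 3)"
        proof -
          have "(real n * sqrt n)\<^sup>2 = real n ^ 3" by (simp add: power_mult_distrib power3_eq_cube power2_eq_square)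
          then show ?thesis unfolding \<alpha>_def power_divide power_mult_distrib[of \<sigma>] by simp
        qed
        moreover have "\<alpha> n k * \<beta> n = (\<sigma> / r) * \<tau> * (real k / (real n * (sqrt n * sqrt n)))"
          unfolding \<alpha>_def \<beta>_def by (simp add: mult_ac del: real_sqrt_mult_self)
        moreover have "(\<beta> n)\<^sup>2 = \<tau>\<^sup>2 / n" unfolding \<beta>_def using n by (simp add: power_divide)
        ultimately show ?thesis using n by (simp add: power2_eq_square[of "real n"] mult.assoc)
      qed
      then have "(\<Sum>k=1..n. expectation (\<lambda>\<omega>. (Z n k \<omega>)\<^sup>2)) = (\<Sum>k=1..n. (\<sigma> / r)\<^sup>2 * (real k ^ 2 * m11 k / real n ^ 3)
         + 2 * (\<sigma> / r) * \<tau> * (real k ^ 1 * m12 k / real n ^ (1 + 1)) + \<tau>\<^sup>2 * (m22 k / n))"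
        using var by (intro sum.cong refl) auto
      then show ?thesis by (simp only: sum.distrib sum_distrib_left[symmetric] sum_divide_distrib)
    qed simp
    moreover have "(\<lambda>n. (\<sigma> / r)\<^sup>2 * ((\<Sum>k=1..n. real k ^ 2 * m11 k) / real n ^ 3) + 2 * (\<sigma> / r) * \<tau> * ((\<Sum>k=1..n. real k ^ 1 * m12 k) / real n ^ (1 + 1))
        + \<tau>\<^sup>2 * ((\<Sum>k=1..n. m22 k) / n)) \<longlonglongrightarrow> (\<sigma> / r)\<^sup>2 * (c / 3) + 2 * (\<sigma> / r) * \<tau> * 0 + \<tau>\<^sup>2 * c"
      by (intro tendsto_intros weighted_cesaro_square weighted_cesaro_null cesaro limits)
    moreover have "(\<sigma> / r)\<^sup>2 * (c / 3) + 2 * (\<sigma> / r) * \<tau> * 0 + \<tau>\<^sup>2 * c = \<sigma>\<^sup>2 * (c / (3 * r\<^sup>2)) + \<tau>\<^sup>2 * c"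
      by (simp add: power_divide)
    ultimately show "(\<lambda>n. \<Sum>k=1..n. expectation (\<lambda>\<omega>. (Z n k \<omega>)\<^sup>2)) \<longlonglongrightarrow> \<sigma>\<^sup>2 * (c / (3 * r\<^sup>2)) + \<tau>\<^sup>2 * c" by (simp only:)
  qed
qed

definition "D n \<omega> = J1 n \<omega> * J2 n \<omega> - (J12 n \<omega>)\<^sup>2"

text \<open>The determinant \<open>D\<close> in the scaling in which it has a positive
  limit.\<close>

definition "d n \<omega> = (J1 n \<omega> / real n ^ 3) * (J2 n \<omega> / real n) - (J12 n \<omega> / real n ^ 2)\<^sup>2"

lemma d_limit: "AE \<omega> in M. (\<lambda>n. d n \<omega>) \<longlonglongrightarrow> c / (3 * r\<^sup>2) * c"
  using statistics_limits(1-3)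
proof eventually_elim
  case (elim \<omega>)
  have "(\<lambda>n. d n \<omega>) \<longlonglongrightarrow> c / (3 * r\<^sup>2) * c - 0\<^sup>2" unfolding d_def by (intro tendsto_intros elim)
  then show ?case by simp
qed

lemma D_eq: "n \<noteq> 0 \<Longrightarrow> D n \<omega> = d n \<omega> * real n ^ 4"
proof -
  assume n: "n \<noteq> 0"
  have "(J12 n \<omega> / real n ^ 2)\<^sup>2 * real n ^ 4 = (J12 n \<omega>)\<^sup>2" using n by (simp add: power_divide)
  moreover have "(J1 n \<omega> / real n ^ 3) * (J2 n \<omega> / real n) * real n ^ 4 = J1 n \<omega> * J2 n \<omega>"
    using n by (simp add: field_simps power4_eq_xxxx power3_eq_cube)
  ultimately show ?thesis unfolding D_def d_def left_diff_distrib by simp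
qed

lemma scaled_errors:
  assumes n: "n \<noteq> 0"
  shows "real n powr (3/2) * ((- A1 n \<omega> * J2 n \<omega> + A2 n \<omega> * J12 n \<omega>) / D n \<omega>)
      = (J2 n \<omega> / real n) / d n \<omega> * - (A1 n \<omega> / (real n * sqrt n)) + (J12 n \<omega> / real n ^ 2) / d n \<omega> * (A2 n \<omega> / sqrt n)"
    "real n powr (1/2) * ((- A1 n \<omega> * J12 n \<omega> + A2 n \<omega> * J1 n \<omega>) / D n \<omega>)
      = (J12 n \<omega> / real n ^ 2) / d n \<omega> * - (A1 n \<omega> / (real n * sqrt n)) + (J1 n \<omega> / real n ^ 3) / d n \<omega> * (A2 n \<omega> / sqrt n)"
proof -
  define s where "s = sqrt n"
  have s: "0 < s" "real n = s * s" using n by (auto simp: s_def)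
  have p: "real n powr (3/2) = s * s * s" "real n powr (1/2) = s"
  proof -
    show "real n powr (1/2) = s" by (simp add: s_def powr_half_sqrt)
    have "real n powr (3/2) = real n powr (1 + 1/2)" by simp
    also have "\<dots> = real n * s" unfolding powr_add using n by (simp add: s_def powr_half_sqrt)
    finally show "real n powr (3/2) = s * s * s" by (simp add: s(2))
  qed
  have ss: "sqrt n = s" by (simp add: s_def)
  show "real n powr (3/2) * ((- A1 n \<omega> * J2 n \<omega> + A2 n \<omega> * J12 n \<omega>) / D n \<omega>)
      = (J2 n \<omega> / real n) / d n \<omega> * - (A1 n \<omega> / (real n * sqrt n)) + (J12 n \<omega> / real n ^ 2) / d n \<omega> * (A2 n \<omega> / sqrt n)"
    unfolding p D_eq[OF n] ss unfolding s(2) using s(1)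
    by (cases "d n \<omega> = 0") (simp_all add: field_simps power2_eq_square power4_eq_xxxx)
  show "real n powr (1/2) * ((- A1 n \<omega> * J12 n \<omega> + A2 n \<omega> * J1 n \<omega>) / D n \<omega>)
      = (J12 n \<omega> / real n ^ 2) / d n \<omega> * - (A1 n \<omega> / (real n * sqrt n)) + (J1 n \<omega> / real n ^ 3) / d n \<omega> * (A2 n \<omega> / sqrt n)"
    unfolding p D_eq[OF n] ss unfolding s(2) using s(1)
    by (cases "d n \<omega> = 0") (simp_all add: field_simps power2_eq_square power3_eq_cube power4_eq_xxxx)
qed

text \<open>Divide numerator and denominator by \<open>n ^ 4\<close>: the determinant has a
  positive limit, and every term of the numerators contains a factor that tends to zero.\<close>

lemma errors_consistent:
  "AE \<omega> in M. (\<lambda>n. (- A1 n \<omega> * J2 n \<omega> + A2 n \<omega> * J12 n \<omega>) / D n \<omega>) \<longlonglongrightarrow> 0 \<and>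
     (\<lambda>n. (- A1 n \<omega> * J12 n \<omega> + A2 n \<omega> * J1 n \<omega>) / D n \<omega>) \<longlonglongrightarrow> 0"
  using statistics_limits d_limit
proof eventually_elim
  case (elim \<omega>)
  have d0: "c / (3 * r\<^sup>2) * c \<noteq> 0" using c r by simp
  have i: "(\<lambda>n. 1 / real n) \<longlonglongrightarrow> 0" by real_asymp
  have "(\<lambda>n. (- (A1 n \<omega> / real n ^ 2) * (J2 n \<omega> / real n) * (1 / real n) + (A2 n \<omega> / real n) * (J12 n \<omega> / real n ^ 2) * (1 / real n)) / d n \<omega>)
     \<longlonglongrightarrow> (- 0 * c * 0 + 0 * 0 * 0) / (c / (3 * r\<^sup>2) * c)"
    by (intro tendsto_intros elim i d0)
  moreover have "\<forall>\<^sub>F n in sequentially. (- (A1 n \<omega> / real n ^ 2) * (J2 n \<omega> / real n) * (1 / real n) + (A2 n \<omega> / real n) * (J12 n \<omega> / real n ^ 2) * (1 / real n)) / d n \<omega>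
     = (- A1 n \<omega> * J2 n \<omega> + A2 n \<omega> * J12 n \<omega>) / D n \<omega>"
  proof (rule eventually_sequentiallyI[of 1])
    fix n :: nat assume "1 \<le> n"
    then have n: "n \<noteq> 0" by simp
    then show "(- (A1 n \<omega> / real n ^ 2) * (J2 n \<omega> / real n) * (1 / real n) + (A2 n \<omega> / real n) * (J12 n \<omega> / real n ^ 2) * (1 / real n)) / d n \<omega>
     = (- A1 n \<omega> * J2 n \<omega> + A2 n \<omega> * J12 n \<omega>) / D n \<omega>"
      unfolding D_eq[OF n] by (cases "d n \<omega> = 0") (simp_all add: field_simps power2_eq_square power4_eq_xxxx)
  qed
  ultimately have 1: "(\<lambda>n. (- A1 n \<omega> * J2 n \<omega> + A2 n \<omega> * J12 n \<omega>) / D n \<omega>) \<longlonglongrightarrow> 0"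
    by (simp add: filterlim_cong[OF refl refl])
  have "(\<lambda>n. (- (A1 n \<omega> / real n ^ 2) * (J12 n \<omega> / real n ^ 2) + (A2 n \<omega> / real n) * (J1 n \<omega> / real n ^ 3)) / d n \<omega>)
     \<longlonglongrightarrow> (- 0 * 0 + 0 * (c / (3 * r\<^sup>2))) / (c / (3 * r\<^sup>2) * c)"
    by (intro tendsto_intros elim d0)
  moreover have "\<forall>\<^sub>F n in sequentially. (- (A1 n \<omega> / real n ^ 2) * (J12 n \<omega> / real n ^ 2) + (A2 n \<omega> / real n) * (J1 n \<omega> / real n ^ 3)) / d n \<omega>
     = (- A1 n \<omega> * J12 n \<omega> + A2 n \<omega> * J1 n \<omega>) / D n \<omega>"
  proof (rule eventually_sequentiallyI[of 1])
    fix n :: nat assume "1 \<le> n"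
    then have n: "n \<noteq> 0" by simp
    then show "(- (A1 n \<omega> / real n ^ 2) * (J12 n \<omega> / real n ^ 2) + (A2 n \<omega> / real n) * (J1 n \<omega> / real n ^ 3)) / d n \<omega>
     = (- A1 n \<omega> * J12 n \<omega> + A2 n \<omega> * J1 n \<omega>) / D n \<omega>"
      unfolding D_eq[OF n] by (cases "d n \<omega> = 0") (simp_all add: field_simps power2_eq_square power3_eq_cube power4_eq_xxxx)
  qed
  ultimately have 2: "(\<lambda>n. (- A1 n \<omega> * J12 n \<omega> + A2 n \<omega> * J1 n \<omega>) / D n \<omega>) \<longlonglongrightarrow> 0"
    by (simp add: filterlim_cong[OF refl refl])
  show ?case using 1 2 by blast
qed

text \<open>The normalized information and the covariance of the normalized scores have the same
  diagonal limit, with entries \<open>c / (3 r\<^sup>2)\<close> and \<open>c\<close>. The errors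
  are the scores multiplied by the inverse information, so their limiting covariance is the
  inverse of that matrix.\<close>

theorem errors_asymptotically_normal:
  fixes X :: "nat \<Rightarrow> 'a \<Rightarrow> real \<times> real"
  assumes mX: "\<And>n. X n \<in> borel_measurable M"
    and eq: "\<And>n. 1 \<le> n \<Longrightarrow> AE \<omega> in M. X n \<omega> =
       (real n powr (3/2) * ((- A1 n \<omega> * J2 n \<omega> + A2 n \<omega> * J12 n \<omega>) / D n \<omega>),
        real n powr (1/2) * ((- A1 n \<omega> * J12 n \<omega> + A2 n \<omega> * J1 n \<omega>) / D n \<omega>))"
  shows "converges_in_distribution M X (diagonal_gaussian (1 / sqrt (c / (3 * r\<^sup>2))) (1 / sqrt c))"
proof -
  define c1 where "c1 = c / (3 * r\<^sup>2)"
  have c1: "0 < c1" using c r by (simp add: c1_def)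
  have K: "0 \<le> K" by (rule order_trans[OF _ fourth_bound(1)[of 1]]) auto
  have d0: "c1 * c \<noteq> 0" using c c1 by simp
  have md[measurable]: "d n \<in> borel_measurable M" for n unfolding d_def[abs_def] by measurable
  note lims = statistics_limits(1)[folded c1_def] statistics_limits(2,3) d_limit[folded c1_def]
  have "converges_in_distribution M X (diagonal_gaussian (1 / c1 * sqrt c1) (1 / c * sqrt c))"
  proof (rule slutsky_diagonal_gaussian[where K = "max (sqrt K / r\<^sup>2) (sqrt K)" and a = "\<lambda>n \<omega>. - (A1 n \<omega> / (real n * sqrt n))"
        and b = "\<lambda>n \<omega>. A2 n \<omega> / sqrt n" and p = "\<lambda>n \<omega>. (J2 n \<omega> / real n) / d n \<omega>" and q = "\<lambda>n \<omega>. (J12 n \<omega> / real n ^ 2) / d n \<omega>"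
        and r = "\<lambda>n \<omega>. (J12 n \<omega> / real n ^ 2) / d n \<omega>" and s = "\<lambda>n \<omega>. (J1 n \<omega> / real n ^ 3) / d n \<omega>"])
    show "AE \<omega> in M. X n \<omega> = ((J2 n \<omega> / real n) / d n \<omega> * - (A1 n \<omega> / (real n * sqrt n)) + (J12 n \<omega> / real n ^ 2) / d n \<omega> * (A2 n \<omega> / sqrt n),
        (J12 n \<omega> / real n ^ 2) / d n \<omega> * - (A1 n \<omega> / (real n * sqrt n)) + (J1 n \<omega> / real n ^ 3) / d n \<omega> * (A2 n \<omega> / sqrt n))" if "1 \<le> n" for n
    proof -
      have "n \<noteq> 0" using that by simp
      from eq[OF that] show ?thesis unfolding scaled_errors[OF \<open>n \<noteq> 0\<close>] .
    qed
    show "integrable M (\<lambda>\<omega>. (- (A1 n \<omega> / (real n * sqrt n)))\<^sup>2)" for n using score_second_moments(1)[of n] by (simp only: power2_minus)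
    show "expectation (\<lambda>\<omega>. (- (A1 n \<omega> / (real n * sqrt n)))\<^sup>2) \<le> max (sqrt K / r\<^sup>2) (sqrt K)" for n
      using score_second_moments(2)[of n] unfolding power2_minus by linarith
    show "integrable M (\<lambda>\<omega>. (A2 n \<omega> / sqrt n)\<^sup>2)" for n by (rule score_second_moments)
    show "expectation (\<lambda>\<omega>. (A2 n \<omega> / sqrt n)\<^sup>2) \<le> max (sqrt K / r\<^sup>2) (sqrt K)" for n
      using score_second_moments(4)[of n] by linarith
    show "AE \<omega> in M. (\<lambda>n. J2 n \<omega> / real n / d n \<omega>) \<longlonglongrightarrow> 1 / c1" using lims
    proof eventually_elim
      case (elim \<omega>)
      have "(\<lambda>n. J2 n \<omega> / real n / d n \<omega>) \<longlonglongrightarrow> c / (c1 * c)" by (intro tendsto_intros elim d0)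
      then show ?case using c by simp
    qed
    show "AE \<omega> in M. (\<lambda>n. J1 n \<omega> / real n ^ 3 / d n \<omega>) \<longlonglongrightarrow> 1 / c" using lims
    proof eventually_elim
      case (elim \<omega>)
      have "(\<lambda>n. J1 n \<omega> / real n ^ 3 / d n \<omega>) \<longlonglongrightarrow> c1 / (c1 * c)" by (intro tendsto_intros elim d0)
      then show ?case using c1 by simp
    qed
    have z: "AE \<omega> in M. (\<lambda>n. J12 n \<omega> / real n ^ 2 / d n \<omega>) \<longlonglongrightarrow> 0" using lims
    proof eventually_elim
      case (elim \<omega>)
      have "(\<lambda>n. J12 n \<omega> / real n ^ 2 / d n \<omega>) \<longlonglongrightarrow> 0 / (c1 * c)" by (intro tendsto_intros elim d0)
      then show ?case by simp
    qed
    show "AE \<omega> in M. (\<lambda>n. J12 n \<omega> / real n ^ 2 / d n \<omega>) \<longlonglongrightarrow> 0" "AE \<omega> in M. (\<lambda>n. J12 n \<omega> / real n ^ 2 / d n \<omega>) \<longlonglongrightarrow> 0"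
      by (rule z)+
    fix \<sigma> \<tau>
    have e: "- ((- \<sigma>)\<^sup>2 * (c / (3 * r\<^sup>2)) + \<tau>\<^sup>2 * c) / 2 = - ((\<sigma> * sqrt c1)\<^sup>2 + (\<tau> * sqrt c)\<^sup>2) / 2"
      using c c1 unfolding c1_def[symmetric] by (simp add: power_mult_distrib)
    show "(\<lambda>n. expectation (\<lambda>\<omega>. iexp (\<sigma> * - (A1 n \<omega> / (real n * sqrt n)) + \<tau> * (A2 n \<omega> / sqrt n))))
       \<longlonglongrightarrow> exp (- ((\<sigma> * sqrt c1)\<^sup>2 + (\<tau> * sqrt c)\<^sup>2) / 2)"
      using score_characteristic_function[of "- \<sigma>" \<tau>] unfolding e by (simp only: minus_mult_commute)
  qed (use mX in measurable)
  moreover have "1 / c1 * sqrt c1 = 1 / sqrt c1" "1 / c * sqrt c = 1 / sqrt c"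
    using c1 c by (simp_all add: real_div_sqrt field_simps)
  ultimately show ?thesis unfolding c1_def by simp
qed

end

section \<open>The estimator of the wave equation\<close>

lemma (in adapted_brownian_motion) AE_w_nonzero:
  assumes t: "0 < t"
  shows "AE \<omega> in M. w t \<omega> \<noteq> 0"
proof -
  have D: "distributed M lborel (incr 0 t) (normal_density 0 (sqrt (t - 0)))"
    by (rule incr_distributed) (use t in auto)
  have "emeasure M (incr 0 t -` {0} \<inter> space M) = (\<integral>\<^sup>+x. ennreal (normal_density 0 (sqrt (t - 0)) x) * indicator {0} x \<partial>lborel)"
    by (rule distributed_emeasure[OF D]) simp
  also have "\<dots> = 0" by (rule nn_integral_null_set) (simp add: null_sets_def)
  finally have "AE \<omega> in M. \<omega> \<notin> incr 0 t -` {0} \<inter> space M"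
    by (intro AE_not_in null_setsI) (use t in \<open>auto intro!: measurable_sets[OF incr_M]\<close>)
  moreover have "AE \<omega> in M. w 0 \<omega> = 0" using brownian by (simp add: brownian_motion_def)
  ultimately show ?thesis using AE_space by eventually_elim (auto simp: incr_def)
qed

text \<open>If \<open>\<beta> \<noteq> 0\<close>, then \<open>U' = V = - (\<alpha> / \<beta>)
  U\<close> with \<open>U 0 = 0\<close>, so \<open>U\<close> vanishes. Then \<open>V\<close>
  vanishes in the interior, as the derivative of \<open>U\<close>.\<close>

lemma oscillator_zero:
  fixes U V :: "real \<Rightarrow> real"
  assumes T: "0 < T" and U: "continuous_on {0..T} U" and V: "continuous_on {0..T} V"
    and eqU: "\<And>t. t \<in> {0..T} \<Longrightarrow> U t = integral {0..t} V"
    and nz: "\<alpha> \<noteq> 0 \<or> \<beta> \<noteq> 0" and dep: "\<And>t. t \<in> {0..T} \<Longrightarrow> \<alpha> * U t + \<beta> * V t = 0"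
  shows "\<And>t. t \<in> {0..T} \<Longrightarrow> U t = 0" "\<And>t. t \<in> {0<..<T} \<Longrightarrow> V t = 0"
proof -
  have dU: "(U has_real_derivative V s) (at s within {0..T})" if "s \<in> {0..T}" for s
  proof (rule has_field_derivative_transform_within[OF _ zero_less_one that])
    show "((\<lambda>s. integral {0..s} V) has_real_derivative V s) (at s within {0..T})"
      by (intro integral_has_real_derivative V that)
  qed (use eqU in auto)
  have U0: "U 0 = 0" using eqU[of 0] T by simp
  show Uz: "U t = 0" if t: "t \<in> {0..T}" for t
  proof (cases "\<beta> = 0")
    case True
    then show ?thesis using nz dep[OF t] by simp
  next
    case False
    define c where "c = - \<alpha> / \<beta>"
    have Vc: "V s = c * U s" if "s \<in> {0..T}" for s
      using dep[OF that] False by (simp add: c_def field_simps add_eq_0_iff)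
    define h where "h = (\<lambda>s. U s * exp (- c * s))"
    have "(h has_real_derivative 0) (at s within {0..T})" if s: "s \<in> {0..T}" for s
      unfolding h_def by (auto intro!: derivative_eq_intros dU s simp: Vc[OF s])
    then have "h t = h 0"
      using has_field_derivative_zero_constant[of "{0..T}" h] t T
      by (metis atLeastAtMost_iff convex_real_interval(5) less_imp_le order_refl)
    then show ?thesis by (simp add: h_def U0)
  qed
  show "V t = 0" if t: "t \<in> {0<..<T}" for t
  proof -
    have tt: "t \<in> {0..T}" using t by simp
    have "(U has_real_derivative V t) (at t)"
      using dU[OF tt] at_within_Icc_at[of 0 t T] t by simp
    moreover have "(U has_real_derivative 0) (at t)"
    proof (rule has_field_derivative_transform_within_open[where S = "{0<..<T}" and f = "\<lambda>_. 0"])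
      show "\<And>x. x \<in> {0<..<T} \<Longrightarrow> 0 = U x" using Uz by auto
    qed (use t in auto)
    ultimately show ?thesis by (rule DERIV_unique)
  qed
qed

context wave_mode begin

text \<open>Otherwise \<open>u\<close> and \<open>v\<close> would vanish, and the equation would
  force \<open>w\<close> to vanish at the interior time \<open>T / 2\<close>.\<close>

lemma not_degenerate:
  "AE \<omega> in M. \<forall>\<alpha> \<beta>. (\<forall>t\<in>{0..T}. \<alpha> * u t \<omega> + \<beta> * v t \<omega> = 0) \<longrightarrow> \<alpha> = 0 \<and> \<beta> = 0"
proof -
  have h: "0 < T / 2" "T / 2 \<in> {0..T}" "T / 2 \<in> {0<..<T}" using T by auto
  show ?thesis using cont eqs AE_w_nonzero[OF h(1)]
  proof eventually_elim
    case (elim \<omega>)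
    note c = elim(1) and e = elim(2) and nz = elim(3)
    show ?case
    proof (intro allI impI, rule ccontr)
      fix \<alpha> \<beta>
      assume dep: "\<forall>t\<in>{0..T}. \<alpha> * u t \<omega> + \<beta> * v t \<omega> = 0" and "\<not> (\<alpha> = 0 \<and> \<beta> = 0)"
      then have n: "\<alpha> \<noteq> 0 \<or> \<beta> \<noteq> 0" by blast
      have e1: "u t \<omega> = integral {0..t} (\<lambda>s. v s \<omega>)" if "t \<in> {0..T}" for t
        by (rule conjunct1[OF bspec[OF e that]])
      have e2: "v t \<omega> = - a * integral {0..t} (\<lambda>s. u s \<omega>) + b * integral {0..t} (\<lambda>s. v s \<omega>) + w t \<omega>" if "t \<in> {0..T}" for t
        by (rule conjunct2[OF bspec[OF e that]])
      note z = oscillator_zero[OF T conjunct1[OF c] conjunct2[OF c] e1 n bspec[OF dep]]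
      have u0: "u t \<omega> = 0" if "t \<in> {0..T}" for t by (rule z(1)[OF _ _ that]; assumption)
      have v0: "v t \<omega> = 0" if "t \<in> {0<..<T}" for t by (rule z(2)[OF _ _ that]; assumption)
      have "integral {0..T / 2} (\<lambda>s. u s \<omega>) = integral {0..T / 2} (\<lambda>s. 0)"
        by (rule Henstock_Kurzweil_Integration.integral_cong, rule u0) (use T in auto)
      moreover have "integral {0..T / 2} (\<lambda>s. v s \<omega>) = 0" using e1[OF h(2)] u0[OF h(2)] by simp
      ultimately have "w (T / 2) \<omega> = 0" using e2[OF h(2)] v0[OF h(3)] by simp
      then show False using nz by simp
    qed
  qed
qed

text \<open>A common bound for the fourth moments of all normalized statistics of the mode. It
  depends on \<open>b\<close> and \<open>T\<close> only, so it serves all modes of the equation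
  alike.\<close>

definition normalized_bound :: real where
  "normalized_bound = (2 * 8 ^ 8 * exp ((exp (\<bar>b\<bar> * T))\<^sup>2 * T / 2) + 1) * exp (3 * T + 3 * T\<^sup>2)
     + T ^ 4 * (2 * 8 ^ 8 * exp ((exp (\<bar>b\<bar> * T))\<^sup>2 * T / 2))"

lemma \<phi>_normalized_bound:
  "s \<in> {0..T} \<Longrightarrow> \<bar>\<phi> (sqrt a) 0 s\<bar> \<le> exp (\<bar>b\<bar> * T)" "s \<in> {0..T} \<Longrightarrow> \<bar>\<phi> 0 1 s\<bar> \<le> exp (\<bar>b\<bar> * T)"
  using kernel_bounds[OF kernel a, of s T] by (auto simp: \<phi>_def)

lemma normalized_score_moments:
  defines "x \<equiv> \<lambda>\<omega>. sqrt a * ito_integral M F w T u \<omega>" and "y \<equiv> ito_integral M F w T v"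
  shows "integrable M (\<lambda>\<omega>. x \<omega> ^ 4)" "integrable M (\<lambda>\<omega>. y \<omega> ^ 4)"
    "expectation (\<lambda>\<omega>. x \<omega> ^ 4) \<le> normalized_bound" "expectation (\<lambda>\<omega>. y \<omega> ^ 4) \<le> normalized_bound"
    "expectation x = 0" "expectation y = 0"
    "expectation (\<lambda>\<omega>. (\<alpha> * x \<omega> + \<beta> * y \<omega>)\<^sup>2) =
       \<alpha>\<^sup>2 * integral {0..T} (\<lambda>t. integral {0..t} (\<lambda>s. (sqrt a * g s)\<^sup>2))
       + 2 * \<alpha> * \<beta> * integral {0..T} (\<lambda>t. integral {0..t} (\<lambda>s. sqrt a * g s * g' s))
       + \<beta>\<^sup>2 * integral {0..T} (\<lambda>t. integral {0..t} (\<lambda>s. (g' s)\<^sup>2))"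
    "null_complete_subalgebra M G \<Longrightarrow> (\<And>t. 0 \<le> t \<Longrightarrow> w t \<in> borel_measurable G) \<Longrightarrow> x \<in> borel_measurable G"
    "null_complete_subalgebra M G \<Longrightarrow> (\<And>t. 0 \<le> t \<Longrightarrow> w t \<in> borel_measurable G) \<Longrightarrow> y \<in> borel_measurable G"
proof -
  have xy: "x = (\<lambda>\<omega>. sqrt a * \<xi> \<omega> + 0 * \<eta> \<omega>)" "y = (\<lambda>\<omega>. 0 * \<xi> \<omega> + 1 * \<eta> \<omega>)"
    by (auto simp: x_def y_def \<xi>_def \<eta>_def)
  have q: "0 \<le> T ^ 4 * (2 * 8 ^ 8 * exp ((exp (\<bar>b\<bar> * T))\<^sup>2 * T / 2))" using T0 by simp
  note mx = ito_combination_moments[OF \<phi>_normalized_bound(1)] and my = ito_combination_moments[OF \<phi>_normalized_bound(2)]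
  show "integrable M (\<lambda>\<omega>. x \<omega> ^ 4)" "expectation x = 0" unfolding xy by (rule mx; assumption)+
  show "integrable M (\<lambda>\<omega>. y \<omega> ^ 4)" "expectation y = 0" unfolding xy by (rule my; assumption)+
  show "expectation (\<lambda>\<omega>. x \<omega> ^ 4) \<le> normalized_bound" unfolding xy normalized_bound_def
    by (rule order_trans[OF mx(2)]) (use q in auto)
  show "expectation (\<lambda>\<omega>. y \<omega> ^ 4) \<le> normalized_bound" unfolding xy normalized_bound_def
    by (rule order_trans[OF my(2)]) (use q in auto)
  show "null_complete_subalgebra M G \<Longrightarrow> (\<And>t. 0 \<le> t \<Longrightarrow> w t \<in> borel_measurable G) \<Longrightarrow> x \<in> borel_measurable G"
    unfolding xy using mode_measurable_subalgebra(1)[of G] by simp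
  show "null_complete_subalgebra M G \<Longrightarrow> (\<And>t. 0 \<le> t \<Longrightarrow> w t \<in> borel_measurable G) \<Longrightarrow> y \<in> borel_measurable G"
    unfolding xy using mode_measurable_subalgebra(2)[of G] by simp
  obtain B where B: "\<And>s. s \<in> {0..T} \<Longrightarrow> \<bar>\<phi> (\<alpha> * sqrt a) \<beta> s\<bar> \<le> B" using \<phi>_bounded by blast
  have e: "\<alpha> * x \<omega> + \<beta> * y \<omega> = (\<alpha> * sqrt a) * \<xi> \<omega> + \<beta> * \<eta> \<omega>" for \<omega> by (simp add: xy)
  note kd = oscillator_kernelD[OF kernel]
  have lin: "integral {0..t} (\<lambda>s. \<alpha>\<^sup>2 * f s + 2 * \<alpha> * \<beta> * h s + \<beta>\<^sup>2 * k s) = \<alpha>\<^sup>2 * integral {0..t} f + 2 * \<alpha> * \<beta> * integral {0..t} h + \<beta>\<^sup>2 * integral {0..t} k"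
    if "continuous_on {0..t} f" "continuous_on {0..t} h" "continuous_on {0..t} k" for t and f h k :: "real \<Rightarrow> real"
    using that by (subst Henstock_Kurzweil_Integration.integral_add; (subst Henstock_Kurzweil_Integration.integral_add)?)
      (auto intro!: integrable_continuous_real continuous_intros)
  have cI: "continuous_on {0..T} (\<lambda>t. integral {0..t} f)" if "\<And>S. continuous_on S f" for f :: "real \<Rightarrow> real"
    by (intro indefinite_integral_continuous_1 integrable_continuous_real that)
  have "expectation (\<lambda>\<omega>. (\<alpha> * x \<omega> + \<beta> * y \<omega>)\<^sup>2) = integral {0..T} (\<lambda>t. integral {0..t} (\<lambda>s. (\<phi> (\<alpha> * sqrt a) \<beta> s)\<^sup>2))"
    unfolding e by (rule ito_combination_moments(4)[OF B])
  also have "(\<lambda>s. (\<phi> (\<alpha> * sqrt a) \<beta> s)\<^sup>2) = (\<lambda>s. \<alpha>\<^sup>2 * (sqrt a * g s)\<^sup>2 + 2 * \<alpha> * \<beta> * (sqrt a * g s * g' s) + \<beta>\<^sup>2 * (g' s)\<^sup>2)"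
    by (rule ext) (simp add: \<phi>_def power2_eq_square algebra_simps del: real_sqrt_mult_self)
  also have "integral {0..T} (\<lambda>t. integral {0..t} (\<lambda>s. \<alpha>\<^sup>2 * (sqrt a * g s)\<^sup>2 + 2 * \<alpha> * \<beta> * (sqrt a * g s * g' s) + \<beta>\<^sup>2 * (g' s)\<^sup>2))
     = integral {0..T} (\<lambda>t. \<alpha>\<^sup>2 * integral {0..t} (\<lambda>s. (sqrt a * g s)\<^sup>2) + 2 * \<alpha> * \<beta> * integral {0..t} (\<lambda>s. sqrt a * g s * g' s) + \<beta>\<^sup>2 * integral {0..t} (\<lambda>s. (g' s)\<^sup>2))"
    by (subst lin) (intro continuous_intros kd, intro continuous_intros kd, intro continuous_intros kd, rule refl)
  also have "\<dots> = \<alpha>\<^sup>2 * integral {0..T} (\<lambda>t. integral {0..t} (\<lambda>s. (sqrt a * g s)\<^sup>2))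
       + 2 * \<alpha> * \<beta> * integral {0..T} (\<lambda>t. integral {0..t} (\<lambda>s. sqrt a * g s * g' s))
       + \<beta>\<^sup>2 * integral {0..T} (\<lambda>t. integral {0..t} (\<lambda>s. (g' s)\<^sup>2))"
    by (rule lin) (intro cI continuous_intros kd)+
  finally show "expectation (\<lambda>\<omega>. (\<alpha> * x \<omega> + \<beta> * y \<omega>)\<^sup>2) =
       \<alpha>\<^sup>2 * integral {0..T} (\<lambda>t. integral {0..t} (\<lambda>s. (sqrt a * g s)\<^sup>2))
       + 2 * \<alpha> * \<beta> * integral {0..T} (\<lambda>t. integral {0..t} (\<lambda>s. sqrt a * g s * g' s))
       + \<beta>\<^sup>2 * integral {0..T} (\<lambda>t. integral {0..t} (\<lambda>s. (g' s)\<^sup>2))" .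
qed

lemma normalized_information_moments:
  defines "q11 \<equiv> \<lambda>\<omega>. a * integral {0..T} (\<lambda>t. (u t \<omega>)\<^sup>2)" and "q12 \<equiv> \<lambda>\<omega>. sqrt a * integral {0..T} (\<lambda>t. u t \<omega> * v t \<omega>)"
    and "q22 \<equiv> \<lambda>\<omega>. integral {0..T} (\<lambda>t. (v t \<omega>)\<^sup>2)"
  shows "integrable M (\<lambda>\<omega>. q11 \<omega> ^ 4)" "integrable M (\<lambda>\<omega>. q12 \<omega> ^ 4)" "integrable M (\<lambda>\<omega>. q22 \<omega> ^ 4)"
    "expectation (\<lambda>\<omega>. q11 \<omega> ^ 4) \<le> normalized_bound" "expectation (\<lambda>\<omega>. q12 \<omega> ^ 4) \<le> normalized_bound"
    "expectation (\<lambda>\<omega>. q22 \<omega> ^ 4) \<le> normalized_bound"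
    "expectation q11 = integral {0..T} (\<lambda>t. integral {0..t} (\<lambda>s. (sqrt a * g s)\<^sup>2))"
    "expectation q12 = integral {0..T} (\<lambda>t. integral {0..t} (\<lambda>s. sqrt a * g s * g' s))"
    "expectation q22 = integral {0..T} (\<lambda>t. integral {0..t} (\<lambda>s. (g' s)\<^sup>2))"
    "null_complete_subalgebra M G \<Longrightarrow> (\<And>t. 0 \<le> t \<Longrightarrow> w t \<in> borel_measurable G) \<Longrightarrow> q11 \<in> borel_measurable G"
    "null_complete_subalgebra M G \<Longrightarrow> (\<And>t. 0 \<le> t \<Longrightarrow> w t \<in> borel_measurable G) \<Longrightarrow> q12 \<in> borel_measurable G"
    "null_complete_subalgebra M G \<Longrightarrow> (\<And>t. 0 \<le> t \<Longrightarrow> w t \<in> borel_measurable G) \<Longrightarrow> q22 \<in> borel_measurable G"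
proof -
  have aa: "sqrt a * sqrt a = a" using a by simp
  have q: "q11 = Q (sqrt a) 0 (sqrt a) 0" "q12 = Q (sqrt a) 0 0 1" "q22 = Q 0 1 0 1"
  proof -
    have "Q (sqrt a) 0 (sqrt a) 0 \<omega> = integral {0..T} (\<lambda>t. a * (u t \<omega>)\<^sup>2)" for \<omega>
    proof -
      have "(sqrt a * y) * (sqrt a * y) = a * y\<^sup>2" for y
        using a by (simp add: power_mult_distrib flip: power2_eq_square)
      then show ?thesis unfolding Q_def X_def by simp
    qed
    then show "q11 = Q (sqrt a) 0 (sqrt a) 0" unfolding q11_def by (simp add: fun_eq_iff)
    have "Q (sqrt a) 0 0 1 \<omega> = integral {0..T} (\<lambda>t. sqrt a * (u t \<omega> * v t \<omega>))" for \<omega>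
      unfolding Q_def X_def by (simp add: mult.assoc)
    then show "q12 = Q (sqrt a) 0 0 1" unfolding q12_def by (simp add: fun_eq_iff)
    show "q22 = Q 0 1 0 1" unfolding q22_def Q_def[abs_def] X_def power2_eq_square by simp
  qed
  have ph: "\<phi> (sqrt a) 0 = (\<lambda>s. sqrt a * g s)" "\<phi> 0 1 = g'" by (auto simp: \<phi>_def)
  have le: "T ^ 4 * (2 * 8 ^ 8 * exp ((exp (\<bar>b\<bar> * T))\<^sup>2 * T / 2)) \<le> normalized_bound"
    unfolding normalized_bound_def by (simp add: add_nonneg_nonneg)
  note m11 = time_product_moments[OF \<phi>_normalized_bound(1) \<phi>_normalized_bound(1)]
    and m12 = time_product_moments[OF \<phi>_normalized_bound(1) \<phi>_normalized_bound(2)]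
    and m22 = time_product_moments[OF \<phi>_normalized_bound(2) \<phi>_normalized_bound(2)]
  show "integrable M (\<lambda>\<omega>. q11 \<omega> ^ 4)" unfolding q by (rule m11(3))
  show "integrable M (\<lambda>\<omega>. q12 \<omega> ^ 4)" unfolding q by (rule m12(3))
  show "integrable M (\<lambda>\<omega>. q22 \<omega> ^ 4)" unfolding q by (rule m22(3))
  show "expectation (\<lambda>\<omega>. q11 \<omega> ^ 4) \<le> normalized_bound" unfolding q by (rule order_trans[OF m11(4) le])
  show "expectation (\<lambda>\<omega>. q12 \<omega> ^ 4) \<le> normalized_bound" unfolding q by (rule order_trans[OF m12(4) le])
  show "expectation (\<lambda>\<omega>. q22 \<omega> ^ 4) \<le> normalized_bound" unfolding q by (rule order_trans[OF m22(4) le])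
  show "expectation q11 = integral {0..T} (\<lambda>t. integral {0..t} (\<lambda>s. (sqrt a * g s)\<^sup>2))"
    using m11(5) unfolding q ph power2_eq_square .
  show "expectation q12 = integral {0..T} (\<lambda>t. integral {0..t} (\<lambda>s. sqrt a * g s * g' s))"
    using m12(5) unfolding q ph .
  show "expectation q22 = integral {0..T} (\<lambda>t. integral {0..t} (\<lambda>s. (g' s)\<^sup>2))"
    using m22(5) unfolding q ph power2_eq_square .
  show "null_complete_subalgebra M G \<Longrightarrow> (\<And>t. 0 \<le> t \<Longrightarrow> w t \<in> borel_measurable G) \<Longrightarrow> q11 \<in> borel_measurable G"
    "null_complete_subalgebra M G \<Longrightarrow> (\<And>t. 0 \<le> t \<Longrightarrow> w t \<in> borel_measurable G) \<Longrightarrow> q12 \<in> borel_measurable G"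
    "null_complete_subalgebra M G \<Longrightarrow> (\<And>t. 0 \<le> t \<Longrightarrow> w t \<in> borel_measurable G) \<Longrightarrow> q22 \<in> borel_measurable G"
    unfolding q by (rule mode_measurable_subalgebra(3); assumption)+
qed

end

text \<open>A vanishing determinant provides a null vector \<open>(\<alpha>, \<beta>)\<close> of
  the information. Its quadratic form is the sum over the modes of \<open>\<integral> (- \<alpha>
  k\<^sup>2 u\<^sub>k + \<beta> v\<^sub>k)\<^sup>2\<close>, so the first mode alone would be
  degenerate. The quadratic form is obtained from the log-likelihood by setting the stochastic
  integrals to zero.\<close>

lemma information_determinant_nonzero:
  fixes U V :: "nat \<Rightarrow> real \<Rightarrow> real"
  assumes T: "0 < T" and N: "1 \<le> N"
    and cont: "\<And>k. k \<in> {1..N} \<Longrightarrow> continuous_on {0..T} (U k)" "\<And>k. k \<in> {1..N} \<Longrightarrow> continuous_on {0..T} (V k)"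
    and indep: "\<And>\<alpha> \<beta>. (\<forall>t\<in>{0..T}. \<alpha> * U 1 t + \<beta> * V 1 t = 0) \<Longrightarrow> \<alpha> = 0 \<and> \<beta> = 0"
  defines "J1 \<equiv> \<Sum>k=1..N. real k ^ 4 * integral {0..T} (\<lambda>t. (U k t)\<^sup>2)"
    and "J2 \<equiv> \<Sum>k=1..N. integral {0..T} (\<lambda>t. (V k t)\<^sup>2)"
    and "J12 \<equiv> \<Sum>k=1..N. (real k)\<^sup>2 * integral {0..T} (\<lambda>t. U k t * V k t)"
  shows "J1 * J2 - J12\<^sup>2 \<noteq> 0"
proof
  assume det: "J1 * J2 - J12\<^sup>2 = 0"
  obtain \<alpha> \<beta> where nz: "\<alpha> \<noteq> 0 \<or> \<beta> \<noteq> 0" and z: "\<alpha>\<^sup>2 * J1 - 2 * \<alpha> * \<beta> * J12 + \<beta>\<^sup>2 * J2 = 0"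
  proof (cases "J1 = 0")
    case True
    then show ?thesis using that[of 1 0] by simp
  next
    case False
    have "J12\<^sup>2 * J1 - 2 * J12 * J1 * J12 + J1\<^sup>2 * J2 = J1 * (J1 * J2 - J12\<^sup>2)" by (simp add: power2_eq_square algebra_simps)
    then show ?thesis using that[of J12 J1] False det by simp
  qed
  have "log_likelihood T (\<lambda>k t _. U k t) (\<lambda>k t _. V k t) (\<lambda>_ _. 0) (\<lambda>_ _. 0) N () \<alpha> \<beta>
      = - 1/2 * (\<alpha>\<^sup>2 * J1 - 2 * \<alpha> * \<beta> * J12 + \<beta>\<^sup>2 * J2)"
    unfolding J1_def J2_def J12_def by (subst log_likelihood_quadratic) (use cont in auto)
  then have "(\<Sum>k=1..N. integral {0..T} (\<lambda>t. (- \<alpha> * (real k)\<^sup>2 * U k t + \<beta> * V k t)\<^sup>2)) = 0"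
    using z by (simp add: log_likelihood_def sum_negf sum_divide_distrib[symmetric])
  moreover have nn: "0 \<le> integral {0..T} (\<lambda>t. (- \<alpha> * (real k)\<^sup>2 * U k t + \<beta> * V k t)\<^sup>2)" if "k \<in> {1..N}" for k
    by (rule Henstock_Kurzweil_Integration.integral_nonneg) (auto intro!: integrable_continuous_real continuous_intros cont that)
  ultimately have "\<forall>k\<in>{1..N}. integral {0..T} (\<lambda>t. (- \<alpha> * (real k)\<^sup>2 * U k t + \<beta> * V k t)\<^sup>2) = 0"
    by (subst (asm) sum_nonneg_eq_0_iff) simp_all
  then have "integral {0..T} (\<lambda>t. (- \<alpha> * (real 1)\<^sup>2 * U 1 t + \<beta> * V 1 t)\<^sup>2) = 0"
    by (rule bspec) (use N in simp)
  then have I: "integral {0..T} (\<lambda>t. (- \<alpha> * U 1 t + \<beta> * V 1 t)\<^sup>2) = 0" by simp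
  have c: "continuous_on {0..T} (\<lambda>t. (- \<alpha> * U 1 t + \<beta> * V 1 t)\<^sup>2)"
    using cont[of 1] N by (auto intro!: continuous_intros)
  have "\<forall>t\<in>{0..T}. (- \<alpha> * U 1 t + \<beta> * V 1 t)\<^sup>2 = 0"
    using integral_eq_0_iff[OF c T] I by simp
  then have "\<forall>t\<in>{0..T}. (- \<alpha>) * U 1 t + \<beta> * V 1 t = 0" by simp
  from indep[OF this] nz show False by simp
qed

lemma estimator_error:
  fixes J1 J2 J12 A1 A2 \<theta>1 \<theta>2 :: real
  assumes "J1 * J2 - J12\<^sup>2 \<noteq> 0" "B1 = \<theta>1 * J1 - \<theta>2 * J12 - A1" "B2 = - \<theta>1 * J12 + \<theta>2 * J2 + A2"
  shows "(B1 * J2 + B2 * J12) / (J1 * J2 - J12\<^sup>2) - \<theta>1 = (- A1 * J2 + A2 * J12) / (J1 * J2 - J12\<^sup>2)"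
    "(B1 * J12 + B2 * J1) / (J1 * J2 - J12\<^sup>2) - \<theta>2 = (- A1 * J12 + A2 * J1) / (J1 * J2 - J12\<^sup>2)"
proof -
  have "B1 * J2 + B2 * J12 = \<theta>1 * (J1 * J2 - J12\<^sup>2) + (- A1 * J2 + A2 * J12)"
    "B1 * J12 + B2 * J1 = \<theta>2 * (J1 * J2 - J12\<^sup>2) + (- A1 * J12 + A2 * J1)"
    unfolding assms(2,3) by (simp_all add: power2_eq_square algebra_simps)
  then show "(B1 * J2 + B2 * J12) / (J1 * J2 - J12\<^sup>2) - \<theta>1 = (- A1 * J2 + A2 * J12) / (J1 * J2 - J12\<^sup>2)"
    "(B1 * J12 + B2 * J1) / (J1 * J2 - J12\<^sup>2) - \<theta>2 = (- A1 * J12 + A2 * J1) / (J1 * J2 - J12\<^sup>2)"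
    using assms(1) by (simp_all add: add_divide_distrib)
qed

theorem theorem1p1:
  fixes M :: "'a measure" and F :: "real \<Rightarrow> 'a measure"
    and W :: "(real \<Rightarrow> real) \<Rightarrow> real \<Rightarrow> 'a \<Rightarrow> real"
    and u :: "real \<Rightarrow> real \<Rightarrow> 'a \<Rightarrow> real" and v :: "nat \<Rightarrow> real \<Rightarrow> 'a \<Rightarrow> real"
    and T \<theta>1 \<theta>2 :: real
  assumes "stochastic_basis M F"
    and "cylindrical_brownian_motion M F W"
    and "T > 0" and "\<theta>1 > 0"
    and "wave_solution M F W T \<theta>1 \<theta>2 u v"
  shows "(AE \<omega> in M.
           (\<lambda>N. fst (wave_mle M F W T \<theta>1 \<theta>2 u v N \<omega>)) \<longlonglongrightarrow> \<theta>1 \<and>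
           (\<lambda>N. snd (wave_mle M F W T \<theta>1 \<theta>2 u v N \<omega>)) \<longlonglongrightarrow> \<theta>2) \<and>
         (\<exists>\<mu> :: (real \<times> real) measure.
           gaussian_measure \<mu> \<and> zero_mean \<mu> \<and> nondegenerate \<mu> \<and>
           converges_in_distribution M
             (\<lambda>N \<omega>. (real N powr (3/2) * (fst (wave_mle M F W T \<theta>1 \<theta>2 u v N \<omega>) - \<theta>1),
                      real N powr (1/2) * (snd (wave_mle M F W T \<theta>1 \<theta>2 u v N \<omega>) - \<theta>2))) \<mu>)"
proof -
  interpret stochastic_basis M F by fact
  define w where "w = (\<lambda>k. W (sine_basis k))"
  define U where "U = fourier_coeff u"
  define a where "a = (\<lambda>k. \<theta>1 * (real k)\<^sup>2)"
  have bm: "brownian_motion M F (w k)" if "1 \<le> k" for k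
    using assms(2) that by (auto simp: cylindrical_brownian_motion_def w_def)
  let ?N = "PiM {0..} (\<lambda>_. borel) :: (real \<Rightarrow> real) measure"
  let ?path = "\<lambda>k \<omega>. \<lambda>t\<in>{0..}. w k t \<omega>"
  have ind: "indep_vars (\<lambda>_. ?N) ?path {1..}"
    using assms(2) by (auto simp: cylindrical_brownian_motion_def w_def)
  have "\<forall>k. \<exists>g g'. oscillator_kernel (a k) \<theta>2 g g'" using oscillator_kernel_exists by blast
  then obtain g g' where ker: "\<And>k. oscillator_kernel (a k) \<theta>2 (g k) (g' k)" by metis
  have wm: "wave_mode M F (w k) T (a k) \<theta>2 (U k) (v k) (g k) (g' k)" if k: "1 \<le> k" for k
  proof
    show "brownian_motion M F (w k)" by (rule bm[OF k])
    show "0 < T" by fact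
    show "0 < a k" using assms(4) k by (simp add: a_def)
    show "adapted F {0..T} (U k)" "adapted F {0..T} (v k)"
      "AE \<omega> in M. continuous_on {0..T} (\<lambda>t. U k t \<omega>) \<and> continuous_on {0..T} (\<lambda>t. v k t \<omega>)"
      using assms(5) k by (auto simp: wave_solution_def U_def)
    show "AE \<omega> in M. \<forall>t\<in>{0..T}. U k t \<omega> = integral {0..t} (\<lambda>s. v k s \<omega>) \<and>
       v k t \<omega> = - a k * integral {0..t} (\<lambda>s. U k s \<omega>) + \<theta>2 * integral {0..t} (\<lambda>s. v k s \<omega>) + w k t \<omega>"
      using assms(5) k by (auto simp: wave_solution_def U_def a_def w_def)
    show "oscillator_kernel (a k) \<theta>2 (g k) (g' k)" by (rule ker)
  qed
  have alim: "filterlim a at_top sequentially" unfolding a_def using assms(4) by real_asymp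
  define m11 where "m11 = (\<lambda>k. integral {0..T} (\<lambda>t. integral {0..t} (\<lambda>s. (sqrt (a k) * g k s)\<^sup>2)))"
  define m12 where "m12 = (\<lambda>k. integral {0..T} (\<lambda>t. integral {0..t} (\<lambda>s. sqrt (a k) * g k s * g' k s)))"
  define m22 where "m22 = (\<lambda>k. integral {0..T} (\<lambda>t. integral {0..t} (\<lambda>s. (g' k s)\<^sup>2)))"
  obtain c where c: "0 < c" "m11 \<longlonglongrightarrow> c" "m22 \<longlonglongrightarrow> c" "m12 \<longlonglongrightarrow> 0"
    using oscillator_energy_limits[OF assms(3) alim ker] unfolding m11_def m12_def m22_def by blast
  define G where "G = (\<lambda>k. completed_vimage_algebra M ?N (?path k))"
  have pathM: "?path k \<in> measurable M ?N" if "1 \<le> k" for k using ind that by (auto simp: indep_vars_def)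
  have G: "null_complete_subalgebra M (G k)" if "1 \<le> k" for k
    unfolding G_def by (rule complete_measure.completed_vimage_algebra(1)[OF complete_measure_M pathM[OF that]])
  have wG: "w k t \<in> borel_measurable (G k)" if k: "1 \<le> k" and t: "0 \<le> t" for k t
  proof -
    have "?path k \<in> measurable (G k) ?N"
      unfolding G_def by (rule complete_measure.completed_vimage_algebra(2)[OF complete_measure_M pathM[OF k]])
    then have "(\<lambda>\<omega>. ?path k \<omega> t) \<in> borel_measurable (G k)"
      by (rule measurable_compose) (rule measurable_component_singleton, use t in simp)
    then show ?thesis using t by simp
  qed
  define \<xi> where "\<xi> = (\<lambda>k. ito_integral M F (w k) T (U k))"
  define y where "y = (\<lambda>k. ito_integral M F (w k) T (v k))"
  define x where "x = (\<lambda>k \<omega>. sqrt (a k) * \<xi> k \<omega>)"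
  define q11 where "q11 = (\<lambda>k \<omega>. a k * integral {0..T} (\<lambda>t. (U k t \<omega>)\<^sup>2))"
  define q12 where "q12 = (\<lambda>k \<omega>. sqrt (a k) * integral {0..T} (\<lambda>t. U k t \<omega> * v k t \<omega>))"
  define q22 where "q22 = (\<lambda>k \<omega>. integral {0..T} (\<lambda>t. (v k t \<omega>)\<^sup>2))"
  \<comment> \<open>\<open>sqrt (a k) = r * k\<close>, so the weight \<open>k / r\<close> turns
    \<open>sqrt (a k)\<close> into \<open>k\<^sup>2\<close>.\<close>
  define r where "r = sqrt \<theta>1"
  have r: "0 < r" "r\<^sup>2 = \<theta>1" using assms(4) by (auto simp: r_def)
  define K where "K = wave_mode.normalized_bound T \<theta>2"
  note score = wave_mode.normalized_score_moments[OF wm] and info = wave_mode.normalized_information_moments[OF wm]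
  interpret IM: independent_modes M G x y q11 q12 q22 m11 m12 m22 r c K
  proof
    show "indep_sets (\<lambda>k. sets (G k)) {1..}" unfolding G_def
      by (rule indep_sets_completed_vimage_algebra[OF complete_measure_M ind])
    show "m11 \<longlonglongrightarrow> c" "m12 \<longlonglongrightarrow> 0" "m22 \<longlonglongrightarrow> c" "0 < r" "0 < c" by fact+
    fix k :: nat assume k: "1 \<le> k"
    show "subalgebra M (G k)" using G[OF k] by (simp add: null_complete_subalgebra_def)
    show "x k \<in> borel_measurable (G k)" "y k \<in> borel_measurable (G k)"
      unfolding x_def y_def \<xi>_def by (rule score(8,9)[OF k G[OF k] wG[OF k]]; assumption)+
    show "q11 k \<in> borel_measurable (G k)" "q12 k \<in> borel_measurable (G k)" "q22 k \<in> borel_measurable (G k)"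
      unfolding q11_def q12_def q22_def by (rule info(10-12)[OF k G[OF k] wG[OF k]]; assumption)+
    show "integrable M (\<lambda>\<omega>. x k \<omega> ^ 4)" "integrable M (\<lambda>\<omega>. y k \<omega> ^ 4)"
      "expectation (\<lambda>\<omega>. x k \<omega> ^ 4) \<le> K" "expectation (\<lambda>\<omega>. y k \<omega> ^ 4) \<le> K" "expectation (x k) = 0" "expectation (y k) = 0"
      unfolding x_def y_def \<xi>_def K_def by (rule score(1-6)[OF k])+
    show "integrable M (\<lambda>\<omega>. q11 k \<omega> ^ 4)" "integrable M (\<lambda>\<omega>. q12 k \<omega> ^ 4)" "integrable M (\<lambda>\<omega>. q22 k \<omega> ^ 4)"
      "expectation (\<lambda>\<omega>. q11 k \<omega> ^ 4) \<le> K" "expectation (\<lambda>\<omega>. q12 k \<omega> ^ 4) \<le> K" "expectation (\<lambda>\<omega>. q22 k \<omega> ^ 4) \<le> K"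
      "expectation (q11 k) = m11 k" "expectation (q12 k) = m12 k" "expectation (q22 k) = m22 k"
      unfolding q11_def q12_def q22_def K_def m11_def m12_def m22_def by (rule info(1-9)[OF k])+
    show "expectation (\<lambda>\<omega>. (\<alpha> * x k \<omega> + \<beta> * y k \<omega>)\<^sup>2) = \<alpha>\<^sup>2 * m11 k + 2 * \<alpha> * \<beta> * m12 k + \<beta>\<^sup>2 * m22 k" for \<alpha> \<beta>
      unfolding x_def y_def \<xi>_def m11_def m12_def m22_def by (rule score(7)[OF k])
  qed
  have sqa: "sqrt (a k) = r * real k" for k
    using assms(4) by (simp add: a_def r_def real_sqrt_mult)
  have J: "IM.J1 n \<omega> = (\<Sum>k=1..n. real k ^ 4 * integral {0..T} (\<lambda>t. (U k t \<omega>)\<^sup>2))"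
    "IM.J12 n \<omega> = (\<Sum>k=1..n. (real k)\<^sup>2 * integral {0..T} (\<lambda>t. U k t \<omega> * v k t \<omega>))"
    "IM.J2 n \<omega> = (\<Sum>k=1..n. integral {0..T} (\<lambda>t. (v k t \<omega>)\<^sup>2))"
    "IM.A1 n \<omega> = (\<Sum>k=1..n. (real k)\<^sup>2 * \<xi> k \<omega>)" "IM.A2 n \<omega> = (\<Sum>k=1..n. y k \<omega>)" for n \<omega>
  proof -
    have p: "(real k / r)\<^sup>2 * (a k * z) = real k ^ 4 * z" "real k / r * (sqrt (a k) * z) = (real k)\<^sup>2 * z" for k z
      unfolding sqa using r assms(4) by (simp_all add: a_def power_divide power2_eq_square power4_eq_xxxx)
    show "IM.J1 n \<omega> = (\<Sum>k=1..n. real k ^ 4 * integral {0..T} (\<lambda>t. (U k t \<omega>)\<^sup>2))"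
      "IM.J12 n \<omega> = (\<Sum>k=1..n. (real k)\<^sup>2 * integral {0..T} (\<lambda>t. U k t \<omega> * v k t \<omega>))"
      "IM.J2 n \<omega> = (\<Sum>k=1..n. integral {0..T} (\<lambda>t. (v k t \<omega>)\<^sup>2))"
      "IM.A1 n \<omega> = (\<Sum>k=1..n. (real k)\<^sup>2 * \<xi> k \<omega>)" "IM.A2 n \<omega> = (\<Sum>k=1..n. y k \<omega>)"
      unfolding IM.J1_def IM.J12_def IM.J2_def IM.A1_def IM.A2_def unfolding q11_def q12_def q22_def x_def p by (rule refl)+
  qed
  define mle where "mle = wave_mle M F W T \<theta>1 \<theta>2 u v"
  define E where "E = (\<lambda>n \<omega>. ((- IM.A1 n \<omega> * IM.J2 n \<omega> + IM.A2 n \<omega> * IM.J12 n \<omega>) / IM.D n \<omega>,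
      (- IM.A1 n \<omega> * IM.J12 n \<omega> + IM.A2 n \<omega> * IM.J1 n \<omega>) / IM.D n \<omega>))"
  have cont: "AE \<omega> in M. \<forall>k. 1 \<le> k \<longrightarrow> continuous_on {0..T} (\<lambda>t. U k t \<omega>) \<and> continuous_on {0..T} (\<lambda>t. v k t \<omega>)"
    unfolding AE_all_countable using assms(5) by (auto simp: wave_solution_def U_def)
  have nondeg: "AE \<omega> in M. \<forall>\<alpha> \<beta>. (\<forall>t\<in>{0..T}. \<alpha> * U 1 t \<omega> + \<beta> * v 1 t \<omega> = 0) \<longrightarrow> \<alpha> = 0 \<and> \<beta> = 0"
    by (rule wave_mode.not_degenerate[OF wm]) simp
  \<comment> \<open>From the first mode on, the determinant of the information does not vanish, so
    that the estimator is the unique critical point and has the closed form.\<close>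
  have err: "AE \<omega> in M. \<forall>n\<ge>1. mle n \<omega> = (\<theta>1 + fst (E n \<omega>), \<theta>2 + snd (E n \<omega>))"
    using cont nondeg
  proof eventually_elim
    case (elim \<omega>)
    show ?case
    proof (intro allI impI)
      fix n :: nat assume n: "1 \<le> n"
      let ?drift = "\<lambda>k t. - \<theta>1 * (real k)\<^sup>2 * U k t \<omega> + \<theta>2 * v k t \<omega>"
      let ?IU = "\<lambda>k. ito_process_integral M F (\<lambda>t \<omega>. - \<theta>1 * (real k)\<^sup>2 * U k t \<omega> + \<theta>2 * v k t \<omega>) (w k) T (U k)"
      let ?IV = "\<lambda>k. ito_process_integral M F (\<lambda>t \<omega>. - \<theta>1 * (real k)\<^sup>2 * U k t \<omega> + \<theta>2 * v k t \<omega>) (w k) T (v k)"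
      have cU: "continuous_on {0..T} (\<lambda>t. U k t \<omega>)" and cV: "continuous_on {0..T} (\<lambda>t. v k t \<omega>)" if "k \<in> {1..n}" for k
        using elim(1) that by auto
      have det: "IM.J1 n \<omega> * IM.J2 n \<omega> - (IM.J12 n \<omega>)\<^sup>2 \<noteq> 0"
        unfolding J
      proof (rule information_determinant_nonzero[OF assms(3) n])
        show "\<alpha> = 0 \<and> \<beta> = 0" if "\<forall>t\<in>{0..T}. \<alpha> * U 1 t \<omega> + \<beta> * v 1 t \<omega> = 0" for \<alpha> \<beta>
          using elim(2) that by blast
      qed (use cU cV in auto)
      have IU: "?IU k \<omega> = - \<theta>1 * (real k)\<^sup>2 * integral {0..T} (\<lambda>t. (U k t \<omega>)\<^sup>2) + \<theta>2 * integral {0..T} (\<lambda>t. U k t \<omega> * v k t \<omega>) + \<xi> k \<omega>"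
        and IV: "?IV k \<omega> = - \<theta>1 * (real k)\<^sup>2 * integral {0..T} (\<lambda>t. U k t \<omega> * v k t \<omega>) + \<theta>2 * integral {0..T} (\<lambda>t. (v k t \<omega>)\<^sup>2) + y k \<omega>"
        if k: "k \<in> {1..n}" for k
      proof -
        have lin: "integral {0..T} (\<lambda>t. p * f t + q * h t) = p * integral {0..T} f + q * integral {0..T} h"
          if "continuous_on {0..T} f" "continuous_on {0..T} h" for p q and f h :: "real \<Rightarrow> real"
          by (rule integral_unique) (intro has_integral_add has_integral_mult_right integrable_integral integrable_continuous_real that)
        have "integral {0..T} (\<lambda>t. U k t \<omega> * ?drift k t) = integral {0..T} (\<lambda>t. (- \<theta>1 * (real k)\<^sup>2) * (U k t \<omega>)\<^sup>2 + \<theta>2 * (U k t \<omega> * v k t \<omega>))"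
          by (rule arg_cong[where f = "integral {0..T}"]) (simp add: fun_eq_iff power2_eq_square algebra_simps)
        also have "\<dots> = (- \<theta>1 * (real k)\<^sup>2) * integral {0..T} (\<lambda>t. (U k t \<omega>)\<^sup>2) + \<theta>2 * integral {0..T} (\<lambda>t. U k t \<omega> * v k t \<omega>)"
          by (rule lin) (intro continuous_intros cU[OF k] cV[OF k])+
        finally show "?IU k \<omega> = - \<theta>1 * (real k)\<^sup>2 * integral {0..T} (\<lambda>t. (U k t \<omega>)\<^sup>2) + \<theta>2 * integral {0..T} (\<lambda>t. U k t \<omega> * v k t \<omega>) + \<xi> k \<omega>"
          by (simp add: ito_process_integral_def \<xi>_def)
        have "integral {0..T} (\<lambda>t. v k t \<omega> * ?drift k t) = integral {0..T} (\<lambda>t. (- \<theta>1 * (real k)\<^sup>2) * (U k t \<omega> * v k t \<omega>) + \<theta>2 * (v k t \<omega>)\<^sup>2)"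
          by (rule arg_cong[where f = "integral {0..T}"]) (simp add: fun_eq_iff power2_eq_square algebra_simps)
        also have "\<dots> = (- \<theta>1 * (real k)\<^sup>2) * integral {0..T} (\<lambda>t. U k t \<omega> * v k t \<omega>) + \<theta>2 * integral {0..T} (\<lambda>t. (v k t \<omega>)\<^sup>2)"
          by (rule lin) (intro continuous_intros cU[OF k] cV[OF k])+
        finally show "?IV k \<omega> = - \<theta>1 * (real k)\<^sup>2 * integral {0..T} (\<lambda>t. U k t \<omega> * v k t \<omega>) + \<theta>2 * integral {0..T} (\<lambda>t. (v k t \<omega>)\<^sup>2) + y k \<omega>"
          by (simp add: ito_process_integral_def y_def)
      qed
      define B1 where "B1 = - (\<Sum>k=1..n. (real k)\<^sup>2 * ?IU k \<omega>)"
      define B2 where "B2 = (\<Sum>k=1..n. ?IV k \<omega>)"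
      have "(\<Sum>k=1..n. (real k)\<^sup>2 * ?IU k \<omega>) = (\<Sum>k=1..n. - \<theta>1 * (real k ^ 4 * integral {0..T} (\<lambda>t. (U k t \<omega>)\<^sup>2))
          + \<theta>2 * ((real k)\<^sup>2 * integral {0..T} (\<lambda>t. U k t \<omega> * v k t \<omega>)) + (real k)\<^sup>2 * \<xi> k \<omega>)"
        by (rule sum.cong[OF refl], subst IU, assumption) (simp add: power2_eq_square power4_eq_xxxx algebra_simps)
      also have "\<dots> = - \<theta>1 * IM.J1 n \<omega> + \<theta>2 * IM.J12 n \<omega> + IM.A1 n \<omega>"
        unfolding J by (simp only: sum.distrib sum_distrib_left)
      finally have B1: "B1 = \<theta>1 * IM.J1 n \<omega> - \<theta>2 * IM.J12 n \<omega> - IM.A1 n \<omega>" unfolding B1_def by simp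
      have "B2 = (\<Sum>k=1..n. - \<theta>1 * ((real k)\<^sup>2 * integral {0..T} (\<lambda>t. U k t \<omega> * v k t \<omega>))
          + \<theta>2 * integral {0..T} (\<lambda>t. (v k t \<omega>)\<^sup>2) + y k \<omega>)"
        unfolding B2_def by (rule sum.cong[OF refl], subst IV, assumption) simp
      also have "\<dots> = - \<theta>1 * IM.J12 n \<omega> + \<theta>2 * IM.J2 n \<omega> + IM.A2 n \<omega>"
        unfolding J by (simp only: sum.distrib sum_distrib_left)
      finally have B2: "B2 = - \<theta>1 * IM.J12 n \<omega> + \<theta>2 * IM.J2 n \<omega> + IM.A2 n \<omega>" .
      let ?P = "((B1 * IM.J2 n \<omega> + B2 * IM.J12 n \<omega>) / (IM.J1 n \<omega> * IM.J2 n \<omega> - (IM.J12 n \<omega>)\<^sup>2),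
                 (B1 * IM.J12 n \<omega> + B2 * IM.J1 n \<omega>) / (IM.J1 n \<omega> * IM.J2 n \<omega> - (IM.J12 n \<omega>)\<^sup>2))"
      have "wave_log_likelihood M F W T \<theta>1 \<theta>2 u v n \<omega> = log_likelihood T U v ?IU ?IV n \<omega>"
        by (simp add: wave_log_likelihood_def Let_def U_def w_def)
      moreover have "critical_point (log_likelihood T U v ?IU ?IV n \<omega>) p \<longleftrightarrow> p = ?P" for p
        unfolding J B1_def B2_def
        by (rule critical_point_log_likelihood_iff) (use cU cV det[unfolded J] in auto)
      ultimately have "mle n \<omega> = ?P" by (simp add: mle_def wave_mle_def)
      moreover have "?P = (\<theta>1 + fst (E n \<omega>), \<theta>2 + snd (E n \<omega>))"
        using estimator_error[OF det B1 B2] by (simp add: E_def IM.D_def algebra_simps)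
      ultimately show "mle n \<omega> = (\<theta>1 + fst (E n \<omega>), \<theta>2 + snd (E n \<omega>))" by simp
    qed
  qed
  have consistent: "AE \<omega> in M. (\<lambda>N. fst (mle N \<omega>)) \<longlonglongrightarrow> \<theta>1 \<and> (\<lambda>N. snd (mle N \<omega>)) \<longlonglongrightarrow> \<theta>2"
    using err IM.errors_consistent
  proof eventually_elim
    case (elim \<omega>)
    have "(\<lambda>n. \<theta>1 + fst (E n \<omega>)) \<longlonglongrightarrow> \<theta>1 + 0" "(\<lambda>n. \<theta>2 + snd (E n \<omega>)) \<longlonglongrightarrow> \<theta>2 + 0"
      unfolding E_def fst_conv snd_conv
      by (intro tendsto_add tendsto_const conjunct1[OF elim(2)] conjunct2[OF elim(2)])+
    moreover have "\<forall>\<^sub>F n in sequentially. \<theta>1 + fst (E n \<omega>) = fst (mle n \<omega>)" "\<forall>\<^sub>F n in sequentially. \<theta>2 + snd (E n \<omega>) = snd (mle n \<omega>)"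
      using elim(1) by (auto intro!: eventually_sequentiallyI[of 1])
    ultimately show ?case unfolding add_0_right by (blast intro: Lim_transform_eventually)
  qed
  define X where "X = (\<lambda>N \<omega>. (real N powr (3/2) * (fst (mle N \<omega>) - \<theta>1), real N powr (1/2) * (snd (mle N \<omega>) - \<theta>2)))"
  have Xeq: "AE \<omega> in M. X n \<omega> = (real n powr (3/2) * fst (E n \<omega>), real n powr (1/2) * snd (E n \<omega>))" if "1 \<le> n" for n
    using err by eventually_elim (use that in \<open>simp add: X_def\<close>)
  have mE: "(\<lambda>\<omega>. fst (E n \<omega>)) \<in> borel_measurable M" "(\<lambda>\<omega>. snd (E n \<omega>)) \<in> borel_measurable M" for n
    unfolding E_def IM.D_def fst_conv snd_conv by measurable
  have mX: "X n \<in> borel_measurable M" for n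
  proof (cases "n = 0")
    case True
    \<comment> \<open>Both norming factors vanish for \<open>n = 0\<close>, whatever the value of
      the estimator.\<close>
    then show ?thesis by (simp add: X_def)
  next
    case False
    show ?thesis
    proof (rule borel_measurable_AE_eq_subalgebra[OF null_complete_subalgebra_self[OF complete_measure_M]])
      show "(\<lambda>\<omega>. (real n powr (3/2) * fst (E n \<omega>), real n powr (1/2) * snd (E n \<omega>))) \<in> borel_measurable M"
        using mE by (intro borel_measurable_Pair borel_measurable_times borel_measurable_const)
      show "AE \<omega> in M. (real n powr (3/2) * fst (E n \<omega>), real n powr (1/2) * snd (E n \<omega>)) = X n \<omega>"
        using Xeq[of n] False by (auto elim: eventually_mono)
    qed
  qed
  define \<mu> where "\<mu> = diagonal_gaussian (1 / sqrt (c / (3 * r\<^sup>2))) (1 / sqrt c)"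
  have pos: "0 < 1 / sqrt (c / (3 * r\<^sup>2))" "0 < 1 / sqrt c" using c r(1) by simp_all
  have "converges_in_distribution M X \<mu>" unfolding \<mu>_def
    by (rule IM.errors_asymptotically_normal[OF mX]) (use Xeq in \<open>simp add: E_def\<close>)
  moreover have "gaussian_measure \<mu>" "zero_mean \<mu>" "nondegenerate \<mu>"
    unfolding \<mu>_def using gaussian_measure_diagonal_gaussian diagonal_gaussian_zero_mean_nondegenerate[OF pos] by auto
  ultimately show ?thesis using consistent unfolding X_def mle_def by blast
qed

end
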